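(* Let $n\ge 1$ be an integer and let $X$ be either the unit ball $B_n$ or the unit polydisk $U^n$ of $\mathbb{C}^n$. Let $T:N_*(X)\to N_*(X)$ be a multiplicative (not necessarily linear) isometry from $N_*(X)$ onto itself; that is, $T$ is surjective, $d(T(f),T(g))=d(f,g)$ and $T(fg)=T(f)T(g)$ for all $f,g\in N_*(X)$. Then there exists a holomorphic automorphism $\Phi$ of $X$ such that one of the following holds: (1) $T(f)=f\circ\Phi$ for every $f\in N_*(X)$; (2) $T(f)=\overline{f\circ\overline{\Phi}}$ for every $f\in N_*(X)$, i.e. $T(f)(z)=\overline{f(\overline{\Phi(z)})}$ for all $z\in X$. Here, if $X=B_n$, $\Phi$ is (the restriction to $B_n$ of) a unitary transformation of $\mathbb{C}^n$; if $X=U^n$, $\Phi(z_1,\dots,z_n)=(\lambda_1z_{i_1},\dots,\lambda_nz_{i_n})$, where $\lambda_j\in\mathbb{C}$ with $|\lambda_j|=1$ for every $1\le j\le n$ and $(i_1,\dots,i_n)$ is some permutation of the integers from $1$ through $n$.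
   Context: Notation. $B_n=\{z\in\mathbb{C}^n:\sum_{j=1}^n|z_j|^2<1\}$ is the unit ball with boundary $S_n$; $U^n=\{z\in\mathbb{C}^n:|z_j|<1,\ 1\le j\le n\}$ is the unit polydisk with distinguished boundary $\mathbb{T}^n=\{z\in\mathbb{C}^n:|z_j|=1,\ 1\le j\le n\}$. $X$ denotes $B_n$ or $U^n$, and $\Gamma$ denotes $S_n$ if $X=B_n$ and $\mathbb{T}^n$ if $X=U^n$. $d\sigma$ is the normalized Lebesgue measure on $\Gamma$ ($\sigma(\Gamma)=1$); integrals with respect to $\sigma$ are over $\Gamma$. The bar on a vector of $\mathbb{C}^n$ denotes coordinatewise complex conjugation. The Nevanlinna class $N(X)$ is the set of all holomorphic functions $f$ on $X$ with $\sup_{0<r<1}\int\log^+|f(rz)|\,d\sigma(z)<\infty$ (equivalently $\sup_{0<r<1}\int\log(1+|f(rz)|)\,d\sigma(z)<\infty$). Each $f\in N(X)$ has a finite nontangential limit almost everywhere on $\Gamma$, also denoted by $f$ (in particular $f(z)=\lim_{r\to1^-}f(rz)$ for almost every $z\in\Gamma$). The Smirnov class $N_*(X)$ is the set of all $f\in N(X)$ satisfying $$\sup_{0<r<1}\int\log^+|f(rz)|\,d\sigma(z)=\int\log^+|f(z)|\,d\sigma(z),$$ or equivalently $\sup_{0<r<1}\int\log(1+|f(rz)|)\,d\sigma(z)=\int\log(1+|f(z)|)\,d\sigma(z)$. It is an algebra under pointwise operations and carries the metric $$d(f,g)=\int\log(1+|f(z)-g(z)|)\,d\sigma(z),\qquad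 f,g\in N_*(X).$$ *)

theory Defs
  imports "HOL-Probability.Probability"
begin

section \<open>Holomorphic functions of several complex variables\<close>

definition holomorphic_vec :: "(complex ^ 'n \<Rightarrow> complex) \<Rightarrow> (complex ^ 'n) set \<Rightarrow> bool" where
  "holomorphic_vec f S \<longleftrightarrow> open S \<and>
     (\<forall>z\<in>S. \<exists>L. (f has_derivative L) (at z) \<and> (\<forall>c v. L (c *s v) = c * L v))"

definition holomorphic_automorphism ::
    "(complex ^ 'n \<Rightarrow> complex ^ 'n) \<Rightarrow> (complex ^ 'n) set \<Rightarrow> bool" where
  "holomorphic_automorphism \<Phi> S \<longleftrightarrow> bij_betw \<Phi> S S \<and>
     (\<forall>i. holomorphic_vec (\<lambda>z. \<Phi> z $ i) S) \<and>
     (\<forall>i. holomorphic_vec (\<lambda>z. inv_into S \<Phi> z $ i) S)"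

definition vec_cnj :: "complex ^ 'n \<Rightarrow> complex ^ 'n" where
  "vec_cnj z = (\<chi> i. cnj (z $ i))"

definition hermitian_inner :: "complex ^ 'n \<Rightarrow> complex ^ 'n \<Rightarrow> complex" where
  "hermitian_inner z w = (\<Sum>i\<in>UNIV. z $ i * cnj (w $ i))"

definition unitary_transformation :: "(complex ^ 'n \<Rightarrow> complex ^ 'n) \<Rightarrow> bool" where
  "unitary_transformation U \<longleftrightarrow> Vector_Spaces.linear (*s) (*s) U \<and> surj U \<and>
     (\<forall>z w. hermitian_inner (U z) (U w) = hermitian_inner z w)"

section \<open>The two domains, their boundaries and normalized Lebesgue measure\<close>

datatype domain_kind = Unit_Ball | Unit_Polydisk

text \<open>The norm of \<^typ>\<open>complex ^ 'n\<close> is the Euclidean one, so \<^term>\<open>ball 0 1\<close> and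
  \<^term>\<open>sphere 0 1\<close> are the unit ball and the unit sphere.\<close>

fun cdomain :: "domain_kind \<Rightarrow> (complex ^ 'n) set" where
  "cdomain Unit_Ball = ball 0 1"
| "cdomain Unit_Polydisk = {z. \<forall>j. cmod (z $ j) < 1}"

fun cboundary :: "domain_kind \<Rightarrow> (complex ^ 'n) set" where
  "cboundary Unit_Ball = sphere 0 1"
| "cboundary Unit_Polydisk = {z. \<forall>j. cmod (z $ j) = 1}"

text \<open>On the sphere, by polar coordinates, the normalized surface measure of \<open>A\<close> is the proportion
  of the volume of the ball taken up by the cone over \<open>A\<close>; that is, it is the image of the uniform
  distribution on the ball under \<open>z \<mapsto> z / \<bar>z\<bar>\<close> (which is \<^const>\<open>sgn\<close>). On the torus it is the
  product of the normalized arc length measures \<open>d\<theta> / 2\<pi>\<close>. Both images live on the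
  whole space and are then restricted to the boundary, which has full measure.\<close>

fun boundary_measure :: "domain_kind \<Rightarrow> (complex ^ 'n) measure" where
  "boundary_measure Unit_Ball =
     restrict_space (distr (uniform_measure lborel (ball 0 1)) borel sgn) (cboundary Unit_Ball)"
| "boundary_measure Unit_Polydisk =
     restrict_space
       (distr (\<Pi>\<^sub>M i\<in>(UNIV :: 'n set). uniform_measure lborel {0..2 * pi}) borel
         (\<lambda>\<theta>. \<chi> i. cis (\<theta> i)))
       (cboundary Unit_Polydisk)"

section \<open>The Nevanlinna and Smirnov classes\<close>

text \<open>Since \<^term>\<open>ln 0 = (0::real)\<close>, this has the usual value \<open>0\<close> at \<open>0\<close>.\<close>

definition log_plus :: "real \<Rightarrow> real" where
  "log_plus x = max 0 (ln x)"

text \<open>A function on the domain \<open>X\<close> is represented by the total function with the fixed value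
  \<^const>\<open>undefined\<close> off \<open>X\<close>, so equality of the representatives is equality on \<open>X\<close>.\<close>

definition nevanlinna :: "domain_kind \<Rightarrow> (complex ^ 'n \<Rightarrow> complex) set" where
  "nevanlinna K = {f \<in> extensional (cdomain K). holomorphic_vec f (cdomain K) \<and>
     (SUP r\<in>{0<..<1}. \<integral>\<^sup>+ z. ennreal (log_plus (cmod (f (r *\<^sub>R z)))) \<partial>boundary_measure K) < \<infinity>}"

text \<open>The radial limit; for \<open>f\<close> in the Nevanlinna class it exists, and equals the nontangential
  limit, almost everywhere on the boundary.\<close>

definition bdry_value :: "(complex ^ 'n \<Rightarrow> complex) \<Rightarrow> complex ^ 'n \<Rightarrow> complex" where
  "bdry_value f z = Lim (at_left 1) (\<lambda>r. f (r *\<^sub>R z))"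

definition smirnov :: "domain_kind \<Rightarrow> (complex ^ 'n \<Rightarrow> complex) set" where
  "smirnov K = {f \<in> nevanlinna K.
     (SUP r\<in>{0<..<1}. \<integral>\<^sup>+ z. ennreal (log_plus (cmod (f (r *\<^sub>R z)))) \<partial>boundary_measure K) =
     (\<integral>\<^sup>+ z. ennreal (log_plus (cmod (bdry_value f z))) \<partial>boundary_measure K)}"

definition smirnov_dist ::
    "domain_kind \<Rightarrow> (complex ^ 'n \<Rightarrow> complex) \<Rightarrow> (complex ^ 'n \<Rightarrow> complex) \<Rightarrow> real" where
  "smirnov_dist K f g =
     (\<integral> z. ln (1 + cmod (bdry_value f z - bdry_value g z)) \<partial>boundary_measure K)"

definition mult_on ::
    "'a set \<Rightarrow> ('a \<Rightarrow> complex) \<Rightarrow> ('a \<Rightarrow> complex) \<Rightarrow> 'a \<Rightarrow> complex" where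
  "mult_on S f g = (\<lambda>z\<in>S. f z * g z)"

end

theory Submission
  imports Defs "HOL-Complex_Analysis.Complex_Analysis"
begin

text \<open>
  A multiplicative isometry \<open>T\<close> of the Smirnov class is first seen to respect the modulus. The distances
  of the powers \<open>f\<^sup>n\<close> from \<open>0\<close> grow like \<open>n\<close> times the mean of \<open>log_plus \<bar>f\<bar>\<close> on the boundary, so \<open>T\<close>
  preserves these means and maps the unit ball of the supremum norm into itself. Applied to constants
  and combined with the distances between constants this gives \<open>T c = c\<close> for \<open>c > 0\<close> and \<open>T \<i> = \<i>\<close> or
  \<open>T \<i> = - \<i>\<close> (\<open>T_cst_pos\<close>, \<open>T_cst_i\<close>). Composition with the reflection \<open>f \<mapsto> cnj \<circ> f \<circ> vec_cnj\<close>
  exchanges the two possibilities, so assume \<open>T \<i> = \<i>\<close>. Then \<open>T\<close> fixes all constants (\<open>T_cst\<close>) and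
  commutes with multiplication by scalars, but additivity is not yet known.

  The linear structure comes from differentiation. Scaling two bounded functions towards \<open>0\<close> turns the
  metric into the mean of \<open>\<bar>f - g\<bar>\<close>, which \<open>T\<close> therefore preserves. Its derivative at \<open>k\<^sup>2\<close>, for an
  invertible \<open>k\<close>, in the direction \<open>k F\<close> is the real part of the inner product of \<open>F\<close> and \<open>k\<close> in the
  Hardy space (\<open>L1_dist_derivative\<close>). As \<open>T\<close> is multiplicative, it preserves these inner products;
  since the invertible functions span, \<open>T\<close> is additive and isometric for the inner product on bounded
  functions (\<open>T_add\<close>, \<open>T_ip\<close>).

  Orthogonality then shows that \<open>T\<close> maps coordinate functions to linear forms: the image of a coordinate
  is orthogonal to products of functions vanishing at the origin, because the coordinate itself is
  (\<open>T_crd_linear\<close>). So \<open>T\<close> is the substitution of a matrix \<open>A\<close> on polynomials, and by density on the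
  whole class. The same holds for the inverse. Invariance of the domain under \<open>A\<close> and its inverse makes
  \<open>A\<close> unitary for the ball and monomial with unimodular entries for the polydisk.

  The function theory behind this is reduced to one variable by slices \<open>c \<mapsto> f (c z)\<close>, over which the
  boundary measure averages (\<open>nn_integral_slices\<close>). The main facts are the almost everywhere existence of
  radial limits (\<open>Nevanlinna_radial_limits\<close>), the mean convergence of the dilates of a Smirnov function
  (\<open>smirnov_L1\<close>), the maximum principle from boundary values (\<open>smirnov_bdry_le_imp\<close>) and the density of
  polynomials (\<open>smirnov_polynomials_dense\<close>).
\<close>

abbreviation (input) \<sigma> :: "domain_kind \<Rightarrow> (complex ^ 'n) measure" where "\<sigma> \<equiv> boundary_measure"

section \<open>Means over the unit circle\<close>

definition unif_angle :: "real measure" where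
  "unif_angle = uniform_measure lborel {0..2 * pi}"

lemma prob_space_unif_angle: "prob_space unif_angle"
  unfolding unif_angle_def by (rule prob_space_uniform_measure) auto

interpretation unif_angle: prob_space unif_angle
  by (rule prob_space_unif_angle)

abbreviation "circle_mean \<equiv> lebesgue_integral unif_angle"

lemma sets_unif_angle [measurable_cong, simp]: "sets unif_angle = sets borel"
  and space_unif_angle [simp]: "space unif_angle = UNIV"
  by (auto simp: unif_angle_def)

lemma measure_unif_angle_UNIV [simp]: "measure unif_angle UNIV = 1"
  using unif_angle.prob_space by simp

lemma unif_angle_density:
  "unif_angle = density lborel (\<lambda>x. ennreal (indicator {0..2*pi} x / (2*pi)))"
  unfolding unif_angle_def uniform_measure_def
  by (rule density_cong) (auto simp: divide_ennreal split: split_indicator simp flip: ennreal_1)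

lemma unif_angle_integral:
  fixes g :: "real \<Rightarrow> 'a::euclidean_space"
  assumes "continuous_on UNIV g"
  shows "integrable unif_angle g"
    and "circle_mean g = integral {0..2*pi} g /\<^sub>R (2*pi)"
proof -
  have [measurable]: "g \<in> borel_measurable borel"
    using assms by (rule borel_measurable_continuous_onI)
  have si: "set_integrable lborel {0..2*pi} g"
    by (rule borel_integrable_atLeastAtMost') (rule continuous_on_subset[OF assms], simp)
  have eq: "(\<lambda>x. (indicator {0..2*pi} x / (2*pi)) *\<^sub>R g x) = (\<lambda>x. (1/(2*pi)) *\<^sub>R (indicator {0..2*pi} x *\<^sub>R g x))"
    by (rule ext, simp only: scaleR_scaleR divide_inverse mult_1_left mult.commute[of "inverse (2*pi)"])
  have "integrable unif_angle g \<longleftrightarrow> integrable lborel (\<lambda>x. (indicator {0..2*pi} x / (2*pi)) *\<^sub>R g x)"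
    unfolding unif_angle_density by (rule integrable_density) auto
  also have "\<dots>" unfolding eq using si unfolding set_integrable_def by (rule integrable_scaleR_right)
  finally show "integrable unif_angle g" .
  have "circle_mean g = integral\<^sup>L lborel (\<lambda>x. (indicator {0..2*pi} x / (2*pi)) *\<^sub>R g x)"
    unfolding unif_angle_density by (rule integral_density) auto
  also have "\<dots> = (1/(2*pi)) *\<^sub>R integral {0..2*pi} g"
    unfolding eq integral_scaleR_right
    unfolding set_borel_integral_eq_integral(2)[OF si, symmetric] set_lebesgue_integral_def ..
  finally show "circle_mean g = integral {0..2*pi} g /\<^sub>R (2*pi)"
    by (simp only: inverse_eq_divide)
qed

lemma continuous_on_circle_compose:
  assumes "continuous_on (sphere 0 1) u"
  shows "continuous_on UNIV (\<lambda>t. u (cis t))"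
  by (rule continuous_on_compose2[OF assms]) (auto intro!: continuous_intros)

lemma Cauchy_mean:
  assumes f: "f holomorphic_on ball 0 R" "1 < R" and z: "cmod z < 1"
  shows "circle_mean (\<lambda>t. f (cis t) * cis t / (cis t - z)) = f z"
proof -
  have sub: "cball 0 1 \<subseteq> ball (0::complex) R" using f by auto
  have "f holomorphic_on cball 0 1" using f(1) sub holomorphic_on_subset by blast
  then have "((\<lambda>u. f u/(u-z)) has_contour_integral (2 * of_real pi * \<i> * f z)) (part_circlepath 0 1 0 (2*pi))"
    using Cauchy_integral_circlepath_simple[of f 0 1 z] z by (simp add: circlepath_def)
  then have "((\<lambda>t. f (cis t) / (cis t - z) * \<i> * cis t) has_integral (2 * of_real pi * \<i> * f z)) {0..2*pi}"
    by (subst (asm) has_contour_integral_part_circlepath_iff) auto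
  then have "((\<lambda>t. (-\<i>) * (f (cis t) / (cis t - z) * \<i> * cis t)) has_integral (-\<i>) * (2 * of_real pi * \<i> * f z)) {0..2*pi}"
    by (rule has_integral_mult_right)
  then have hi: "((\<lambda>t. f (cis t) * cis t / (cis t - z)) has_integral (2 * of_real pi * f z)) {0..2*pi}"
    by (simp add: field_simps)
  have nz: "cis t - z \<noteq> 0" for t using z by auto
  have cf: "continuous_on (sphere 0 1) f"
    by (rule continuous_on_subset[OF holomorphic_on_imp_continuous_on[OF f(1)]]) (use f in auto)
  have "continuous_on UNIV (\<lambda>t. f (cis t) * cis t / (cis t - z))"
    by (intro continuous_intros continuous_on_circle_compose[OF cf]) (use nz in auto)
  then have "circle_mean (\<lambda>t. f (cis t) * cis t / (cis t - z)) =
      (2 * of_real pi * f z) /\<^sub>R (2 * pi)"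
    by (simp only: unif_angle_integral(2) integral_unique[OF hi])
  also have "\<dots> = f z"
    by (simp only: scaleR_conv_of_real) simp
  finally show ?thesis .
qed

lemma holomorphic_mean_value:
  assumes "f holomorphic_on ball 0 R" "1 < R"
  shows "circle_mean (\<lambda>t. f (cis t)) = f 0"
  using Cauchy_mean[OF assms, of 0] by simp

lemma Poisson_inequality:
  assumes f: "f holomorphic_on ball 0 R" "1 < R" and r: "0 \<le> r" "r < 1"
  shows "cmod (f (r * cis x))
    \<le> circle_mean (\<lambda>t. cmod (f (cis t)) * ((1 - r\<^sup>2) / (cmod (cis t - r * cis x))\<^sup>2))"
proof -
  define z where "z = r * cis x"
  have nz: "cmod z = r" using r by (simp add: z_def norm_mult)
  define S where "S = (if r = 0 then R else min R (1/r))"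
  have S: "1 < S" "S \<le> R" using r f by (auto simp: S_def)
  have nn: "1 - cnj z * w \<noteq> 0" if "cmod w < S" for w
  proof
    assume "1 - cnj z * w = 0"
    then have "cmod (cnj z * w) = 1" by simp
    then have "r * cmod w = 1" by (simp add: norm_mult nz)
    moreover have "r * cmod w < 1"
    proof (cases "r = 0")
      case False
      then have "cmod w < 1/r" using that by (simp add: S_def)
      then show ?thesis using False r by (simp add: field_simps)
    qed simp
    ultimately show False by simp
  qed
  define G where "G w = f w * ((1 - r\<^sup>2) / (1 - cnj z * w))" for w
  have "f holomorphic_on ball 0 S" using f(1) by (rule holomorphic_on_subset) (use S in auto)
  then have G: "G holomorphic_on ball 0 S"
    unfolding G_def by (intro holomorphic_intros) (use nn in auto)
  have r2: "r\<^sup>2 \<noteq> 1" using r by (metis abs_square_eq_1 abs_of_nonneg less_irrefl)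
  have zz: "cnj z * z = of_real (r\<^sup>2)"
    using nz by (metis complex_norm_square mult.commute of_real_power)
  have "G z = f z"
    using r2 by (simp add: G_def zz) (metis (no_types) diff_eq_diff_eq eq_iff_diff_eq_0 mult.right_neutral divide_self of_real_1 of_real_diff of_real_eq_0_iff of_real_power)
  moreover have "circle_mean (\<lambda>t. G (cis t) * cis t / (cis t - z)) = G z"
    by (rule Cauchy_mean[OF G S(1)]) (use nz r in simp)
  moreover have "cmod (circle_mean (\<lambda>t. G (cis t) * cis t / (cis t - z)))
     \<le> circle_mean (\<lambda>t. cmod (G (cis t) * cis t / (cis t - z)))"
    by (rule integral_norm_bound)
  moreover have "cmod (G (cis t) * cis t / (cis t - z)) = cmod (f (cis t)) * ((1 - r\<^sup>2) / (cmod (cis t - z))\<^sup>2)" for t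
  proof -
    have "cmod (1 - cnj z * cis t) = cmod (cnj (cis t) * (cis t - z))"
    proof -
      have "cnj (1 - cnj z * cis t) = cnj (cis t) * (cis t - z)"
        by (simp add: algebra_simps cis_cnj) (simp add: cis_mult)
      then show ?thesis by (metis complex_mod_cnj)
    qed
    then have "cmod (1 - cnj z * cis t) = cmod (cis t - z)" by (simp add: norm_mult)
    moreover have "cmod (1 - (of_real r)\<^sup>2) = 1 - r\<^sup>2"
    proof -
      have "1 - (complex_of_real r)\<^sup>2 = of_real (1 - r\<^sup>2)" by simp
      moreover have "r\<^sup>2 \<le> 1" using r by (simp add: power_le_one)
      ultimately show ?thesis by (metis abs_of_nonneg diff_ge_0_iff_ge norm_of_real)
    qed
    ultimately show ?thesis
      by (simp add: G_def norm_mult norm_divide power2_eq_square)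
  qed
  ultimately show ?thesis by (simp add: z_def)
qed

lemma mean_cis_power: "circle_mean (\<lambda>t. cis t ^ k * cnj (cis t ^ n)) = (if k = n then 1 else 0)"
proof -
  have pos: "circle_mean (\<lambda>t. cis t ^ m) = 0" if "m > 0" for m
    using holomorphic_mean_value[of "\<lambda>z. z ^ m" 2] that by (simp add: holomorphic_intros)
  have cc: "cis t ^ n * cnj (cis t) ^ n = 1" for t n
    by (simp add: power_mult_distrib[symmetric] cis_cnj cis_mult)
  have cc': "cis t ^ n * cnj (cis t ^ n) = 1" for t n using cc by simp
  consider "k = n" | m where "m > 0" "k = m + n" | m where "m > 0" "n = m + k"
    by (metis add.commute less_imp_add_positive linorder_neqE_nat)
  then show ?thesis
  proof cases
    case 1 then show ?thesis using cc by simp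
  next
    case 2
    have e: "cis t ^ (m+n) * cnj (cis t ^ n) = cis t ^ m" for t using cc'[of t n] by (simp only: power_add mult.assoc mult_1_right)
    show ?thesis unfolding 2(2) e using pos 2 by simp
  next
    case 3
    have "cis t ^ k * cnj (cis t ^ (m+k)) = cnj (cis t ^ m)" for t
      using cc'[of t k] by (simp only: power_add complex_cnj_mult mult.assoc[symmetric] mult.commute[of "cnj (cis t ^ m)"] mult_1_left)
    then have "circle_mean (\<lambda>t. cis t ^ k * cnj (cis t ^ n)) = circle_mean (\<lambda>t. cnj (cis t ^ m))"
      using 3 by simp
    also have "\<dots> = cnj (circle_mean (\<lambda>t. cis t ^ m))" by (rule Bochner_Integration.integral_cnj)
    finally show ?thesis using pos 3 by simp
  qed
qed

lemma mean_mult_cnj_power_series: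
  assumes f: "f holomorphic_on ball 0 1" and a: "0 \<le> a" "a < 1" and b: "0 \<le> b" "b < 1"
  defines "c \<equiv> \<lambda>n. (deriv ^^ n) f 0 / fact n"
  shows "(\<lambda>n. of_real ((cmod (c n))\<^sup>2 * (a * b) ^ n)) sums circle_mean (\<lambda>t. f (a * cis t) * cnj (f (b * cis t)))"
proof -
  have ser: "(\<lambda>n. c n * w ^ n) sums f w" if "cmod w < 1" for w
    using holomorphic_power_series[OF f, of w] that by (simp add: c_def)
  have abs: "summable (\<lambda>n. cmod (c n) * r ^ n)" if r01: "0 \<le> r" "r < 1" for r :: real
  proof -
    obtain r' where r': "r < r'" "r' < 1" using dense[OF r01(2)] by blast
    have "cmod (of_real r') < 1" using r' that by simp
    from sums_summable[OF ser[OF this]]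
    have "summable (\<lambda>n. norm (c n * of_real r ^ n))"
      by (rule powser_insidea) (use r' that in simp)
    moreover have "(\<lambda>n. norm (c n * of_real r ^ n)) = (\<lambda>n. cmod (c n) * r ^ n)"
      using that by (simp add: norm_mult norm_power)
    ultimately show ?thesis by (simp only:)
  qed
  have cf: "continuous_on UNIV (\<lambda>t. f (r * cis t))" if "0 \<le> r" "r < 1" for r :: real
    by (rule continuous_on_compose2[OF holomorphic_on_imp_continuous_on[OF f]])
       (use that in \<open>auto intro!: continuous_intros simp: norm_mult\<close>)
  obtain B where B: "cmod (f (a * cis t)) \<le> B" for t
  proof -
    have "compact (cball (0::complex) a)" by simp
    moreover have "continuous_on (cball 0 a) f"
      by (rule continuous_on_subset[OF holomorphic_on_imp_continuous_on[OF f]]) (use a in auto)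
    ultimately have "bounded (f ` cball 0 a)" using compact_continuous_image compact_imp_bounded by blast
    then obtain B where "\<forall>w\<in>cball 0 a. cmod (f w) \<le> B" by (auto simp: bounded_iff)
    then show ?thesis using that[of B] a by (auto simp: norm_mult)
  qed
  have inner: "circle_mean (\<lambda>t. f (a * cis t) * cnj (cis t ^ n)) = c n * a ^ n" for n
  proof -
    have "(\<lambda>k. circle_mean (\<lambda>t. (c k * (a * cis t) ^ k) * cnj (cis t ^ n))) sums
      circle_mean (\<lambda>t. \<Sum>k. (c k * (a * cis t) ^ k) * cnj (cis t ^ n))"
    proof (rule sums_integral)
      show "integrable unif_angle (\<lambda>t. c k * (complex_of_real a * cis t) ^ k * cnj (cis t ^ n))" for k
        by (intro unif_angle_integral(1) continuous_intros)
      show "AE x in unif_angle. summable (\<lambda>k. norm (c k * (complex_of_real a * cis x) ^ k * cnj (cis x ^ n)))"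
        using abs[OF a] a by (simp add: norm_mult norm_power)
      show "summable (\<lambda>k. \<integral> x. norm (c k * (complex_of_real a * cis x) ^ k * cnj (cis x ^ n)) \<partial>unif_angle)"
        using abs[OF a] a by (simp add: norm_mult norm_power unif_angle.prob_space)
    qed
    moreover have "(\<Sum>k. (c k * (a * cis t) ^ k) * cnj (cis t ^ n)) = f (a * cis t) * cnj (cis t ^ n)" for t
      using sums_mult2[OF ser[of "a * cis t"]] a by (simp add: norm_mult sums_iff)
    moreover have "circle_mean (\<lambda>t. (c k * (a * cis t) ^ k) * cnj (cis t ^ n)) = (if k = n then c n * a ^ n else 0)" for k
    proof -
      have "circle_mean (\<lambda>t. (c k * (a * cis t) ^ k) * cnj (cis t ^ n)) =
        circle_mean (\<lambda>t. (c k * a ^ k) * (cis t ^ k * cnj (cis t ^ n)))"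
        by (simp only: power_mult_distrib mult.assoc of_real_power)
      also have "\<dots> = (c k * a ^ k) * circle_mean (\<lambda>t. cis t ^ k * cnj (cis t ^ n))"
        by (rule integral_mult_right_zero)
      finally show ?thesis unfolding mean_cis_power by simp
    qed
    ultimately have "(\<lambda>k. if k = n then c n * a ^ n else 0) sums circle_mean (\<lambda>t. f (a * cis t) * cnj (cis t ^ n))"
      by simp
    moreover have "(\<lambda>k. if k = n then c n * a ^ n else 0) sums (c n * a ^ n)"
      using sums_single[of n "\<lambda>k. c k * of_real a ^ k"] by (simp cong: if_cong)
    ultimately show ?thesis using sums_unique2 by blast
  qed
  have "(\<lambda>n. circle_mean (\<lambda>t. f (a * cis t) * cnj (c n * (b * cis t) ^ n))) sums
      circle_mean (\<lambda>t. \<Sum>n. f (a * cis t) * cnj (c n * (b * cis t) ^ n))"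
  proof (rule sums_integral)
    show "integrable unif_angle (\<lambda>t. f (a * cis t) * cnj (c n * (b * cis t) ^ n))" for n
      by (intro unif_angle_integral(1) continuous_intros cf a)
    show "AE t in unif_angle. summable (\<lambda>n. norm (f (a * cis t) * cnj (c n * (b * cis t) ^ n)))"
      using abs[OF b] b by (auto simp: norm_mult norm_power intro!: summable_mult AE_I2)
    show "summable (\<lambda>n. \<integral> t. norm (f (a * cis t) * cnj (c n * (b * cis t) ^ n)) \<partial>unif_angle)"
    proof (rule summable_comparison_test'[where N=0])
      show "summable (\<lambda>n. B * (cmod (c n) * b ^ n))" using abs[OF b] by (rule summable_mult)
      fix n
      have "(\<integral> t. norm (f (a * cis t) * cnj (c n * (b * cis t) ^ n)) \<partial>unif_angle) \<le> (\<integral> t. B * (cmod (c n) * b ^ n) \<partial>unif_angle)"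
      proof (rule integral_mono)
        show "integrable unif_angle (\<lambda>t. norm (f (a * cis t) * cnj (c n * (b * cis t) ^ n)))"
          by (intro unif_angle_integral(1) continuous_intros cf a)
        show "norm (f (a * cis t) * cnj (c n * (b * cis t) ^ n)) \<le> B * (cmod (c n) * b ^ n)" for t
          using B[of t] b by (auto simp: norm_mult norm_power intro!: mult_right_mono)
      qed auto
      then show "norm (\<integral> t. norm (f (a * cis t) * cnj (c n * (b * cis t) ^ n)) \<partial>unif_angle) \<le> B * (cmod (c n) * b ^ n)"
        by (simp add: unif_angle.prob_space)
    qed
  qed
  moreover have "(\<Sum>n. f (a * cis t) * cnj (c n * (b * cis t) ^ n)) = f (a * cis t) * cnj (f (b * cis t))" for t
  proof -
    have "(\<lambda>n. cnj (c n * (b * cis t) ^ n)) sums cnj (f (b * cis t))"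
      using ser[of "b * cis t"] b by (simp only: sums_cnj) (simp add: norm_mult)
    from sums_mult[OF this] show ?thesis by (simp add: sums_iff)
  qed
  moreover have "circle_mean (\<lambda>t. f (a * cis t) * cnj (c n * (b * cis t) ^ n)) = of_real ((cmod (c n))\<^sup>2 * (a * b) ^ n)" for n
  proof -
    have "circle_mean (\<lambda>t. f (a * cis t) * cnj (c n * (b * cis t) ^ n)) =
        circle_mean (\<lambda>t. (cnj (c n) * b ^ n) * (f (a * cis t) * cnj (cis t ^ n)))"
      by (simp only: power_mult_distrib complex_cnj_mult complex_cnj_power complex_cnj_complex_of_real mult_ac of_real_power)
    also have "\<dots> = (cnj (c n) * b ^ n) * (c n * a ^ n)"
      unfolding inner[symmetric] by (rule integral_mult_right_zero)
    also have "\<dots> = (c n * cnj (c n)) * (a * b) ^ n" by (simp add: power_mult_distrib mult_ac)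
    finally show ?thesis by (simp only: complex_norm_square[symmetric]) simp
  qed
  ultimately show ?thesis by simp
qed

section \<open>The radial maximal inequality\<close>

text \<open>The weight is decreasing in \<open>s\<close>, so integrating by parts transfers an average bound for \<open>v\<close> into a
  bound against the weight; the constant comes from the total mass \<open>pi / 2\<close> of \<open>\<delta> / (\<delta>\<^sup>2 + s\<^sup>2)\<close> on the
  half line.\<close>

lemma kernel_average_bound:
  fixes v :: "real \<Rightarrow> real"
  assumes v: "continuous_on UNIV v" and l: "0 \<le> \<kappa>" and d: "0 < \<delta>"
    and avg: "\<And>h. 0 < h \<Longrightarrow> h \<le> pi \<Longrightarrow> integral {0..h} v \<le> 2 * h * \<kappa>"
  shows "integral {0..pi} (\<lambda>s. \<delta> / (\<delta>\<^sup>2 + s\<^sup>2) * v s) \<le> pi * \<kappa>"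
proof -
  define k where "k s = \<delta> / (\<delta>\<^sup>2 + s\<^sup>2)" for s
  have pos: "\<delta>\<^sup>2 + s\<^sup>2 > 0" for s using d by (simp add: add_pos_nonneg)
  have contk: "continuous_on UNIV k" unfolding k_def using pos by (intro continuous_intros) (metis less_irrefl)
  define A where "A y = integral {0..y} v" for y
  define B where "B y = integral {0..y} (\<lambda>s. k s * v s)" for y
  have cv: "continuous_on {0..pi} v" and ckv: "continuous_on {0..pi} (\<lambda>s. k s * v s)"
    using v contk by (auto intro!: continuous_intros intro: continuous_on_subset)
  \<comment> \<open>The derivative of \<open>F\<close> is \<open>- k' y * (2 * \<kappa> * y - A y)\<close>, which is nonnegative.\<close>
  define F where "F y = 2 * \<kappa> * arctan (y / \<delta>) - B y - k y * (2 * \<kappa> * y - A y)" for y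
  have dA: "(A has_real_derivative v y) (at y)" if "0 < y" "y < pi" for y
  proof -
    have "(A has_real_derivative v y) (at y within {0..pi})"
      unfolding A_def by (rule integral_has_real_derivative[OF cv]) (use that in auto)
    moreover have "at y within {0..pi} = at y" by (rule at_within_Icc_at) (use that in auto)
    ultimately show ?thesis by simp
  qed
  have dB: "(B has_real_derivative k y * v y) (at y)" if "0 < y" "y < pi" for y
  proof -
    have "(B has_real_derivative k y * v y) (at y within {0..pi})"
      unfolding B_def by (rule integral_has_real_derivative[OF ckv]) (use that in auto)
    moreover have "at y within {0..pi} = at y" by (rule at_within_Icc_at) (use that in auto)
    ultimately show ?thesis by simp
  qed
  have dk: "(k has_real_derivative - (2 * y * \<delta> / (\<delta>\<^sup>2 + y\<^sup>2)\<^sup>2)) (at y)" for y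
    unfolding k_def using pos[of y]
    by (auto intro!: derivative_eq_intros simp: power2_eq_square)
  have dat: "((\<lambda>y. arctan (y / \<delta>)) has_real_derivative k y) (at y)" for y
  proof -
    have "((\<lambda>y. arctan (y / \<delta>)) has_real_derivative inverse (1 + (y/\<delta>)\<^sup>2) * (1 / \<delta>)) (at y)"
      using d by (auto intro!: derivative_eq_intros)
    moreover have "inverse (1 + (y/\<delta>)\<^sup>2) * (1 / \<delta>) = k y"
    proof -
      have "1 + (y/\<delta>)\<^sup>2 = (\<delta>\<^sup>2 + y\<^sup>2) / \<delta>\<^sup>2"
        using d by (simp add: power_divide add_divide_distrib)
      then show ?thesis using d by (simp add: k_def power2_eq_square)
    qed
    ultimately show ?thesis by simp
  qed
  have "F 0 \<le> F pi"
  proof (rule DERIV_nonneg_imp_increasing_open[where f=F])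
    fix y :: real assume y: "0 < y" "y < pi"
    have D: "(F has_real_derivative 2 * \<kappa> * k y - k y * v y -
        (- (2 * y * \<delta> / (\<delta>\<^sup>2 + y\<^sup>2)\<^sup>2) * (2 * \<kappa> * y - A y) + (2 * \<kappa> * 1 - v y) * k y)) (at y)"
      unfolding F_def
      by (intro DERIV_diff DERIV_mult DERIV_cmult DERIV_ident dA[OF y] dB[OF y] dk dat)
    have eq: "2 * \<kappa> * k y - k y * v y -
        (- (2 * y * \<delta> / (\<delta>\<^sup>2 + y\<^sup>2)\<^sup>2) * (2 * \<kappa> * y - A y) + (2 * \<kappa> * 1 - v y) * k y)
      = (2 * y * \<delta> / (\<delta>\<^sup>2 + y\<^sup>2)\<^sup>2) * (2 * \<kappa> * y - A y)"
      by (simp add: algebra_simps)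
    have "(2 * y * \<delta> / (\<delta>\<^sup>2 + y\<^sup>2)\<^sup>2) * (2 * \<kappa> * y - A y) \<ge> 0"
      using avg[of y] y d by (intro mult_nonneg_nonneg divide_nonneg_nonneg) (auto simp: A_def mult_ac)
    then show "\<exists>z. (F has_real_derivative z) (at y) \<and> 0 \<le> z"
      using D unfolding eq by blast
  next
    have "continuous_on {0..pi} A" "continuous_on {0..pi} B" unfolding A_def B_def
      by (intro indefinite_integral_continuous_1 integrable_continuous_real cv ckv)+
    then show "continuous_on {0..pi} F" unfolding F_def
      using d by (intro continuous_intros continuous_on_subset[OF contk]) auto
  qed simp
  then have 1: "B pi \<le> 2 * \<kappa> * arctan (pi / \<delta>) - k pi * (2 * \<kappa> * pi - A pi)"
    by (simp add: F_def A_def B_def)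
  have "A pi \<le> 2 * \<kappa> * pi" using avg[of pi] by (simp add: A_def mult_ac)
  then have 2: "k pi * (2 * \<kappa> * pi - A pi) \<ge> 0"
    using d by (intro mult_nonneg_nonneg) (auto simp: k_def)
  have 3: "2 * \<kappa> * arctan (pi / \<delta>) \<le> 2 * \<kappa> * (pi/2)"
    using l arctan_ubound[of "pi/\<delta>"] by (intro mult_left_mono) auto
  have "2 * \<kappa> * (pi/2) = pi * \<kappa>" by simp
  with 1 2 3 have "B pi \<le> pi * \<kappa>" by linarith
  then show ?thesis unfolding B_def k_def .
qed

lemma nn_integral_Icc_eq_integral:
  fixes u :: "real \<Rightarrow> real"
  assumes u: "continuous_on UNIV u" and nn: "\<And>t. 0 \<le> u t"
  shows "emeasure (density lborel (\<lambda>t. ennreal (u t))) {a..b} = ennreal (integral {a..b} u)"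
proof -
  have [measurable]: "u \<in> borel_measurable borel" using u by (rule borel_measurable_continuous_onI)
  have si: "set_integrable lborel {a..b} u"
    by (rule borel_integrable_atLeastAtMost') (rule continuous_on_subset[OF u], simp)
  have "emeasure (density lborel (\<lambda>t. ennreal (u t))) {a..b} = (\<integral>\<^sup>+ x. ennreal (u x) * indicator {a..b} x \<partial>lborel)"
    by (rule emeasure_density) auto
  also have "\<dots> = (\<integral>\<^sup>+ x. ennreal (indicator {a..b} x *\<^sub>R u x) \<partial>lborel)"
    by (rule nn_integral_cong) (auto split: split_indicator)
  also have "\<dots> = ennreal (LINT x:{a..b}|lborel. u x)"
    unfolding set_lebesgue_integral_def
    by (rule nn_integral_eq_integral) (use si nn in \<open>auto simp: set_integrable_def\<close>)
  finally show ?thesis by (simp add: set_borel_integral_eq_integral(2)[OF si])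
qed

text \<open>The Hardy--Littlewood maximal inequality of weak type on the circle. The intervals with too large
  an average are thinned out to a disjoint family by Vitali's covering lemma, and the fivefold dilates
  of that family form \<open>U\<close>. Centres in one period and radii at most \<open>pi\<close> keep the disjoint intervals
  within three periods, so the factor \<open>30 * pi\<close> is \<open>5 * 3 * (2 * pi)\<close>.\<close>

lemma maximal_inequality_periodic:
  fixes u :: "real \<Rightarrow> real"
  assumes u: "continuous_on UNIV u" and nn: "\<And>t. 0 \<le> u t" and per: "\<And>t. u (t + 2*pi) = u t"
    and l: "0 < \<kappa>"
  obtains U where "U \<in> sets borel"
    "emeasure lborel U \<le> ennreal (30 * pi / \<kappa> * circle_mean u)"
    "\<And>x h. \<lbrakk>x \<in> {0..2*pi}; x \<notin> U; 0 < h; h \<le> pi\<rbrakk> \<Longrightarrow> integral {x-h..x+h} u \<le> 2 * h * \<kappa>"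
proof -
  define \<mu> where "\<mu> = density lborel (\<lambda>t. ennreal (u t))"
  have [measurable]: "u \<in> borel_measurable borel" using u by (rule borel_measurable_continuous_onI)
  define K where "K = {(x,h). x \<in> {0..2*pi} \<and> 0 < h \<and> h \<le> pi \<and> integral {x-h..x+h} u > 2 * h * \<kappa>}"
  have "fst ` K \<subseteq> (\<Union>i\<in>K. cball (fst i) (snd i))" by (fastforce simp: K_def)
  moreover have "0 < snd i \<and> snd i \<le> pi" if "i \<in> K" for i using that by (auto simp: K_def)
  ultimately obtain C where C: "countable C" "C \<subseteq> K"
     "pairwise (\<lambda>i j. disjnt (cball (fst i) (snd i)) (cball (fst j) (snd j))) C"
     "fst ` K \<subseteq> (\<Union>i\<in>C. cball (fst i) (5 * snd i))"
    using Vitali_covering_lemma_cballs[where S="fst ` K" and K=K and a=fst and r=snd and B=pi] by blast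
  define U where "U = (\<Union>i\<in>C. cball (fst i) (5 * snd i))"
  have Ub: "U \<in> sets borel" unfolding U_def using C(1) by (intro sets.countable_UN') auto
  have per': "integral {2*pi*real_of_int k..2*pi*(real_of_int k+1)} u = integral {0..2*pi} u" if "k \<in> {-1,0,1}" for k
  proof -
    have "u \<circ> ((+) (2*pi*real_of_int k)) = u"
      using that per per[of "t - 2*pi" for t] by (auto simp: o_def add.commute)
    then have "integral {0..2*pi} u = integral {0+2*pi*real_of_int k..2*pi+2*pi*real_of_int k} u"
      using integral_shift_Icc_real[of 0 "2*pi" u "2*pi*real_of_int k"] by simp
    then show ?thesis by (simp add: algebra_simps)
  qed
  have int: "u integrable_on {a..b}" for a b
    by (rule integrable_continuous_real) (rule continuous_on_subset[OF u], simp)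
  have tot: "integral {-2*pi..4*pi} u = 6 * pi * circle_mean u"
  proof -
    have "integral {-2*pi..4*pi} u = integral {-2*pi..0} u + integral {0..4*pi} u"
      by (rule Henstock_Kurzweil_Integration.integral_combine[symmetric]) (auto intro: int)
    also have "integral {0..4*pi} u = integral {0..2*pi} u + integral {2*pi..4*pi} u"
      by (rule Henstock_Kurzweil_Integration.integral_combine[symmetric]) (auto intro: int)
    finally have "integral {-2*pi..4*pi} u = 3 * integral {0..2*pi} u"
      using per'[of "-1"] per'[of 1] by simp
    moreover have "circle_mean u = integral {0..2*pi} u / (2*pi)"
      using unif_angle_integral(2)[OF u] by (simp only: real_scaleR_def divide_inverse_commute)
    ultimately show ?thesis by simp
  qed
  have "emeasure lborel U = (\<integral>\<^sup>+x. indicator U x \<partial>lborel)" using Ub by simp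
  also have "\<dots> \<le> (\<integral>\<^sup>+x. \<integral>\<^sup>+i. indicator (cball (fst i) (5 * snd i)) x \<partial>count_space C \<partial>lborel)"
  proof (intro nn_integral_mono)
    fix x :: real
    show "indicator U x \<le> (\<integral>\<^sup>+i. indicator (cball (fst i) (5 * snd i)) x \<partial>count_space C)"
    proof (cases "x \<in> U")
      case True
      then obtain i where i: "i \<in> C" "x \<in> cball (fst i) (5 * snd i)" by (auto simp: U_def)
      have "(1::ennreal) = indicator (cball (fst i) (5 * snd i)) x" using i by simp
      also have "\<dots> \<le> (\<integral>\<^sup>+i. indicator (cball (fst i) (5 * snd i)) x \<partial>count_space C)"
        using i(1) by (rule nn_integral_ge_point)
      finally show ?thesis using True by simp
    qed simp
  qed
  also have "\<dots> = (\<integral>\<^sup>+i. \<integral>\<^sup>+x. indicator (cball (fst i) (5 * snd i)) x \<partial>lborel \<partial>count_space C)"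
    by (rule nn_integral_count_space_nn_integral[OF C(1)]) (intro borel_measurable_indicator, simp)
  also have "\<dots> \<le> (\<integral>\<^sup>+i. ennreal (5/\<kappa>) * emeasure \<mu> (cball (fst i) (snd i)) \<partial>count_space C)"
  proof (rule nn_integral_mono)
    fix i assume "i \<in> space (count_space C)"
    then have i: "i \<in> K" using C by auto
    obtain x h where xh: "i = (x,h)" by (cases i)
    have h: "0 < h" "2 * h * \<kappa> < integral {x-h..x+h} u" using i xh by (auto simp: K_def)
    have "(\<integral>\<^sup>+y. indicator (cball (fst i) (5 * snd i)) y \<partial>lborel) = ennreal (10 * h)"
      using h by (simp add: xh cball_eq_atLeastAtMost)
    also have "\<dots> \<le> ennreal (5/\<kappa> * integral {x-h..x+h} u)"
      using h l by (intro ennreal_leI) (simp add: field_simps)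
    also have "\<dots> = ennreal (5/\<kappa>) * ennreal (integral {x-h..x+h} u)"
      using l by (intro ennreal_mult') simp
    also have "\<dots> = ennreal (5/\<kappa>) * emeasure \<mu> (cball (fst i) (snd i))"
      by (simp add: xh \<mu>_def cball_eq_atLeastAtMost nn_integral_Icc_eq_integral[OF u nn])
    finally show "(\<integral>\<^sup>+y. indicator (cball (fst i) (5 * snd i)) y \<partial>lborel) \<le> ennreal (5/\<kappa>) * emeasure \<mu> (cball (fst i) (snd i))" .
  qed
  also have "\<dots> = ennreal (5/\<kappa>) * (\<integral>\<^sup>+i. emeasure \<mu> (cball (fst i) (snd i)) \<partial>count_space C)"
    by (rule nn_integral_cmult) simp
  also have "(\<integral>\<^sup>+i. emeasure \<mu> (cball (fst i) (snd i)) \<partial>count_space C) = emeasure \<mu> (\<Union>i\<in>C. cball (fst i) (snd i))"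
  proof (rule emeasure_UN_countable[symmetric])
    show "disjoint_family_on (\<lambda>i. cball (fst i) (snd i)) C"
      using C(3) by (auto simp: disjoint_family_on_def pairwise_def disjnt_def)
  qed (use C in \<open>auto simp: \<mu>_def\<close>)
  also have "\<dots> \<le> emeasure \<mu> {-2*pi..4*pi}"
  proof (rule emeasure_mono)
    show "(\<Union>i\<in>C. cball (fst i) (snd i)) \<subseteq> {-2*pi..4*pi}"
      using C(2) by (force simp: K_def cball_eq_atLeastAtMost)
  qed (simp add: \<mu>_def)
  also have "\<dots> = ennreal (6 * pi * circle_mean u)"
    unfolding \<mu>_def nn_integral_Icc_eq_integral[OF u nn] tot ..
  finally have "emeasure lborel U \<le> ennreal (5/\<kappa>) * ennreal (6 * pi * circle_mean u)"
    by (simp add: mult_left_mono)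
  also have "\<dots> = ennreal (30 * pi / \<kappa> * circle_mean u)"
    using l by (subst ennreal_mult'[symmetric]) (auto simp: mult_ac)
  finally have 1: "emeasure lborel U \<le> ennreal (30 * pi / \<kappa> * circle_mean u)" .
  show thesis
  proof (rule that[OF Ub 1])
    fix x h assume "x \<in> {0..2*pi}" "x \<notin> U" "0 < h" "h \<le> pi"
    then show "integral {x-h..x+h} u \<le> 2 * h * \<kappa>"
      using C(4) by (force simp: K_def U_def)
  qed
qed

lemma sin_half_lower_bound:
  assumes "0 \<le> s" "s \<le> pi"
  shows "s / 4 \<le> sin (s / 2)"
proof -
  define y where "y = s / 2"
  have y: "0 \<le> y" "y \<le> 1.6" using assms pi_less_4 pi_approx by (auto simp: y_def)
  have "\<bar>sin y - (\<Sum>m<3. sin_coeff m * y ^ m)\<bar> \<le> inverse (fact 3) * \<bar>y\<bar> ^ 3"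
    by (rule Maclaurin_sin_bound)
  moreover have "(\<Sum>m<3. sin_coeff m * y ^ m) = y"
    by (simp add: eval_nat_numeral sin_coeff_def)
  ultimately have "\<bar>sin y - y\<bar> \<le> y ^ 3 / 6" using y by (simp add: fact_numeral)
  moreover have "y ^ 3 / 6 \<le> y / 2"
  proof -
    have "y * y \<le> 1.6 * 1.6" using y by (intro mult_mono) auto
    then have "y * (y * y) \<le> y * 3" using y by (intro mult_left_mono) auto
    then show ?thesis by (simp add: power3_eq_cube mult_ac)
  qed
  ultimately have "y / 2 \<le> sin y" by linarith
  then show ?thesis by (simp add: y_def)
qed

lemma cmod_cis_minus_real_sq:
  "(cmod (cis s - of_real r))\<^sup>2 = (1 - r)\<^sup>2 + 4 * r * (sin (s/2))\<^sup>2"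
proof -
  have "(cmod (cis s - of_real r))\<^sup>2 = (cos s - r)\<^sup>2 + (sin s)\<^sup>2"
    by (simp add: cmod_power2)
  also have "\<dots> = ((cos s)\<^sup>2 + (sin s)\<^sup>2) - 2 * r * cos s + r\<^sup>2" by (simp add: power2_diff algebra_simps)
  also have "(cos s)\<^sup>2 + (sin s)\<^sup>2 = 1" by simp
  also have "cos s = 1 - 2 * (sin (s/2))\<^sup>2"
    using cos_double_sin[of "s/2"] by simp
  finally show ?thesis by (simp add: power2_diff algebra_simps)
qed

text \<open>The Poisson kernel at radius \<open>r\<close> is dominated by a multiple of \<open>\<delta> / (\<delta>\<^sup>2 + s\<^sup>2)\<close> with
  \<open>\<delta> = 1 - r\<close>. Hence off the exceptional set of the maximal inequality for \<open>\<bar>g\<bar>\<close> all values of \<open>g\<close>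
  along the radius are controlled.\<close>

lemma radial_maximal_inequality:
  assumes g: "g holomorphic_on ball 0 R" "1 < R" and l: "0 < \<kappa>"
  obtains U where "U \<in> sets borel"
    "emeasure lborel U \<le> ennreal (240 * pi / \<kappa> * circle_mean (\<lambda>t. cmod (g (cis t))))"
    "\<And>x r. \<lbrakk>x \<in> {0..2*pi}; x \<notin> U; 1/2 \<le> r; r < 1\<rbrakk> \<Longrightarrow> cmod (g (of_real r * cis x)) \<le> \<kappa>"
proof -
  define u where "u t = cmod (g (cis t))" for t
  have contg: "continuous_on (sphere 0 1) g"
    by (rule continuous_on_subset[OF holomorphic_on_imp_continuous_on[OF g(1)]]) (use g in auto)
  have u: "continuous_on UNIV u" unfolding u_def
    by (intro continuous_intros continuous_on_circle_compose contg)
  have nn: "0 \<le> u t" and per: "u (t + 2*pi) = u t" for t by (auto simp: u_def simp flip: cis_mult)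
  obtain U where U: "U \<in> sets borel"
    "emeasure lborel U \<le> ennreal (30 * pi / (\<kappa>/8) * circle_mean u)"
    "\<And>x h. \<lbrakk>x \<in> {0..2*pi}; x \<notin> U; 0 < h; h \<le> pi\<rbrakk> \<Longrightarrow> integral {x-h..x+h} u \<le> 2 * h * (\<kappa>/8)"
    using maximal_inequality_periodic[OF u nn per, of "\<kappa>/8"] l by auto
  have int: "f integrable_on {a..b}" if "continuous_on UNIV f" for a b and f :: "real \<Rightarrow> real"
    by (rule integrable_continuous_real) (rule continuous_on_subset[OF that], simp)
  show thesis
  proof (rule that[OF U(1)])
    show "emeasure lborel U \<le> ennreal (240 * pi / \<kappa> * circle_mean (\<lambda>t. cmod (g (cis t))))"
      using U(2) unfolding u_def by simp
    fix x r assume x: "x \<in> {0..2*pi}" "x \<notin> U" and r: "1/2 \<le> r" "r < (1::real)"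
    define \<delta> where "\<delta> = 1 - r"
    have d: "0 < \<delta>" using r by (simp add: \<delta>_def)
    define G where "G z = g (cis x * z)" for z
    have G: "G holomorphic_on ball 0 R" unfolding G_def
      by (rule holomorphic_on_compose_gen[OF _ g(1), unfolded o_def])
         (auto intro!: holomorphic_intros simp: norm_mult)
    have contG: "continuous_on (sphere 0 1) G"
      by (rule continuous_on_subset[OF holomorphic_on_imp_continuous_on[OF G]]) (use g in auto)
    define w where "w t = cmod (G (cis t)) * ((1 - r\<^sup>2) / (cmod (cis t - of_real r))\<^sup>2)" for t
    have nz: "cis t \<noteq> of_real r" for t
      using r by (metis abs_of_nonneg divide_nonneg_nonneg less_irrefl norm_cis norm_of_real order_trans zero_le_numeral zero_le_one)
    have w: "continuous_on UNIV w" unfolding w_def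
      by (intro continuous_intros continuous_on_circle_compose contG) (use nz in auto)
    define v where "v s = u (x + s) + u (x - s)" for s
    have v: "continuous_on UNIV v" unfolding v_def
      by (intro continuous_intros continuous_on_compose2[OF u]) auto
    have "cmod (g (of_real r * cis x)) = cmod (G (of_real r * cis 0))" by (simp add: G_def mult.commute)
    also have "\<dots> \<le> circle_mean w"
      unfolding w_def using Poisson_inequality[OF G g(2), of r 0] r by simp
    also have "\<dots> = integral {0..2*pi} w / (2*pi)"
      using unif_angle_integral(2)[OF w] by (simp only: real_scaleR_def divide_inverse_commute)
    also have "integral {0..2*pi} w = integral {0..pi} (\<lambda>t. w t + w (2*pi - t))"
    proof -
      have "integral {0..2*pi} w = integral {0..pi} w + integral {pi..2*pi} w"
        by (rule Henstock_Kurzweil_Integration.integral_combine[symmetric]) (auto intro: int w)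
      also have "integral {pi..2*pi} w = integral {-2*pi..-pi} (\<lambda>t. w (-t))"
        using Henstock_Kurzweil_Integration.integral_reflect_real[of "2*pi" pi w] by simp
      also have "\<dots> = integral {0..pi} (\<lambda>t. w (2*pi - t))"
        using integral_shift_Icc_real[of 0 pi "\<lambda>t. w (-t)" "-2*pi"] by (simp add: o_def)
      also have "integral {0..pi} w + integral {0..pi} (\<lambda>t. w (2*pi - t)) = integral {0..pi} (\<lambda>t. w t + w (2*pi - t))"
        by (rule Henstock_Kurzweil_Integration.integral_add[symmetric])
           (intro int w continuous_on_compose2[OF w] continuous_intros; simp)+
      finally show ?thesis .
    qed
    also have "\<dots> \<le> integral {0..pi} (\<lambda>s. 16 * (\<delta> / (\<delta>\<^sup>2 + s\<^sup>2) * v s))"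
    proof (rule integral_le)
      show "(\<lambda>t. w t + w (2*pi - t)) integrable_on {0..pi}"
        by (intro int continuous_intros w continuous_on_compose2[OF w]) auto
      have "\<delta>\<^sup>2 + s\<^sup>2 \<noteq> 0" for s using d by (metis add_pos_nonneg less_irrefl zero_le_power2 zero_less_power)
      then show "(\<lambda>s. 16 * (\<delta> / (\<delta>\<^sup>2 + s\<^sup>2) * v s)) integrable_on {0..pi}"
        by (intro int continuous_intros v) auto
      fix s assume s: "s \<in> {0..pi}"
      have eqs: "cis x * cis s = cis (x + s)" "cis x * cis (2*pi - s) = cis (x - s)"
        by (simp_all add: cis_mult) (metis (no_types) add_diff_eq cis_2pi cis_mult add.commute diff_add_eq mult.left_neutral)
      have sym: "cmod (cis (2*pi - s) - of_real r) = cmod (cis s - of_real r)"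
      proof -
        have "cis (2*pi - s) - of_real r = cnj (cis s - of_real r)"
          by (simp add: cis_cnj) (metis cis_2pi cis_mult mult.left_neutral uminus_add_conv_diff add.commute)
        then show ?thesis by (metis complex_mod_cnj)
      qed
      have "(s/4)\<^sup>2 \<le> (sin (s/2))\<^sup>2"
        using sin_half_lower_bound[of s] s by (intro power_mono) auto
      then have "(1/2) * ((s/4)\<^sup>2) \<le> r * (sin (s/2))\<^sup>2" using r by (intro mult_mono) auto
      then have "s\<^sup>2 / 8 \<le> 4 * r * (sin (s/2))\<^sup>2" by (simp add: power_divide)
      moreover have "\<delta>\<^sup>2 / 8 \<le> \<delta>\<^sup>2" by simp
      ultimately have "(\<delta>\<^sup>2 + s\<^sup>2) / 8 \<le> (cmod (cis s - of_real r))\<^sup>2"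
        unfolding cmod_cis_minus_real_sq \<delta>_def[symmetric] by (simp only: add_divide_distrib add_mono)
      moreover have "1 - r\<^sup>2 \<le> 2 * \<delta>"
      proof -
        have "1 - r\<^sup>2 = (1 - r) * (1 + r)" by (simp add: power2_eq_square algebra_simps)
        also have "\<dots> \<le> \<delta> * 2" unfolding \<delta>_def using r by (intro mult_left_mono) auto
        finally show ?thesis by simp
      qed
      moreover have "0 < \<delta>\<^sup>2 + s\<^sup>2" using d by (simp add: add_pos_nonneg)
      moreover have "0 \<le> 1 - r\<^sup>2" using r by (simp add: power_le_one)
      ultimately have "(1 - r\<^sup>2) / (cmod (cis s - of_real r))\<^sup>2 \<le> (2 * \<delta>) / ((\<delta>\<^sup>2 + s\<^sup>2) / 8)"
        using d by (intro frac_le) auto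
      then have ker: "(1 - r\<^sup>2) / (cmod (cis s - of_real r))\<^sup>2 \<le> 16 * (\<delta> / (\<delta>\<^sup>2 + s\<^sup>2))" by simp
      have "w s + w (2*pi - s) = v s * ((1 - r\<^sup>2) / (cmod (cis s - of_real r))\<^sup>2)"
        by (simp only: w_def G_def eqs sym v_def u_def distrib_right)
      also have "\<dots> \<le> v s * (16 * (\<delta> / (\<delta>\<^sup>2 + s\<^sup>2)))"
        using ker nn by (intro mult_left_mono) (auto simp: v_def)
      finally show "w s + w (2*pi - s) \<le> 16 * (\<delta> / (\<delta>\<^sup>2 + s\<^sup>2) * v s)" by (simp add: mult_ac)
    qed
    also have "\<dots> = 16 * integral {0..pi} (\<lambda>s. \<delta> / (\<delta>\<^sup>2 + s\<^sup>2) * v s)"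
      by (rule Henstock_Kurzweil_Integration.integral_mult_right)
    also have "integral {0..pi} (\<lambda>s. \<delta> / (\<delta>\<^sup>2 + s\<^sup>2) * v s) \<le> pi * (\<kappa>/8)"
    proof (rule kernel_average_bound[OF v _ d])
      fix h :: real assume h: "0 < h" "h \<le> pi"
      have "integral {x-h..x+h} u = integral {x-h..x} u + integral {x..x+h} u"
        by (rule Henstock_Kurzweil_Integration.integral_combine[symmetric]) (use h in \<open>auto intro: int u\<close>)
      also have "integral {x..x+h} u = integral {0..h} (\<lambda>s. u (x + s))"
        using integral_shift_Icc_real[of 0 h u x] by (simp add: o_def add.commute)
      also have "integral {x-h..x} u = integral {-h..0} (\<lambda>s. u (x + s))"
        using integral_shift_Icc_real[of "-h" 0 u x] by (simp add: o_def)
      also have "\<dots> = integral {0..h} (\<lambda>s. u (x - s))"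
        using Henstock_Kurzweil_Integration.integral_reflect_real[of 0 "-h" "\<lambda>s. u (x + s)"] by simp
      also have "integral {0..h} (\<lambda>s. u (x - s)) + integral {0..h} (\<lambda>s. u (x + s)) = integral {0..h} v"
      proof -
        have "v = (\<lambda>s. u (x - s) + u (x + s))" by (rule ext) (simp add: v_def add.commute)
        then show ?thesis
          by (simp only:) (rule Henstock_Kurzweil_Integration.integral_add[symmetric];
             intro int continuous_on_compose2[OF u] continuous_intros; simp)
      qed
      finally show "integral {0..h} v \<le> 2 * h * (\<kappa>/8)" using U(3)[OF x h] by simp
    qed (use l in simp)
    finally show "cmod (g (of_real r * cis x)) \<le> \<kappa>" by (simp add: field_simps)
  qed
qed

section \<open>Radial limits of bounded functions in the disc\<close>

text \<open>A Cauchy criterion, because the limit function is not available beforehand: the exceptional sets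
  below are described by oscillation alone.\<close>

lemma at_left_limit_iff_Cauchy:
  fixes F :: "real \<Rightarrow> complex"
  shows "(\<exists>l. (F \<longlongrightarrow> l) (at_left 1)) \<longleftrightarrow>
    (\<forall>e>0. \<exists>\<rho><1. \<forall>r\<in>{\<rho><..<1}. \<forall>r'\<in>{\<rho><..<1}. cmod (F r - F r') \<le> e)"
    (is "?L \<longleftrightarrow> ?R")
proof
  assume ?L
  then obtain l where l: "(F \<longlongrightarrow> l) (at_left 1)" ..
  show ?R
  proof (intro allI impI)
    fix e :: real assume "e > 0"
    then have "eventually (\<lambda>r. dist (F r) l < e/2) (at_left 1)"
      using tendstoD[OF l, of "e/2"] by simp
    then obtain \<rho> where \<rho>: "\<rho> < 1" "\<And>r. \<rho> < r \<Longrightarrow> r < 1 \<Longrightarrow> dist (F r) l < e/2"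
      unfolding eventually_at_left[OF zero_less_one] by blast
    have "cmod (F r - F r') \<le> e" if "r \<in> {\<rho><..<1}" "r' \<in> {\<rho><..<1}" for r r'
    proof -
      have "dist (F r) l < e/2" "dist (F r') l < e/2" using that \<rho>(2) by auto
      then have "dist (F r) (F r') < e" by (rule dist_triangle_half_l)
      then show ?thesis by (simp add: dist_norm)
    qed
    with \<rho>(1) show "\<exists>\<rho><1. \<forall>r\<in>{\<rho><..<1}. \<forall>r'\<in>{\<rho><..<1}. cmod (F r - F r') \<le> e" by blast
  qed
next
  assume R: ?R
  define s where "s n = 1 - inverse (real (Suc n))" for n
  have s1: "s n < 1" for n by (simp add: s_def)
  have "(\<lambda>n. inverse (real (Suc n))) \<longlonglongrightarrow> 0" by (rule LIMSEQ_inverse_real_of_nat)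
  then have "(\<lambda>n. 1 - inverse (real (Suc n))) \<longlonglongrightarrow> 1 - 0" by (intro tendsto_intros)
  then have slim: "s \<longlonglongrightarrow> 1" unfolding s_def by simp
  have ev: "\<exists>N. \<forall>n\<ge>N. s n > \<rho>" if "\<rho> < 1" for \<rho>
    using order_tendstoD(1)[OF slim that] by (simp add: eventually_sequentially)
  have "Cauchy (\<lambda>n. F (s n))"
  proof (rule metric_CauchyI)
    fix e :: real assume "e > 0"
    then obtain \<rho> where \<rho>: "\<rho> < 1" "\<forall>r\<in>{\<rho><..<1}. \<forall>r'\<in>{\<rho><..<1}. cmod (F r - F r') \<le> e/2"
      using R half_gt_zero by blast
    obtain N where N: "\<forall>n\<ge>N. s n > \<rho>" using ev[OF \<rho>(1)] by blast
    have "dist (F (s m)) (F (s n)) < e" if "m \<ge> N" "n \<ge> N" for m n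
    proof -
      have "cmod (F (s m) - F (s n)) \<le> e/2" using \<rho>(2) N that s1 by simp
      then show ?thesis using \<open>e > 0\<close> by (simp add: dist_norm)
    qed
    then show "\<exists>M. \<forall>m\<ge>M. \<forall>n\<ge>M. dist (F (s m)) (F (s n)) < e" by blast
  qed
  then obtain l where l: "(\<lambda>n. F (s n)) \<longlonglongrightarrow> l"
    using Cauchy_convergent convergent_def by blast
  have "(F \<longlongrightarrow> l) (at_left 1)"
  proof (rule tendstoI)
    fix e :: real assume e: "e > 0"
    then obtain \<rho> where \<rho>: "\<rho> < 1" "\<forall>r\<in>{\<rho><..<1}. \<forall>r'\<in>{\<rho><..<1}. cmod (F r - F r') \<le> e/2"
      using R half_gt_zero by blast
    obtain N where N: "\<forall>n\<ge>N. s n > \<rho>" using ev[OF \<rho>(1)] by blast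
    have "dist (F r) l < e" if "\<rho> < r" "r < 1" for r
    proof -
      have "(\<lambda>n. cmod (F r - F (s n))) \<longlonglongrightarrow> cmod (F r - l)"
        by (intro tendsto_intros l)
      moreover have "eventually (\<lambda>n. cmod (F r - F (s n)) \<le> e/2) sequentially"
        unfolding eventually_sequentially using \<rho>(2) N that s1 by (intro exI[of _ N]) simp
      ultimately have "cmod (F r - l) \<le> e/2"
        by (rule tendsto_upperbound) simp
      then show ?thesis using e by (simp add: dist_norm)
    qed
    then show "eventually (\<lambda>r. dist (F r) l < e) (at_left 1)"
      unfolding eventually_at_left[OF zero_less_one] using \<rho>(1) by blast
  qed
  then show ?L ..
qed

text \<open>By Parseval the square means \<open>W r\<close> of the dilates increase with \<open>r\<close> and are bounded, hence converge,
  and the square mean of the difference of two dilates is at most \<open>W s - W \<rho>\<close>. The inequality of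
  Cauchy and Schwarz passes to the first power.\<close>

lemma bounded_holomorphic_L1_Cauchy:
  assumes f: "f holomorphic_on ball 0 1" and B: "\<And>z. cmod z < 1 \<Longrightarrow> cmod (f z) \<le> B" and e: "0 < e"
  obtains \<rho>\<^sub>0 where "0 \<le> \<rho>\<^sub>0" "\<rho>\<^sub>0 < 1"
    "\<And>\<rho> s. \<rho>\<^sub>0 \<le> \<rho> \<Longrightarrow> \<rho> \<le> s \<Longrightarrow> s < 1 \<Longrightarrow>
      circle_mean (\<lambda>t. cmod (f (of_real s * cis t) - f (of_real \<rho> * cis t))) \<le> e"
proof -
  define c where "c n = (deriv ^^ n) f 0 / fact n" for n
  define K where "K a b = circle_mean (\<lambda>t. f (of_real a * cis t) * cnj (f (of_real b * cis t)))" for a b :: real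
  have cf: "continuous_on UNIV (\<lambda>t. f (of_real r * cis t))" if "0 \<le> r" "r < 1" for r :: real
    by (rule continuous_on_compose2[OF holomorphic_on_imp_continuous_on[OF f]])
       (use that in \<open>auto intro!: continuous_intros simp: norm_mult\<close>)
  have ser: "(\<lambda>n. (cmod (c n))\<^sup>2 * (a * b) ^ n) sums Re (K a b)" if "0 \<le> a" "a < 1" "0 \<le> b" "b < 1" for a b
    using sums_Re[OF mean_mult_cnj_power_series[OF f that]] unfolding c_def K_def by simp
  define W where "W r = Re (K r r)" for r
  have K_int: "integrable unif_angle (\<lambda>t. f (of_real a * cis t) * cnj (f (of_real b * cis t)))"
    if "0 \<le> a" "a < 1" "0 \<le> b" "b < 1" for a b :: real
    by (intro unif_angle_integral continuous_intros cf that)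
  have KW: "W \<rho> \<le> Re (K s \<rho>)" if "0 \<le> \<rho>" "\<rho> \<le> s" "s < 1" for \<rho> s
    unfolding W_def using that
    by (intro sums_le[OF _ ser ser]) (auto intro!: mult_left_mono power_mono mult_right_mono)
  have Wmono: "W \<rho> \<le> W s" if "0 \<le> \<rho>" "\<rho> \<le> s" "s < 1" for \<rho> s
    unfolding W_def using that
    by (intro sums_le[OF _ ser ser]) (auto intro!: mult_left_mono power_mono mult_mono)
  have Wb: "W r \<le> B\<^sup>2" if r: "0 \<le> r" "r < 1" for r
  proof -
    have "W r = circle_mean (\<lambda>t. Re (f (of_real r * cis t) * cnj (f (of_real r * cis t))))"
      unfolding W_def K_def by (rule integral_Re[symmetric, OF K_int[OF r r]])
    also have "\<dots> \<le> circle_mean (\<lambda>t. B\<^sup>2)"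
    proof (rule integral_mono)
      show "integrable unif_angle (\<lambda>t. Re (f (of_real r * cis t) * cnj (f (of_real r * cis t))))"
        by (rule integrable_Re[OF K_int[OF r r]])
      fix t
      have "cmod (f (of_real r * cis t)) \<le> B" by (rule B) (use r in \<open>simp add: norm_mult\<close>)
      then have "(cmod (f (of_real r * cis t)))\<^sup>2 \<le> B\<^sup>2" by (intro power_mono) auto
      then show "Re (f (of_real r * cis t) * cnj (f (of_real r * cis t))) \<le> B\<^sup>2"
        by (simp only: complex_norm_square[symmetric] of_real_power[symmetric] Re_complex_of_real)
    qed simp
    finally show ?thesis by simp
  qed
  have bdd: "bdd_above (W ` {0..<1})" using Wb by (intro bdd_aboveI2[of _ _ "B\<^sup>2"]) auto
  have "(SUP r\<in>{0..<1}. W r) - e\<^sup>2 < (SUP r\<in>{0..<1}. W r)" using e by simp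
  then obtain \<rho>\<^sub>0 where r0: "\<rho>\<^sub>0 \<in> {0..<1}" "(SUP r\<in>{0..<1}. W r) - e\<^sup>2 < W \<rho>\<^sub>0"
    using less_cSUP_iff[of "{0..<1::real}" W, OF _ bdd] by auto
  show thesis
  proof (rule that)
    show "0 \<le> \<rho>\<^sub>0" "\<rho>\<^sub>0 < 1" using r0 by auto
    fix \<rho> s assume as: "\<rho>\<^sub>0 \<le> \<rho>" "\<rho> \<le> s" "s < 1"
    then have rs: "0 \<le> \<rho>" "\<rho> < 1" "0 \<le> s" using r0 by auto
    define h where "h t = f (of_real s * cis t) - f (of_real \<rho> * cis t)" for t
    have ch: "continuous_on UNIV h" unfolding h_def using rs as by (intro continuous_intros cf)
    have ih: "integrable unif_angle (\<lambda>t. cmod (h t))" "integrable unif_angle (\<lambda>t. (cmod (h t))\<^sup>2)"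
      by (intro unif_angle_integral continuous_intros ch)+
    have "complex_of_real ((cmod (h t))\<^sup>2) = f (of_real s * cis t) * cnj (f (of_real s * cis t))
       - f (of_real s * cis t) * cnj (f (of_real \<rho> * cis t)) - cnj (f (of_real s * cis t) * cnj (f (of_real \<rho> * cis t)))
       + f (of_real \<rho> * cis t) * cnj (f (of_real \<rho> * cis t))" for t
      unfolding complex_norm_square h_def by (simp add: algebra_simps)
    then have "complex_of_real (circle_mean (\<lambda>t. (cmod (h t))\<^sup>2)) = K s s - K s \<rho> - cnj (K s \<rho>) + K \<rho> \<rho>"
      unfolding K_def integral_complex_of_real[symmetric] Bochner_Integration.integral_cnj[symmetric]
      using K_int rs as by (simp only: Bochner_Integration.integral_add Bochner_Integration.integral_diff
         Bochner_Integration.integrable_diff Bochner_Integration.integrable_add integrable_cnj)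
    then have "circle_mean (\<lambda>t. (cmod (h t))\<^sup>2) = W s - 2 * Re (K s \<rho>) + W \<rho>"
      unfolding W_def by (metis (no_types, lifting) Re_complex_of_real cnj.simps(1) diff_diff_eq minus_complex.sel(1) mult_2 plus_complex.sel(1))
    also have "\<dots> \<le> W s - W \<rho>" using KW[of \<rho> s] rs as by simp
    also have "\<dots> \<le> e\<^sup>2"
    proof -
      have "W s \<le> (SUP r\<in>{0..<1}. W r)" using rs as by (intro cSUP_upper bdd) auto
      moreover have "W \<rho>\<^sub>0 \<le> W \<rho>" using r0 rs as by (intro Wmono) auto
      ultimately show ?thesis using r0(2) by linarith
    qed
    finally have sq: "circle_mean (\<lambda>t. (cmod (h t))\<^sup>2) \<le> e\<^sup>2" .
    have "circle_mean (\<lambda>t. cmod (h t)) \<le> circle_mean (\<lambda>t. e / 2 + (cmod (h t))\<^sup>2 / (2 * e))"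
    proof (rule integral_mono)
      fix t
      have "0 \<le> (cmod (h t) - e)\<^sup>2" by simp
      then have "2 * e * cmod (h t) \<le> e * e + (cmod (h t))\<^sup>2" by (simp add: power2_eq_square algebra_simps)
      then show "cmod (h t) \<le> e / 2 + (cmod (h t))\<^sup>2 / (2 * e)" using e by (simp add: field_simps)
    qed (use ih in auto)
    also have "\<dots> = e / 2 + circle_mean (\<lambda>t. (cmod (h t))\<^sup>2) / (2 * e)"
      using ih by simp
    also have "\<dots> \<le> e / 2 + e\<^sup>2 / (2 * e)" using sq e by (intro add_left_mono divide_right_mono) auto
    also have "\<dots> = e" using e by (simp add: power2_eq_square)
    finally show "circle_mean (\<lambda>t. cmod (f (of_real s * cis t) - f (of_real \<rho> * cis t))) \<le> e"
      by (simp add: h_def)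
  qed
qed

text \<open>Fatou's theorem. The maximal inequality applies to the difference of two dilates of \<open>f\<close>, which is
  small in the mean. So outside a set of small measure \<open>f\<close> oscillates little along the radii near the
  boundary, and the points with large oscillation form a null set.\<close>

lemma Fatou_bounded_holomorphic:
  assumes f: "f holomorphic_on ball 0 1" and B: "\<And>z. cmod z < 1 \<Longrightarrow> cmod (f z) \<le> B"
  shows "AE x in unif_angle. \<exists>l. ((\<lambda>r. f (of_real r * cis x)) \<longlongrightarrow> l) (at_left 1)"
proof -
  define N where "N k = {x\<in>{0..2*pi}. \<forall>\<rho><1. \<exists>r\<in>{\<rho><..<1}. \<exists>r'\<in>{\<rho><..<1}.
      cmod (f (of_real r * cis x) - f (of_real r' * cis x)) > 3 * inverse (real (Suc k))}" for k
  have cov: "\<exists>V\<in>sets borel. N k \<subseteq> V \<and> emeasure lborel V \<le> ennreal \<eta>" if \<eta>: "\<eta> > 0" for k \<eta>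
  proof -
    define \<kappa> where "\<kappa> = inverse (real (Suc k))"
    have \<kappa>: "\<kappa> > 0" by (simp add: \<kappa>_def)
    define e where "e = \<eta> * \<kappa> / (240 * pi)"
    have e: "e > 0" using \<eta> \<kappa> by (simp add: e_def)
    obtain \<rho>\<^sub>0 where r0: "0 \<le> \<rho>\<^sub>0" "\<rho>\<^sub>0 < 1"
      "\<And>\<rho> s. \<rho>\<^sub>0 \<le> \<rho> \<Longrightarrow> \<rho> \<le> s \<Longrightarrow> s < 1 \<Longrightarrow>
        circle_mean (\<lambda>t. cmod (f (of_real s * cis t) - f (of_real \<rho> * cis t))) \<le> e"
      using bounded_holomorphic_L1_Cauchy[OF f B e] by blast
    define \<rho> where "\<rho> = max \<rho>\<^sub>0 (1/2)"
    have \<rho>: "\<rho>\<^sub>0 \<le> \<rho>" "1/2 \<le> \<rho>" "\<rho> < 1" using r0 by (auto simp: \<rho>_def)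
    define s where "s n = 1 - (1 - \<rho>) * inverse (real (Suc n))" for n
    have s: "\<rho> \<le> s n" "s n < 1" for n
    proof -
      have "inverse (real (Suc n)) \<le> 1" by (simp add: field_simps)
      then have "(1 - \<rho>) * inverse (real (Suc n)) \<le> (1 - \<rho>) * 1" using \<rho> by (intro mult_left_mono) auto
      then show "\<rho> \<le> s n" by (simp add: s_def)
      show "s n < 1" using \<rho> by (simp add: s_def)
    qed
    have slim: "s \<longlonglongrightarrow> 1"
      unfolding s_def using tendsto_diff[OF tendsto_const tendsto_mult_left[OF LIMSEQ_inverse_real_of_nat, of "1-\<rho>"], of 1] by simp
    define g where "g n z = f (of_real (s n) * z) - f (of_real \<rho> * z)" for n z
    have "\<exists>U. U \<in> sets borel \<and> emeasure lborel U \<le> ennreal \<eta> \<and>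
      (\<forall>x r. x \<in> {0..2*pi} \<longrightarrow> x \<notin> U \<longrightarrow> 1/2 \<le> r \<longrightarrow> r < 1 \<longrightarrow> cmod (g n (of_real r * cis x)) \<le> \<kappa>)" for n
    proof -
      define R where "R = 1 / s n"
      have R: "1 < R" using s[of n] \<rho> by (simp add: R_def field_simps)
      have g: "g n holomorphic_on ball 0 R"
      proof -
        have "cmod (of_real (s n) * z) < 1" "cmod (of_real \<rho> * z) < 1" if "z \<in> ball 0 R" for z
        proof -
          have pos: "0 < s n" using s[of n] \<rho> by linarith
          have z: "s n * cmod z < 1" using that pos by (simp add: R_def field_simps)
          have "\<rho> * cmod z \<le> s n * cmod z" using s[of n] by (intro mult_right_mono) auto
          then show "cmod (of_real (s n) * z) < 1" "cmod (of_real \<rho> * z) < 1"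
            using z pos \<rho> by (auto simp: norm_mult)
        qed
        then show ?thesis unfolding g_def
          by (intro holomorphic_intros holomorphic_on_compose_gen[OF _ f, unfolded o_def]) auto
      qed
      obtain U where U: "U \<in> sets borel"
        "emeasure lborel U \<le> ennreal (240 * pi / \<kappa> * circle_mean (\<lambda>t. cmod (g n (cis t))))"
        "\<And>x r. \<lbrakk>x \<in> {0..2*pi}; x \<notin> U; 1/2 \<le> r; r < 1\<rbrakk> \<Longrightarrow> cmod (g n (of_real r * cis x)) \<le> \<kappa>"
        using radial_maximal_inequality[OF g R \<kappa>] by blast
      have "240 * pi / \<kappa> * circle_mean (\<lambda>t. cmod (g n (cis t))) \<le> 240 * pi / \<kappa> * e"
        using r0(3)[OF \<rho>(1) s(1) s(2), of n] \<kappa> by (intro mult_left_mono) (auto simp: g_def)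
      also have "\<dots> = \<eta>" using \<kappa> by (simp add: e_def)
      finally have "emeasure lborel U \<le> ennreal \<eta>" using U(2) order_trans ennreal_leI by blast
      then show ?thesis using U by blast
    qed
    then obtain U where U: "\<And>n. U n \<in> sets borel" "\<And>n. emeasure lborel (U n) \<le> ennreal \<eta>"
      "\<And>n x r. \<lbrakk>x \<in> {0..2*pi}; x \<notin> U n; 1/2 \<le> r; r < 1\<rbrakk> \<Longrightarrow> cmod (g n (of_real r * cis x)) \<le> \<kappa>"
      by metis
    define A where "A m = (\<Inter>n\<in>{m..}. U n)" for m
    define V where "V = (\<Union>m. A m)"
    have Am: "A m \<in> sets borel" for m unfolding A_def using U(1) by (intro sets.countable_INT') auto
    have Vs: "V \<in> sets borel" unfolding V_def using Am by auto
    have "incseq A" unfolding A_def by (intro incseq_SucI INF_superset_mono) auto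
    then have "emeasure lborel V = (SUP m. emeasure lborel (A m))"
      unfolding V_def using Am by (intro SUP_emeasure_incseq[symmetric]) auto
    also have "\<dots> \<le> ennreal \<eta>"
    proof (rule SUP_least)
      fix m
      have "emeasure lborel (A m) \<le> emeasure lborel (U m)"
        by (rule emeasure_mono) (auto simp: A_def U(1))
      then show "emeasure lborel (A m) \<le> ennreal \<eta>" using U(2) order_trans by blast
    qed
    finally have Ve: "emeasure lborel V \<le> ennreal \<eta>" .
    have "N k \<subseteq> V"
    proof
      fix x assume xN: "x \<in> N k"
      then have x: "x \<in> {0..2*pi}" by (simp add: N_def)
      show "x \<in> V"
      proof (rule ccontr)
        assume "x \<notin> V"
        then have inf: "\<exists>n\<ge>m. x \<notin> U n" for m by (auto simp: V_def A_def)
        have cont: "isCont f z" if "cmod z < 1" for z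
          using holomorphic_on_imp_continuous_on[OF f] that
          by (simp add: continuous_on_eq_continuous_at)
        have le: "cmod (f (of_real r * cis x) - f (of_real \<rho> * (of_real r * cis x))) \<le> \<kappa>" if r: "1/2 \<le> r" "r < 1" for r
        proof (rule ccontr)
          assume "\<not> ?thesis"
          then have gt: "cmod (f (of_real r * cis x) - f (of_real \<rho> * (of_real r * cis x))) > \<kappa>" by simp
          have "(\<lambda>n. of_real (s n) * (of_real r * cis x)) \<longlonglongrightarrow> of_real 1 * (of_real r * cis x)"
            by (intro tendsto_intros slim)
          then have "(\<lambda>n. f (of_real (s n) * (of_real r * cis x))) \<longlonglongrightarrow> f (of_real r * cis x)"
            using r by (intro isCont_tendsto_compose[OF cont]) (auto simp: norm_mult)
          then have "(\<lambda>n. cmod (g n (of_real r * cis x))) \<longlonglongrightarrow> cmod (f (of_real r * cis x) - f (of_real \<rho> * (of_real r * cis x)))"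
            unfolding g_def by (intro tendsto_intros)
          from order_tendstoD(1)[OF this gt] obtain m where "\<forall>n\<ge>m. \<kappa> < cmod (g n (of_real r * cis x))"
            by (auto simp: eventually_sequentially)
          moreover obtain n where "n \<ge> m" "x \<notin> U n" using inf by blast
          ultimately show False using U(3)[OF x \<open>x \<notin> U n\<close> r] by force
        qed
        have "((\<lambda>r. f (of_real \<rho> * (of_real r * cis x))) \<longlongrightarrow> f (of_real \<rho> * (of_real 1 * cis x))) (at_left 1)"
          using \<rho> by (intro isCont_tendsto_compose[OF cont] tendsto_intros) (auto simp: norm_mult)
        then have "eventually (\<lambda>r. dist (f (of_real \<rho> * (of_real r * cis x))) (f (of_real \<rho> * (of_real 1 * cis x))) < \<kappa>/2) (at_left 1)"
          using \<kappa> by (intro tendstoD) auto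
        then obtain b where b: "b < 1" "\<And>r. b < r \<Longrightarrow> r < 1 \<Longrightarrow> dist (f (of_real \<rho> * (of_real r * cis x))) (f (of_real \<rho> * (of_real 1 * cis x))) < \<kappa>/2"
          unfolding eventually_at_left[OF zero_less_one] by blast
        have close: "cmod (f (of_real r * cis x) - f (of_real \<rho> * (of_real 1 * cis x))) \<le> 3/2 * \<kappa>" if "max b (1/2) < r" "r < 1" for r
        proof -
          have "cmod (f (of_real r * cis x) - f (of_real \<rho> * (of_real 1 * cis x))) \<le>
             cmod (f (of_real r * cis x) - f (of_real \<rho> * (of_real r * cis x))) +
             cmod (f (of_real \<rho> * (of_real r * cis x)) - f (of_real \<rho> * (of_real 1 * cis x)))"
            unfolding dist_norm[symmetric] by (rule dist_triangle)
          moreover have "cmod (f (of_real r * cis x) - f (of_real \<rho> * (of_real r * cis x))) \<le> \<kappa>"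
            using that by (intro le) auto
          moreover have "cmod (f (of_real \<rho> * (of_real r * cis x)) - f (of_real \<rho> * (of_real 1 * cis x))) < \<kappa>/2"
            using b(2)[of r] that by (simp add: dist_norm)
          ultimately show ?thesis by linarith
        qed
        have "max b (1/2) < 1" using b by simp
        then obtain r r' where rr: "r \<in> {max b (1/2)<..<1}" "r' \<in> {max b (1/2)<..<1}"
          "cmod (f (of_real r * cis x) - f (of_real r' * cis x)) > 3 * \<kappa>"
          using xN unfolding N_def \<kappa>_def by blast
        define w where "w = f (of_real \<rho> * (of_real 1 * cis x))"
        have "cmod (f (of_real r * cis x) - w) \<le> 3/2 * \<kappa>" "cmod (f (of_real r' * cis x) - w) \<le> 3/2 * \<kappa>"
          unfolding w_def using rr by (intro close; simp)+
        moreover have "cmod (f (of_real r * cis x) - f (of_real r' * cis x)) \<le>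
           cmod (f (of_real r * cis x) - w) + cmod (f (of_real r' * cis x) - w)"
          using norm_triangle_ineq4[of "f (of_real r * cis x) - w" "f (of_real r' * cis x) - w"] by simp
        ultimately show False using rr(3) by linarith
      qed
    qed
    with Vs Ve show ?thesis by blast
  qed
  have null: "\<exists>Z\<in>null_sets lborel. N k \<subseteq> Z" for k
  proof -
    have "\<exists>V. V\<in>sets borel \<and> N k \<subseteq> V \<and> emeasure lborel V \<le> ennreal (inverse (real (Suc n)))" for n
      using cov[of "inverse (real (Suc n))" k] by auto
    then obtain V where V: "\<And>n. V n \<in> sets borel" "\<And>n. N k \<subseteq> V n"
      "\<And>n. emeasure lborel (V n) \<le> ennreal (inverse (real (Suc n)))" by metis
    have Zs: "(\<Inter>n. V n) \<in> sets borel" using V(1) by auto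
    have "emeasure lborel (\<Inter>n. V n) \<le> ennreal (inverse (real (Suc n)))" for n
      using V(1) Zs by (intro order_trans[OF emeasure_mono V(3)]) auto
    moreover have "(\<lambda>n. ennreal (inverse (real (Suc n)))) \<longlonglongrightarrow> ennreal 0"
      by (intro tendsto_ennrealI LIMSEQ_inverse_real_of_nat)
    ultimately have "emeasure lborel (\<Inter>n. V n) \<le> ennreal 0"
      by (intro tendsto_lowerbound[where F=sequentially]) auto
    then have "(\<Inter>n. V n) \<in> null_sets lborel" using Zs by (simp add: null_sets_def)
    moreover have "N k \<subseteq> (\<Inter>n. V n)" using V(2) by blast
    ultimately show ?thesis by blast
  qed
  then obtain Z where Z: "\<And>k. Z k \<in> null_sets lborel" "\<And>k. N k \<subseteq> Z k" by metis
  have "(\<Union>k. Z k) \<in> null_sets lborel" using Z(1) by auto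
  then have "AE x in lborel. x \<notin> (\<Union>k. Z k)" by (rule AE_not_in)
  then have "AE x in lborel. x \<in> {0..2*pi} \<longrightarrow> (\<exists>l. ((\<lambda>r. f (of_real r * cis x)) \<longlongrightarrow> l) (at_left 1))"
  proof (rule AE_mp, intro AE_I2 impI)
    fix x assume x: "x \<notin> (\<Union>k. Z k)" "x \<in> {0..2*pi}"
    show "\<exists>l. ((\<lambda>r. f (of_real r * cis x)) \<longlongrightarrow> l) (at_left 1)"
      unfolding at_left_limit_iff_Cauchy
    proof (intro allI impI)
      fix e :: real assume "e > 0"
      then obtain k where k: "inverse (real (Suc k)) < e / 3"
        using reals_Archimedean[of "e/3"] by auto
      have "x \<notin> N k" using x Z(2) by blast
      then obtain \<rho> where "\<rho> < 1" "\<And>r r'. r\<in>{\<rho><..<1} \<Longrightarrow> r'\<in>{\<rho><..<1} \<Longrightarrow>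
         \<not> cmod (f (of_real r * cis x) - f (of_real r' * cis x)) > 3 * inverse (real (Suc k))"
        using x(2) unfolding N_def by blast
      then show "\<exists>\<rho><1. \<forall>r\<in>{\<rho><..<1}. \<forall>r'\<in>{\<rho><..<1}. cmod (f (of_real r * cis x) - f (of_real r' * cis x)) \<le> e"
        using k by (intro exI[of _ \<rho>]) force
    qed
  qed
  then show ?thesis unfolding unif_angle_def
    by (intro AE_uniform_measureI) auto
qed

section \<open>Subharmonic functions in the disc\<close>

text \<open>On the unit circle \<open>cnj w\<close> is \<open>1 / w\<close>, so a real polynomial in the two real coordinates becomes a
  polynomial in \<open>w\<close> after multiplication by a power of \<open>w\<close>.\<close>

lemma real_polynomial_on_circle:
  assumes "real_polynomial_function (q :: complex \<Rightarrow> real)"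
  shows "\<exists>P N. \<forall>w. cmod w = 1 \<longrightarrow> complex_of_real (q w) * w ^ N = poly P w"
  using assms
proof induction
  case (linear q)
  define A where "A = (complex_of_real (q 1) - \<i> * of_real (q \<i>)) / 2"
  define B where "B = (complex_of_real (q 1) + \<i> * of_real (q \<i>)) / 2"
  have "complex_of_real (q w) * w ^ 1 = poly [:B, 0, A:] w" if w: "cmod w = 1" for w
  proof -
    have "q w = q (Re w *\<^sub>R 1 + Im w *\<^sub>R \<i>)"
      by (metis complex_eq mult.commute scaleR_conv_of_real mult.right_neutral)
    also have "\<dots> = Re w * q 1 + Im w * q \<i>"
      using linear by (simp add: linear_simps)
    finally have q: "complex_of_real (q w) = of_real (Re w) * of_real (q 1) + of_real (Im w) * of_real (q \<i>)" by simp
    have cc: "cnj w * w = 1" using w complex_norm_square[of w] by (simp add: mult.commute)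
    have re: "complex_of_real (Re w) = (w + cnj w) / 2" and im: "complex_of_real (Im w) = - \<i> * (w - cnj w) / 2"
      by (simp_all add: complex_eq_iff)
    have "complex_of_real (q w) = A * w + B * cnj w"
      unfolding q re im A_def B_def by (simp add: field_simps)
    then have "complex_of_real (q w) * w = A * w * w + B * (cnj w * w)" by (simp add: algebra_simps)
    then show ?thesis unfolding cc by (simp add: algebra_simps)
  qed
  then show ?case by blast
next
  case (const c)
  have "\<forall>w. cmod w = 1 \<longrightarrow> complex_of_real c * w ^ 0 = poly [:of_real c:] w" by simp
  then show ?case by blast
next
  case (add f g)
  then obtain P N Q M where
    "\<And>w. cmod w = 1 \<Longrightarrow> complex_of_real (f w) * w ^ N = poly P w"
    "\<And>w. cmod w = 1 \<Longrightarrow> complex_of_real (g w) * w ^ M = poly Q w" by blast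
  then have "complex_of_real (f w + g w) * w ^ (N + M) = poly (P * monom 1 M + Q * monom 1 N) w" if "cmod w = 1" for w
    using that by (simp add: power_add distrib_right poly_monom flip: mult.assoc)
  then show ?case by blast
next
  case (mult f g)
  then obtain P N Q M where
    "\<And>w. cmod w = 1 \<Longrightarrow> complex_of_real (f w) * w ^ N = poly P w"
    "\<And>w. cmod w = 1 \<Longrightarrow> complex_of_real (g w) * w ^ M = poly Q w" by blast
  then have "complex_of_real (f w * g w) * w ^ (N + M) = poly (P * Q) w" if "cmod w = 1" for w
    using that by (simp add: power_add) (metis mult.assoc mult.commute)
  then show ?case by blast
qed

text \<open>Stone--Weierstrass makes \<open>u\<close> close to a trigonometric polynomial. A real trigonometric polynomial
  is the real part on the circle of an entire function, since its negative frequencies are conjugate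
  to positive ones.\<close>

lemma circle_function_approx_Re_entire:
  fixes u :: "complex \<Rightarrow> real"
  assumes u: "continuous_on (sphere 0 1) u" and e: "0 < e"
  obtains p where "p holomorphic_on UNIV"
    "\<And>w. cmod w = 1 \<Longrightarrow> u w \<le> Re (p w)" "\<And>w. cmod w = 1 \<Longrightarrow> Re (p w) \<le> u w + e"
proof -
  have "continuous_on (sphere 0 1) (\<lambda>w. u w + e/2)" by (intro continuous_intros u)
  then obtain q where q: "real_polynomial_function q" "\<And>w. w \<in> sphere 0 1 \<Longrightarrow> \<bar>u w + e/2 - q w\<bar> < e/2"
    using Stone_Weierstrass_real_polynomial_function[of "sphere (0::complex) 1" "\<lambda>w. u w + e/2" "e/2"] e by auto
  obtain P N where PN: "\<And>w. cmod w = 1 \<Longrightarrow> complex_of_real (q w) * w ^ N = poly P w"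
    using real_polynomial_on_circle[OF q(1)] by blast
  define p where "p w = (\<Sum>i\<le>degree P. if N \<le> i then coeff P i * w ^ (i - N) else cnj (coeff P i) * w ^ (N - i))" for w
  have hol: "p holomorphic_on UNIV"
    unfolding p_def
  proof (intro holomorphic_on_sum)
    fix i
    show "(\<lambda>w. if N \<le> i then coeff P i * w ^ (i - N) else cnj (coeff P i) * w ^ (N - i)) holomorphic_on UNIV"
      by (cases "N \<le> i") (auto intro!: holomorphic_intros)
  qed
  have Rep: "Re (p w) = q w" if w: "cmod w = 1" for w
  proof -
    have cc: "w ^ n * cnj w ^ n = 1" for n
      using w complex_norm_square[of w] by (simp flip: power_mult_distrib)
    have "complex_of_real (q w) = complex_of_real (q w) * w ^ N * cnj w ^ N"
      using cc[of N] by (simp only: mult.assoc mult_1_right)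
    also have "\<dots> = (\<Sum>i\<le>degree P. coeff P i * w ^ i * cnj w ^ N)"
      unfolding PN[OF w] poly_altdef sum_distrib_right ..
    finally have "q w = (\<Sum>i\<le>degree P. Re (coeff P i * w ^ i * cnj w ^ N))"
      by (metis (no_types, lifting) Re_complex_of_real Re_sum sum.cong)
    also have "\<dots> = (\<Sum>i\<le>degree P. Re (if N \<le> i then coeff P i * w ^ (i - N) else cnj (coeff P i) * w ^ (N - i)))"
    proof (rule sum.cong)
      fix i
      show "Re (coeff P i * w ^ i * cnj w ^ N) = Re (if N \<le> i then coeff P i * w ^ (i - N) else cnj (coeff P i) * w ^ (N - i))"
      proof (cases "N \<le> i")
        case True
        then have "w ^ i * cnj w ^ N = w ^ (i - N) * (w ^ N * cnj w ^ N)"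
          by (simp flip: power_add mult.assoc)
        then have "w ^ i * cnj w ^ N = w ^ (i - N)" unfolding cc by simp
        then show ?thesis using True by (simp only: mult.assoc if_True)
      next
        case False
        then have "w ^ i * cnj w ^ N = (w ^ i * cnj w ^ i) * cnj w ^ (N - i)"
          by (simp flip: power_add add: mult.assoc)
        then have "w ^ i * cnj w ^ N = cnj w ^ (N - i)" unfolding cc by simp
        then have "coeff P i * w ^ i * cnj w ^ N = cnj (cnj (coeff P i) * w ^ (N - i))"
          by (simp add: mult.assoc)
        then have "Re (coeff P i * w ^ i * cnj w ^ N) = Re (cnj (coeff P i) * w ^ (N - i))"
          by (metis complex_cnj_cnj cnj.simps(1))
        then show ?thesis using False by (simp only: if_False)
      qed
    qed simp
    finally show ?thesis unfolding p_def by simp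
  qed
  show thesis
  proof (rule that[OF hol])
    fix w :: complex assume w: "cmod w = 1"
    have "\<bar>u w + e/2 - q w\<bar> < e/2" using q(2) w by simp
    then show "u w \<le> Re (p w)" "Re (p w) \<le> u w + e" unfolding Rep[OF w] by linarith+
  qed
qed

text \<open>A substitute for the Poisson integral of \<open>u\<close>: a majorant that is the real part of an entire
  function, up to an arbitrarily small loss in its value at the origin.\<close>

lemma harmonic_majorant:
  fixes u :: "complex \<Rightarrow> real"
  assumes u: "continuous_on (sphere 0 1) u" and e: "0 < e"
  obtains p where "p holomorphic_on UNIV" "\<And>w. cmod w = 1 \<Longrightarrow> u w \<le> Re (p w)"
    "Re (p 0) \<le> circle_mean (\<lambda>t. u (cis t)) + e"
proof -
  obtain p where p: "p holomorphic_on UNIV"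
    "\<And>w. cmod w = 1 \<Longrightarrow> u w \<le> Re (p w)" "\<And>w. cmod w = 1 \<Longrightarrow> Re (p w) \<le> u w + e"
    using circle_function_approx_Re_entire[OF u e] by blast
  have cp: "continuous_on UNIV (\<lambda>t. p (cis t))"
    by (rule continuous_on_compose2[OF holomorphic_on_imp_continuous_on[OF p(1)]]) (auto intro: continuous_intros)
  have ip: "integrable unif_angle (\<lambda>t. p (cis t))" by (rule unif_angle_integral[OF cp])
  have iu: "integrable unif_angle (\<lambda>t. u (cis t))" by (intro unif_angle_integral continuous_on_circle_compose u)
  have "p 0 = circle_mean (\<lambda>t. p (cis t))"
    by (rule holomorphic_mean_value[symmetric, where R=2]) (auto intro: holomorphic_on_subset[OF p(1)])
  then have "Re (p 0) = circle_mean (\<lambda>t. Re (p (cis t)))"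
    using integral_Re[OF ip] by simp
  also have "\<dots> \<le> circle_mean (\<lambda>t. u (cis t) + e)"
    by (rule integral_mono) (use ip iu p(3) in \<open>auto intro: integrable_Re\<close>)
  also have "\<dots> = circle_mean (\<lambda>t. u (cis t)) + e" using iu by simp
  finally show thesis using that p by blast
qed

lemma modulus_le_exp_Re:
  assumes f: "f holomorphic_on ball 0 R" "1 < R" and p: "p holomorphic_on UNIV"
    and le: "\<And>w. cmod w = 1 \<Longrightarrow> cmod (f w) \<le> exp (Re (p w))" and z: "cmod z \<le> 1"
  shows "cmod (f z) \<le> exp (Re (p z))"
proof -
  define g where "g w = f w * exp (- p w)" for w
  have g: "g holomorphic_on ball 0 R" unfolding g_def
    by (intro holomorphic_intros f holomorphic_on_subset[OF p]) auto
  have gc: "cmod (g w) = cmod (f w) / exp (Re (p w))" for w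
    by (simp add: g_def norm_mult exp_minus norm_inverse norm_exp_eq_Re divide_inverse)
  have "cmod (g z) \<le> 1"
  proof (rule maximum_modulus_frontier[where S="cball 0 1" and f=g])
    show "g holomorphic_on interior (cball 0 1)"
      by (rule holomorphic_on_subset[OF g]) (use f in auto)
    show "continuous_on (closure (cball 0 1)) g"
      by (rule continuous_on_subset[OF holomorphic_on_imp_continuous_on[OF g]]) (use f in auto)
    show "cmod (g w) \<le> 1" if "w \<in> frontier (cball 0 1)" for w
      using le[of w] that by (simp add: gc)
  qed (use z in auto)
  then show ?thesis by (simp add: gc)
qed

text \<open>The assumption \<open>sub\<close> is subharmonicity tested against real parts of entire functions; such tests
  suffice because these real parts approximate every continuous function on the circle.\<close>

lemma subharmonic_mean_le:
  fixes v :: "complex \<Rightarrow> real"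
  assumes v: "continuous_on (cball 0 1) v"
    and sub: "\<And>p z. \<lbrakk>p holomorphic_on UNIV; \<And>w. cmod w = 1 \<Longrightarrow> v w \<le> Re (p w); cmod z \<le> 1\<rbrakk> \<Longrightarrow> v z \<le> Re (p z)"
    and \<rho>: "0 \<le> \<rho>" "\<rho> \<le> 1"
  shows "circle_mean (\<lambda>t. v (of_real \<rho> * cis t)) \<le> circle_mean (\<lambda>t. v (cis t))"
proof (rule field_le_epsilon)
  fix e :: real assume "0 < e"
  then obtain p where p: "p holomorphic_on UNIV" "\<And>w. cmod w = 1 \<Longrightarrow> v w \<le> Re (p w)"
    "Re (p 0) \<le> circle_mean (\<lambda>t. v (cis t)) + e"
    using harmonic_majorant[OF continuous_on_subset[OF v]] by (metis sphere_cball)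
  have cp: "continuous_on UNIV (\<lambda>t. p (of_real \<rho> * cis t))"
    by (rule continuous_on_compose2[OF holomorphic_on_imp_continuous_on[OF p(1)]]) (auto intro!: continuous_intros)
  have ip: "integrable unif_angle (\<lambda>t. p (of_real \<rho> * cis t))" by (rule unif_angle_integral[OF cp])
  have "continuous_on UNIV (\<lambda>t. v (of_real \<rho> * cis t))"
    by (rule continuous_on_compose2[OF v]) (use \<rho> in \<open>auto intro!: continuous_intros simp: norm_mult\<close>)
  then have iv: "integrable unif_angle (\<lambda>t. v (of_real \<rho> * cis t))" by (rule unif_angle_integral)
  have "(\<lambda>z. p (of_real \<rho> * z)) holomorphic_on ball 0 2"
    by (rule holomorphic_on_compose_gen[OF _ p(1), unfolded o_def]) (auto intro!: holomorphic_intros)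
  then have "circle_mean (\<lambda>t. p (of_real \<rho> * cis t)) = p 0"
    using holomorphic_mean_value[of "\<lambda>z. p (of_real \<rho> * z)" 2] by simp
  then have "circle_mean (\<lambda>t. Re (p (of_real \<rho> * cis t))) = Re (p 0)"
    using integral_Re[OF ip] by simp
  moreover have "circle_mean (\<lambda>t. v (of_real \<rho> * cis t)) \<le> circle_mean (\<lambda>t. Re (p (of_real \<rho> * cis t)))"
  proof (rule integral_mono[OF iv])
    show "integrable unif_angle (\<lambda>t. Re (p (of_real \<rho> * cis t)))" using ip by (rule integrable_Re)
    show "v (of_real \<rho> * cis t) \<le> Re (p (of_real \<rho> * cis t))" for t
      by (rule sub[OF p(1,2)]) (use \<rho> in \<open>auto simp: norm_mult\<close>)
  qed
  ultimately show "circle_mean (\<lambda>t. v (of_real \<rho> * cis t)) \<le> circle_mean (\<lambda>t. v (cis t)) + e"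
    using p(3) by linarith
qed

lemma log_plus_nonneg [simp]: "0 \<le> log_plus x"
  by (simp add: log_plus_def)

lemma log_plus_eq: "0 \<le> x \<Longrightarrow> log_plus x = ln (max 1 x)"
  by (cases "x = 0") (auto simp: log_plus_def max_def ln_ge_zero_iff not_le)

lemma exp_log_plus: "0 \<le> x \<Longrightarrow> exp (log_plus x) = max 1 x"
  by (simp add: log_plus_eq)

lemma continuous_on_log_plus:
  assumes "continuous_on S (f :: 'a::topological_space \<Rightarrow> complex)"
  shows "continuous_on S (\<lambda>z. log_plus (cmod (f z)))"
  unfolding log_plus_eq[OF norm_ge_zero]
  by (intro continuous_intros assms) (metis less_max_iff_disj less_numeral_extra(1,3))

lemma continuous_on_ln_1_plus_cmod:
  assumes "continuous_on S (f :: 'a::topological_space \<Rightarrow> complex)"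
  shows "continuous_on S (\<lambda>z. ln (1 + cmod (f z)))"
  by (intro continuous_intros assms) (metis add_pos_nonneg less_irrefl norm_ge_zero zero_less_one)

lemma log_plus_subharmonic:
  assumes f: "f holomorphic_on ball 0 R" "1 < R" and p: "p holomorphic_on UNIV"
    and le: "\<And>w. cmod w = 1 \<Longrightarrow> log_plus (cmod (f w)) \<le> Re (p w)" and z: "cmod z \<le> 1"
  shows "log_plus (cmod (f z)) \<le> Re (p z)"
proof -
  have le': "max 1 (cmod (f w)) \<le> exp (Re (p w))" if "cmod w = 1" for w
    using le[OF that] by (simp only: exp_log_plus[OF norm_ge_zero, symmetric] exp_le_cancel_iff)
  have "cmod (f z) \<le> exp (Re (p z))"
    by (rule modulus_le_exp_Re[OF f p _ z]) (use le' in auto)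
  moreover have "cmod 1 \<le> exp (Re (p z))"
    by (rule modulus_le_exp_Re[where f = "\<lambda>_. 1" and R=2]) (use le' p z in auto)
  ultimately have "exp (log_plus (cmod (f z))) \<le> exp (Re (p z))"
    by (simp add: exp_log_plus)
  then show ?thesis by simp
qed

lemma ln_1_plus_cmod_subharmonic:
  assumes f: "f holomorphic_on ball 0 R" "1 < R" and p: "p holomorphic_on UNIV"
    and le: "\<And>w. cmod w = 1 \<Longrightarrow> ln (1 + cmod (f w)) \<le> Re (p w)" and z: "cmod z \<le> 1"
  shows "ln (1 + cmod (f z)) \<le> Re (p z)"
proof -
  have pos: "0 < 1 + cmod w" for w by (simp add: add_pos_nonneg)
  define c where "c = (if f z = 0 then 1 else cnj (sgn (f z)))"
  have c: "cmod c = 1" by (simp add: c_def norm_sgn)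
  have cz: "c * f z = of_real (cmod (f z))"
    by (simp add: c_def sgn_eq) (simp add: complex_norm_square[symmetric] mult.commute power2_eq_square)
  have "cmod (1 + c * f z) \<le> exp (Re (p z))"
  proof (rule modulus_le_exp_Re[OF _ f(2) p _ z])
    show "(\<lambda>w. 1 + c * f w) holomorphic_on ball 0 R" by (intro holomorphic_intros f)
    fix w :: complex assume w: "cmod w = 1"
    have "cmod (1 + c * f w) \<le> 1 + cmod (f w)"
      using norm_triangle_ineq[of 1 "c * f w"] c by (simp add: norm_mult)
    also have "\<dots> = exp (ln (1 + cmod (f w)))" using pos by simp
    also have "\<dots> \<le> exp (Re (p w))" using le[OF w] by simp
    finally show "cmod (1 + c * f w) \<le> exp (Re (p w))" .
  qed
  moreover have "cmod (1 + c * f z) = 1 + cmod (f z)"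
    unfolding cz by (metis abs_of_pos norm_of_real of_real_1 of_real_add pos)
  ultimately have "ln (1 + cmod (f z)) \<le> ln (exp (Re (p z)))"
    using pos by (subst ln_le_cancel_iff) auto
  then show ?thesis by simp
qed

lemma holomorphic_dilate:
  assumes "f holomorphic_on ball 0 1" "0 < s" "s < 1"
  shows "(\<lambda>z. f (of_real s * z)) holomorphic_on ball 0 (1/s)" "1 < 1 / s"
proof -
  show "(\<lambda>z. f (of_real s * z)) holomorphic_on ball 0 (1/s)"
    using assms(2) by (intro holomorphic_on_compose_gen[OF _ assms(1), unfolded o_def] holomorphic_intros)
      (auto simp: norm_mult field_simps)
qed (use assms in simp)

lemma mean_log_mono:
  assumes f: "f holomorphic_on ball 0 1" and rs: "0 \<le> r" "r \<le> s" "s < 1"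
  shows "circle_mean (\<lambda>t. log_plus (cmod (f (of_real r * cis t)))) \<le> circle_mean (\<lambda>t. log_plus (cmod (f (of_real s * cis t))))"
    and "circle_mean (\<lambda>t. ln (1 + cmod (f (of_real r * cis t)))) \<le> circle_mean (\<lambda>t. ln (1 + cmod (f (of_real s * cis t))))"
proof -
  have "(circle_mean (\<lambda>t. log_plus (cmod (f (of_real r * cis t)))) \<le> circle_mean (\<lambda>t. log_plus (cmod (f (of_real s * cis t)))))
    \<and> (circle_mean (\<lambda>t. ln (1 + cmod (f (of_real r * cis t)))) \<le> circle_mean (\<lambda>t. ln (1 + cmod (f (of_real s * cis t)))))"
  proof (cases "s = 0")
    case True then show ?thesis using rs by simp
  next
    case False
    then have s: "0 < s" "s < 1" using rs by auto
    note g = holomorphic_dilate[OF f s]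
    have cg: "continuous_on (cball 0 1) (\<lambda>z. f (of_real s * z))"
      by (rule continuous_on_subset[OF holomorphic_on_imp_continuous_on[OF g(1)]]) (use g(2) in auto)
    have eq: "of_real s * (of_real (r/s) * z) = of_real r * (z::complex)" for z using s by simp
    have rs': "0 \<le> r/s" "r/s \<le> 1" using rs s by auto
    have "circle_mean (\<lambda>t. log_plus (cmod (f (of_real s * (of_real (r/s) * cis t))))) \<le> circle_mean (\<lambda>t. log_plus (cmod (f (of_real s * cis t))))"
      by (rule subharmonic_mean_le[where v="\<lambda>z. log_plus (cmod (f (of_real s * z)))",
          OF continuous_on_log_plus[OF cg] _ rs']) (use log_plus_subharmonic[OF g] in blast)
    moreover have "circle_mean (\<lambda>t. ln (1 + cmod (f (of_real s * (of_real (r/s) * cis t))))) \<le> circle_mean (\<lambda>t. ln (1 + cmod (f (of_real s * cis t))))"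
      by (rule subharmonic_mean_le[where v="\<lambda>z. ln (1 + cmod (f (of_real s * z)))",
          OF continuous_on_ln_1_plus_cmod[OF cg] _ rs']) (use ln_1_plus_cmod_subharmonic[OF g] in blast)
    ultimately show ?thesis unfolding eq by blast
  qed
  then show "circle_mean (\<lambda>t. log_plus (cmod (f (of_real r * cis t)))) \<le> circle_mean (\<lambda>t. log_plus (cmod (f (of_real s * cis t))))"
    "circle_mean (\<lambda>t. ln (1 + cmod (f (of_real r * cis t)))) \<le> circle_mean (\<lambda>t. ln (1 + cmod (f (of_real s * cis t))))"
    by auto
qed

definition radii :: "nat \<Rightarrow> real" where "radii n = 1 - inverse (real (Suc (Suc n)))"

lemma radii: "0 < radii n" "radii n < 1"
  by (auto simp: radii_def field_simps)

lemma radii_tendsto: "radii \<longlonglongrightarrow> 1"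
proof -
  have "(\<lambda>n. 1 - inverse (real (Suc (Suc n)))) \<longlonglongrightarrow> 1 - 0"
    by (intro tendsto_intros LIMSEQ_Suc[OF LIMSEQ_inverse_real_of_nat])
  then show ?thesis by (simp add: radii_def[abs_def])
qed

lemma radii_at_left: "filterlim radii (at_left 1) sequentially"
  unfolding filterlim_at by (auto simp: radii radii_tendsto less_imp_neq)

lemma radii_mono: "m \<le> n \<Longrightarrow> radii m \<le> radii n"
  by (simp add: radii_def field_simps)

section \<open>Radial limits of functions of bounded characteristic\<close>

text \<open>Jensen's inequality for the dilates of \<open>h\<close> bounds \<open>ln \<bar>h 0\<bar>\<close> by the mean of \<open>ln \<bar>h\<bar>\<close>, truncated
  below at \<open>ln \<epsilon>\<close>. If the radial limit vanished on a set of positive measure, letting \<open>\<epsilon>\<close> tend to \<open>0\<close>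
  would force \<open>ln \<bar>h 0\<bar>\<close> to be arbitrarily negative.\<close>

lemma bounded_holomorphic_limit_nonzero:
  assumes h: "h holomorphic_on ball 0 1" and b: "\<And>z. cmod z < 1 \<Longrightarrow> cmod (h z) \<le> 1" and h0: "h 0 \<noteq> 0"
  shows "AE t in unif_angle. \<not> ((\<lambda>r. h (of_real r * cis t)) \<longlongrightarrow> 0) (at_left 1)"
proof -
  have ch: "continuous_on UNIV (\<lambda>t. h (of_real (radii n) * cis t))" for n
    by (rule continuous_on_compose2[OF holomorphic_on_imp_continuous_on[OF h]])
       (use radii in \<open>auto intro!: continuous_intros simp: norm_mult less_imp_le abs_of_pos\<close>)
  have [measurable]: "(\<lambda>t. h (of_real (radii n) * cis t)) \<in> borel_measurable borel" for n
    by (rule borel_measurable_continuous_onI[OF ch])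
  define H where "H t = lim (\<lambda>n. h (of_real (radii n) * cis t))" for t
  have [measurable]: "H \<in> borel_measurable borel"
    unfolding H_def by measurable
  have FB: "AE t in unif_angle. \<exists>l. ((\<lambda>r. h (of_real r * cis t)) \<longlongrightarrow> l) (at_left 1)"
    by (rule Fatou_bounded_holomorphic[OF h b])
  have lim: "AE t in unif_angle. (\<lambda>n. h (of_real (radii n) * cis t)) \<longlonglongrightarrow> H t"
    using FB
  proof eventually_elim
    case (elim t)
    then obtain l where "((\<lambda>r. h (of_real r * cis t)) \<longlongrightarrow> l) (at_left 1)" by blast
    then have "(\<lambda>n. h (of_real (radii n) * cis t)) \<longlonglongrightarrow> l"
      by (rule filterlim_compose[OF _ radii_at_left])
    then show ?case unfolding H_def using limI by fastforce
  qed
  define Z where "Z = {t. H t = 0}"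
  have [measurable]: "Z \<in> sets borel" unfolding Z_def by measurable
  have key: "ln (cmod (h 0)) \<le> ln \<epsilon> * measure unif_angle Z" if \<epsilon>: "0 < \<epsilon>" "\<epsilon> \<le> 1" for \<epsilon> :: real
  proof -
    have mpos: "0 < max \<epsilon> x" for x using \<epsilon> by auto
    have cm: "continuous_on S (\<lambda>z. ln (max \<epsilon> (cmod (g z))))" if "continuous_on S g" for S :: "'b::topological_space set" and g :: "'b \<Rightarrow> complex"
      by (intro continuous_intros that) (metis mpos less_irrefl)
    have le: "ln (cmod (h 0)) \<le> circle_mean (\<lambda>t. ln (max \<epsilon> (cmod (h (of_real (radii n) * cis t)))))" for n
    proof -
      note g = holomorphic_dilate[OF h radii(1)[of n] radii(2)[of n]]
      have cg: "continuous_on (cball 0 1) (\<lambda>z. h (of_real (radii n) * z))"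
        by (rule continuous_on_subset[OF holomorphic_on_imp_continuous_on[OF g(1)]]) (use g(2) in auto)
      show ?thesis
      proof (rule field_le_epsilon)
        fix e :: real assume "0 < e"
        then obtain p where p: "p holomorphic_on UNIV"
          "\<And>w. cmod w = 1 \<Longrightarrow> ln (max \<epsilon> (cmod (h (of_real (radii n) * w)))) \<le> Re (p w)"
          "Re (p 0) \<le> circle_mean (\<lambda>t. ln (max \<epsilon> (cmod (h (of_real (radii n) * cis t))))) + e"
          using harmonic_majorant[OF cm[OF continuous_on_subset[OF cg sphere_cball]]] by blast
        have "cmod (h (of_real (radii n) * 0)) \<le> exp (Re (p 0))"
        proof (rule modulus_le_exp_Re[OF g p(1)])
          fix w :: complex assume "cmod w = 1"
          from p(2)[OF this] have "exp (ln (max \<epsilon> (cmod (h (of_real (radii n) * w))))) \<le> exp (Re (p w))"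
            by (simp only: exp_le_cancel_iff)
          then have "max \<epsilon> (cmod (h (of_real (radii n) * w))) \<le> exp (Re (p w))"
            by (simp only: exp_ln[OF mpos])
          then show "cmod (h (of_real (radii n) * w)) \<le> exp (Re (p w))" by simp
        qed simp
        then have "cmod (h 0) \<le> exp (Re (p 0))" by simp
        then have "ln (cmod (h 0)) \<le> ln (exp (Re (p 0)))" using h0 by (subst ln_le_cancel_iff) auto
        then have "ln (cmod (h 0)) \<le> Re (p 0)" by simp
        with p(3) show "ln (cmod (h 0)) \<le> circle_mean (\<lambda>t. ln (max \<epsilon> (cmod (h (of_real (radii n) * cis t))))) + e"
          by linarith
      qed
    qed
    have "(\<lambda>n. circle_mean (\<lambda>t. ln (max \<epsilon> (cmod (h (of_real (radii n) * cis t)))))) \<longlonglongrightarrow>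
        circle_mean (\<lambda>t. ln (max \<epsilon> (cmod (H t))))"
    proof (rule integral_dominated_convergence[where w="\<lambda>_. \<bar>ln \<epsilon>\<bar>"])
      show "AE t in unif_angle. (\<lambda>n. ln (max \<epsilon> (cmod (h (of_real (radii n) * cis t))))) \<longlonglongrightarrow> ln (max \<epsilon> (cmod (H t)))"
        using lim by eventually_elim (use mpos in \<open>auto intro!: tendsto_intros simp: less_imp_neq[symmetric]\<close>)
      show "AE t in unif_angle. norm (ln (max \<epsilon> (cmod (h (of_real (radii n) * cis t))))) \<le> \<bar>ln \<epsilon>\<bar>" for n
      proof (intro AE_I2)
        fix t
        have "cmod (h (of_real (radii n) * cis t)) \<le> 1"
          by (rule b) (use radii in \<open>auto simp: norm_mult less_imp_le abs_of_pos\<close>)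
        then have "ln (max \<epsilon> (cmod (h (of_real (radii n) * cis t)))) \<le> 0" using \<epsilon> mpos by (simp add: ln_le_zero_iff)
        moreover have "ln \<epsilon> \<le> ln (max \<epsilon> (cmod (h (of_real (radii n) * cis t))))" using \<epsilon> mpos by (subst ln_le_cancel_iff) auto
        ultimately show "norm (ln (max \<epsilon> (cmod (h (of_real (radii n) * cis t))))) \<le> \<bar>ln \<epsilon>\<bar>" by simp
      qed
    qed auto
    then have "ln (cmod (h 0)) \<le> circle_mean (\<lambda>t. ln (max \<epsilon> (cmod (H t))))"
      by (rule tendsto_lowerbound) (use le in auto)
    also have "\<dots> \<le> circle_mean (\<lambda>t. ln \<epsilon> * indicator Z t)"
    proof (rule integral_mono_AE)
      have Hb: "AE t in unif_angle. cmod (H t) \<le> 1"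
        using lim
      proof eventually_elim
        case (elim t)
        show ?case
          by (rule tendsto_upperbound[OF tendsto_norm[OF elim]])
             (auto intro!: always_eventually b simp: norm_mult radii less_imp_le abs_of_pos)
      qed
      show "integrable unif_angle (\<lambda>t. ln (max \<epsilon> (cmod (H t))))"
      proof (rule unif_angle.integrable_const_bound[where B="\<bar>ln \<epsilon>\<bar>"])
        show "AE t in unif_angle. norm (ln (max \<epsilon> (cmod (H t)))) \<le> \<bar>ln \<epsilon>\<bar>"
          using Hb
        proof eventually_elim
          case (elim t)
          then have "ln (max \<epsilon> (cmod (H t))) \<le> 0" using \<epsilon> mpos by (simp add: ln_le_zero_iff)
          moreover have "ln \<epsilon> \<le> ln (max \<epsilon> (cmod (H t)))" using \<epsilon> mpos by (subst ln_le_cancel_iff) auto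
          ultimately show ?case by simp
        qed
      qed simp
      show "AE t in unif_angle. ln (max \<epsilon> (cmod (H t))) \<le> ln \<epsilon> * indicator Z t"
        using Hb
      proof eventually_elim
        case (elim t)
        show ?case
        proof (cases "t \<in> Z")
          case True then show ?thesis using \<epsilon> by (simp add: Z_def max_def)
        next
          case False then show ?thesis using elim \<epsilon> mpos by (simp add: ln_le_zero_iff)
        qed
      qed
      show "integrable unif_angle (\<lambda>t. ln \<epsilon> * indicator Z t)"
        by (intro integrable_mult_right integrable_real_indicator) (auto simp: unif_angle.emeasure_eq_measure)
    qed
    also have "\<dots> = ln \<epsilon> * measure unif_angle Z" by simp
    finally show ?thesis .
  qed
  have "measure unif_angle Z = 0"
  proof (rule ccontr)
    assume "measure unif_angle Z \<noteq> 0"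
    then have m: "measure unif_angle Z > 0" by (simp add: zero_less_measure_iff)
    define k where "k = (1 + \<bar>ln (cmod (h 0))\<bar>) / measure unif_angle Z"
    have k: "k > 0" using m by (simp add: k_def)
    have "ln (cmod (h 0)) \<le> ln (exp (-k)) * measure unif_angle Z"
      by (rule key) (use k in auto)
    also have "\<dots> = - (1 + \<bar>ln (cmod (h 0))\<bar>)" using m by (simp add: k_def)
    finally show False by linarith
  qed
  then have "AE t in unif_angle. t \<notin> Z"
    by (intro AE_not_in) (simp add: null_sets_def unif_angle.emeasure_eq_measure)
  with lim show ?thesis
  proof eventually_elim
    case (elim t)
    show ?case
    proof
      assume "((\<lambda>r. h (of_real r * cis t)) \<longlongrightarrow> 0) (at_left 1)"
      then have "(\<lambda>n. h (of_real (radii n) * cis t)) \<longlonglongrightarrow> 0"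
        by (rule filterlim_compose[OF _ radii_at_left])
      then have "H t = 0" using elim(1) LIMSEQ_unique by blast
      then show False using elim(2) by (simp add: Z_def)
    qed
  qed
qed

text \<open>A function of bounded characteristic is a quotient of bounded functions. On each dilate,
  \<open>log_plus \<bar>f\<bar>\<close> has a majorant \<open>Re p\<close> whose value at \<open>0\<close> is controlled by \<open>C\<close>; then \<open>exp (- p)\<close> and its
  product with \<open>f\<close> are bounded by \<open>1\<close>. Montel's theorem gives a limit \<open>g\<close>, not zero at the origin, for
  which \<open>g\<close> and \<open>f * g\<close> are bounded, and both have radial limits, almost everywhere nonzero for \<open>g\<close>.\<close>

theorem Nevanlinna_radial_limits:
  assumes f: "f holomorphic_on ball 0 1"
    and C: "\<And>n. circle_mean (\<lambda>t. log_plus (cmod (f (of_real (radii n) * cis t)))) \<le> C"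
  shows "AE t in unif_angle. \<exists>l. ((\<lambda>r. f (of_real r * cis t)) \<longlongrightarrow> l) (at_left 1)"
proof -
  have "\<exists>p. p holomorphic_on UNIV \<and> Re (p 0) \<le> C + 1 \<and>
      (\<forall>z. cmod z \<le> 1 \<longrightarrow> log_plus (cmod (f (of_real (radii n) * z))) \<le> Re (p z))" for n
  proof -
    note g = holomorphic_dilate[OF f radii(1)[of n] radii(2)[of n]]
    have cg: "continuous_on (cball 0 1) (\<lambda>z. f (of_real (radii n) * z))"
      by (rule continuous_on_subset[OF holomorphic_on_imp_continuous_on[OF g(1)]]) (use g(2) in auto)
    obtain p where p: "p holomorphic_on UNIV"
          "\<And>w. cmod w = 1 \<Longrightarrow> log_plus (cmod (f (of_real (radii n) * w))) \<le> Re (p w)"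
          "Re (p 0) \<le> circle_mean (\<lambda>t. log_plus (cmod (f (of_real (radii n) * cis t)))) + 1"
      using harmonic_majorant[OF continuous_on_log_plus[OF continuous_on_subset[OF cg sphere_cball]] zero_less_one] by blast
    have "\<forall>z. cmod z \<le> 1 \<longrightarrow> log_plus (cmod (f (of_real (radii n) * z))) \<le> Re (p z)"
      using log_plus_subharmonic[OF g p(1,2)] by blast
    moreover have "Re (p 0) \<le> C + 1" using p(3) C[of n] by linarith
    ultimately show ?thesis using p(1) by blast
  qed
  then obtain p where p: "\<And>n. p n holomorphic_on UNIV" "\<And>n. Re (p n 0) \<le> C + 1"
    "\<And>n z. cmod z \<le> 1 \<Longrightarrow> log_plus (cmod (f (of_real (radii n) * z))) \<le> Re (p n z)" by metis
  define h where "h n z = exp (- p n z)" for n z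
  have hh: "h n holomorphic_on ball 0 1" for n unfolding h_def
    by (intro holomorphic_intros holomorphic_on_subset[OF p(1)]) auto
  have hc: "cmod (h n z) = exp (- Re (p n z))" for n z by (simp add: h_def)
  have h1: "cmod (h n z) \<le> 1" if "cmod z \<le> 1" for n z
    using order_trans[OF log_plus_nonneg p(3)[OF that, of n]] unfolding hc by simp
  have hf: "cmod (f (of_real (radii n) * z) * h n z) \<le> 1" if "cmod z \<le> 1" for n z
  proof -
    have "cmod (f (of_real (radii n) * z)) \<le> exp (log_plus (cmod (f (of_real (radii n) * z))))"
      by (simp add: exp_log_plus)
    also have "\<dots> \<le> exp (Re (p n z))" using p(3)[OF that] by simp
    finally have "cmod (f (of_real (radii n) * z)) * exp (- Re (p n z)) \<le> exp (Re (p n z)) * exp (- Re (p n z))"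
      by (rule mult_right_mono) simp
    then show ?thesis by (simp add: norm_mult hc flip: exp_add)
  qed
  obtain g k where g: "g holomorphic_on ball 0 1" "strict_mono (k :: nat \<Rightarrow> nat)"
    "\<And>x. x \<in> ball 0 1 \<Longrightarrow> (\<lambda>n. h (k n) x) \<longlonglongrightarrow> g x"
  proof (rule Montel[of "ball 0 1" "range h" h])
    show "\<exists>B. \<forall>h'\<in>range h. \<forall>z\<in>K. cmod (h' z) \<le> B" if "compact K" "K \<subseteq> ball 0 1" for K
      using h1 that by (intro exI[of _ 1]) force
  qed (use hh in auto)
  have g1: "cmod (g z) \<le> 1" if "cmod z < 1" for z
    by (rule tendsto_upperbound[OF tendsto_norm[OF g(3)]]) (use that h1 in \<open>auto intro!: always_eventually\<close>)
  have g0: "g 0 \<noteq> 0"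
  proof -
    have "exp (- (C + 1)) \<le> cmod (h (k n) 0)" for n
      using p(2)[of "k n"] by (simp add: hc)
    then have "exp (- (C + 1)) \<le> cmod (g 0)"
      by (intro tendsto_lowerbound[OF tendsto_norm[OF g(3)]] always_eventually allI) auto
    moreover have "0 < exp (- (C + 1))" by simp
    ultimately show ?thesis by auto
  qed
  have fg1: "cmod (f z * g z) \<le> 1" if z: "cmod z < 1" for z
  proof -
    have "isCont f z" using holomorphic_on_imp_continuous_on[OF f] z by (simp add: continuous_on_eq_continuous_at)
    moreover have "(\<lambda>n. of_real (radii (k n)) * z) \<longlonglongrightarrow> of_real 1 * z"
      using LIMSEQ_subseq_LIMSEQ[OF radii_tendsto g(2)] by (intro tendsto_intros) (simp add: o_def)
    ultimately have "(\<lambda>n. f (of_real (radii (k n)) * z)) \<longlonglongrightarrow> f z"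
      by (simp only: of_real_1 mult_1_left) (rule isCont_tendsto_compose)
    then have "(\<lambda>n. cmod (f (of_real (radii (k n)) * z) * h (k n) z)) \<longlonglongrightarrow> cmod (f z * g z)"
      using g(3) z by (intro tendsto_intros) auto
    then show ?thesis by (rule tendsto_upperbound) (use hf z in \<open>auto intro!: always_eventually\<close>)
  qed
  have fg: "(\<lambda>z. f z * g z) holomorphic_on ball 0 1" by (intro holomorphic_intros f g)
  have A: "AE t in unif_angle. \<exists>l. ((\<lambda>r. f (of_real r * cis t) * g (of_real r * cis t)) \<longlongrightarrow> l) (at_left 1)"
    by (rule Fatou_bounded_holomorphic[OF fg fg1])
  moreover have "AE t in unif_angle. \<exists>l. ((\<lambda>r. g (of_real r * cis t)) \<longlongrightarrow> l) (at_left 1)"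
    by (rule Fatou_bounded_holomorphic[OF g(1) g1])
  moreover have "AE t in unif_angle. \<not> ((\<lambda>r. g (of_real r * cis t)) \<longlongrightarrow> 0) (at_left 1)"
    by (rule bounded_holomorphic_limit_nonzero[OF g(1) g1 g0])
  ultimately show ?thesis
  proof eventually_elim
    case (elim t)
    obtain a where a: "((\<lambda>r. f (of_real r * cis t) * g (of_real r * cis t)) \<longlongrightarrow> a) (at_left 1)" using elim(1) by blast
    obtain b where b: "((\<lambda>r. g (of_real r * cis t)) \<longlongrightarrow> b) (at_left 1)" using elim(2) by blast
    have b0: "b \<noteq> 0" using b elim(3) by blast
    have "((\<lambda>r. (f (of_real r * cis t) * g (of_real r * cis t)) / g (of_real r * cis t)) \<longlongrightarrow> a / b) (at_left 1)"
      by (intro tendsto_divide a b b0)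
    moreover have "eventually (\<lambda>r. (f (of_real r * cis t) * g (of_real r * cis t)) / g (of_real r * cis t) = f (of_real r * cis t)) (at_left 1)"
      using tendsto_imp_eventually_ne[OF b b0] by eventually_elim simp
    ultimately have "((\<lambda>r. f (of_real r * cis t)) \<longlongrightarrow> a / b) (at_left 1)"
      by (rule Lim_transform_eventually)
    then show ?case by blast
  qed
qed

section \<open>Symmetries of the boundary measure\<close>

lemma nn_integral_lborel_translate:
  fixes c :: "'a::euclidean_space"
  assumes [measurable]: "f \<in> borel_measurable borel"
  shows "(\<integral>\<^sup>+x. f (c + x) \<partial>lborel) = (\<integral>\<^sup>+x. f x \<partial>lborel)"
proof -
  have "(\<integral>\<^sup>+x. f x \<partial>lborel) = (\<integral>\<^sup>+x. f x \<partial>distr lborel borel ((+) c))"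
    by (simp add: lborel_distr_plus)
  also have "\<dots> = (\<integral>\<^sup>+x. f (c + x) \<partial>lborel)"
    by (rule nn_integral_distr) auto
  finally show ?thesis by simp
qed

lemma emeasure_lborel_open_pos:
  assumes "open S" "S \<noteq> {}"
  shows "emeasure lborel (S :: 'a::euclidean_space set) \<noteq> 0"
proof
  assume "emeasure lborel S = 0"
  then have "S \<in> null_sets lborel" using assms by (simp add: null_sets_def)
  then have "negligible S" by (simp add: negligible_iff_null_sets null_sets_completionI)
  then show False using open_not_negligible[OF assms] by blast
qed

text \<open>As in the uniqueness proof for Haar measure, Fubini's theorem for a set \<open>A\<close> and the unit ball together
  with translation invariance evaluates the measure of the preimage of \<open>A\<close>. The result is the same for
  all linear isometries because they preserve the ball.\<close>

lemma lborel_distr_linear_isometry: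
  fixes V :: "'a::euclidean_space \<Rightarrow> 'a"
  assumes lin: "linear V" and iso: "\<And>x. norm (V x) = norm x" and sur: "surj V"
  shows "distr lborel borel V = lborel"
proof -
  have key: "emeasure lborel (W -` A) = emeasure lborel (uminus -` A)"
    if A[measurable]: "A \<in> sets borel" and W: "linear W" "\<And>x. norm (W x) = norm x" "surj W" for A :: "'a set" and W :: "'a \<Rightarrow> 'a"
  proof -
    have [measurable]: "W \<in> borel_measurable borel"
      using W(1) by (intro borel_measurable_continuous_onI linear_continuous_on linear_conv_bounded_linear[THEN iffD1])
    define B where "B = ball (0::'a) 1"
    have [measurable]: "B \<in> sets borel" by (simp add: B_def)
    have Bp: "emeasure lborel B \<noteq> 0" "emeasure lborel B \<noteq> \<infinity>"
      using emeasure_lborel_ball_finite[of "0::'a" 1] emeasure_lborel_open_pos[of "ball (0::'a) 1"]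
      by (auto simp: B_def)
    have WB: "indicator B (W x) = (indicator B x :: ennreal)" for x
      by (auto simp: B_def W(2) split: split_indicator)
    have "emeasure lborel (W -` A) * emeasure lborel B = (\<integral>\<^sup>+x. indicator A (W x) * emeasure lborel B \<partial>lborel)"
    proof -
      have "W -` A \<in> sets borel" using measurable_sets[of W borel borel A] by simp
      then have "emeasure lborel (W -` A) = (\<integral>\<^sup>+x. indicator (W -` A) x \<partial>lborel)" by simp
      also have "\<dots> = (\<integral>\<^sup>+x. indicator A (W x) \<partial>lborel)"
        by (intro nn_integral_cong) (auto split: split_indicator)
      finally show ?thesis by (simp add: nn_integral_multc)
    qed
    also have "\<dots> = (\<integral>\<^sup>+x. indicator A (W x) * (\<integral>\<^sup>+y. indicator B (W x + y) \<partial>lborel) \<partial>lborel)"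
      by (subst nn_integral_lborel_translate) auto
    also have "\<dots> = (\<integral>\<^sup>+x. (\<integral>\<^sup>+y. indicator A (W x) * indicator B (W x + y) \<partial>lborel) \<partial>lborel)"
      by (subst nn_integral_cmult) auto
    also have "\<dots> = (\<integral>\<^sup>+y. (\<integral>\<^sup>+x. indicator A (W x) * indicator B (W x + y) \<partial>lborel) \<partial>lborel)"
      by (rule lborel_pair.Fubini') measurable
    also have "\<dots> = (\<integral>\<^sup>+y. (\<integral>\<^sup>+x. indicator A (W x - y) * indicator B (W x) \<partial>lborel) \<partial>lborel)"
    proof (rule nn_integral_cong)
      fix y :: 'a
      obtain b where b: "y = W b" using W(3) by (metis surjD)
      have "(\<integral>\<^sup>+x. indicator A (W x - y) * indicator B (W x) \<partial>lborel) = (\<integral>\<^sup>+x. indicator A (W (b + x) - y) * indicator B (W (b + x)) \<partial>lborel)"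
        by (rule nn_integral_lborel_translate[symmetric]) measurable
      also have "\<dots> = (\<integral>\<^sup>+x. indicator A (W x) * indicator B (W x + y) \<partial>lborel)"
        by (simp add: linear_add[OF W(1)] b add.commute)
      finally show "(\<integral>\<^sup>+x. indicator A (W x) * indicator B (W x + y) \<partial>lborel) = (\<integral>\<^sup>+x. indicator A (W x - y) * indicator B (W x) \<partial>lborel)" ..
    qed
    also have "\<dots> = (\<integral>\<^sup>+x. (\<integral>\<^sup>+y. indicator A (W x - y) * indicator B (W x) \<partial>lborel) \<partial>lborel)"
      by (rule lborel_pair.Fubini') measurable
    also have "\<dots> = (\<integral>\<^sup>+x. emeasure lborel (uminus -` A) * indicator B x \<partial>lborel)"
    proof (rule nn_integral_cong)
      fix x :: 'a
      have "(\<integral>\<^sup>+y. indicator A (W x - y) * indicator B (W x) \<partial>lborel) = (\<integral>\<^sup>+y. indicator A (- (- W x + y)) \<partial>lborel) * indicator B x"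
        unfolding WB by (subst nn_integral_multc) auto
      also have "(\<integral>\<^sup>+y. indicator A (- (- W x + y)) \<partial>lborel) = (\<integral>\<^sup>+y. indicator A (- y) \<partial>lborel)"
        by (rule nn_integral_lborel_translate) measurable
      also have "\<dots> = (\<integral>\<^sup>+y. indicator (uminus -` A) y \<partial>lborel)"
        by (intro nn_integral_cong) (auto split: split_indicator)
      also have "\<dots> = emeasure lborel (uminus -` A)"
        by (rule nn_integral_indicator) (use measurable_sets[of uminus borel borel A] in simp)
      finally show "(\<integral>\<^sup>+y. indicator A (W x - y) * indicator B (W x) \<partial>lborel) = emeasure lborel (uminus -` A) * indicator B x" .
    qed
    also have "\<dots> = emeasure lborel (uminus -` A) * emeasure lborel B"
      by (subst nn_integral_cmult) auto
    finally show ?thesis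
      using Bp ennreal_mult_cancel_left[of "emeasure lborel B" "emeasure lborel (W -` A)" "emeasure lborel (uminus -` A)"]
      by (simp only: mult.commute[of _ "emeasure lborel B"]) (auto simp: top_unique)
  qed
  show ?thesis
  proof (rule measure_eqI)
    fix A assume "A \<in> sets (distr lborel borel V)"
    then have A: "A \<in> sets borel" by simp
    have "V \<in> borel_measurable borel"
      using lin by (intro borel_measurable_continuous_onI linear_continuous_on linear_conv_bounded_linear[THEN iffD1])
    then have "emeasure (distr lborel borel V) A = emeasure lborel (V -` A)"
      using A by (simp add: emeasure_distr)
    also have "\<dots> = emeasure lborel A"
      using key[OF A lin iso sur] key[OF A linear_ident] by (simp add: vimage_def)
    finally show "emeasure (distr lborel borel V) A = emeasure lborel A" .
  qed simp
qed

lemma norm_vector_scalar_mult: "norm (c *s (z :: complex ^ 'n)) = cmod c * norm z"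
  by (simp add: norm_vec_def norm_mult L2_set_right_distrib)

lemma scaleR_eq_smult: "r *\<^sub>R (z :: complex ^ 'n) = complex_of_real r *s z"
  by (simp only: vec_eq_iff vector_scaleR_component vector_smult_component) (simp add: scaleR_conv_of_real)

lemma smult_smult [simp]: "a *s (b *s z) = (a * b) *s (z :: complex ^ 'n)"
  by (simp add: vec_eq_iff mult.assoc)

lemma vec_cnj_nth [simp]: "vec_cnj z $ i = cnj (z $ i)"
  by (simp add: vec_cnj_def)

lemma vec_cnj_vec_cnj [simp]: "vec_cnj (vec_cnj z) = z"
  by (simp add: vec_eq_iff)

lemma norm_vec_cnj [simp]: "norm (vec_cnj z) = norm z"
  by (simp add: norm_vec_def)

lemma linear_vec_cnj: "linear vec_cnj"
  by (rule linearI) (auto simp: vec_eq_iff)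

lemma linear_smult: "linear (\<lambda>z :: complex ^ 'n. c *s z)"
  by (rule linearI) (auto simp: vec_eq_iff distrib_left)

lemma borel_measurable_smult [measurable]: "(\<lambda>z :: complex ^ 'n. c *s z) \<in> borel_measurable borel"
  by (intro borel_measurable_continuous_onI linear_continuous_on linear_conv_bounded_linear[THEN iffD1] linear_smult)

lemma borel_measurable_vec_cnj [measurable]: "vec_cnj \<in> borel_measurable borel"
  by (intro borel_measurable_continuous_onI linear_continuous_on linear_conv_bounded_linear[THEN iffD1] linear_vec_cnj)

lemma borel_measurable_vec:
  fixes f :: "'a \<Rightarrow> complex ^ 'n"
  assumes [measurable]: "\<And>i. (\<lambda>x. f x $ i) \<in> borel_measurable M"
  shows "f \<in> borel_measurable M"
  by (subst borel_measurable_euclidean_space) (auto simp: Basis_vec_def inner_axis)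

lemma closed_cboundary: "closed (cboundary K :: (complex ^ 'n) set)"
proof (cases K)
  case Unit_Polydisk
  have "closed {z :: complex ^ 'n. \<forall>j. cmod (z $ j) = 1}"
    by (intro closed_Collect_all closed_Collect_eq continuous_intros)
  then show ?thesis using Unit_Polydisk by simp
qed simp

lemma cboundary_borel [measurable]: "cboundary K \<in> sets borel"
  by (rule borel_closed[OF closed_cboundary])

lemma sets_boundary_measure [measurable_cong, simp]: "sets (\<sigma> K) = sets (restrict_space borel (cboundary K))"
  by (cases K; simp; rule sets_restrict_space_cong; simp)

lemma space_boundary_measure [simp]: "space (\<sigma> K) = cboundary K"
  by (cases K) (auto simp: space_restrict_space)

lemma cboundary_smult: "z \<in> cboundary K \<Longrightarrow> cmod c = 1 \<Longrightarrow> c *s z \<in> cboundary K"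
  by (cases K) (auto simp: norm_vector_scalar_mult norm_mult)

lemma cboundary_vec_cnj: "z \<in> cboundary K \<Longrightarrow> vec_cnj z \<in> cboundary K"
  by (cases K) auto

lemma distr_restrict_space_invariant:
  assumes inv: "distr M M V = M" and V: "V \<in> M \<rightarrow>\<^sub>M M" and S: "S \<in> sets M" and VS: "\<And>x. V x \<in> S \<longleftrightarrow> x \<in> S"
  shows "distr (restrict_space M S) (restrict_space M S) V = restrict_space M S"
proof (rule measure_eqI)
  fix A assume "A \<in> sets (distr (restrict_space M S) (restrict_space M S) V)"
  then have A: "A \<in> sets M" "A \<subseteq> S" using S by (auto simp: sets_restrict_space_iff)
  have sp: "S \<subseteq> space M" using S sets.sets_into_space by auto
  have V': "V \<in> restrict_space M S \<rightarrow>\<^sub>M restrict_space M S"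
    by (rule measurable_restrict_space3[OF V]) (use VS in auto)
  have "emeasure (distr (restrict_space M S) (restrict_space M S) V) A = emeasure (restrict_space M S) (V -` A \<inter> S)"
    using A S sp by (subst emeasure_distr[OF V']) (auto simp: sets_restrict_space_iff space_restrict_space Int_absorb2)
  also have "\<dots> = emeasure M (V -` A \<inter> S)" using S by (subst emeasure_restrict_space) auto
  also have "V -` A \<inter> S = V -` A \<inter> space M" using A(2) VS sp by auto
  also have "emeasure M \<dots> = emeasure (distr M M V) A" using A by (subst emeasure_distr[OF V]) auto
  also have "\<dots> = emeasure (restrict_space M S) A" using A S inv by (subst emeasure_restrict_space) auto
  finally show "emeasure (distr (restrict_space M S) (restrict_space M S) V) A = emeasure (restrict_space M S) A" .
qed simp

lemma ball_measure_isometry_invariant: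
  fixes V :: "'a::euclidean_space \<Rightarrow> 'a"
  assumes lin: "linear V" and iso: "\<And>x. norm (V x) = norm x" and sur: "surj V"
  shows "distr (distr (uniform_measure lborel (ball 0 1)) borel sgn) borel V = distr (uniform_measure lborel (ball 0 1)) borel sgn"
proof -
  have [measurable]: "V \<in> borel_measurable borel"
      using lin by (intro borel_measurable_continuous_onI linear_continuous_on linear_conv_bounded_linear[THEN iffD1])
  have [measurable]: "(sgn :: 'a \<Rightarrow> 'a) \<in> borel_measurable borel" unfolding sgn_div_norm[abs_def] by measurable
  let ?U = "uniform_measure lborel (ball 0 1) :: 'a measure"
  have U: "distr ?U borel V = ?U"
  proof (rule measure_eqI)
    fix A assume "A \<in> sets (distr ?U borel V)"
    then have A[measurable]: "A \<in> sets borel" by simp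
    have VA: "V -` A \<in> sets borel" using measurable_sets[of V borel borel A] by simp
    have "emeasure (distr ?U borel V) A = emeasure lborel (ball 0 1 \<inter> V -` A) / emeasure lborel (ball (0::'a) 1)"
      using VA by (subst emeasure_distr) auto
    also have "ball 0 1 \<inter> V -` A = V -` (ball 0 1 \<inter> A)" by (auto simp: iso)
    also have "emeasure lborel (V -` (ball 0 1 \<inter> A)) = emeasure (distr lborel borel V) (ball 0 1 \<inter> A)"
      by (subst emeasure_distr) auto
    also have "distr lborel borel V = lborel" by (rule lborel_distr_linear_isometry[OF lin iso sur])
    finally show "emeasure (distr ?U borel V) A = emeasure ?U A" by simp
  qed simp
  have "V \<circ> sgn = sgn \<circ> V"
    by (rule ext) (simp add: sgn_div_norm iso linear_scale[OF lin])
  have "distr (distr ?U borel sgn) borel V = distr ?U borel (V \<circ> sgn)"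
    by (rule distr_distr) measurable
  also have "\<dots> = distr (distr ?U borel V) borel sgn"
    unfolding \<open>V \<circ> sgn = sgn \<circ> V\<close> by (rule distr_distr[symmetric]) measurable
  finally show ?thesis by (simp only: U)
qed

lemma measurable_cis_vec:
  "(\<lambda>\<theta>. \<chi> i. cis (\<theta> i)) \<in> (\<Pi>\<^sub>M i\<in>(UNIV :: 'n set). unif_angle) \<rightarrow>\<^sub>M (borel :: (complex ^ 'n) measure)"
proof (rule borel_measurable_vec)
  fix i :: 'n
  let ?P = "\<Pi>\<^sub>M i\<in>(UNIV :: 'n set). unif_angle"
  have [measurable]: "cis \<in> borel_measurable borel"
    by (intro borel_measurable_continuous_onI continuous_intros)
  have "(\<lambda>\<theta>. \<theta> i) \<in> ?P \<rightarrow>\<^sub>M unif_angle"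
    by (rule measurable_component_singleton[where M="\<lambda>_. unif_angle"]) simp
  then have [measurable]: "(\<lambda>\<theta>. \<theta> i) \<in> borel_measurable ?P"
    by (simp only: measurable_cong_sets[OF refl sets_unif_angle])
  show "(\<lambda>\<theta>. (\<chi> i. cis (\<theta> i)) $ i) \<in> borel_measurable ?P" by simp
qed

lemma torus_measure_invariant:
  fixes V :: "complex ^ 'n \<Rightarrow> complex ^ 'n"
  assumes \<phi>: "distr unif_angle borel \<phi> = unif_angle" and [measurable]: "\<phi> \<in> borel_measurable borel" "V \<in> borel_measurable borel"
    and V: "\<And>\<theta>. V (\<chi> i. cis (\<theta> i)) = (\<chi> i. cis (\<phi> (\<theta> i)))"
  defines "P \<equiv> \<Pi>\<^sub>M i\<in>(UNIV :: 'n set). unif_angle"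
  shows "distr (distr P borel (\<lambda>\<theta>. \<chi> i. cis (\<theta> i))) borel V = distr P borel (\<lambda>\<theta>. \<chi> i. cis (\<theta> i))"
proof -
  interpret product_prob_space "\<lambda>i::'n. unif_angle" UNIV by unfold_locales
  have [measurable]: "(\<lambda>\<theta>. \<chi> i. cis (\<theta> i)) \<in> P \<rightarrow>\<^sub>M (borel :: (complex ^ 'n) measure)"
    unfolding P_def by (rule measurable_cis_vec)
  have [measurable]: "(\<lambda>\<theta>. \<lambda>i\<in>UNIV. \<phi> (\<theta> i)) \<in> P \<rightarrow>\<^sub>M P" unfolding P_def by measurable
  have "distr P P (\<lambda>\<theta>. \<lambda>i\<in>UNIV. \<phi> (\<theta> i)) = P" unfolding P_def
  proof (rule PiM_eqI)
    fix A :: "'n \<Rightarrow> real set" assume A: "\<And>i. i \<in> UNIV \<Longrightarrow> A i \<in> sets unif_angle"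
    have A': "A i \<in> sets borel" for i using A[of i] by simp
    have vs: "\<phi> -` A i \<in> sets borel" for i using measurable_sets[of \<phi> borel borel "A i"] A' by simp
    have "emeasure (distr P P (\<lambda>\<theta>. \<lambda>i\<in>UNIV. \<phi> (\<theta> i))) (Pi\<^sub>E UNIV A) = emeasure P ((\<lambda>\<theta>. \<lambda>i\<in>UNIV. \<phi> (\<theta> i)) -` Pi\<^sub>E UNIV A \<inter> space P)"
      by (rule emeasure_distr) (auto simp: P_def A' intro!: sets_PiM_I_finite)
    also have "(\<lambda>\<theta>. \<lambda>i\<in>UNIV. \<phi> (\<theta> i)) -` Pi\<^sub>E UNIV A \<inter> space P = Pi\<^sub>E UNIV (\<lambda>i. \<phi> -` A i)"
      by (auto simp: P_def space_PiM PiE_def Pi_def)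
    also have "emeasure P \<dots> = (\<Prod>i\<in>UNIV. emeasure unif_angle (\<phi> -` A i))"
      unfolding P_def by (rule emeasure_PiM) (auto simp: vs)
    also have "\<dots> = (\<Prod>i\<in>UNIV. emeasure (distr unif_angle borel \<phi>) (A i))"
      by (intro prod.cong refl) (subst emeasure_distr; simp add: A')
    finally show "emeasure (distr (Pi\<^sub>M UNIV (\<lambda>i. unif_angle)) (Pi\<^sub>M UNIV (\<lambda>i. unif_angle)) (\<lambda>\<theta>. \<lambda>i\<in>UNIV. \<phi> (\<theta> i))) (Pi\<^sub>E UNIV A) = (\<Prod>i\<in>UNIV. emeasure unif_angle (A i))"
      unfolding P_def \<phi> .
  qed auto
  note P = this
  have "V \<circ> (\<lambda>\<theta>. \<chi> i. cis (\<theta> i)) = (\<lambda>\<theta>. \<chi> i. cis (\<theta> i)) \<circ> (\<lambda>\<theta>. \<lambda>i\<in>UNIV. \<phi> (\<theta> i))"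
    by (rule ext) (simp add: V)
  note comm = this
  have "distr (distr P borel (\<lambda>\<theta>. \<chi> i. cis (\<theta> i))) borel V = distr P borel (V \<circ> (\<lambda>\<theta>. \<chi> i. cis (\<theta> i)))"
    by (rule distr_distr) measurable
  also have "\<dots> = distr (distr P P (\<lambda>\<theta>. \<lambda>i\<in>UNIV. \<phi> (\<theta> i))) borel (\<lambda>\<theta>. \<chi> i. cis (\<theta> i))"
    unfolding comm by (rule distr_distr[symmetric]) measurable
  finally show ?thesis by (simp only: P)
qed

lemma unif_angle_emeasure:
  assumes "A \<in> sets borel"
  shows "emeasure unif_angle A = emeasure lborel ({0..2*pi} \<inter> A) / ennreal (2*pi)"
  using assms by (simp add: unif_angle_def)

lemma unif_angle_rotate:
  assumes t: "0 \<le> t" "t < 2*pi"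
  defines "\<phi> \<equiv> \<lambda>\<theta>. if \<theta> + t < 2*pi then \<theta> + t else \<theta> + t - 2*pi"
  shows "distr unif_angle borel \<phi> = unif_angle"
proof (rule measure_eqI)
  fix A assume "A \<in> sets (distr unif_angle borel \<phi>)"
  then have A[measurable]: "A \<in> sets borel" by simp
  have [measurable]: "\<phi> \<in> borel_measurable borel" unfolding \<phi>_def by measurable
  have tr: "emeasure lborel {x. c + x \<in> B} = emeasure lborel B" if [measurable]: "B \<in> sets borel" for c :: real and B
  proof -
    have "emeasure lborel B = emeasure (distr lborel borel ((+) c)) B" by (simp add: lborel_distr_plus)
    also have "\<dots> = emeasure lborel {x. c + x \<in> B}" by (subst emeasure_distr) (auto simp: vimage_def)
    finally show ?thesis ..
  qed
  let ?B1 = "A \<inter> {t..<2*pi}" and ?B2 = "A \<inter> {0..t}"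
  have "emeasure lborel ({0..2*pi} \<inter> \<phi> -` A) = emeasure lborel ({x. t + x \<in> ?B1} \<union> {x. (t - 2*pi) + x \<in> ?B2})"
    by (rule arg_cong[where f="emeasure lborel"]) (use t in \<open>auto simp: \<phi>_def algebra_simps split: if_splits\<close>)
  also have "\<dots> = emeasure lborel {x. t + x \<in> ?B1} + emeasure lborel {x. (t - 2*pi) + x \<in> ?B2}"
    by (rule plus_emeasure[symmetric]) (use t in auto)
  also have "\<dots> = emeasure lborel ?B1 + emeasure lborel ?B2"
    by (intro arg_cong2[where f="(+)"] tr) auto
  also have "emeasure lborel ?B2 = emeasure lborel (A \<inter> {0..<t})"
    by (rule emeasure_eq_AE) (use AE_lborel_singleton[of t] in \<open>auto elim!: eventually_mono\<close>)
  also have "emeasure lborel ?B1 + emeasure lborel (A \<inter> {0..<t}) = emeasure lborel (?B1 \<union> (A \<inter> {0..<t}))"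
    by (rule plus_emeasure) auto
  also have "\<dots> = emeasure lborel ({0..2*pi} \<inter> A)"
    by (rule emeasure_eq_AE) (use AE_lborel_singleton[of "2*pi"] t in \<open>auto elim!: eventually_mono\<close>)
  finally have "emeasure lborel ({0..2*pi} \<inter> \<phi> -` A) = emeasure lborel ({0..2*pi} \<inter> A)" .
  then show "emeasure (distr unif_angle borel \<phi>) A = emeasure unif_angle A"
    using measurable_sets[of \<phi> borel borel A]
    by (subst emeasure_distr) (auto simp: unif_angle_emeasure)
qed simp

lemma unif_angle_reflect: "distr unif_angle borel (\<lambda>\<theta>. 2*pi - \<theta>) = unif_angle"
proof (rule measure_eqI)
  fix A assume "A \<in> sets (distr unif_angle borel (\<lambda>\<theta>. 2*pi - \<theta>))"
  then have A[measurable]: "A \<in> sets borel" by simp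
  have "emeasure lborel ({0..2*pi} \<inter> (\<lambda>\<theta>. 2*pi - \<theta>) -` A) = emeasure (distr lborel borel (\<lambda>x. 2*pi + (-1) * x)) ({0..2*pi} \<inter> A)"
    by (subst emeasure_distr) (auto intro!: arg_cong[where f="emeasure lborel"])
  also have "\<dots> = emeasure lborel ({0..2*pi} \<inter> A)"
    using lborel_real_affine[of "-1" "2*pi"] by (simp add: density_1)
  finally show "emeasure (distr unif_angle borel (\<lambda>\<theta>. 2*pi - \<theta>)) A = emeasure unif_angle A"
    using measurable_sets[of "\<lambda>\<theta>. 2*pi - \<theta>" borel borel A]
    by (subst emeasure_distr) (auto simp: unif_angle_emeasure)
qed simp

lemma boundary_measure_rotate:
  assumes c: "cmod c = 1"
  shows "distr (\<sigma> K) (\<sigma> K) (\<lambda>z. c *s z) = (\<sigma> K :: (complex ^ 'n) measure)"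
proof -
  have VS: "c *s z \<in> cboundary K \<longleftrightarrow> z \<in> cboundary K" for K and z :: "complex ^ 'n"
    using c by (cases K) (auto simp: norm_vector_scalar_mult norm_mult)
  have sur: "surj (\<lambda>z :: complex ^ 'n. c *s z)"
  proof (rule surjI[of _ "\<lambda>z. inverse c *s z"])
    have "c \<noteq> 0" using c by auto
    then show "c *s (inverse c *s z) = z" for z :: "complex ^ 'n" by simp
  qed
  show ?thesis
  proof (cases K)
    case Unit_Ball
    have "distr (boundary_measure Unit_Ball) (boundary_measure Unit_Ball) (\<lambda>z :: complex ^ 'n. c *s z) = boundary_measure Unit_Ball"
      unfolding boundary_measure.simps
    proof (rule distr_restrict_space_invariant)
      let ?M = "distr (uniform_measure lborel (ball 0 1)) borel sgn :: (complex ^ 'n) measure"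
      have "distr ?M ?M (\<lambda>z. c *s z) = distr ?M borel (\<lambda>z. c *s z)" by (rule distr_cong) auto
      also have "\<dots> = ?M"
        by (rule ball_measure_isometry_invariant[OF linear_smult _ sur]) (simp add: norm_vector_scalar_mult c)
      finally show "distr ?M ?M (\<lambda>z. c *s z) = ?M" .
    qed (use VS[of _ Unit_Ball] in auto)
    then show ?thesis using Unit_Ball by simp
  next
    case Unit_Polydisk
    define t where "t = Arg2pi c"
    have t: "0 \<le> t" "t < 2*pi" by (auto simp: t_def Arg2pi_ge_0 Arg2pi_lt_2pi)
    have ct: "c = cis t" unfolding t_def using Arg2pi_eq[of c] c by (simp add: cis_conv_exp)
    have "distr (boundary_measure Unit_Polydisk) (boundary_measure Unit_Polydisk) (\<lambda>z :: complex ^ 'n. c *s z) = boundary_measure Unit_Polydisk"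
      unfolding boundary_measure.simps unif_angle_def[symmetric]
    proof (rule distr_restrict_space_invariant)
      let ?M = "distr (Pi\<^sub>M UNIV (\<lambda>i. unif_angle)) borel (\<lambda>\<theta>. \<chi> i. cis (\<theta> i)) :: (complex ^ 'n) measure"
      have "distr ?M ?M (\<lambda>z. c *s z) = distr ?M borel (\<lambda>z. c *s z)" by (rule distr_cong) auto
      also have "\<dots> = ?M"
      proof (rule torus_measure_invariant[OF unif_angle_rotate[OF t]])
        fix \<theta> :: "'n \<Rightarrow> real"
        show "c *s (\<chi> i. cis (\<theta> i)) = (\<chi> i. cis (if \<theta> i + t < 2 * pi then \<theta> i + t else \<theta> i + t - 2 * pi))"
          by (auto simp: vec_eq_iff ct cis_mult add.commute cis_divide[symmetric])
      qed auto
      finally show "distr ?M ?M (\<lambda>z. c *s z) = ?M" .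
    qed (use VS[of _ Unit_Polydisk] cboundary_borel[of Unit_Polydisk] in auto)
    then show ?thesis using Unit_Polydisk by simp
  qed
qed

lemma boundary_measure_vec_cnj:
  "distr (\<sigma> K) (\<sigma> K) vec_cnj = (\<sigma> K :: (complex ^ 'n) measure)"
proof -
  have VS: "vec_cnj z \<in> cboundary K \<longleftrightarrow> z \<in> cboundary K" for K and z :: "complex ^ 'n"
    by (cases K) auto
  have sur: "surj (vec_cnj :: complex ^ 'n \<Rightarrow> complex ^ 'n)" by (rule surjI[of _ vec_cnj]) simp
  show ?thesis
  proof (cases K)
    case Unit_Ball
    have "distr (boundary_measure Unit_Ball) (boundary_measure Unit_Ball) vec_cnj = (boundary_measure Unit_Ball :: (complex ^ 'n) measure)"
      unfolding boundary_measure.simps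
    proof (rule distr_restrict_space_invariant)
      let ?M = "distr (uniform_measure lborel (ball 0 1)) borel sgn :: (complex ^ 'n) measure"
      have "distr ?M ?M vec_cnj = distr ?M borel vec_cnj" by (rule distr_cong) auto
      also have "\<dots> = ?M"
        by (rule ball_measure_isometry_invariant[OF linear_vec_cnj norm_vec_cnj sur])
      finally show "distr ?M ?M vec_cnj = ?M" .
    qed (use VS[of _ Unit_Ball] in auto)
    then show ?thesis using Unit_Ball by simp
  next
    case Unit_Polydisk
    have "distr (boundary_measure Unit_Polydisk) (boundary_measure Unit_Polydisk) vec_cnj = (boundary_measure Unit_Polydisk :: (complex ^ 'n) measure)"
      unfolding boundary_measure.simps unif_angle_def[symmetric]
    proof (rule distr_restrict_space_invariant)
      let ?M = "distr (Pi\<^sub>M UNIV (\<lambda>i. unif_angle)) borel (\<lambda>\<theta>. \<chi> i. cis (\<theta> i)) :: (complex ^ 'n) measure"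
      have "distr ?M ?M vec_cnj = distr ?M borel vec_cnj" by (rule distr_cong) auto
      also have "\<dots> = ?M"
      proof (rule torus_measure_invariant[OF unif_angle_reflect])
        fix \<theta> :: "'n \<Rightarrow> real"
        show "vec_cnj (\<chi> i. cis (\<theta> i)) = (\<chi> i. cis (2 * pi - \<theta> i))"
          by (auto simp: vec_eq_iff cis_cnj cis_divide[symmetric]) (simp add: cis_inverse[symmetric] inverse_eq_divide)
      qed auto
      finally show "distr ?M ?M vec_cnj = ?M" .
    qed (use VS[of _ Unit_Polydisk] cboundary_borel[of Unit_Polydisk] in auto)
    then show ?thesis using Unit_Polydisk by simp
  qed
qed

lemma prob_space_restrict_full:
  assumes M: "prob_space M" and S: "S \<in> sets M" and ae: "AE x in M. x \<in> S"
  shows "prob_space (restrict_space M S)"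
proof
  have "emeasure M S = 1" using prob_space.emeasure_eq_1_AE[OF M S ae] .
  then show "emeasure (restrict_space M S) (space (restrict_space M S)) = 1"
    using S sets.sets_into_space[OF S] by (simp add: emeasure_restrict_space space_restrict_space Int_absorb2)
qed

lemma prob_space_boundary_measure: "prob_space (\<sigma> K :: (complex ^ 'n) measure)"
proof (cases K)
  case Unit_Ball
  let ?U = "uniform_measure lborel (ball 0 1) :: (complex ^ 'n) measure"
  have [measurable]: "(sgn :: complex ^ 'n \<Rightarrow> complex ^ 'n) \<in> borel_measurable borel"
    unfolding sgn_div_norm[abs_def] by measurable
  have "prob_space ?U"
    using emeasure_lborel_open_pos[of "ball (0::complex ^ 'n) 1"] emeasure_lborel_ball_finite[of "0::complex ^ 'n" 1]
    by (intro prob_space_uniform_measure) auto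
  then interpret U: prob_space ?U .
  have [measurable]: "sgn \<in> ?U \<rightarrow>\<^sub>M (borel :: (complex ^ 'n) measure)" by simp
  interpret D: prob_space "distr ?U borel sgn" by (rule U.prob_space_distr) measurable
  have "AE x in ?U. x \<noteq> 0"
    by (rule AE_uniform_measureI) (use AE_lborel_singleton[of "0::complex ^ 'n"] in auto)
  then have "AE x in ?U. sgn x \<in> sphere 0 1"
    by eventually_elim (simp add: norm_sgn)
  then have "AE x in distr ?U borel sgn. x \<in> sphere 0 1"
    by (subst AE_distr_iff) auto
  then have "prob_space (restrict_space (distr ?U borel sgn) (sphere 0 1))"
    by (intro prob_space_restrict_full D.prob_space_axioms) auto
  then show ?thesis using Unit_Ball by simp
next
  case Unit_Polydisk
  let ?P = "\<Pi>\<^sub>M i\<in>(UNIV :: 'n set). unif_angle"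
  interpret product_prob_space "\<lambda>i::'n. unif_angle" UNIV by unfold_locales
  have m: "(\<lambda>\<theta>. \<chi> i. cis (\<theta> i)) \<in> ?P \<rightarrow>\<^sub>M (borel :: (complex ^ 'n) measure)"
    by (rule measurable_cis_vec)
  interpret D: prob_space "distr ?P borel (\<lambda>\<theta>. \<chi> i. cis (\<theta> i)) :: (complex ^ 'n) measure"
    by (rule prob_space_distr[OF m])
  have "AE z in distr ?P borel (\<lambda>\<theta>. \<chi> i. cis (\<theta> i)). z \<in> (cboundary Unit_Polydisk :: (complex ^ 'n) set)"
  proof (subst AE_distr_iff[OF m])
    show "{z \<in> space borel. z \<in> (cboundary Unit_Polydisk :: (complex ^ 'n) set)} \<in> sets borel"
      by (simp only: space_borel UNIV_I simp_thms Collect_mem_eq cboundary_borel)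
  qed simp
  then have "prob_space (restrict_space (distr ?P borel (\<lambda>\<theta>. \<chi> i. cis (\<theta> i))) (cboundary Unit_Polydisk :: (complex ^ 'n) set))"
        by (intro prob_space_restrict_full D.prob_space_axioms) (simp only: sets_distr cboundary_borel)
  then show ?thesis using Unit_Polydisk by (simp add: unif_angle_def)
qed

lemma norm_cis_diff_le: "cmod (cis a - cis b) \<le> \<bar>a - b\<bar>"
proof -
  have "(cmod (cis (a - b) - of_real 1))\<^sup>2 = (2 * sin ((a - b)/2))\<^sup>2"
    unfolding cmod_cis_minus_real_sq by (simp add: power_mult_distrib)
  then have "cmod (cis (a - b) - 1) = \<bar>2 * sin ((a - b)/2)\<bar>"
    by (metis abs_norm_cancel of_real_1 power2_eq_iff_nonneg abs_ge_zero power2_abs)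
  also have "\<dots> \<le> \<bar>a - b\<bar>" using abs_sin_x_le_abs_x[of "(a - b)/2"] by (simp add: abs_mult)
  finally have *: "cmod (cis (a - b) - 1) \<le> \<bar>a - b\<bar>" .
  have "cis a - cis b = cis b * (cis (a - b) - 1)" by (simp add: algebra_simps cis_mult)
  then have "cmod (cis a - cis b) = cmod (cis (a - b) - 1)" by (simp add: norm_mult)
  with * show ?thesis by simp
qed

text \<open>The measure has full support, so an almost everywhere bound for a continuous function on the
  distinguished boundary holds everywhere.\<close>

lemma boundary_measure_open_pos:
  fixes \<zeta> :: "complex ^ 'n"
  assumes W: "open W" and \<zeta>: "\<zeta> \<in> W" "\<zeta> \<in> cboundary K"
  shows "emeasure (\<sigma> K) (W \<inter> cboundary K) \<noteq> 0"
proof (cases K)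
  case Unit_Ball
  let ?U = "uniform_measure lborel (ball 0 1) :: (complex ^ 'n) measure"
  have [measurable]: "(sgn :: complex ^ 'n \<Rightarrow> complex ^ 'n) \<in> borel_measurable borel"
    unfolding sgn_div_norm[abs_def] by measurable
  have [measurable]: "W \<in> sets borel" using W by simp
  let ?S = "- {0} \<inter> sgn -` W :: (complex ^ 'n) set"
  have "open ?S"
  proof -
    have "continuous_on (- {0}) (sgn :: complex ^ 'n \<Rightarrow> complex ^ 'n)"
      unfolding sgn_div_norm[abs_def] by (intro continuous_intros) auto
    then show ?thesis by (rule continuous_open_preimage[OF _ _ W]) auto
  qed
  then have o: "open (ball 0 1 \<inter> ?S)" by (intro open_Int[OF open_ball])
  have n1: "norm \<zeta> = 1" using \<zeta> Unit_Ball by simp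
  then have "(1/2) *\<^sub>R \<zeta> \<in> ball 0 1 \<inter> ?S" using \<zeta>(1) by (auto simp: sgn_div_norm)
  then have "emeasure lborel (ball 0 1 \<inter> ?S) \<noteq> 0" using emeasure_lborel_open_pos[OF o] by blast
  then have "emeasure ?U ?S \<noteq> 0"
    using o emeasure_lborel_ball_finite[of "0::complex ^ 'n" 1] \<open>open ?S\<close>
    by (subst emeasure_uniform_measure) (auto simp: ennreal_divide_eq_0_iff)
  moreover have "emeasure ?U ?S \<le> emeasure ?U (sgn -` (W \<inter> sphere 0 1))"
  proof (rule emeasure_mono)
    show "?S \<subseteq> sgn -` (W \<inter> sphere 0 1)" by (auto simp: norm_sgn)
    show "sgn -` (W \<inter> sphere 0 1) \<in> sets ?U"
      using measurable_sets[of sgn borel borel "W \<inter> sphere (0::complex ^ 'n) 1"] by simp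
  qed
  ultimately have "emeasure (distr ?U borel sgn) (W \<inter> sphere 0 1) \<noteq> 0"
    by (subst emeasure_distr) auto
  then show ?thesis using Unit_Ball by (simp add: emeasure_restrict_space)
next
  case Unit_Polydisk
  let ?P = "\<Pi>\<^sub>M i\<in>(UNIV :: 'n set). unif_angle"
  interpret product_prob_space "\<lambda>i::'n. unif_angle" UNIV by unfold_locales
  let ?c = "\<lambda>\<theta>. \<chi> i. cis (\<theta> i) :: complex ^ 'n"
  have m: "?c \<in> ?P \<rightarrow>\<^sub>M borel" by (rule measurable_cis_vec)
  define \<tau> where "\<tau> = (\<lambda>i. Arg2pi (\<zeta> $ i))"
  have \<tau>: "0 \<le> \<tau> i" "\<tau> i < 2*pi" for i by (auto simp: \<tau>_def Arg2pi_ge_0 Arg2pi_lt_2pi)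
  have \<zeta>1: "cmod (\<zeta> $ i) = 1" for i using \<zeta>(2) Unit_Polydisk by simp
  have \<zeta>\<tau>: "\<zeta> $ i = cis (\<tau> i)" for i
    unfolding \<tau>_def using Arg2pi_eq[of "\<zeta> $ i"] \<zeta>1[of i] by (simp add: cis_conv_exp)
  obtain e where e: "e > 0" "\<And>z. dist z \<zeta> < e \<Longrightarrow> z \<in> W"
    using W \<zeta>(1) by (auto simp: open_dist)
  define \<delta> where "\<delta> = e / (2 * real CARD('n))"
  have \<delta>: "\<delta> > 0" using e by (simp add: \<delta>_def)
  define A where "A i = {\<tau> i - \<delta><..<\<tau> i + \<delta>}" for i
  have sub: "?c \<theta> \<in> W" if "\<And>i. \<theta> i \<in> A i" for \<theta>
  proof (rule e(2))
    have "cmod (cis (\<theta> i) - cis (\<tau> i)) \<le> \<delta>" for i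
    proof -
      have "cmod (cis (\<theta> i) - cis (\<tau> i)) \<le> \<bar>\<theta> i - \<tau> i\<bar>"
        using norm_cis_diff_le[of "\<theta> i" "\<tau> i"] .
      also have "\<dots> \<le> \<delta>" using that[of i] by (auto simp: A_def)
      finally show ?thesis .
    qed
    then have "(\<Sum>i\<in>UNIV. cmod ((?c \<theta> - \<zeta>) $ i)) \<le> (\<Sum>i\<in>(UNIV::'n set). \<delta>)"
      by (intro sum_mono) (simp add: \<zeta>\<tau>)
    also have "\<dots> = e / 2" by (simp add: \<delta>_def)
    also have "\<dots> < e" using e by simp
    finally show "dist (?c \<theta>) \<zeta> < e"
      unfolding dist_norm norm_vec_def using L2_set_le_sum[of UNIV "\<lambda>i. cmod ((?c \<theta> - \<zeta>) $ i)"] by simp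
  qed
  have pos: "emeasure unif_angle (A i) \<noteq> 0" for i
  proof -
    have "emeasure lborel {max 0 (\<tau> i - \<delta>)<..<min (2*pi) (\<tau> i + \<delta>)} \<le> emeasure lborel ({0..2*pi} \<inter> A i)"
      by (rule emeasure_mono) (auto simp: A_def)
    moreover have "max 0 (\<tau> i - \<delta>) < min (2*pi) (\<tau> i + \<delta>)" using \<tau>[of i] \<delta> by auto
    then have "{max 0 (\<tau> i - \<delta>)<..<min (2*pi) (\<tau> i + \<delta>)} \<noteq> {}"
      by (simp only: greaterThanLessThan_empty_iff not_le)
    then have "emeasure lborel {max 0 (\<tau> i - \<delta>)<..<min (2*pi) (\<tau> i + \<delta>)} \<noteq> 0"
      by (intro emeasure_lborel_open_pos) auto
    ultimately have "emeasure lborel ({0..2*pi} \<inter> A i) \<noteq> 0" by auto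
    then show ?thesis by (simp add: unif_angle_emeasure A_def ennreal_divide_eq_0_iff)
  qed
  have "emeasure ?P (Pi\<^sub>E UNIV A) = (\<Prod>i\<in>UNIV. emeasure unif_angle (A i))"
    by (rule emeasure_PiM) (auto simp: A_def)
  then have "emeasure ?P (Pi\<^sub>E UNIV A) \<noteq> 0" using pos by simp
  moreover have "emeasure ?P (Pi\<^sub>E UNIV A) \<le> emeasure ?P (?c -` (W \<inter> cboundary K) \<inter> space ?P)"
  proof (rule emeasure_mono)
    show "Pi\<^sub>E UNIV A \<subseteq> ?c -` (W \<inter> cboundary K) \<inter> space ?P"
      using sub Unit_Polydisk by (auto simp: space_PiM PiE_def)
    show "?c -` (W \<inter> cboundary K) \<inter> space ?P \<in> sets ?P"
      by (rule measurable_sets[OF m]) (use W in auto)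
  qed
  ultimately have "emeasure (distr ?P borel ?c) (W \<inter> cboundary K) \<noteq> 0"
    using W by (subst emeasure_distr[OF m]) auto
  then show ?thesis using Unit_Polydisk cboundary_borel[of Unit_Polydisk, where ?'a='n]
    by (simp add: unif_angle_def emeasure_restrict_space)
qed

lemma AE_boundary_imp_all:
  fixes u :: "complex ^ 'n \<Rightarrow> real"
  assumes u: "continuous_on (cboundary K) u" and ae: "AE z in \<sigma> K. u z \<le> M" and z: "z \<in> cboundary K"
  shows "u z \<le> M"
proof (rule ccontr)
  assume "\<not> u z \<le> M"
  have "openin (top_of_set (cboundary K)) (cboundary K \<inter> u -` {M<..})"
    using u by (rule continuous_openin_preimage_gen) simp
  then obtain W where W: "open W" "cboundary K \<inter> u -` {M<..} = cboundary K \<inter> W"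
    by (auto simp: openin_open)
  have "z \<in> W" using z W(2) \<open>\<not> u z \<le> M\<close> by auto
  then have nz: "emeasure (\<sigma> K) (W \<inter> cboundary K) \<noteq> 0"
    using boundary_measure_open_pos[OF W(1)] z by blast
  have "x \<notin> W \<inter> cboundary K" if "u x \<le> M" for x
  proof
    assume "x \<in> W \<inter> cboundary K"
    then have "x \<in> cboundary K \<inter> u -` {M<..}" using W(2) by blast
    then show False using that by simp
  qed
  then have "AE x in \<sigma> K. x \<notin> W \<inter> cboundary K"
    using ae by (auto elim!: eventually_mono)
  have WN: "W \<inter> cboundary K \<in> sets (\<sigma> K)"
    using W(1) by (simp add: sets_restrict_space_iff Int_commute)
  with \<open>AE x in \<sigma> K. x \<notin> W \<inter> cboundary K\<close>
  have "emeasure (\<sigma> K) (W \<inter> cboundary K) = 0"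
    using AE_iff_null_sets[OF WN] by (simp add: null_setsD1)
  with nz show False by simp
qed

section \<open>Integration over circular slices\<close>

lemma measurable_rotate_pair [measurable]:
  "(\<lambda>(z, t). cis t *s z) \<in> \<sigma> K \<Otimes>\<^sub>M unif_angle \<rightarrow>\<^sub>M (\<sigma> K :: (complex ^ 'n) measure)"
proof -
  have [measurable]: "cis \<in> borel_measurable borel"
    by (intro borel_measurable_continuous_onI continuous_intros)
  have nth: "(\<lambda>z. z $ i) \<in> borel_measurable (restrict_space borel (cboundary K) :: (complex ^ 'n) measure)" for i
    by (rule measurable_restrict_space1[OF borel_measurable_continuous_onI[OF linear_continuous_on[OF bounded_linear_vec_nth]]])
  have "(\<lambda>(z, t). cis t *s z) \<in> \<sigma> K \<Otimes>\<^sub>M unif_angle \<rightarrow>\<^sub>M (borel :: (complex ^ 'n) measure)"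
  proof (rule borel_measurable_vec)
    fix i :: 'n
    have [measurable]: "(\<lambda>x. fst x $ i) \<in> borel_measurable (restrict_space borel (cboundary K) \<Otimes>\<^sub>M (borel :: real measure))"
      by (rule measurable_compose[OF measurable_fst nth])
    have "(\<lambda>x. cis (snd x) * (fst x $ i)) \<in> borel_measurable (\<sigma> K \<Otimes>\<^sub>M unif_angle)" by measurable
    then show "(\<lambda>x. (case x of (z, t) \<Rightarrow> cis t *s (z :: complex ^ 'n)) $ i) \<in> borel_measurable (\<sigma> K \<Otimes>\<^sub>M unif_angle)"
      by (simp only: split_beta vector_smult_component)
  qed
  then show ?thesis
    by (subst measurable_cong_sets[OF refl sets_boundary_measure])
       (rule measurable_restrict_space2, auto simp: space_pair_measure intro!: cboundary_smult)
qed

lemma measurable_rotate [measurable]: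
  "(\<lambda>z. cis t *s z) \<in> \<sigma> K \<rightarrow>\<^sub>M (\<sigma> K :: (complex ^ 'n) measure)"
  using measurable_compose[OF measurable_Pair2' measurable_rotate_pair, of t] by simp

text \<open>Rotation invariance and Fubini: the integral over the boundary is an average over its circular
  slices. This reduces every statement about radial limits to one complex variable.\<close>

lemma nn_integral_slices:
  assumes [measurable]: "u \<in> borel_measurable (\<sigma> K :: (complex ^ 'n) measure)"
  shows "(\<integral>\<^sup>+z. u z \<partial>\<sigma> K) = (\<integral>\<^sup>+z. \<integral>\<^sup>+t. u (cis t *s z) \<partial>unif_angle \<partial>\<sigma> K)"
proof -
  interpret S: prob_space "\<sigma> K :: (complex ^ 'n) measure" by (rule prob_space_boundary_measure)
  interpret P: pair_sigma_finite "\<sigma> K :: (complex ^ 'n) measure" unif_angle by unfold_locales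
  have m: "(\<lambda>(z, t). u (cis t *s z)) \<in> borel_measurable (\<sigma> K \<Otimes>\<^sub>M unif_angle)"
    using measurable_compose[OF measurable_rotate_pair assms] by (simp add: case_prod_beta)
  have "(\<integral>\<^sup>+z. \<integral>\<^sup>+t. u (cis t *s z) \<partial>unif_angle \<partial>\<sigma> K) = (\<integral>\<^sup>+t. \<integral>\<^sup>+z. u (cis t *s z) \<partial>\<sigma> K \<partial>unif_angle)"
    using P.Fubini'[OF m] by simp
  also have "\<dots> = (\<integral>\<^sup>+t. (\<integral>\<^sup>+z. u z \<partial>\<sigma> K) \<partial>unif_angle)"
  proof (rule nn_integral_cong)
    fix t
    have "(\<integral>\<^sup>+z. u z \<partial>\<sigma> K) = (\<integral>\<^sup>+z. u z \<partial>distr (\<sigma> K) (\<sigma> K) (\<lambda>z. cis t *s z))"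
      by (simp add: boundary_measure_rotate)
    also have "\<dots> = (\<integral>\<^sup>+z. u (cis t *s z) \<partial>\<sigma> K)"
      by (rule nn_integral_distr) measurable
    finally show "(\<integral>\<^sup>+z. u (cis t *s z) \<partial>\<sigma> K) = (\<integral>\<^sup>+z. u z \<partial>\<sigma> K)" ..
  qed
  also have "\<dots> = (\<integral>\<^sup>+z. u z \<partial>\<sigma> K)"
    using unif_angle.emeasure_space_1 by simp
  finally show ?thesis ..
qed

lemma AE_slices:
  fixes P :: "complex ^ 'n \<Rightarrow> bool"
  assumes P: "{z \<in> cboundary K. P z} \<in> sets (\<sigma> K)"
    and ae: "AE z in \<sigma> K. AE t in unif_angle. P (cis t *s z)"
  shows "AE z in \<sigma> K. P z"
proof -
  let ?M = "\<sigma> K :: (complex ^ 'n) measure"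
  let ?N = "cboundary K - {z \<in> cboundary K. P z}"
  have N: "?N \<in> sets (\<sigma> K)" using P sets.compl_sets[of "{z \<in> cboundary K. P z}" "\<sigma> K"] by simp
  have "emeasure (\<sigma> K) ?N = (\<integral>\<^sup>+z. indicator ?N z \<partial>?M)" using N by simp
  also have "\<dots> = (\<integral>\<^sup>+z. \<integral>\<^sup>+t. indicator ?N (cis t *s z) \<partial>unif_angle \<partial>?M)"
    by (rule nn_integral_slices) (use N in measurable)
  also have "\<dots> = (\<integral>\<^sup>+z. 0 \<partial>?M)"
  proof (rule nn_integral_cong_AE)
    show "AE z in \<sigma> K. (\<integral>\<^sup>+t. indicator ?N (cis t *s z) \<partial>unif_angle) = 0"
      using ae
    proof eventually_elim
      case (elim z)
      have "(\<integral>\<^sup>+t. indicator ?N (cis t *s z) \<partial>unif_angle) = (\<integral>\<^sup>+t. 0 \<partial>unif_angle)"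
        by (rule nn_integral_cong_AE) (use elim in \<open>auto elim!: eventually_mono\<close>)
      then show ?case by simp
    qed
  qed
  finally have "?N \<in> null_sets (\<sigma> K)" using N by (simp add: null_sets_def)
  then have "AE z in \<sigma> K. z \<notin> ?N" by (rule AE_not_in)
  moreover have "AE z in \<sigma> K. z \<in> cboundary K" by (rule AE_I2) simp
  ultimately show ?thesis by eventually_elim auto
qed

lemma integral_slices:
  fixes u :: "complex ^ 'n \<Rightarrow> complex"
  assumes [measurable]: "u \<in> borel_measurable (\<sigma> K)" and B: "\<And>z. z \<in> cboundary K \<Longrightarrow> cmod (u z) \<le> B"
  shows "(\<integral>z. u z \<partial>\<sigma> K) = (\<integral>z. \<integral>t. u (cis t *s z) \<partial>unif_angle \<partial>\<sigma> K)"
proof -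
  interpret S: prob_space "\<sigma> K :: (complex ^ 'n) measure" by (rule prob_space_boundary_measure)
  interpret P: pair_prob_space "\<sigma> K :: (complex ^ 'n) measure" unif_angle by unfold_locales
  have m: "(\<lambda>(z, t). u (cis t *s z)) \<in> borel_measurable (\<sigma> K \<Otimes>\<^sub>M unif_angle)"
    using measurable_compose[OF measurable_rotate_pair assms(1)] by (simp add: case_prod_beta)
  have int: "integrable (\<sigma> K \<Otimes>\<^sub>M unif_angle) (\<lambda>(z, t). u (cis t *s z))"
    by (rule P.integrable_const_bound[OF _ m, of B])
       (auto simp: space_pair_measure intro!: AE_I2 B cboundary_smult)
  have "(\<integral>z. \<integral>t. u (cis t *s z) \<partial>unif_angle \<partial>\<sigma> K) = (\<integral>t. \<integral>z. u (cis t *s z) \<partial>\<sigma> K \<partial>unif_angle)"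
    using P.Fubini_integral[OF int] by simp
  also have "\<dots> = (\<integral>t. (\<integral>z. u z \<partial>\<sigma> K) \<partial>unif_angle)"
  proof (rule Bochner_Integration.integral_cong[OF refl])
    fix t
    have "(\<integral>z. u z \<partial>\<sigma> K) = (\<integral>z. u z \<partial>distr (\<sigma> K) (\<sigma> K) (\<lambda>z. cis t *s z))"
      by (simp add: boundary_measure_rotate)
    also have "\<dots> = (\<integral>z. u (cis t *s z) \<partial>\<sigma> K)"
      by (rule integral_distr) measurable
    finally show "(\<integral>z. u (cis t *s z) \<partial>\<sigma> K) = (\<integral>z. u z \<partial>\<sigma> K)" ..
  qed
  finally show ?thesis by simp
qed

section \<open>Holomorphic functions on the ball and the polydisk\<close>

fun cclosed :: "domain_kind \<Rightarrow> (complex ^ 'n) set" where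
  "cclosed Unit_Ball = cball 0 1"
| "cclosed Unit_Polydisk = {z. \<forall>j. cmod (z $ j) \<le> 1}"

lemma compact_cclosed: "compact (cclosed K :: (complex ^ 'n) set)"
proof (cases K)
  case Unit_Polydisk
  have "closed {z :: complex ^ 'n. \<forall>j. cmod (z $ j) \<le> 1}"
    by (intro closed_Collect_all closed_Collect_le continuous_intros)
  moreover have "bounded {z :: complex ^ 'n. \<forall>j. cmod (z $ j) \<le> 1}"
  proof (rule boundedI)
    fix z :: "complex ^ 'n" assume z: "z \<in> {z. \<forall>j. cmod (z $ j) \<le> 1}"
    have "norm z \<le> (\<Sum>i\<in>UNIV. cmod (z $ i))" unfolding norm_vec_def by (rule L2_set_le_sum) simp
    also have "\<dots> \<le> (\<Sum>i\<in>(UNIV::'n set). 1)" using z by (intro sum_mono) auto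
    finally show "norm z \<le> real CARD('n)" by simp
  qed
  ultimately show ?thesis using Unit_Polydisk by (simp add: compact_eq_bounded_closed)
qed simp

lemma open_cdomain: "open (cdomain K :: (complex ^ 'n) set)"
proof (cases K)
  case Unit_Polydisk
  have "open (\<Inter>j. {z :: complex ^ 'n. cmod (z $ j) < 1})"
    by (intro open_INT open_Collect_less continuous_intros ballI) auto
  also have "(\<Inter>j. {z :: complex ^ 'n. cmod (z $ j) < 1}) = cdomain Unit_Polydisk" by auto
  finally show ?thesis using Unit_Polydisk by simp
qed simp

lemma cboundary_subset_cclosed: "cboundary K \<subseteq> cclosed K"
  and cdomain_subset_cclosed: "cdomain K \<subseteq> cclosed K"
  by (cases K; force simp: less_imp_le)+

lemma zero_in_cdomain [simp]: "0 \<in> cdomain K"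
  by (cases K) auto

lemma cclosed_smult: "z \<in> cclosed K \<Longrightarrow> cmod c < 1 \<Longrightarrow> c *s z \<in> cdomain K"
proof (cases K)
  case Unit_Ball
  assume "z \<in> cclosed K" "cmod c < 1"
  then have "cmod c * norm z \<le> cmod c * 1" using Unit_Ball by (intro mult_left_mono) auto
  then show ?thesis using \<open>cmod c < 1\<close> Unit_Ball by (simp add: norm_vector_scalar_mult)
next
  case Unit_Polydisk
  assume z: "z \<in> cclosed K" "cmod c < 1"
  have "cmod c * cmod (z $ j) < 1" for j
  proof -
    have "cmod c * cmod (z $ j) \<le> cmod c * 1" using Unit_Polydisk z by (intro mult_left_mono) auto
    then show ?thesis using z by simp
  qed
  then show ?thesis using Unit_Polydisk by (simp add: norm_mult)
qed

lemma cdomain_smult: "z \<in> cdomain K \<Longrightarrow> cmod c \<le> 1 \<Longrightarrow> c *s z \<in> cdomain K"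
proof (cases K)
  case Unit_Ball
  assume "z \<in> cdomain K" "cmod c \<le> 1"
  moreover then have "cmod c * norm z \<le> 1 * norm z" by (intro mult_right_mono) auto
  ultimately show ?thesis using Unit_Ball by (simp add: norm_vector_scalar_mult)
next
  case Unit_Polydisk
  assume z: "z \<in> cdomain K" "cmod c \<le> 1"
  have "cmod c * cmod (z $ j) < 1" for j
  proof -
    have "cmod c * cmod (z $ j) \<le> 1 * cmod (z $ j)" using z by (intro mult_right_mono) auto
    then show ?thesis using z Unit_Polydisk by (simp add: le_less_trans)
  qed
  then show ?thesis using Unit_Polydisk by (simp add: norm_mult)
qed

lemma cboundary_scaleR_cdomain: "z \<in> cclosed K \<Longrightarrow> 0 \<le> r \<Longrightarrow> r < 1 \<Longrightarrow> r *\<^sub>R z \<in> cdomain K"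
  unfolding scaleR_eq_smult by (rule cclosed_smult) auto

lemma vec_cnj_cdomain: "z \<in> cdomain K \<Longrightarrow> vec_cnj z \<in> cdomain K"
  by (cases K) auto

text \<open>Used to turn non-strict bounds on the domain into strict ones.\<close>

lemma cdomain_expand:
  fixes z :: "complex ^ 'n"
  assumes "z \<in> cdomain K"
  obtains r w where "0 < r" "r < 1" "w \<in> cdomain K" "z = r *\<^sub>R w"
proof -
  have "((\<lambda>s. (1 + s) *\<^sub>R z) \<longlongrightarrow> (1 + 0) *\<^sub>R z) (at_right (0::real))"
    by (intro tendsto_intros)
  then have "eventually (\<lambda>s. (1 + s) *\<^sub>R z \<in> cdomain K) (at_right (0::real))"
    by (rule topological_tendstoD) (use assms open_cdomain in auto)
  then obtain b where b: "b > 0" "\<And>s. 0 < s \<Longrightarrow> s < b \<Longrightarrow> (1 + s) *\<^sub>R z \<in> cdomain K"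
    unfolding eventually_at_right[OF zero_less_one] by blast
  define s where "s = b / 2"
  have s: "0 < s" "s < b" using b(1) by (auto simp: s_def)
  show ?thesis
  proof (rule that[of "1 / (1+s)" "(1+s) *\<^sub>R z"])
    show "(1 + s) *\<^sub>R z \<in> cdomain K" using b(2) s by blast
  qed (use s in auto)
qed

lemma holomorphic_vecE:
  assumes "holomorphic_vec f S" "z \<in> S"
  obtains L where "(f has_derivative L) (at z)" "\<And>c v. L (c *s v) = c * L v"
proof -
  have "\<exists>L. (f has_derivative L) (at z) \<and> (\<forall>c v. L (c *s v) = c * L v)"
    using assms by (simp add: holomorphic_vec_def)
  then show thesis using that by auto
qed

lemma holomorphic_vec_continuous_on: "holomorphic_vec f S \<Longrightarrow> continuous_on S f"
  unfolding holomorphic_vec_def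
  by (meson continuous_at_imp_continuous_on has_derivative_continuous)

lemma holomorphic_vec_line:
  assumes f: "holomorphic_vec f S"
  shows "(\<lambda>c. f (z + c *s v)) holomorphic_on {c. z + c *s v \<in> S}"
proof -
  have "(\<lambda>c. f (z + c *s v)) field_differentiable (at c)" if c: "z + c *s v \<in> S" for c
  proof -
    obtain L where L: "(f has_derivative L) (at (z + c *s v))" "\<And>c v. L (c *s v) = c * L v"
      using holomorphic_vecE[OF f c] by blast
    have bl: "bounded_linear (\<lambda>c. c *s v)"
      by (intro linear_conv_bounded_linear[THEN iffD1] linearI) (auto simp: vec_eq_iff distrib_right)
    have "((\<lambda>c. z + c *s v) has_derivative (\<lambda>c. 0 + c *s v)) (at c)"
      by (rule has_derivative_add[OF has_derivative_const bounded_linear_imp_has_derivative[OF bl]])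
    then have "((\<lambda>c. z + c *s v) has_derivative (\<lambda>c. c *s v)) (at c)" by simp
    from has_derivative_compose[OF this L(1)]
    have "((\<lambda>c. f (z + c *s v)) has_derivative (\<lambda>c. L v * c)) (at c)"
      by (simp add: L(2) mult.commute)
    then show ?thesis by (auto simp: field_differentiable_def has_field_derivative_def)
  qed
  then show ?thesis
    by (auto simp: holomorphic_on_def intro: field_differentiable_at_within)
qed

lemma holomorphic_vec_slice:
  assumes f: "holomorphic_vec f (cdomain K)" and z: "z \<in> cclosed K"
  shows "(\<lambda>c. f (c *s z)) holomorphic_on ball 0 1"
proof -
  have "(\<lambda>c. f (0 + c *s z)) holomorphic_on {c. 0 + c *s z \<in> cdomain K}"
    by (rule holomorphic_vec_line[OF f])
  then show ?thesis using cclosed_smult[OF z] by (auto elim!: holomorphic_on_subset)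
qed

lemma holomorphic_vec_cong:
  assumes f: "holomorphic_vec f S" and eq: "\<And>z. z \<in> S \<Longrightarrow> f z = g z"
  shows "holomorphic_vec g S"
  unfolding holomorphic_vec_def
proof (intro conjI ballI)
  show "open S" using f by (simp add: holomorphic_vec_def)
  fix z assume z: "z \<in> S"
  obtain L where L: "(f has_derivative L) (at z)" "\<And>c v. L (c *s v) = c * L v"
    using holomorphic_vecE[OF f z] by blast
  have "(g has_derivative L) (at z)"
    by (rule has_derivative_transform_within_open[OF L(1) \<open>open S\<close> z eq])
  then show "\<exists>L. (g has_derivative L) (at z) \<and> (\<forall>c v. L (c *s v) = c * L v)" using L by blast
qed

lemma holomorphic_vec_const: "open S \<Longrightarrow> holomorphic_vec (\<lambda>_. c) S"
  unfolding holomorphic_vec_def by (intro conjI ballI exI[of _ "\<lambda>_. 0"]) auto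

lemma holomorphic_vec_nth: "open S \<Longrightarrow> holomorphic_vec (\<lambda>z. z $ i) S"
  unfolding holomorphic_vec_def
  by (intro conjI ballI exI[of _ "\<lambda>v. v $ i"])
     (auto intro: bounded_linear_imp_has_derivative bounded_linear_vec_nth)

lemma holomorphic_vec_add:
  assumes "holomorphic_vec f S" "holomorphic_vec g S"
  shows "holomorphic_vec (\<lambda>z. f z + g z) S"
  unfolding holomorphic_vec_def
proof (intro conjI ballI)
  show "open S" using assms by (simp add: holomorphic_vec_def)
  fix z assume z: "z \<in> S"
  obtain L where L: "(f has_derivative L) (at z)" "\<And>c v. L (c *s v) = c * L v"
    using holomorphic_vecE[OF assms(1) z] by blast
  obtain M where M: "(g has_derivative M) (at z)" "\<And>c v. M (c *s v) = c * M v"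
    using holomorphic_vecE[OF assms(2) z] by blast
  show "\<exists>L. ((\<lambda>z. f z + g z) has_derivative L) (at z) \<and> (\<forall>c v. L (c *s v) = c * L v)"
    by (intro exI[of _ "\<lambda>v. L v + M v"]) (auto simp: L(2) M(2) distrib_left intro: has_derivative_add L M)
qed

lemma holomorphic_vec_mult:
  assumes "holomorphic_vec f S" "holomorphic_vec g S"
  shows "holomorphic_vec (\<lambda>z. f z * g z) S"
  unfolding holomorphic_vec_def
proof (intro conjI ballI)
  show "open S" using assms by (simp add: holomorphic_vec_def)
  fix z assume z: "z \<in> S"
  obtain L where L: "(f has_derivative L) (at z)" "\<And>c v. L (c *s v) = c * L v"
    using holomorphic_vecE[OF assms(1) z] by blast
  obtain M where M: "(g has_derivative M) (at z)" "\<And>c v. M (c *s v) = c * M v"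
    using holomorphic_vecE[OF assms(2) z] by blast
  show "\<exists>L. ((\<lambda>z. f z * g z) has_derivative L) (at z) \<and> (\<forall>c v. L (c *s v) = c * L v)"
  proof (intro exI conjI allI)
    show "((\<lambda>z. f z * g z) has_derivative (\<lambda>v. f z * M v + L v * g z)) (at z)"
      by (rule has_derivative_mult[OF L(1) M(1)])
  qed (simp add: L(2) M(2) algebra_simps)
qed

lemma holomorphic_vec_inverse:
  assumes "holomorphic_vec f S" "\<And>z. z \<in> S \<Longrightarrow> f z \<noteq> 0"
  shows "holomorphic_vec (\<lambda>z. inverse (f z)) S"
  unfolding holomorphic_vec_def
proof (intro conjI ballI)
  show "open S" using assms by (simp add: holomorphic_vec_def)
  fix z assume z: "z \<in> S"
  obtain L where L: "(f has_derivative L) (at z)" "\<And>c v. L (c *s v) = c * L v"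
    using holomorphic_vecE[OF assms(1) z] by blast
  show "\<exists>L. ((\<lambda>z. inverse (f z)) has_derivative L) (at z) \<and> (\<forall>c v. L (c *s v) = c * L v)"
  proof (intro exI conjI allI)
    show "((\<lambda>z. inverse (f z)) has_derivative (\<lambda>v. - (inverse (f z) * L v * inverse (f z)))) (at z)"
      by (rule Deriv.has_derivative_inverse[OF assms(2)[OF z] L(1)])
  qed (simp add: L(2))
qed

lemma holomorphic_vec_compose_linear:
  assumes f: "holomorphic_vec f S" and B: "linear B" "\<And>c v. B (c *s v) = c *s B v" and S': "open S'" "B ` S' \<subseteq> S"
  shows "holomorphic_vec (\<lambda>z. f (B z)) S'"
  unfolding holomorphic_vec_def
proof (intro conjI ballI)
  fix z assume "z \<in> S'"
  then have "B z \<in> S" using S' by blast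
  then obtain L where L: "(f has_derivative L) (at (B z))" "\<And>c v. L (c *s v) = c * L v"
    using holomorphic_vecE[OF f] by blast
  have "(B has_derivative B) (at z)"
    using B(1) linear_conv_bounded_linear bounded_linear_imp_has_derivative by blast
  from has_derivative_compose[OF this L(1)]
  show "\<exists>L. ((\<lambda>z. f (B z)) has_derivative L) (at z) \<and> (\<forall>c v. L (c *s v) = c * L v)"
    using L B by (intro exI[of _ "\<lambda>v. L (B v)"]) auto
qed (rule S')

lemma holomorphic_vec_reflect:
  assumes f: "holomorphic_vec f (cdomain K)"
  shows "holomorphic_vec (\<lambda>z. cnj (f (vec_cnj z))) (cdomain K)"
  unfolding holomorphic_vec_def
proof (intro conjI ballI open_cdomain)
  fix z :: "complex ^ 'a" assume "z \<in> cdomain K"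
  then have "vec_cnj z \<in> cdomain K" by (rule vec_cnj_cdomain)
  then obtain L where L: "(f has_derivative L) (at (vec_cnj z))" "\<And>c v. L (c *s v) = c * L v"
    using holomorphic_vecE[OF f] by blast
  have "(vec_cnj has_derivative vec_cnj) (at z)"
    using linear_vec_cnj linear_conv_bounded_linear bounded_linear_imp_has_derivative by blast
  from has_derivative_compose[OF this L(1)]
  have "((\<lambda>z. cnj (f (vec_cnj z))) has_derivative (\<lambda>v. cnj (L (vec_cnj v)))) (at z)"
    by (rule has_derivative_cnj)
  moreover have "vec_cnj (c *s v) = cnj c *s vec_cnj v" for c and v :: "complex ^ 'a"
    by (simp add: vec_eq_iff)
  ultimately show "\<exists>L. ((\<lambda>z. cnj (f (vec_cnj z))) has_derivative L) (at z) \<and> (\<forall>c v. L (c *s v) = c * L v)"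
    using L by (intro exI[of _ "\<lambda>v. cnj (L (vec_cnj v))"]) auto
qed

text \<open>Dominated convergence with a variable dominating function \<open>A n\<close> that converges in the mean. It is
  needed because the dilates of a Smirnov function are not dominated by one integrable function, while
  their \<open>log_plus\<close> converges in the mean.\<close>

lemma generalized_dominated_convergence:
  fixes \<phi> :: "nat \<Rightarrow> 'a \<Rightarrow> real"
  assumes m [measurable]: "\<And>n. \<phi> n \<in> borel_measurable M" "\<phi>' \<in> borel_measurable M"
    and A: "\<And>n. integrable M (A n)" "integrable M A'" "(\<lambda>n. \<integral>x. \<bar>A n x - A' x\<bar> \<partial>M) \<longlonglongrightarrow> 0"
    and Alim: "AE x in M. (\<lambda>n. A n x) \<longlonglongrightarrow> A' x"
    and lim: "AE x in M. (\<lambda>n. \<phi> n x) \<longlonglongrightarrow> \<phi>' x"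
    and le: "\<And>n. AE x in M. 0 \<le> \<phi> n x \<and> \<phi> n x \<le> A n x"
  shows "integrable M \<phi>'" "\<And>n. integrable M (\<phi> n)" "(\<lambda>n. integral\<^sup>L M (\<phi> n)) \<longlonglongrightarrow> integral\<^sup>L M \<phi>'"
proof -
  have [measurable]: "A n \<in> borel_measurable M" "A' \<in> borel_measurable M" for n using A by auto
  show int: "integrable M (\<phi> n)" for n
    by (rule Bochner_Integration.integrable_bound[OF A(1)[of n] m(1)]) (use le[of n] in \<open>eventually_elim, auto\<close>)
  have le_all: "AE x in M. \<forall>n. 0 \<le> \<phi> n x \<and> \<phi> n x \<le> A n x"
    using le by (simp add: AE_all_countable)
  have lim': "AE x in M. 0 \<le> \<phi>' x \<and> \<phi>' x \<le> A' x"
    using le_all Alim lim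
  proof eventually_elim
    case (elim x)
    show ?case
      using LIMSEQ_le_const[OF elim(3), of 0] LIMSEQ_le[OF elim(3) elim(2)] elim(1) by blast
  qed
  show int': "integrable M \<phi>'"
    by (rule Bochner_Integration.integrable_bound[OF A(2) m(2)]) (use lim' in \<open>eventually_elim, auto\<close>)
  have 1: "(\<lambda>n. \<integral>x. min (\<phi> n x) (A' x) \<partial>M) \<longlonglongrightarrow> (\<integral>x. \<phi>' x \<partial>M)"
  proof (rule integral_dominated_convergence[OF _ _ A(2)])
    show "AE x in M. (\<lambda>n. min (\<phi> n x) (A' x)) \<longlonglongrightarrow> \<phi>' x"
      using lim lim'
    proof eventually_elim
      case (elim x)
      have "(\<lambda>n. min (\<phi> n x) (A' x)) \<longlonglongrightarrow> min (\<phi>' x) (A' x)" by (intro tendsto_min elim(1) tendsto_const)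
      then show ?case using elim(2) by (simp add: min_def)
    qed
    show "AE x in M. norm (min (\<phi> n x) (A' x)) \<le> A' x" for n
      using le[of n] lim' by eventually_elim auto
  qed auto
  have imin: "integrable M (\<lambda>x. min (\<phi> n x) (A' x))" for n
    using int[of n] A(2) by (rule Bochner_Integration.integrable_min)
  have 2: "(\<lambda>n. (\<integral>x. \<phi> n x \<partial>M) - (\<integral>x. min (\<phi> n x) (A' x) \<partial>M)) \<longlonglongrightarrow> 0"
  proof (rule Lim_null_comparison[OF _ A(3)], rule always_eventually, rule allI)
    fix n
    have "(\<integral>x. \<phi> n x \<partial>M) - (\<integral>x. min (\<phi> n x) (A' x) \<partial>M) = (\<integral>x. \<phi> n x - min (\<phi> n x) (A' x) \<partial>M)"
      using int imin by simp
    also have "norm \<dots> \<le> (\<integral>x. norm (\<phi> n x - min (\<phi> n x) (A' x)) \<partial>M)" by (rule integral_norm_bound)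
    also have "\<dots> \<le> (\<integral>x. \<bar>A n x - A' x\<bar> \<partial>M)"
    proof (rule integral_mono_AE)
      show "AE x in M. norm (\<phi> n x - min (\<phi> n x) (A' x)) \<le> \<bar>A n x - A' x\<bar>"
        using le[of n] by eventually_elim (auto simp: min_def)
    qed (use int imin A in auto)
    finally show "norm ((\<integral>x. \<phi> n x \<partial>M) - (\<integral>x. min (\<phi> n x) (A' x) \<partial>M)) \<le> (\<integral>x. \<bar>A n x - A' x\<bar> \<partial>M)" .
  qed
  show "(\<lambda>n. integral\<^sup>L M (\<phi> n)) \<longlonglongrightarrow> integral\<^sup>L M \<phi>'"
    using tendsto_add[OF 2 1] by simp
qed

lemma borel_measurable_boundary:
  "continuous_on (cboundary K) (g :: complex ^ 'n \<Rightarrow> 'b::topological_space) \<Longrightarrow> g \<in> borel_measurable (\<sigma> K)"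
  by (subst measurable_cong_sets[OF sets_boundary_measure refl])
     (rule borel_measurable_continuous_on_restrict)

lemma AE_boundary: "AE z in \<sigma> K. z \<in> cboundary K"
  by (rule AE_I2) simp

lemma boundary_integrable_bounded:
  fixes g :: "complex ^ 'n \<Rightarrow> 'b::{banach, second_countable_topology}"
  assumes "g \<in> borel_measurable (\<sigma> K)" "AE z in \<sigma> K. norm (g z) \<le> B"
  shows "integrable (\<sigma> K) g"
proof -
  interpret prob_space "\<sigma> K :: (complex ^ 'n) measure" by (rule prob_space_boundary_measure)
  show ?thesis by (rule integrable_const_bound[OF assms(2,1)])
qed

lemma dilate_continuous:
  assumes f: "holomorphic_vec f (cdomain K)" and r: "0 \<le> r" "r < 1"
  shows "continuous_on (cclosed K) (\<lambda>z. f (r *\<^sub>R z))"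
  by (rule continuous_on_compose2[OF holomorphic_vec_continuous_on[OF f]])
     (use r cboundary_scaleR_cdomain in \<open>auto intro!: continuous_intros\<close>)

lemma dilate_bounded:
  assumes f: "holomorphic_vec f (cdomain K)" and r: "0 \<le> r" "r < 1"
  obtains B where "0 < B" "\<And>z. z \<in> cclosed K \<Longrightarrow> cmod (f (r *\<^sub>R z)) \<le> B"
proof -
  have "bounded ((\<lambda>z. f (r *\<^sub>R z)) ` cclosed K)"
    by (intro compact_imp_bounded compact_continuous_image dilate_continuous[OF f r] compact_cclosed)
  then obtain B where "B > 0" "\<forall>x\<in>(\<lambda>z. f (r *\<^sub>R z)) ` cclosed K. cmod x \<le> B"
    unfolding bounded_pos by blast
  then show thesis using that[of B] by blast
qed

lemma dilate_measurable [measurable]: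
  assumes f: "holomorphic_vec f (cdomain K)" and r: "0 \<le> r" "r < 1"
  shows "(\<lambda>z. f (r *\<^sub>R z)) \<in> borel_measurable (\<sigma> K)"
  by (rule borel_measurable_boundary[OF continuous_on_subset[OF dilate_continuous[OF f r] cboundary_subset_cclosed]])

lemma log_plus_measurable [measurable]: "log_plus \<in> borel_measurable borel"
  unfolding log_plus_def[abs_def] by measurable

lemma ln1p_measurable [measurable]: "(\<lambda>z. ln (1 + cmod z)) \<in> borel_measurable borel"
  by measurable

lemma log_plus_mono: "0 \<le> x \<Longrightarrow> x \<le> y \<Longrightarrow> log_plus x \<le> log_plus y"
  by (subst (1 2) log_plus_eq) (auto simp: max_def)

lemma log_plus_eq_0_iff: "0 \<le> x \<Longrightarrow> log_plus x = 0 \<longleftrightarrow> x \<le> 1"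
  by (auto simp: log_plus_eq max_def)

lemma log_plus_mult: "0 \<le> x \<Longrightarrow> 0 \<le> y \<Longrightarrow> log_plus (x * y) \<le> log_plus x + log_plus y"
proof -
  assume xy: "0 \<le> x" "0 \<le> y"
  have "max 1 (x * y) \<le> max 1 x * max 1 y"
  proof (rule max.boundedI)
    have "1 * 1 \<le> max 1 x * max 1 y" by (intro mult_mono) auto
    then show "1 \<le> max 1 x * max 1 y" by simp
    show "x * y \<le> max 1 x * max 1 y" using xy by (intro mult_mono) auto
  qed
  then have "ln (max 1 (x * y)) \<le> ln (max 1 x * max 1 y)"
    by (subst ln_le_cancel_iff) (auto simp: less_max_iff_disj zero_less_mult_iff)
  also have "\<dots> = ln (max 1 x) + ln (max 1 y)" by (rule ln_mult_pos) (auto simp: less_max_iff_disj)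
  finally show ?thesis using xy by (simp add: log_plus_eq)
qed

lemma ln_1_plus_cmod_diff_le: "ln (1 + cmod (a - b)) \<le> 2 * ln 2 + log_plus (cmod a) + log_plus (cmod b)"
proof -
  have 1: "ln (1 + x) \<le> ln 2 + log_plus x" if "0 \<le> x" for x :: real
  proof -
    have "ln (1 + x) \<le> ln (2 * max 1 x)" using that by (subst ln_le_cancel_iff) (auto simp: max_def)
    also have "\<dots> = ln 2 + ln (max 1 x)" by (rule ln_mult_pos) (auto simp: less_max_iff_disj)
    finally show ?thesis using that by (simp add: log_plus_eq)
  qed
  have "1 + cmod (a - b) \<le> (1 + cmod a) * (1 + cmod b)"
    using norm_triangle_ineq4[of a b] by (simp add: algebra_simps) (metis add.assoc add_increasing2 mult_nonneg_nonneg norm_ge_zero add.commute)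
  then have "ln (1 + cmod (a - b)) \<le> ln ((1 + cmod a) * (1 + cmod b))"
    by (subst ln_le_cancel_iff) (auto simp: add_pos_nonneg zero_less_mult_iff)
  also have "\<dots> = ln (1 + cmod a) + ln (1 + cmod b)" by (rule ln_mult_pos) (auto simp: add_pos_nonneg)
  finally show ?thesis using 1[of "cmod a"] 1[of "cmod b"] by simp
qed

lemma ln_1_plus_nonneg: "0 \<le> x \<Longrightarrow> 0 \<le> ln (1 + x :: real)"
  by simp

section \<open>Radial limits and boundary values\<close>

definition radial_limit_exists :: "(complex ^ 'n \<Rightarrow> complex) \<Rightarrow> complex ^ 'n \<Rightarrow> bool" where
  "radial_limit_exists f z \<longleftrightarrow> (\<exists>l. ((\<lambda>r. f (r *\<^sub>R z)) \<longlongrightarrow> l) (at_left 1))"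

text \<open>By continuity along the radius rational radii decide whether the limit exists. This gives
  measurability of the set of boundary points with a radial limit.\<close>

lemma radial_limit_exists_rational:
  assumes f: "holomorphic_vec f (cdomain K)" and z: "z \<in> cboundary K"
  shows "radial_limit_exists f z \<longleftrightarrow>
    (\<forall>k::nat. \<exists>m::nat. \<forall>q q'::rat. of_rat q \<in> {radii m<..<1} \<longrightarrow> of_rat q' \<in> {radii m<..<1} \<longrightarrow>
       cmod (f (of_rat q *\<^sub>R z) - f (of_rat q' *\<^sub>R z)) \<le> inverse (real (Suc k)))" (is "_ \<longleftrightarrow> ?R")
proof
  assume "radial_limit_exists f z"
  then have L: "\<forall>e>0. \<exists>\<rho><1. \<forall>r\<in>{\<rho><..<1}. \<forall>r'\<in>{\<rho><..<1}. cmod (f (r *\<^sub>R z) - f (r' *\<^sub>R z)) \<le> e"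
    unfolding radial_limit_exists_def at_left_limit_iff_Cauchy by blast
  show ?R
  proof
    fix k :: nat
    have "inverse (real (Suc k)) > 0" by simp
    with L obtain \<rho> where \<rho>: "\<rho> < 1" "\<forall>r\<in>{\<rho><..<1}. \<forall>r'\<in>{\<rho><..<1}. cmod (f (r *\<^sub>R z) - f (r' *\<^sub>R z)) \<le> inverse (real (Suc k))"
      by meson
    obtain m where "\<rho> < radii m" using order_tendstoD(1)[OF radii_tendsto \<rho>(1)] by (auto simp: eventually_sequentially)
    then show "\<exists>m. \<forall>q q'::rat. of_rat q \<in> {radii m<..<1} \<longrightarrow> of_rat q' \<in> {radii m<..<1} \<longrightarrow>
       cmod (f (of_rat q *\<^sub>R z) - f (of_rat q' *\<^sub>R z)) \<le> inverse (real (Suc k))"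
      using \<rho>(2) by (intro exI[of _ m]) auto
  qed
next
  assume R: ?R
  have cont: "isCont (\<lambda>r. f (r *\<^sub>R z)) r" if "0 < r" "r < 1" for r :: real
  proof -
    have "continuous_on {0<..<1} (\<lambda>r::real. f (r *\<^sub>R z))"
      by (rule continuous_on_compose2[OF holomorphic_vec_continuous_on[OF f]])
         (use z cboundary_scaleR_cdomain cboundary_subset_cclosed in \<open>force intro!: continuous_intros\<close>)+
    then show ?thesis using that by (simp add: continuous_on_eq_continuous_at)
  qed
  show "radial_limit_exists f z"
    unfolding radial_limit_exists_def at_left_limit_iff_Cauchy
  proof (intro allI impI)
    fix e :: real assume "e > 0"
    then obtain k where k: "inverse (real (Suc k)) < e" using reals_Archimedean by blast
    obtain m where m: "\<And>q q'::rat. of_rat q \<in> {radii m<..<1} \<Longrightarrow> of_rat q' \<in> {radii m<..<1} \<Longrightarrow>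
       cmod (f (of_rat q *\<^sub>R z) - f (of_rat q' *\<^sub>R z)) \<le> inverse (real (Suc k))" using R by meson
    have approx: "\<exists>q::rat. of_rat q \<in> {radii m<..<1} \<and> cmod (f (of_rat q *\<^sub>R z) - w) > e"
      if r: "r \<in> {radii m<..<1}" and gt: "cmod (f (r *\<^sub>R z) - w) > e" for r w
    proof -
      have r01: "0 < r" "r < 1" using r radii(1)[of m] by auto
      have "isCont (\<lambda>r. cmod (f (r *\<^sub>R z) - w)) r" by (intro continuous_intros cont r01)
      then have "((\<lambda>r. cmod (f (r *\<^sub>R z) - w)) \<longlongrightarrow> cmod (f (r *\<^sub>R z) - w)) (at r)" by (simp add: isCont_def)
      from order_tendstoD(1)[OF this gt]
      obtain d where d: "d > 0" "\<And>s. s \<noteq> r \<Longrightarrow> dist s r < d \<Longrightarrow> cmod (f (s *\<^sub>R z) - w) > e"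
        unfolding eventually_at by auto
      have "max (radii m) (r - d) < r" using r d by auto
      then obtain s where s: "s \<in> \<rat>" "max (radii m) (r - d) < s" "s < r" using Rats_dense_in_real by blast
      obtain q where q: "s = of_rat q" using s(1) by (auto simp: Rats_def)
      show ?thesis using s r d(2)[of s] unfolding q by (intro exI[of _ q]) (auto simp: dist_real_def simp del: of_rat_less_1_iff)
    qed
    show "\<exists>\<rho><1. \<forall>r\<in>{\<rho><..<1}. \<forall>r'\<in>{\<rho><..<1}. cmod (f (r *\<^sub>R z) - f (r' *\<^sub>R z)) \<le> e"
    proof (intro exI conjI ballI)
      show "radii m < 1" by (rule radii)
      fix r r' assume r: "r \<in> {radii m<..<1}" and r': "r' \<in> {radii m<..<1}"
      show "cmod (f (r *\<^sub>R z) - f (r' *\<^sub>R z)) \<le> e"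
      proof (rule ccontr)
        assume "\<not> ?thesis"
        then have "cmod (f (r *\<^sub>R z) - f (r' *\<^sub>R z)) > e" by simp
        then obtain q :: rat where q: "of_rat q \<in> {radii m<..<1}" "cmod (f (of_rat q *\<^sub>R z) - f (r' *\<^sub>R z)) > e"
          using approx[OF r] by blast
        then have "cmod (f (r' *\<^sub>R z) - f (of_rat q *\<^sub>R z)) > e" by (simp add: norm_minus_commute)
        then obtain q' :: rat where q': "of_rat q' \<in> {radii m<..<1}" "cmod (f (of_rat q' *\<^sub>R z) - f (of_rat q *\<^sub>R z)) > e"
          using approx[OF r'] by blast
        show False using m[OF q'(1) q(1)] q'(2) k by linarith
      qed
    qed
  qed
qed

lemma radial_limit_exists_measurable:
  assumes f: "holomorphic_vec f (cdomain K)"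
  shows "{z \<in> cboundary K. radial_limit_exists f z} \<in> sets (\<sigma> K)"
proof -
  let ?Q = "\<lambda>z k m q q'. of_rat q \<in> {radii m<..<1} \<longrightarrow> of_rat q' \<in> {radii m<..<1} \<longrightarrow>
       cmod (f (of_rat q *\<^sub>R z) - f (of_rat q' *\<^sub>R z)) \<le> inverse (real (Suc k))"
  have Q: "{z \<in> space (\<sigma> K). ?Q z k m q q'} \<in> sets (\<sigma> K)" for k m :: nat and q q' :: rat
  proof (cases "of_rat q \<in> {radii m<..<1} \<and> of_rat q' \<in> {radii m<..<1}")
    case True
    then have "0 \<le> (of_rat q::real)" "(of_rat q::real) < 1" "0 \<le> (of_rat q'::real)" "(of_rat q'::real) < 1"
      using radii(1)[of m] unfolding greaterThanLessThan_iff by linarith+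
    note [measurable] = dilate_measurable[OF f this(1,2)] dilate_measurable[OF f this(3,4)]
    have "{z \<in> space (\<sigma> K). cmod (f (of_rat q *\<^sub>R z) - f (of_rat q' *\<^sub>R z)) \<le> inverse (real (Suc k))} \<in> sets (\<sigma> K)"
      by measurable
    then show ?thesis using True by simp
  next
    case False
    then have "{z \<in> space (\<sigma> K). ?Q z k m q q'} = space (\<sigma> K)" by auto
    then show ?thesis by (simp only: sets.top)
  qed
  have "{z \<in> cboundary K. radial_limit_exists f z} = {z \<in> space (\<sigma> K). \<forall>k. \<exists>m. \<forall>q q'. ?Q z k m q q'}"
    using radial_limit_exists_rational[OF f] by auto
  also have "\<dots> \<in> sets (\<sigma> K)"
    by (intro sets.sets_Collect_countable_All sets.sets_Collect_countable_Ex Q)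
  finally show ?thesis .
qed

lemma radii_scaleR_tendsto:
  assumes "((\<lambda>r. f (r *\<^sub>R z)) \<longlongrightarrow> l) (at_left 1)"
  shows "(\<lambda>n. f (radii n *\<^sub>R z)) \<longlonglongrightarrow> l"
  using filterlim_compose[OF assms radii_at_left] .

lemma bdry_value_tendsto:
  assumes "radial_limit_exists f z"
  shows "((\<lambda>r. f (r *\<^sub>R z)) \<longlongrightarrow> bdry_value f z) (at_left 1)"
  using assms unfolding radial_limit_exists_def bdry_value_def
  by (metis tendsto_Lim trivial_limit_at_left_real)

lemma bdry_value_eqI:
  assumes "((\<lambda>r. f (r *\<^sub>R z)) \<longlongrightarrow> l) (at_left 1)"
  shows "bdry_value f z = l"
  unfolding bdry_value_def by (rule tendsto_Lim[OF trivial_limit_at_left_real assms])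

lemma bdry_value_measurable [measurable]:
  assumes f: "holomorphic_vec f (cdomain K)"
  shows "bdry_value f \<in> borel_measurable (\<sigma> K)"
proof -
  note [measurable] = dilate_measurable[OF f less_imp_le[OF radii(1)] radii(2)]
  have eq: "bdry_value f z = (if z \<in> {z \<in> cboundary K. radial_limit_exists f z} then lim (\<lambda>n. f (radii n *\<^sub>R z)) else (THE l. False))"
    if "z \<in> space (\<sigma> K)" for z
  proof (cases "radial_limit_exists f z")
    case True
    then show ?thesis using radii_scaleR_tendsto[OF bdry_value_tendsto[OF True]] that by (simp add: limI)
  next
    case False
    then have "(\<lambda>l. ((\<lambda>r. f (r *\<^sub>R z)) \<longlongrightarrow> l) (at_left 1)) = (\<lambda>l. False)" by (auto simp: radial_limit_exists_def)
    then show ?thesis using False by (simp add: bdry_value_def t2_space_class.Lim_def)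
  qed
  have "(\<lambda>z. if z \<in> {z \<in> cboundary K. radial_limit_exists f z} then lim (\<lambda>n. f (radii n *\<^sub>R z)) else (THE l. False)) \<in> borel_measurable (\<sigma> K)"
  proof (rule measurable_If_set)
    have "{z \<in> cboundary K. radial_limit_exists f z} \<inter> space (\<sigma> K) = {z \<in> cboundary K. radial_limit_exists f z}" by auto
    then show "{z \<in> cboundary K. radial_limit_exists f z} \<inter> space (\<sigma> K) \<in> sets (\<sigma> K)"
      using radial_limit_exists_measurable[OF f] by (simp only:)
  qed measurable
  then show ?thesis using measurable_cong[of "\<sigma> K" "bdry_value f", OF eq] by blast
qed

lemma slice_eq: "f (r *\<^sub>R (cis t *s z)) = (\<lambda>c. f (c *s z)) (of_real r * cis t)"
  by (simp add: scaleR_eq_smult)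

lemma slice_mean_nn_integral:
  fixes f :: "complex ^ 'n \<Rightarrow> complex"
  assumes f: "holomorphic_vec f (cdomain K)" and z: "z \<in> cboundary K" and r: "0 \<le> r" "r < 1"
  shows "(\<integral>\<^sup>+t. ennreal (log_plus (cmod (f (r *\<^sub>R (cis t *s z))))) \<partial>unif_angle) =
      ennreal (\<integral>t. log_plus (cmod (f (of_real r * cis t *s z))) \<partial>unif_angle)"
    and "(\<integral>\<^sup>+t. ennreal (ln (1 + cmod (f (r *\<^sub>R (cis t *s z))))) \<partial>unif_angle) =
      ennreal (\<integral>t. ln (1 + cmod (f (of_real r * cis t *s z))) \<partial>unif_angle)"
proof -
  have h: "(\<lambda>c. f (c *s z)) holomorphic_on ball 0 1"
    by (rule holomorphic_vec_slice[OF f]) (use z cboundary_subset_cclosed in auto)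
  have c: "continuous_on UNIV (\<lambda>t. f (of_real r * cis t *s z))"
    by (rule continuous_on_compose2[OF holomorphic_on_imp_continuous_on[OF h]])
       (use r in \<open>auto intro!: continuous_intros simp: norm_mult\<close>)
  show "(\<integral>\<^sup>+t. ennreal (log_plus (cmod (f (r *\<^sub>R (cis t *s z))))) \<partial>unif_angle) =
      ennreal (\<integral>t. log_plus (cmod (f (of_real r * cis t *s z))) \<partial>unif_angle)"
    unfolding slice_eq by (intro nn_integral_eq_integral unif_angle_integral continuous_on_log_plus c) simp
  show "(\<integral>\<^sup>+t. ennreal (ln (1 + cmod (f (r *\<^sub>R (cis t *s z))))) \<partial>unif_angle) =
      ennreal (\<integral>t. ln (1 + cmod (f (of_real r * cis t *s z))) \<partial>unif_angle)"
    unfolding slice_eq by (intro nn_integral_eq_integral unif_angle_integral continuous_on_ln_1_plus_cmod c) simp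
qed

lemma boundary_mean_log_mono:
  fixes f :: "complex ^ 'n \<Rightarrow> complex"
  assumes f: "holomorphic_vec f (cdomain K)" and rs: "0 \<le> r" "r \<le> s" "s < 1"
  shows "(\<integral>\<^sup>+z. ennreal (log_plus (cmod (f (r *\<^sub>R z)))) \<partial>\<sigma> K) \<le> (\<integral>\<^sup>+z. ennreal (log_plus (cmod (f (s *\<^sub>R z)))) \<partial>\<sigma> K)"
    and "(\<integral>\<^sup>+z. ennreal (ln (1 + cmod (f (r *\<^sub>R z)))) \<partial>\<sigma> K) \<le> (\<integral>\<^sup>+z. ennreal (ln (1 + cmod (f (s *\<^sub>R z)))) \<partial>\<sigma> K)"
proof -
  have r1: "r < 1" and s0: "0 \<le> s" using rs by auto
  note m [measurable] = dilate_measurable[OF f rs(1) r1] dilate_measurable[OF f s0 rs(3)]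
  have h: "(\<lambda>c. f (c *s z)) holomorphic_on ball 0 1" if "z \<in> cboundary K" for z
    by (rule holomorphic_vec_slice[OF f]) (use that cboundary_subset_cclosed in auto)
  show "(\<integral>\<^sup>+z. ennreal (log_plus (cmod (f (r *\<^sub>R z)))) \<partial>\<sigma> K) \<le> (\<integral>\<^sup>+z. ennreal (log_plus (cmod (f (s *\<^sub>R z)))) \<partial>\<sigma> K)"
    by (subst (1 2) nn_integral_slices, measurable, rule nn_integral_mono)
       (simp only: space_boundary_measure slice_mean_nn_integral[OF f _ rs(1) r1] slice_mean_nn_integral[OF f _ s0 rs(3)] ennreal_leI mean_log_mono[OF h rs])
  show "(\<integral>\<^sup>+z. ennreal (ln (1 + cmod (f (r *\<^sub>R z)))) \<partial>\<sigma> K) \<le> (\<integral>\<^sup>+z. ennreal (ln (1 + cmod (f (s *\<^sub>R z)))) \<partial>\<sigma> K)"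
    by (subst (1 2) nn_integral_slices, measurable, rule nn_integral_mono)
       (simp only: space_boundary_measure slice_mean_nn_integral[OF f _ rs(1) r1] slice_mean_nn_integral[OF f _ s0 rs(3)] ennreal_leI mean_log_mono[OF h rs])
qed

lemma nevanlinna_hol: "f \<in> nevanlinna K \<Longrightarrow> holomorphic_vec f (cdomain K)"
  and nevanlinna_ext: "f \<in> nevanlinna K \<Longrightarrow> f \<in> extensional (cdomain K)"
  by (auto simp: nevanlinna_def)

text \<open>By monotone convergence almost every slice function has bounded
  characteristic, so the theorem in one variable applies to it.\<close>

lemma nevanlinna_radial_limits:
  fixes f :: "complex ^ 'n \<Rightarrow> complex"
  assumes f: "f \<in> nevanlinna K"
  shows "AE z in \<sigma> K. radial_limit_exists f z"
proof (rule AE_slices[OF radial_limit_exists_measurable[OF nevanlinna_hol[OF f]]])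
  note hol = nevanlinna_hol[OF f]
  let ?M = "\<sigma> K :: (complex ^ 'n) measure"
  define I where "I n z = (\<integral>\<^sup>+t. ennreal (log_plus (cmod (f (radii n *\<^sub>R (cis t *s z))))) \<partial>unif_angle)" for n z
  note [measurable] = dilate_measurable[OF hol less_imp_le[OF radii(1)] radii(2)]
  have h: "(\<lambda>c. f (c *s z)) holomorphic_on ball 0 1" if "z \<in> cboundary K" for z
    by (rule holomorphic_vec_slice[OF hol]) (use that cboundary_subset_cclosed in auto)
  have I_eq: "I n z = ennreal (\<integral>t. log_plus (cmod (f (of_real (radii n) * cis t *s z))) \<partial>unif_angle)" if "z \<in> cboundary K" for n z
    unfolding I_def using slice_mean_nn_integral(1)[OF hol that less_imp_le[OF radii(1)] radii(2)] .
  have [measurable]: "I n \<in> borel_measurable ?M" for n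
  proof -
    have "(\<lambda>(z, t). ennreal (log_plus (cmod (f (radii n *\<^sub>R (cis t *s z)))))) \<in> borel_measurable (?M \<Otimes>\<^sub>M unif_angle)"
      using measurable_compose[OF measurable_rotate_pair, of "\<lambda>z. ennreal (log_plus (cmod (f (radii n *\<^sub>R z))))" K borel]
      by (simp add: case_prod_beta)
    then show ?thesis unfolding I_def by (rule unif_angle.borel_measurable_nn_integral)
  qed
  have "(\<integral>\<^sup>+z. (SUP n. I n z) \<partial>?M) = (SUP n. \<integral>\<^sup>+z. I n z \<partial>?M)"
  proof (rule nn_integral_monotone_convergence_SUP_AE)
    fix n
    have "I n z \<le> I (Suc n) z" if z: "z \<in> cboundary K" for z
      unfolding I_eq[OF z]
      by (intro ennreal_leI mean_log_mono(1)[OF h[OF z]] radii(1)[THEN less_imp_le] radii(2) radii_mono) simp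
    then show "AE z in ?M. I n z \<le> I (Suc n) z" by (intro AE_I2) simp
  qed measurable
  also have "\<dots> = (SUP n. \<integral>\<^sup>+z. ennreal (log_plus (cmod (f (radii n *\<^sub>R z)))) \<partial>?M)"
    unfolding I_def by (subst (2) nn_integral_slices) simp_all
  also have "\<dots> \<le> (SUP r\<in>{0<..<1}. \<integral>\<^sup>+z. ennreal (log_plus (cmod (f (r *\<^sub>R z)))) \<partial>?M)"
    by (rule SUP_least, rule SUP_upper) (auto simp: radii)
  also have "\<dots> < \<infinity>" using f by (simp add: nevanlinna_def)
  finally have "(\<integral>\<^sup>+z. (SUP n. I n z) \<partial>?M) \<noteq> \<infinity>" by simp
  then have "AE z in ?M. (SUP n. I n z) \<noteq> \<infinity>" by (intro nn_integral_PInf_AE) auto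
  with AE_boundary[of K]
  show "AE z in ?M. AE t in unif_angle. radial_limit_exists f (cis t *s z)"
  proof eventually_elim
    case (elim z)
    then obtain C where C: "(SUP n. I n z) = ennreal C" "0 \<le> C" by (cases "SUP n. I n z") auto
    have "AE t in unif_angle. \<exists>l. ((\<lambda>r. (\<lambda>c. f (c *s z)) (of_real r * cis t)) \<longlongrightarrow> l) (at_left 1)"
    proof (rule Nevanlinna_radial_limits[OF h[OF elim(1)]])
      fix n
      have "I n z \<le> ennreal C" unfolding C(1)[symmetric] by (rule SUP_upper) simp
      then show "(\<integral>t. log_plus (cmod (f (of_real (radii n) * cis t *s z))) \<partial>unif_angle) \<le> C"
        unfolding I_eq[OF elim(1)] using C(2) by simp
    qed
    then show ?case unfolding radial_limit_exists_def slice_eq .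
  qed
qed

section \<open>The Smirnov class\<close>

lemma tendsto_log_plus:
  assumes "(f \<longlongrightarrow> (l::complex)) F"
  shows "((\<lambda>x. log_plus (cmod (f x))) \<longlongrightarrow> log_plus (cmod l)) F"
proof -
  have "max 1 (cmod l) \<noteq> 0" by (auto simp: max_def)
  then show ?thesis unfolding log_plus_eq[OF norm_ge_zero]
    by (intro tendsto_ln tendsto_max tendsto_norm assms tendsto_const)
qed

lemma tendsto_ln_1_plus_cmod:
  assumes "(f \<longlongrightarrow> (l::complex)) F"
  shows "((\<lambda>x. ln (1 + cmod (f x))) \<longlongrightarrow> ln (1 + cmod l)) F"
proof -
  have "1 + cmod l \<noteq> 0" by (metis add_pos_nonneg less_irrefl norm_ge_zero zero_less_one)
  then show ?thesis by (intro tendsto_ln tendsto_add tendsto_norm assms tendsto_const)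
qed

lemma smirnov_nevanlinna: "f \<in> smirnov K \<Longrightarrow> f \<in> nevanlinna K"
  by (simp add: smirnov_def)

lemma smirnov_hol: "f \<in> smirnov K \<Longrightarrow> holomorphic_vec f (cdomain K)"
  and smirnov_ext: "f \<in> smirnov K \<Longrightarrow> f \<in> extensional (cdomain K)"
  by (simp_all add: smirnov_nevanlinna nevanlinna_hol nevanlinna_ext)

lemma smirnov_radial_limits:
  "f \<in> smirnov K \<Longrightarrow> AE z in \<sigma> K. radial_limit_exists f z"
  by (rule nevanlinna_radial_limits[OF smirnov_nevanlinna])

lemma smirnov_bdry_measurable: "f \<in> smirnov K \<Longrightarrow> bdry_value f \<in> borel_measurable (\<sigma> K)"
  by (rule bdry_value_measurable[OF smirnov_hol])

lemma cboundary_dilate: "z \<in> cboundary K \<Longrightarrow> 0 \<le> r \<Longrightarrow> r < 1 \<Longrightarrow> r *\<^sub>R z \<in> cdomain K"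
  by (rule cboundary_scaleR_cdomain[OF subsetD[OF cboundary_subset_cclosed]])

lemmas dilate_radii_measurable = dilate_measurable[OF _ less_imp_le[OF radii(1)] radii(2)]

lemma dilate_radii_log_plus_integrable:
  assumes f: "holomorphic_vec f (cdomain K)"
  shows "integrable (\<sigma> K) (\<lambda>z. log_plus (cmod (f (radii n *\<^sub>R z))))"
proof -
  obtain B where B: "0 < B" "\<And>z. z \<in> cclosed K \<Longrightarrow> cmod (f (radii n *\<^sub>R z)) \<le> B"
    using dilate_bounded[OF f less_imp_le[OF radii(1)] radii(2)] by metis
  note [measurable] = dilate_radii_measurable[OF f]
  show ?thesis
  proof (rule boundary_integrable_bounded[of _ _ "log_plus B"])
    show "AE z in \<sigma> K. norm (log_plus (cmod (f (radii n *\<^sub>R z)))) \<le> log_plus B"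
      using AE_boundary[of K] by eventually_elim
        (use B cboundary_subset_cclosed in \<open>auto intro!: log_plus_mono\<close>)
  qed measurable
qed

text \<open>The defining equality of the Smirnov class says that the integrals of \<open>log_plus \<bar>f\<bar>\<close> over the
  dilates converge to the integral of the boundary function; together with convergence almost
  everywhere Scheffe's lemma improves this to convergence in the mean.\<close>

lemma smirnov_L1:
  fixes f :: "complex ^ 'n \<Rightarrow> complex"
  assumes f: "f \<in> smirnov K"
  shows "integrable (\<sigma> K) (\<lambda>z. log_plus (cmod (bdry_value f z)))"
    and "(\<lambda>n. \<integral>z. \<bar>log_plus (cmod (f (radii n *\<^sub>R z))) - log_plus (cmod (bdry_value f z))\<bar> \<partial>\<sigma> K) \<longlonglongrightarrow> 0"
    and "AE z in \<sigma> K. (\<lambda>n. f (radii n *\<^sub>R z)) \<longlonglongrightarrow> bdry_value f z"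
    and "AE z in \<sigma> K. (\<lambda>n. log_plus (cmod (f (radii n *\<^sub>R z)))) \<longlonglongrightarrow> log_plus (cmod (bdry_value f z))"
proof -
  let ?M = "\<sigma> K :: (complex ^ 'n) measure"
  note [measurable] = dilate_radii_measurable[OF smirnov_hol[OF f]] smirnov_bdry_measurable[OF f]
  have eq: "(SUP r\<in>{0<..<1}. \<integral>\<^sup>+ z. ennreal (log_plus (cmod (f (r *\<^sub>R z)))) \<partial>?M) =
     (\<integral>\<^sup>+ z. ennreal (log_plus (cmod (bdry_value f z))) \<partial>?M)"
    and fin: "(SUP r\<in>{0<..<1}. \<integral>\<^sup>+ z. ennreal (log_plus (cmod (f (r *\<^sub>R z)))) \<partial>?M) < \<infinity>"
    using f by (auto simp: smirnov_def nevanlinna_def)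
  show int: "integrable ?M (\<lambda>z. log_plus (cmod (bdry_value f z)))"
    by (rule integrableI_nonneg) (use eq fin in auto)
  show lim0: "AE z in ?M. (\<lambda>n. f (radii n *\<^sub>R z)) \<longlonglongrightarrow> bdry_value f z"
    using smirnov_radial_limits[OF f] by eventually_elim (rule radii_scaleR_tendsto[OF bdry_value_tendsto])
  then show lim: "AE z in ?M. (\<lambda>n. log_plus (cmod (f (radii n *\<^sub>R z)))) \<longlonglongrightarrow> log_plus (cmod (bdry_value f z))"
    by eventually_elim (rule tendsto_log_plus)
  have "(\<lambda>n. \<integral>\<^sup>+z. norm (log_plus (cmod (f (radii n *\<^sub>R z))) - log_plus (cmod (bdry_value f z))) \<partial>?M) \<longlonglongrightarrow> 0"
  proof (rule Scheffe_lemma2[OF _ int lim])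
    fix n
    have "(\<integral>\<^sup>+ z. norm (log_plus (cmod (f (radii n *\<^sub>R z)))) \<partial>?M) \<le> (SUP r\<in>{0<..<1}. \<integral>\<^sup>+ z. ennreal (log_plus (cmod (f (r *\<^sub>R z)))) \<partial>?M)"
      by (rule SUP_upper2[of "radii n"]) (auto simp: radii)
    then show "(\<integral>\<^sup>+ z. norm (log_plus (cmod (f (radii n *\<^sub>R z)))) \<partial>?M) \<le> (\<integral>\<^sup>+ z. norm (log_plus (cmod (bdry_value f z))) \<partial>?M)"
      unfolding eq by simp
  qed measurable
  also have "(\<lambda>n. \<integral>\<^sup>+z. norm (log_plus (cmod (f (radii n *\<^sub>R z))) - log_plus (cmod (bdry_value f z))) \<partial>?M)
     = (\<lambda>n. ennreal (\<integral>z. \<bar>log_plus (cmod (f (radii n *\<^sub>R z))) - log_plus (cmod (bdry_value f z))\<bar> \<partial>?M))"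
    by (rule ext, subst nn_integral_eq_integral[symmetric])
       (auto intro!: Bochner_Integration.integrable_diff integrable_abs dilate_radii_log_plus_integrable smirnov_hol[OF f] int)
  finally have "(\<lambda>n. ennreal (\<integral>z. \<bar>log_plus (cmod (f (radii n *\<^sub>R z))) - log_plus (cmod (bdry_value f z))\<bar> \<partial>?M)) \<longlonglongrightarrow> ennreal 0"
    by simp
  then show "(\<lambda>n. \<integral>z. \<bar>log_plus (cmod (f (radii n *\<^sub>R z))) - log_plus (cmod (bdry_value f z))\<bar> \<partial>?M) \<longlonglongrightarrow> 0"
    by (subst (asm) tendsto_ennreal_iff) auto
qed

text \<open>Conversely a mean-convergent majorant of \<open>log_plus \<bar>f\<bar>\<close> along the dilates is enough for membership.
  This is how products and reflections are seen to stay in the class.\<close>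

lemma smirnovI:
  fixes f :: "complex ^ 'n \<Rightarrow> complex"
  assumes hol: "holomorphic_vec f (cdomain K)" and ext: "f \<in> extensional (cdomain K)"
    and rad: "AE z in \<sigma> K. radial_limit_exists f z"
    and A: "\<And>n. integrable (\<sigma> K) (A n)" "integrable (\<sigma> K) A'"
      "(\<lambda>n. \<integral>z. \<bar>A n z - A' z\<bar> \<partial>\<sigma> K) \<longlonglongrightarrow> 0"
      "AE z in \<sigma> K. (\<lambda>n. A n z) \<longlonglongrightarrow> A' z"
    and le: "\<And>n z. z \<in> cboundary K \<Longrightarrow> log_plus (cmod (f (radii n *\<^sub>R z))) \<le> A n z"
  shows "f \<in> smirnov K"
proof -
  let ?M = "\<sigma> K :: (complex ^ 'n) measure"
  note [measurable] = dilate_radii_measurable[OF hol] bdry_value_measurable[OF hol]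
  have lim: "AE z in ?M. (\<lambda>n. log_plus (cmod (f (radii n *\<^sub>R z)))) \<longlonglongrightarrow> log_plus (cmod (bdry_value f z))"
    using rad by eventually_elim (rule tendsto_log_plus[OF radii_scaleR_tendsto[OF bdry_value_tendsto]])
  have m1: "(\<lambda>z. log_plus (cmod (f (radii n *\<^sub>R z)))) \<in> borel_measurable ?M" for n by measurable
  have m2: "(\<lambda>z. log_plus (cmod (bdry_value f z))) \<in> borel_measurable ?M" by measurable
  have le': "AE z in ?M. 0 \<le> log_plus (cmod (f (radii n *\<^sub>R z))) \<and> log_plus (cmod (f (radii n *\<^sub>R z))) \<le> A n z" for n
    using AE_boundary[of K] by eventually_elim (simp add: le)
  note G = generalized_dominated_convergence(1,3)[OF m1 m2 A lim le']
  define I where "I r = (\<integral>\<^sup>+ z. ennreal (log_plus (cmod (f (r *\<^sub>R z)))) \<partial>?M)" for r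
  have Ieq: "I (radii n) = ennreal (\<integral>z. log_plus (cmod (f (radii n *\<^sub>R z))) \<partial>?M)" for n
    unfolding I_def by (intro nn_integral_eq_integral dilate_radii_log_plus_integrable hol) simp
  have mono: "I r \<le> I s" if "0 \<le> r" "r \<le> s" "s < 1" for r s
    unfolding I_def by (rule boundary_mean_log_mono(1)[OF hol that])
  have "(\<lambda>n. I (radii n)) \<longlonglongrightarrow> ennreal (\<integral>z. log_plus (cmod (bdry_value f z)) \<partial>?M)"
    unfolding Ieq by (intro tendsto_ennrealI G)
  moreover have "incseq (\<lambda>n. I (radii n))"
    by (intro incseq_SucI mono less_imp_le[OF radii(1)] radii_mono radii(2)) simp
  then have "(\<lambda>n. I (radii n)) \<longlonglongrightarrow> (SUP n. I (radii n))" by (rule LIMSEQ_SUP)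
  ultimately have "(SUP n. I (radii n)) = ennreal (\<integral>z. log_plus (cmod (bdry_value f z)) \<partial>?M)"
    using LIMSEQ_unique by blast
  moreover have "(SUP r\<in>{0<..<1}. I r) = (SUP n. I (radii n))"
  proof (rule antisym)
    show "(SUP r\<in>{0<..<1}. I r) \<le> (SUP n. I (radii n))"
    proof (rule SUP_mono)
      fix r :: real assume r: "r \<in> {0<..<1}"
      then obtain n where "r < radii n" using order_tendstoD(1)[OF radii_tendsto, of r] by (auto simp: eventually_sequentially)
      then show "\<exists>n\<in>UNIV. I r \<le> I (radii n)" using r by (intro bexI[of _ n] mono) (auto simp: radii)
    qed
    show "(SUP n. I (radii n)) \<le> (SUP r\<in>{0<..<1}. I r)"
      by (rule SUP_least, rule SUP_upper) (auto simp: radii)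
  qed
  moreover have "ennreal (\<integral>z. log_plus (cmod (bdry_value f z)) \<partial>?M) = (\<integral>\<^sup>+ z. ennreal (log_plus (cmod (bdry_value f z))) \<partial>?M)"
    by (rule nn_integral_eq_integral[symmetric]) (use G in auto)
  ultimately have *: "(SUP r\<in>{0<..<1}. I r) = (\<integral>\<^sup>+ z. ennreal (log_plus (cmod (bdry_value f z))) \<partial>?M)"
    "(SUP r\<in>{0<..<1}. I r) = ennreal (\<integral>z. log_plus (cmod (bdry_value f z)) \<partial>?M)" by auto
  have "(SUP r\<in>{0<..<1}. I r) < \<infinity>" unfolding *(2) by simp
  with * show ?thesis using hol ext unfolding smirnov_def nevanlinna_def I_def by simp
qed

lemma radial_tendsto_cong:
  fixes z :: "complex ^ 'n"
  assumes z: "z \<in> cboundary K" and eq: "\<And>w. w \<in> cdomain K \<Longrightarrow> h w = k w"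
    and lim: "((\<lambda>r. k (r *\<^sub>R z)) \<longlongrightarrow> (l::complex)) (at_left 1)"
  shows "((\<lambda>r. h (r *\<^sub>R z)) \<longlongrightarrow> l) (at_left 1)"
proof (rule Lim_transform_eventually[OF lim])
  have "eventually (\<lambda>r::real. 0 < r \<and> r < 1) (at_left 1)"
    by (rule eventually_at_leftI[of 0]) auto
  then show "eventually (\<lambda>r. k (r *\<^sub>R z) = h (r *\<^sub>R z)) (at_left 1)"
  proof eventually_elim
    case (elim r)
    have "r *\<^sub>R z \<in> cdomain K"
      by (rule cboundary_scaleR_cdomain) (use z elim cboundary_subset_cclosed in auto)
    then show ?case by (simp add: eq)
  qed
qed

lemma bdry_value_combine:
  assumes z: "z \<in> cboundary K" and rad: "radial_limit_exists f z" "radial_limit_exists g z"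
    and eq: "\<And>w. w \<in> cdomain K \<Longrightarrow> h w = \<phi> (f w) (g w)"
    and cont: "\<And>F a b l m. (a \<longlongrightarrow> l) F \<Longrightarrow> (b \<longlongrightarrow> m) F \<Longrightarrow> ((\<lambda>r::real. \<phi> (a r) (b r)) \<longlongrightarrow> \<phi> l m) F"
  shows "radial_limit_exists h z" "bdry_value h z = \<phi> (bdry_value f z) (bdry_value g z)"
proof -
  have "((\<lambda>r. h (r *\<^sub>R z)) \<longlongrightarrow> \<phi> (bdry_value f z) (bdry_value g z)) (at_left 1)"
    by (rule radial_tendsto_cong[OF z eq]) (auto intro!: cont bdry_value_tendsto rad)
  then show "radial_limit_exists h z" "bdry_value h z = \<phi> (bdry_value f z) (bdry_value g z)"
    by (auto simp: radial_limit_exists_def intro!: bdry_value_eqI)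
qed

lemma mult_on_apply: "z \<in> S \<Longrightarrow> mult_on S f g z = f z * g z"
  by (simp add: mult_on_def)

lemma mult_on_ext [simp]: "mult_on S f g \<in> extensional S"
  by (simp add: mult_on_def)

lemma mult_on_hol:
  assumes "holomorphic_vec f (cdomain K)" "holomorphic_vec g (cdomain K)"
  shows "holomorphic_vec (mult_on (cdomain K) f g) (cdomain K)"
  by (rule holomorphic_vec_cong[OF holomorphic_vec_mult[OF assms]]) (simp add: mult_on_apply)

lemma dilate_in_domain: "z \<in> cboundary K \<Longrightarrow> radii n *\<^sub>R z \<in> cdomain K"
  using cboundary_scaleR_cdomain[of z K "radii n"] cboundary_subset_cclosed less_imp_le[OF radii(1)] radii(2) by blast

lemma smirnov_mult_on:
  fixes f g :: "complex ^ 'n \<Rightarrow> complex"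
  assumes f: "f \<in> smirnov K" and g: "g \<in> smirnov K"
  shows "mult_on (cdomain K) f g \<in> smirnov K"
    and "AE z in \<sigma> K. bdry_value (mult_on (cdomain K) f g) z = bdry_value f z * bdry_value g z"
proof -
  let ?M = "\<sigma> K :: (complex ^ 'n) measure"
  let ?lf = "\<lambda>n z. log_plus (cmod (f (radii n *\<^sub>R z)))" and ?lg = "\<lambda>n z. log_plus (cmod (g (radii n *\<^sub>R z)))"
  let ?lf' = "\<lambda>z. log_plus (cmod (bdry_value f z))" and ?lg' = "\<lambda>z. log_plus (cmod (bdry_value g z))"
  have b: "AE z in ?M. radial_limit_exists (mult_on (cdomain K) f g) z \<and> bdry_value (mult_on (cdomain K) f g) z = bdry_value f z * bdry_value g z"
    using AE_boundary[of K] smirnov_radial_limits[OF f] smirnov_radial_limits[OF g]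
  proof eventually_elim
    case (elim z)
    show ?case
      using bdry_value_combine[OF elim, of "mult_on (cdomain K) f g" "(*)"]
      by (auto simp: mult_on_apply intro: tendsto_mult)
  qed
  then show "AE z in ?M. bdry_value (mult_on (cdomain K) f g) z = bdry_value f z * bdry_value g z"
    by eventually_elim simp
  note Lf = smirnov_L1[OF f] and Lg = smirnov_L1[OF g]
  note int = dilate_radii_log_plus_integrable[OF smirnov_hol[OF f]] dilate_radii_log_plus_integrable[OF smirnov_hol[OF g]]
  show "mult_on (cdomain K) f g \<in> smirnov K"
  proof (rule smirnovI[where A="\<lambda>n z. ?lf n z + ?lg n z" and A'="\<lambda>z. ?lf' z + ?lg' z"])
    show "holomorphic_vec (mult_on (cdomain K) f g) (cdomain K)" by (intro mult_on_hol smirnov_hol f g)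
    show "AE z in ?M. radial_limit_exists (mult_on (cdomain K) f g) z" using b by eventually_elim simp
    show "integrable ?M (\<lambda>z. ?lf n z + ?lg n z)" for n using int by simp
    show "integrable ?M (\<lambda>z. ?lf' z + ?lg' z)" using Lf(1) Lg(1) by simp
    show "AE z in ?M. (\<lambda>n. ?lf n z + ?lg n z) \<longlonglongrightarrow> ?lf' z + ?lg' z"
      using Lf(4) Lg(4) by eventually_elim (rule tendsto_add)
    show "(\<lambda>n. \<integral>z. \<bar>?lf n z + ?lg n z - (?lf' z + ?lg' z)\<bar> \<partial>?M) \<longlonglongrightarrow> 0"
    proof (rule Lim_null_comparison[OF always_eventually tendsto_add[OF Lf(2) Lg(2), simplified]], rule allI)
      fix n
      have "(\<integral>z. \<bar>?lf n z + ?lg n z - (?lf' z + ?lg' z)\<bar> \<partial>?M) \<le> (\<integral>z. \<bar>?lf n z - ?lf' z\<bar> + \<bar>?lg n z - ?lg' z\<bar> \<partial>?M)"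
        by (rule integral_mono) (use int Lf(1) Lg(1) in auto)
      also have "\<dots> = (\<integral>z. \<bar>?lf n z - ?lf' z\<bar> \<partial>?M) + (\<integral>z. \<bar>?lg n z - ?lg' z\<bar> \<partial>?M)"
        using int Lf(1) Lg(1) by simp
      finally show "norm (\<integral>z. \<bar>?lf n z + ?lg n z - (?lf' z + ?lg' z)\<bar> \<partial>?M) \<le> (\<integral>z. \<bar>?lf n z - ?lf' z\<bar> \<partial>?M) + (\<integral>z. \<bar>?lg n z - ?lg' z\<bar> \<partial>?M)"
        by simp
    qed
    show "log_plus (cmod (mult_on (cdomain K) f g (radii n *\<^sub>R z))) \<le> ?lf n z + ?lg n z" if "z \<in> cboundary K" for n z
      using dilate_in_domain[OF that] by (simp add: mult_on_apply norm_mult log_plus_mult)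
  qed simp
qed

definition bounded_hol :: "domain_kind \<Rightarrow> (complex ^ 'n \<Rightarrow> complex) set" where
  "bounded_hol K = {f \<in> extensional (cdomain K). holomorphic_vec f (cdomain K) \<and>
     (\<exists>M. \<forall>z\<in>cdomain K. cmod (f z) \<le> M)}"

lemma bounded_holI:
  assumes "f \<in> extensional (cdomain K)" "holomorphic_vec f (cdomain K)" "\<And>z. z \<in> cdomain K \<Longrightarrow> cmod (f z) \<le> M"
  shows "f \<in> bounded_hol K"
  using assms by (auto simp: bounded_hol_def)

lemma bounded_holE:
  assumes "f \<in> bounded_hol K"
  obtains M where "0 < M" "\<And>z. z \<in> cdomain K \<Longrightarrow> cmod (f z) \<le> M"
proof -
  obtain M where M: "\<And>z. z \<in> cdomain K \<Longrightarrow> cmod (f z) \<le> M" using assms by (auto simp: bounded_hol_def)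
  have "cmod (f z) \<le> max 1 M" if "z \<in> cdomain K" for z using M[OF that] by simp
  then show thesis using that[of "max 1 M"] by simp
qed

lemma bounded_hol_hol: "f \<in> bounded_hol K \<Longrightarrow> holomorphic_vec f (cdomain K)"
  and bounded_hol_ext: "f \<in> bounded_hol K \<Longrightarrow> f \<in> extensional (cdomain K)"
  by (auto simp: bounded_hol_def)

lemma bounded_hol_smirnov:
  fixes f :: "complex ^ 'n \<Rightarrow> complex"
  assumes f: "f \<in> bounded_hol K"
  shows "f \<in> smirnov K"
proof -
  interpret prob_space "\<sigma> K :: (complex ^ 'n) measure" by (rule prob_space_boundary_measure)
  obtain M where M: "0 < M" "\<And>z. z \<in> cdomain K \<Longrightarrow> cmod (f z) \<le> M" using bounded_holE[OF f] by metis
  have le: "log_plus (cmod (f (r *\<^sub>R z))) \<le> log_plus M" if "z \<in> cboundary K" "0 \<le> r" "r < 1" for r z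
    using M(2)[OF cboundary_dilate[OF that]] by (intro log_plus_mono) auto
  have "(SUP r\<in>{0<..<1}. \<integral>\<^sup>+ z. ennreal (log_plus (cmod (f (r *\<^sub>R z)))) \<partial>\<sigma> K) \<le> ennreal (log_plus M)"
  proof (rule SUP_least)
    fix r :: real assume "r \<in> {0<..<1}"
    then have "(\<integral>\<^sup>+ z. ennreal (log_plus (cmod (f (r *\<^sub>R z)))) \<partial>\<sigma> K) \<le> (\<integral>\<^sup>+ z. ennreal (log_plus M) \<partial>(\<sigma> K :: (complex ^ 'n) measure))"
      by (intro nn_integral_mono ennreal_leI le) auto
    also have "\<dots> = ennreal (log_plus M)" using emeasure_space_1 by simp
    finally show "(\<integral>\<^sup>+ z. ennreal (log_plus (cmod (f (r *\<^sub>R z)))) \<partial>\<sigma> K) \<le> ennreal (log_plus M)" .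
  qed
  then have "(SUP r\<in>{0<..<1}. \<integral>\<^sup>+ z. ennreal (log_plus (cmod (f (r *\<^sub>R z)))) \<partial>\<sigma> K) < \<infinity>"
    by (rule le_less_trans) simp
  then have nev: "f \<in> nevanlinna K" using f by (simp add: nevanlinna_def bounded_hol_def)
  show ?thesis
    by (rule smirnovI[OF bounded_hol_hol[OF f] bounded_hol_ext[OF f] nevanlinna_radial_limits[OF nev],
          where A="\<lambda>_ _. log_plus M" and A'="\<lambda>_. log_plus M"])
       (simp_all add: le[OF _ less_imp_le[OF radii(1)] radii(2)])
qed

lemma bounded_hol_bdry_le:
  fixes f :: "complex ^ 'n \<Rightarrow> complex"
  assumes f: "f \<in> bounded_hol K" and M: "\<And>z. z \<in> cdomain K \<Longrightarrow> cmod (f z) \<le> M"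
  shows "AE z in \<sigma> K. cmod (bdry_value f z) \<le> M"
  using smirnov_L1(3)[OF bounded_hol_smirnov[OF f]] AE_boundary[of K]
proof eventually_elim
  case (elim z)
  show ?case
    by (rule tendsto_upperbound[OF tendsto_norm[OF elim(1)]])
       (auto intro!: always_eventually M dilate_in_domain elim)
qed

subsection \<open>The metric\<close>

lemma smirnov_diff_convergence:
  fixes f g :: "complex ^ 'n \<Rightarrow> complex"
  assumes f: "f \<in> smirnov K" and g: "g \<in> smirnov K"
  shows "integrable (\<sigma> K) (\<lambda>z. ln (1 + cmod (bdry_value f z - bdry_value g z)))"
    and "(\<lambda>n. \<integral>z. ln (1 + cmod (f (radii n *\<^sub>R z) - g (radii n *\<^sub>R z))) \<partial>\<sigma> K) \<longlonglongrightarrow> smirnov_dist K f g"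
    and "(\<lambda>n. \<integral>z. ln (1 + cmod (f (radii n *\<^sub>R z) - bdry_value f z)) \<partial>\<sigma> K) \<longlonglongrightarrow> 0"
    and "\<And>n. integrable (\<sigma> K) (\<lambda>z. ln (1 + cmod (f (radii n *\<^sub>R z) - g (radii n *\<^sub>R z))))"
proof -
  let ?M = "\<sigma> K :: (complex ^ 'n) measure"
  let ?lf = "\<lambda>n z. log_plus (cmod (f (radii n *\<^sub>R z)))" and ?lg = "\<lambda>n z. log_plus (cmod (g (radii n *\<^sub>R z)))"
  let ?lf' = "\<lambda>z. log_plus (cmod (bdry_value f z))" and ?lg' = "\<lambda>z. log_plus (cmod (bdry_value g z))"
  interpret prob_space ?M by (rule prob_space_boundary_measure)
  note Lf = smirnov_L1[OF f] and Lg = smirnov_L1[OF g]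
  note int = dilate_radii_log_plus_integrable[OF smirnov_hol[OF f]] dilate_radii_log_plus_integrable[OF smirnov_hol[OF g]]
  note m [measurable] = dilate_radii_measurable[OF smirnov_hol[OF f]] dilate_radii_measurable[OF smirnov_hol[OF g]]
    smirnov_bdry_measurable[OF f] smirnov_bdry_measurable[OF g]
  have conv: "integrable ?M (\<lambda>z. ln (1 + cmod (bdry_value f z - k' z))) \<and>
     (\<forall>n. integrable ?M (\<lambda>z. ln (1 + cmod (f (radii n *\<^sub>R z) - k n z)))) \<and>
     (\<lambda>n. \<integral>z. ln (1 + cmod (f (radii n *\<^sub>R z) - k n z)) \<partial>?M) \<longlonglongrightarrow> (\<integral>z. ln (1 + cmod (bdry_value f z - k' z)) \<partial>?M)"
    if [measurable]: "\<And>n. k n \<in> borel_measurable ?M" "k' \<in> borel_measurable ?M"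
      and ki: "\<And>n. integrable ?M (\<lambda>z. log_plus (cmod (k n z)))" "integrable ?M (\<lambda>z. log_plus (cmod (k' z)))"
      and kl: "AE z in ?M. (\<lambda>n. k n z) \<longlonglongrightarrow> k' z"
      and kL: "(\<lambda>n. \<integral>z. \<bar>log_plus (cmod (k n z)) - log_plus (cmod (k' z))\<bar> \<partial>?M) \<longlonglongrightarrow> 0" for k k'
  proof -
    let ?A = "\<lambda>n z. 2 * ln 2 + ?lf n z + log_plus (cmod (k n z))" and ?A' = "\<lambda>z. 2 * ln 2 + ?lf' z + log_plus (cmod (k' z))"
    have A: "integrable ?M (?A n)" for n using int ki by simp
    have A': "integrable ?M ?A'" using Lf(1) ki by simp
    have AL: "(\<lambda>n. \<integral>z. \<bar>?A n z - ?A' z\<bar> \<partial>?M) \<longlonglongrightarrow> 0"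
    proof (rule Lim_null_comparison[OF always_eventually tendsto_add[OF Lf(2) kL, simplified]], rule allI)
      fix n
      have "(\<integral>z. \<bar>?A n z - ?A' z\<bar> \<partial>?M) \<le> (\<integral>z. \<bar>?lf n z - ?lf' z\<bar> + \<bar>log_plus (cmod (k n z)) - log_plus (cmod (k' z))\<bar> \<partial>?M)"
        by (rule integral_mono) (use int Lf(1) ki in auto)
      also have "\<dots> = (\<integral>z. \<bar>?lf n z - ?lf' z\<bar> \<partial>?M) + (\<integral>z. \<bar>log_plus (cmod (k n z)) - log_plus (cmod (k' z))\<bar> \<partial>?M)"
        using int Lf(1) ki by simp
      finally show "norm (\<integral>z. \<bar>?A n z - ?A' z\<bar> \<partial>?M) \<le> (\<integral>z. \<bar>?lf n z - ?lf' z\<bar> \<partial>?M) + (\<integral>z. \<bar>log_plus (cmod (k n z)) - log_plus (cmod (k' z))\<bar> \<partial>?M)"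
        by simp
    qed
    have Al: "AE z in ?M. (\<lambda>n. ?A n z) \<longlonglongrightarrow> ?A' z"
      using Lf(4) kl
    proof eventually_elim
      case (elim z)
      show ?case by (rule tendsto_add[OF tendsto_add[OF tendsto_const elim(1)] tendsto_log_plus[OF elim(2)]])
    qed
    have lim: "AE z in ?M. (\<lambda>n. ln (1 + cmod (f (radii n *\<^sub>R z) - k n z))) \<longlonglongrightarrow> ln (1 + cmod (bdry_value f z - k' z))"
      using Lf(3) kl by eventually_elim (intro tendsto_ln_1_plus_cmod tendsto_diff)
    have le: "AE z in ?M. 0 \<le> ln (1 + cmod (f (radii n *\<^sub>R z) - k n z)) \<and> ln (1 + cmod (f (radii n *\<^sub>R z) - k n z)) \<le> ?A n z" for n
      by (intro AE_I2 conjI ln_1_plus_cmod_diff_le ln_1_plus_nonneg norm_ge_zero)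
    have m1: "(\<lambda>z. ln (1 + cmod (f (radii n *\<^sub>R z) - k n z))) \<in> borel_measurable ?M" for n by measurable
    have m2: "(\<lambda>z. ln (1 + cmod (bdry_value f z - k' z))) \<in> borel_measurable ?M" by measurable
    show ?thesis using generalized_dominated_convergence[OF m1 m2 A A' AL Al lim le] by blast
  qed
  have 1: "integrable ?M (\<lambda>z. ln (1 + cmod (bdry_value f z - bdry_value g z))) \<and>
     (\<forall>n. integrable ?M (\<lambda>z. ln (1 + cmod (f (radii n *\<^sub>R z) - g (radii n *\<^sub>R z))))) \<and>
     (\<lambda>n. \<integral>z. ln (1 + cmod (f (radii n *\<^sub>R z) - g (radii n *\<^sub>R z))) \<partial>?M) \<longlonglongrightarrow> (\<integral>z. ln (1 + cmod (bdry_value f z - bdry_value g z)) \<partial>?M)"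
    by (rule conv[OF m(2) m(4) int(2) Lg(1) Lg(3) Lg(2)])
  then show "integrable ?M (\<lambda>z. ln (1 + cmod (bdry_value f z - bdry_value g z)))"
    "\<And>n. integrable ?M (\<lambda>z. ln (1 + cmod (f (radii n *\<^sub>R z) - g (radii n *\<^sub>R z))))"
    "(\<lambda>n. \<integral>z. ln (1 + cmod (f (radii n *\<^sub>R z) - g (radii n *\<^sub>R z))) \<partial>?M) \<longlonglongrightarrow> smirnov_dist K f g"
    by (auto simp: smirnov_dist_def)
  have "(\<lambda>n. \<integral>z. ln (1 + cmod (f (radii n *\<^sub>R z) - bdry_value f z)) \<partial>?M) \<longlonglongrightarrow> (\<integral>z. ln (1 + cmod (bdry_value f z - bdry_value f z)) \<partial>?M)"
    by (rule conv[of "\<lambda>_. bdry_value f" "bdry_value f", THEN conjunct2, THEN conjunct2]) (use Lf(1) m in auto)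
  then show "(\<lambda>n. \<integral>z. ln (1 + cmod (f (radii n *\<^sub>R z) - bdry_value f z)) \<partial>?M) \<longlonglongrightarrow> 0" by simp
qed

lemma holomorphic_vec_diff:
  assumes "holomorphic_vec f S" "holomorphic_vec g S"
  shows "holomorphic_vec (\<lambda>z. f z - g z) S"
proof -
  have "open S" using assms by (simp add: holomorphic_vec_def)
  from holomorphic_vec_add[OF assms(1) holomorphic_vec_mult[OF holomorphic_vec_const[OF this, of "-1"] assms(2)]]
  show ?thesis by simp
qed

text \<open>The means of \<open>ln (1 + \<bar>f - g\<bar>)\<close> increase with the radius because this function is subharmonic on
  slices.\<close>

lemma smirnov_dist_ge_dilate:
  fixes f g :: "complex ^ 'n \<Rightarrow> complex"
  assumes f: "f \<in> smirnov K" and g: "g \<in> smirnov K" and r: "0 \<le> r" "r < 1"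
  shows "(\<integral>\<^sup>+z. ennreal (ln (1 + cmod (f (r *\<^sub>R z) - g (r *\<^sub>R z)))) \<partial>\<sigma> K) \<le> ennreal (smirnov_dist K f g)"
proof -
  note hol = holomorphic_vec_diff[OF smirnov_hol[OF f] smirnov_hol[OF g]]
  obtain N where N: "r < radii N" using order_tendstoD(1)[OF radii_tendsto r(2)] by (auto simp: eventually_sequentially)
  have "(\<lambda>n. ennreal (\<integral>z. ln (1 + cmod (f (radii n *\<^sub>R z) - g (radii n *\<^sub>R z))) \<partial>\<sigma> K)) \<longlonglongrightarrow> ennreal (smirnov_dist K f g)"
    by (intro tendsto_ennrealI smirnov_diff_convergence(2) f g)
  then show ?thesis
  proof (rule tendsto_lowerbound)
    show "eventually (\<lambda>n. (\<integral>\<^sup>+z. ennreal (ln (1 + cmod (f (r *\<^sub>R z) - g (r *\<^sub>R z)))) \<partial>\<sigma> K) \<le>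
        ennreal (\<integral>z. ln (1 + cmod (f (radii n *\<^sub>R z) - g (radii n *\<^sub>R z))) \<partial>\<sigma> K)) sequentially"
      unfolding eventually_sequentially
    proof (intro exI allI impI)
      fix n assume "N \<le> n"
      then have "r \<le> radii n" using N radii_mono[of N n] by linarith
      from boundary_mean_log_mono(2)[OF hol r(1) this radii(2)]
      show "(\<integral>\<^sup>+z. ennreal (ln (1 + cmod (f (r *\<^sub>R z) - g (r *\<^sub>R z)))) \<partial>\<sigma> K) \<le>
        ennreal (\<integral>z. ln (1 + cmod (f (radii n *\<^sub>R z) - g (radii n *\<^sub>R z))) \<partial>\<sigma> K)"
        by (subst nn_integral_eq_integral[symmetric]) (auto intro: smirnov_diff_convergence(4)[OF f g])
    qed
  qed simp
qed

subsection \<open>The maximum principle from the distinguished boundary\<close>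

text \<open>For the polydisk the distinguished boundary is much smaller than the topological one, and the
  variables are moved to modulus one in turn.\<close>

lemma cboundary_max_principle:
  fixes h :: "complex ^ 'n \<Rightarrow> complex"
  assumes h: "holomorphic_vec h (cdomain K)" and r: "0 < r" "r < 1"
    and le: "\<And>z. z \<in> cboundary K \<Longrightarrow> cmod (h (r *\<^sub>R z)) \<le> M" and z: "z \<in> cclosed K"
  shows "cmod (h (r *\<^sub>R z)) \<le> M"
proof (cases K)
  case Unit_Ball
  have ex: "\<exists>\<zeta> \<rho>. \<zeta> \<in> cboundary K \<and> 0 \<le> \<rho> \<and> \<rho> \<le> 1 \<and> z = complex_of_real \<rho> *s \<zeta>"
  proof (cases "z = 0")
    case True
    obtain \<zeta> :: "complex ^ 'n" where "norm \<zeta> = 1" using vector_choose_size[of 1] by auto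
    then show ?thesis using True Unit_Ball by (intro exI[of _ \<zeta>] exI[of _ 0]) auto
  next
    case False
    then have "z = norm z *\<^sub>R sgn z" by (simp add: sgn_div_norm)
    then show ?thesis using False z Unit_Ball unfolding scaleR_eq_smult[symmetric]
      by (intro exI[of _ "sgn z"] exI[of _ "norm z"]) (auto simp: norm_sgn)
  qed
  then obtain \<zeta> \<rho> where \<zeta>: "\<zeta> \<in> cboundary K" "0 \<le> \<rho>" "\<rho> \<le> 1" "z = complex_of_real \<rho> *s \<zeta>" by blast
  let ?g = "\<lambda>c. h (c *s \<zeta>)"
  have g: "?g holomorphic_on ball 0 1"
    by (rule holomorphic_vec_slice[OF h]) (use \<zeta>(1) cboundary_subset_cclosed in auto)
  have sub: "cball 0 r \<subseteq> ball (0::complex) 1" using r by auto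
  have "cmod (?g (of_real r * of_real \<rho>)) \<le> M"
  proof (rule maximum_modulus_frontier[where S="cball 0 r" and f="?g"])
    show "?g holomorphic_on interior (cball 0 r)"
      by (rule holomorphic_on_subset[OF g]) (use sub in auto)
    show "continuous_on (closure (cball 0 r)) ?g"
      by (rule continuous_on_subset[OF holomorphic_on_imp_continuous_on[OF g]]) (use sub in auto)
    show "cmod (?g c) \<le> M" if "c \<in> frontier (cball 0 r)" for c
    proof -
      have c: "cmod c = r" using that r by simp
      have "c *s \<zeta> = r *\<^sub>R ((c / of_real r) *s \<zeta>)" using r by (simp add: scaleR_eq_smult)
      moreover have "(c / of_real r) *s \<zeta> \<in> cboundary K" using \<zeta>(1) c r by (intro cboundary_smult) (auto simp: norm_divide)
      ultimately show ?thesis using le by simp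
    qed
    show "of_real r * of_real \<rho> \<in> cball (0::complex) r" using \<zeta> r by (simp add: norm_mult mult_left_le)
  qed simp
  then show ?thesis unfolding \<zeta>(4) by (simp add: scaleR_eq_smult)
next
  case Unit_Polydisk
  have "cmod (h (r *\<^sub>R w)) \<le> M"
    if "finite J" "\<And>j. j \<notin> J \<Longrightarrow> cmod (w $ j) = 1" "\<And>j. cmod (w $ j) \<le> 1" for J :: "'n set" and w :: "complex ^ 'n"
    using that
  proof (induction J arbitrary: w rule: finite_induct)
    case empty
    then show ?case using le[of w] Unit_Polydisk by simp
  next
    case (insert j J)
    define w0 where "w0 = (\<chi> i. if i = j then 0 else w $ i)"
    let ?g = "\<lambda>c. h (r *\<^sub>R w0 + c *s axis j 1)"
    have g: "?g holomorphic_on ball 0 1"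
    proof (rule holomorphic_on_subset[OF holomorphic_vec_line[OF h]])
      show "ball 0 1 \<subseteq> {c. r *\<^sub>R w0 + c *s axis j 1 \<in> cdomain K}"
      proof
        fix c :: complex assume c: "c \<in> ball 0 1"
        have "cmod ((r *\<^sub>R w0 + c *s axis j 1) $ i) < 1" for i
        proof (cases "i = j")
          case True then show ?thesis using c by (simp add: w0_def axis_def)
        next
          case False
          have "r * cmod (w $ i) \<le> r * 1" using insert.prems(2)[of i] r by (intro mult_left_mono) auto
          then have "r * cmod (w $ i) < 1" using r by linarith
          then show ?thesis using False r by (simp add: w0_def axis_def)
        qed
        then show "c \<in> {c. r *\<^sub>R w0 + c *s axis j 1 \<in> cdomain K}" using Unit_Polydisk by simp
      qed
    qed
    have sub: "cball 0 r \<subseteq> ball (0::complex) 1" using r by auto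
    have "cmod (?g (of_real r * w $ j)) \<le> M"
    proof (rule maximum_modulus_frontier[where S="cball 0 r" and f="?g"])
      show "?g holomorphic_on interior (cball 0 r)"
        by (rule holomorphic_on_subset[OF g]) (use sub in auto)
      show "continuous_on (closure (cball 0 r)) ?g"
        by (rule continuous_on_subset[OF holomorphic_on_imp_continuous_on[OF g]]) (use sub in auto)
      show "cmod (?g c) \<le> M" if "c \<in> frontier (cball 0 r)" for c
      proof -
        have c: "cmod c = r" using that r by simp
        define w' where "w' = (\<chi> i. if i = j then c / of_real r else w $ i)"
        have "r *\<^sub>R w0 + c *s axis j 1 = r *\<^sub>R w'"
          using r by (auto simp: vec_eq_iff w0_def w'_def axis_def scaleR_eq_smult)
        moreover have "cmod (h (r *\<^sub>R w')) \<le> M"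
          by (rule insert.IH) (use insert.prems insert.hyps c r in \<open>auto simp: w'_def norm_divide\<close>)
        ultimately show ?thesis by simp
      qed
      have "r * cmod (w $ j) \<le> r * 1" using insert.prems(2)[of j] r by (intro mult_left_mono) auto
      then show "of_real r * w $ j \<in> cball 0 r" using r by (simp add: norm_mult)
    qed simp
    moreover have "r *\<^sub>R w0 + (of_real r * w $ j) *s axis j 1 = r *\<^sub>R w"
      by (auto simp: vec_eq_iff w0_def axis_def scaleR_eq_smult)
    ultimately show ?case by simp
  qed
  from this[of UNIV z] show ?thesis using z Unit_Polydisk by simp
qed

lemma AE_dilate_max_principle:
  fixes h :: "complex ^ 'n \<Rightarrow> complex"
  assumes h: "holomorphic_vec h (cdomain K)"
    and ae: "\<And>r. 0 < r \<Longrightarrow> r < 1 \<Longrightarrow> AE z in \<sigma> K. cmod (h (r *\<^sub>R z)) \<le> M"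
    and z: "z \<in> cdomain K"
  shows "cmod (h z) \<le> M"
proof -
  obtain r w where w: "0 < r" "r < 1" "w \<in> cdomain K" "z = r *\<^sub>R w" using cdomain_expand[OF z] by metis
  have c: "continuous_on (cboundary K) (\<lambda>z. cmod (h (r *\<^sub>R z)))"
    using w by (intro continuous_intros continuous_on_subset[OF dilate_continuous[OF h] cboundary_subset_cclosed]) auto
  have "cmod (h (r *\<^sub>R w)) \<le> M"
    by (rule cboundary_max_principle[OF h w(1,2) AE_boundary_imp_all[OF c ae[OF w(1,2)]]])
       (use w(3) cdomain_subset_cclosed in auto)
  then show ?thesis using w(4) by simp
qed

text \<open>Convergence in the metric determines the limit on every dilated boundary, by
  \<open>smirnov_dist_ge_dilate\<close> and Fatou's lemma, and the maximum principle carries the equality inside.\<close>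

lemma smirnov_limit_unique:
  fixes g u :: "complex ^ 'n \<Rightarrow> complex"
  assumes f: "\<And>n::nat. f n \<in> smirnov K" and g: "g \<in> smirnov K" and u: "holomorphic_vec u (cdomain K)"
    and d: "(\<lambda>n. smirnov_dist K (f n) g) \<longlonglongrightarrow> 0"
    and p: "\<And>z. z \<in> cdomain K \<Longrightarrow> (\<lambda>n. f n z) \<longlonglongrightarrow> u z" and z: "z \<in> cdomain K"
  shows "g z = u z"
proof -
  let ?M = "\<sigma> K :: (complex ^ 'n) measure"
  note hol = holomorphic_vec_diff[OF u smirnov_hol[OF g]]
  have "cmod (u z - g z) \<le> 0"
  proof (rule AE_dilate_max_principle[OF hol _ z])
    fix r :: real assume r: "0 < r" "r < 1"
    then have r0: "0 \<le> r" by simp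
    note [measurable] = dilate_measurable[OF u r0 r(2)] dilate_measurable[OF smirnov_hol[OF g] r0 r(2)]
      dilate_measurable[OF smirnov_hol[OF f] r0 r(2)]
    have "(\<integral>\<^sup>+z. ennreal (ln (1 + cmod (u (r *\<^sub>R z) - g (r *\<^sub>R z)))) \<partial>?M) =
       (\<integral>\<^sup>+z. liminf (\<lambda>n. ennreal (ln (1 + cmod (f n (r *\<^sub>R z) - g (r *\<^sub>R z))))) \<partial>?M)"
    proof (rule nn_integral_cong)
      fix z assume "z \<in> space ?M"
      then have "r *\<^sub>R z \<in> cdomain K" using r0 r by (intro cboundary_dilate) auto
      from p[OF this] have "(\<lambda>n. ennreal (ln (1 + cmod (f n (r *\<^sub>R z) - g (r *\<^sub>R z))))) \<longlonglongrightarrow> ennreal (ln (1 + cmod (u (r *\<^sub>R z) - g (r *\<^sub>R z))))"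
        by (intro tendsto_ennrealI tendsto_ln_1_plus_cmod tendsto_diff tendsto_const)
      then show "ennreal (ln (1 + cmod (u (r *\<^sub>R z) - g (r *\<^sub>R z)))) = liminf (\<lambda>n. ennreal (ln (1 + cmod (f n (r *\<^sub>R z) - g (r *\<^sub>R z)))))"
        by (rule lim_imp_Liminf[OF sequentially_bot, symmetric])
    qed
    also have "\<dots> \<le> liminf (\<lambda>n. \<integral>\<^sup>+z. ennreal (ln (1 + cmod (f n (r *\<^sub>R z) - g (r *\<^sub>R z)))) \<partial>?M)"
      by (rule nn_integral_liminf) measurable
    also have "\<dots> \<le> liminf (\<lambda>n. ennreal (smirnov_dist K (f n) g))"
      by (intro Liminf_mono always_eventually allI smirnov_dist_ge_dilate f g r0 r)
    also have "\<dots> = 0"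
      using tendsto_ennrealI[OF d] by (simp add: lim_imp_Liminf)
    finally have "(\<integral>\<^sup>+z. ennreal (ln (1 + cmod (u (r *\<^sub>R z) - g (r *\<^sub>R z)))) \<partial>?M) = 0" by simp
    then have "AE z in ?M. ennreal (ln (1 + cmod (u (r *\<^sub>R z) - g (r *\<^sub>R z)))) = 0"
      by (subst (asm) nn_integral_0_iff_AE) auto
    then show "AE z in ?M. cmod (u (r *\<^sub>R z) - g (r *\<^sub>R z)) \<le> 0"
    proof eventually_elim
      case (elim z)
      then have "ln (1 + cmod (u (r *\<^sub>R z) - g (r *\<^sub>R z))) \<le> 0" by (simp add: ennreal_eq_0_iff)
      then show ?case by (subst (asm) ln_le_zero_iff) (auto simp: add_pos_nonneg)
    qed
  qed
  then show ?thesis by simp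
qed

lemma extensional_eqI:
  "f \<in> extensional S \<Longrightarrow> g \<in> extensional S \<Longrightarrow> (\<And>z. z \<in> S \<Longrightarrow> f z = g z) \<Longrightarrow> f = g"
  by (rule extensionalityI)

lemma smirnov_dist_eq_0:
  fixes f g :: "complex ^ 'n \<Rightarrow> complex"
  assumes "f \<in> smirnov K" "g \<in> smirnov K" "smirnov_dist K f g = 0"
  shows "f = g"
proof (rule extensional_eqI[OF smirnov_ext[OF assms(1)] smirnov_ext[OF assms(2)]])
  fix z :: "complex ^ 'n" assume z: "z \<in> cdomain K"
  have "g z = f z"
    by (rule smirnov_limit_unique[where f="\<lambda>_. f", OF assms(1,2) smirnov_hol[OF assms(1)] _ _ z])
       (use assms(3) in auto)
  then show "f z = g z" by simp
qed

text \<open>The Smirnov condition is essential: the inner function in the denominator of a general Nevanlinna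
  function is invisible in the moduli on the boundary.\<close>

lemma smirnov_bdry_le_imp:
  fixes f :: "complex ^ 'n \<Rightarrow> complex"
  assumes f: "f \<in> smirnov K" and b: "AE z in \<sigma> K. cmod (bdry_value f z) \<le> 1" and z: "z \<in> cdomain K"
  shows "cmod (f z) \<le> 1"
proof (rule AE_dilate_max_principle[OF smirnov_hol[OF f] _ z])
  let ?M = "\<sigma> K :: (complex ^ 'n) measure"
  fix r :: real assume r: "0 < r" "r < 1"
  then have r0: "0 \<le> r" by simp
  note [measurable] = dilate_measurable[OF smirnov_hol[OF f] r0 r(2)]
  have "(\<integral>\<^sup>+ z. ennreal (log_plus (cmod (f (r *\<^sub>R z)))) \<partial>?M) \<le> (SUP r\<in>{0<..<1}. \<integral>\<^sup>+ z. ennreal (log_plus (cmod (f (r *\<^sub>R z)))) \<partial>?M)"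
    by (rule SUP_upper) (use r in auto)
  also have "\<dots> = (\<integral>\<^sup>+ z. ennreal (log_plus (cmod (bdry_value f z))) \<partial>?M)" using f by (simp add: smirnov_def)
  also have "\<dots> = (\<integral>\<^sup>+ z. 0 \<partial>?M)"
    by (rule nn_integral_cong_AE) (use b in \<open>eventually_elim, simp add: log_plus_eq_0_iff\<close>)
  finally have "(\<integral>\<^sup>+ z. ennreal (log_plus (cmod (f (r *\<^sub>R z)))) \<partial>?M) = 0" by simp
  then have "AE z in ?M. ennreal (log_plus (cmod (f (r *\<^sub>R z)))) = 0"
    by (subst (asm) nn_integral_0_iff_AE) auto
  then show "AE z in ?M. cmod (f (r *\<^sub>R z)) \<le> 1"
    by eventually_elim (simp add: ennreal_eq_0_iff log_plus_eq_0_iff[symmetric] antisym)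
qed

section \<open>Density of the polynomials\<close>

inductive polyfun :: "(complex ^ 'n \<Rightarrow> complex) \<Rightarrow> bool" where
  const: "polyfun (\<lambda>_. c)"
| coord: "polyfun (\<lambda>z. z $ i)"
| add: "polyfun p \<Longrightarrow> polyfun q \<Longrightarrow> polyfun (\<lambda>z. p z + q z)"
| mult: "polyfun p \<Longrightarrow> polyfun q \<Longrightarrow> polyfun (\<lambda>z. p z * q z)"

lemma polyfun_hol: "polyfun p \<Longrightarrow> open S \<Longrightarrow> holomorphic_vec p S"
  by (induction rule: polyfun.induct)
     (auto intro: holomorphic_vec_const holomorphic_vec_nth holomorphic_vec_add holomorphic_vec_mult)

lemma polyfun_continuous_on: "polyfun p \<Longrightarrow> continuous_on S p"
  by (rule continuous_on_subset[OF holomorphic_vec_continuous_on[OF polyfun_hol[OF _ open_UNIV]]]) auto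

lemma polyfun_sum: "(\<And>i. i \<in> I \<Longrightarrow> polyfun (p i)) \<Longrightarrow> polyfun (\<lambda>z. \<Sum>i\<in>I. p i z)"
  by (induction I rule: infinite_finite_induct) (auto intro: polyfun.intros)

lemma polyfun_poly: "polyfun q \<Longrightarrow> polyfun (\<lambda>z. poly P (q z))"
  by (induction P) (auto intro: polyfun.intros)

text \<open>Interpolation at \<open>0, \<dots>, k\<close>: the values there determine a polynomial of degree at most \<open>k\<close> linearly,
  with polynomials as coefficients.\<close>

lemma Lagrange_interpolation:
  fixes a :: "nat \<Rightarrow> complex"
  obtains L :: "nat \<Rightarrow> complex poly" where
    "\<And>a x. (\<Sum>j\<le>k. a j * x ^ j) = (\<Sum>m\<le>k. (\<Sum>j\<le>k. a j * of_nat m ^ j) * poly (L m) (x::complex))"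
proof -
  define D where "D m = (\<Prod>l\<in>{..k}-{m}. [:- of_nat l, 1:] :: complex poly)" for m
  define L where "L m = smult (inverse (poly (D m) (of_nat m))) (D m)" for m
  have Dm: "poly (D m) (of_nat n) = (\<Prod>l\<in>{..k}-{m}. of_nat n - of_nat l)" for m n
    by (simp add: D_def poly_prod)
  have Lval: "poly (L m) (of_nat n) = (if m = n then 1 else 0)" if "m \<le> k" "n \<le> k" for m n
  proof (cases "m = n")
    case True
    have "poly (D n) (of_nat n) \<noteq> 0" unfolding Dm by (auto simp: prod_zero_iff)
    then show ?thesis using True by (simp add: L_def)
  next
    case False
    then have "poly (D m) (of_nat n) = 0" unfolding Dm using that by (auto simp: prod_zero_iff)
    then show ?thesis using False by (simp add: L_def)
  qed
  have degL: "degree (L m) \<le> k" if "m \<le> k" for m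
  proof -
    have "degree (D m) \<le> sum (degree \<circ> (\<lambda>l. [:- of_nat l, 1:] :: complex poly)) ({..k}-{m})"
      unfolding D_def by (rule degree_prod_sum_le) simp
    also have "\<dots> = k" using that by (simp add: o_def)
    finally show ?thesis unfolding L_def using degree_smult_le order_trans by blast
  qed
  have "(\<Sum>j\<le>k. a j * x ^ j) = (\<Sum>m\<le>k. (\<Sum>j\<le>k. a j * of_nat m ^ j) * poly (L m) x)" for a and x :: complex
  proof -
    let ?P = "\<Sum>j\<le>k. monom (a j) j" and ?Q = "\<Sum>m\<le>k. smult (\<Sum>j\<le>k. a j * of_nat m ^ j) (L m)"
    have "?P = ?Q"
    proof (rule poly_eqI_degree[where A="of_nat ` {..k}"])
      have c: "card ((of_nat :: nat \<Rightarrow> complex) ` {..k}) = Suc k" by (subst card_image) (auto intro: inj_onI)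
      show "card ((of_nat :: nat \<Rightarrow> complex) ` {..k}) > degree ?P"
        unfolding c by (rule le_imp_less_Suc, rule degree_sum_le) (auto intro: order_trans[OF degree_monom_le])
      show "card ((of_nat :: nat \<Rightarrow> complex) ` {..k}) > degree ?Q"
        unfolding c by (rule le_imp_less_Suc, rule degree_sum_le) (auto intro: order_trans[OF degree_smult_le] degL)
      fix y :: complex assume "y \<in> of_nat ` {..k}"
      then obtain n where n: "n \<le> k" "y = of_nat n" by auto
      have "poly ?Q y = (\<Sum>m\<le>k. (\<Sum>j\<le>k. a j * of_nat m ^ j) * poly (L m) (of_nat n))"
        by (simp add: poly_sum n)
      also have "\<dots> = (\<Sum>m\<le>k. if m = n then (\<Sum>j\<le>k. a j * of_nat m ^ j) else 0)"
        by (rule sum.cong) (use n Lval in auto)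
      also have "\<dots> = poly ?P y" using n by (simp add: poly_sum poly_monom)
      finally show "poly ?P y = poly ?Q y" ..
    qed
    from arg_cong[OF this, of "\<lambda>p. poly p x"] show ?thesis by (simp add: poly_sum poly_monom)
  qed
  then show thesis by (rule that)
qed

text \<open>Bounding the degree in each variable makes the Lagrange formula applicable to one variable after
  the other.\<close>

lemma separately_polynomial_imp_polyfun:
  fixes F :: "complex ^ 'n \<Rightarrow> complex"
  assumes sep: "\<And>z i. \<exists>a. \<forall>x. F (\<chi> j. if j = i then x else z $ j) = (\<Sum>j\<le>k. a j * x ^ j)"
  shows "polyfun F"
proof -
  obtain L :: "nat \<Rightarrow> complex poly" where
    L: "\<And>a x. (\<Sum>j\<le>k. a j * x ^ j) = (\<Sum>m\<le>k. (\<Sum>j\<le>k. a j * of_nat m ^ j) * poly (L m) (x::complex))"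
    using Lagrange_interpolation by blast
  have "polyfun (\<lambda>z. F (\<chi> i. if i \<in> J then z $ i else w $ i))" if "finite J" for J and w :: "complex ^ 'n"
    using that
  proof (induction J arbitrary: w rule: finite_induct)
    case empty
    then show ?case by (simp add: polyfun.const)
  next
    case (insert i J)
    have eq: "F (\<chi> j. if j \<in> insert i J then z $ j else w $ j) =
       (\<Sum>m\<le>k. F (\<chi> j. if j \<in> J then z $ j else (\<chi> j. if j = i then of_nat m else w $ j) $ j) * poly (L m) (z $ i))" for z
    proof -
      let ?y = "\<chi> j. if j \<in> J then z $ j else w $ j"
      obtain a where a: "\<And>x. F (\<chi> j. if j = i then x else ?y $ j) = (\<Sum>j\<le>k. a j * x ^ j)" using sep by blast
      have 1: "(\<chi> j. if j \<in> insert i J then z $ j else w $ j) = (\<chi> j. if j = i then z $ i else ?y $ j)"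
        by (auto simp: vec_eq_iff)
      have 2: "(\<chi> j. if j \<in> J then z $ j else (\<chi> j. if j = i then of_nat m else w $ j) $ j) = (\<chi> j. if j = i then of_nat m else ?y $ j)" for m :: nat
        using insert.hyps by (auto simp: vec_eq_iff)
      show ?thesis unfolding 1 2 a by (rule L)
    qed
    show ?case unfolding eq
      by (intro polyfun_sum polyfun.mult insert.IH polyfun_poly polyfun.coord)
  qed
  from this[of UNIV 0] show ?thesis by simp
qed

text \<open>The homogeneous component of degree \<open>k\<close> of the expansion of \<open>f\<close> at the origin, read off from slices.\<close>

definition homog :: "(complex ^ 'n \<Rightarrow> complex) \<Rightarrow> nat \<Rightarrow> complex ^ 'n \<Rightarrow> complex" where
  "homog f k z = (deriv ^^ k) (\<lambda>c. f (c *s z)) 0 / fact k"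

lemma slice_near_zero:
  fixes f :: "complex ^ 'n \<Rightarrow> complex"
  assumes f: "holomorphic_vec f (cdomain K)"
  obtains \<delta> B where "0 < \<delta>" "0 \<le> B"
    "\<And>z. norm z \<le> \<delta> \<Longrightarrow> (\<lambda>c. f (c *s z)) holomorphic_on ball 0 2"
    "\<And>z c. norm z \<le> \<delta> \<Longrightarrow> cmod c \<le> 2 \<Longrightarrow> cmod (f (c *s z)) \<le> B"
    "\<And>z :: complex ^ 'n. norm z \<le> 2 * \<delta> \<Longrightarrow> z \<in> cdomain K"
proof -
  obtain e where e: "e > 0" "cball (0::complex^'n) e \<subseteq> cdomain K"
    using open_contains_cball[of "cdomain K :: (complex^'n) set"] open_cdomain zero_in_cdomain by blast
  have "bounded (f ` cball 0 e)"
    by (intro compact_imp_bounded compact_continuous_image continuous_on_subset[OF holomorphic_vec_continuous_on[OF f] e(2)]) simp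
  then obtain B where "\<forall>x\<in>f ` cball 0 e. cmod x \<le> B" unfolding bounded_iff by blast
  then have B: "\<And>w. w \<in> cball 0 e \<Longrightarrow> cmod (f w) \<le> B" by blast
  have n: "norm (c *s z) \<le> e" if "norm z \<le> e/2" "cmod c \<le> 2" for c and z :: "complex^'n"
  proof -
    have "cmod c * norm z \<le> 2 * (e/2)" using that by (intro mult_mono) auto
    then show ?thesis by (simp add: norm_vector_scalar_mult)
  qed
  show thesis
  proof (rule that[of "e/2" B])
    have "cmod (f 0) \<le> B" using B e by simp
    then show "0 \<le> B" using norm_ge_zero order_trans by blast
    fix z :: "complex^'n"
    show "cmod (f (c *s z)) \<le> B" if "norm z \<le> e/2" "cmod c \<le> 2" for c
      using n[OF that] B by simp
    show "z \<in> cdomain K" if "norm z \<le> 2 * (e/2)" using that e by auto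
    assume z: "norm z \<le> e/2"
    have "(\<lambda>c. f (0 + c *s z)) holomorphic_on {c. 0 + c *s z \<in> cdomain K}" by (rule holomorphic_vec_line[OF f])
    moreover have "ball 0 2 \<subseteq> {c. 0 + c *s z \<in> cdomain K}" using n[OF z] e(2) by auto
    ultimately show "(\<lambda>c. f (c *s z)) holomorphic_on ball 0 2" by (auto elim: holomorphic_on_subset)
  qed (use e in auto)
qed

lemma homog_scale:
  fixes f :: "complex ^ 'n \<Rightarrow> complex"
  assumes f: "holomorphic_vec f (cdomain K)"
  shows "homog f k (a *s z) = a ^ k * homog f k z"
proof -
  define T where "T = {c. c *s z \<in> cdomain K}"
  have T: "open T" "0 \<in> T"
  proof -
    have "continuous_on UNIV (\<lambda>c. c *s z)"
      by (intro linear_continuous_on linear_conv_bounded_linear[THEN iffD1] linearI) (auto simp: vec_eq_iff distrib_right)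
    then have "open ((\<lambda>c. c *s z) -` cdomain K)" using open_cdomain by (rule open_vimage[rotated])
    then show "open T" by (simp add: T_def vimage_def)
    show "0 \<in> T" by (simp add: T_def)
  qed
  have hol: "(\<lambda>c. f (c *s z)) holomorphic_on T"
    using holomorphic_vec_line[OF f, of 0 z] by (simp add: T_def)
  define S where "S = (\<lambda>w. a * w) -` T"
  have S: "open S" "0 \<in> S"
    unfolding S_def using T by (auto intro!: open_vimage continuous_intros)
  have "(deriv ^^ k) (\<lambda>w. (\<lambda>c. f (c *s z)) (a * w)) 0 = a ^ k * (deriv ^^ k) (\<lambda>c. f (c *s z)) (a * 0)"
    by (rule higher_deriv_compose_linear[OF hol S(1) T(1) S(2)]) (simp add: S_def)
  then show ?thesis by (simp add: homog_def mult.commute)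
qed

lemma homog_sums:
  assumes f: "holomorphic_vec f (cdomain K)" and z: "z \<in> cclosed K" and c: "cmod c < 1"
  shows "(\<lambda>k. homog f k z * c ^ k) sums f (c *s z)"
  using holomorphic_power_series[OF holomorphic_vec_slice[OF f z], of c] c by (simp add: homog_def)

lemma homog_bound_near_zero:
  assumes "(\<lambda>c. f (c *s z)) holomorphic_on ball 0 2" "\<And>c. cmod c \<le> 2 \<Longrightarrow> cmod (f (c *s z)) \<le> B"
  shows "cmod (homog f k z) \<le> B * (2/3) ^ k"
proof -
  have "norm ((deriv ^^ k) (\<lambda>c. f (c *s z)) 0) \<le> fact k * B / (3/2) ^ k"
  proof (rule Cauchy_inequality)
    show "(\<lambda>c. f (c *s z)) holomorphic_on ball 0 (3/2)" by (rule holomorphic_on_subset[OF assms(1)]) auto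
    show "continuous_on (cball 0 (3/2)) (\<lambda>c. f (c *s z))"
      by (rule continuous_on_subset[OF holomorphic_on_imp_continuous_on[OF assms(1)]]) auto
  qed (use assms(2) in auto)
  then have "norm ((deriv ^^ k) (\<lambda>c. f (c *s z)) 0) / fact k \<le> (fact k * B / (3/2) ^ k) / fact k"
    by (rule divide_right_mono) simp
  then have "cmod (homog f k z) \<le> (fact k * B / (3/2) ^ k) / fact k"
    by (simp only: homog_def norm_divide norm_fact)
  also have "\<dots> = B * (2/3) ^ k" by (simp add: power_divide)
  finally show ?thesis .
qed

lemma homog_line_holomorphic_near_zero:
  fixes f :: "complex ^ 'n \<Rightarrow> complex"
  assumes f: "holomorphic_vec f (cdomain K)" and \<delta>: "0 < \<delta>" "0 \<le> B"
    "\<And>z. norm z \<le> \<delta> \<Longrightarrow> (\<lambda>c. f (c *s z)) holomorphic_on ball 0 2"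
    "\<And>z c. norm z \<le> \<delta> \<Longrightarrow> cmod c \<le> 2 \<Longrightarrow> cmod (f (c *s z)) \<le> B"
    "\<And>z :: complex ^ 'n. norm z \<le> 2 * \<delta> \<Longrightarrow> z \<in> cdomain K"
    and ab: "\<And>\<mu>. \<mu> \<in> ball 0 R \<Longrightarrow> norm (a + \<mu> *s b) \<le> \<delta>"
  shows "(\<lambda>\<mu>. homog f k (a + \<mu> *s b)) holomorphic_on ball 0 R"
proof (induction k rule: less_induct)
  case (less k)
  define t where "t n = inverse (real (Suc n))" for n
  have t: "0 < t n" "t n \<le> 1" for n by (auto simp: t_def field_simps)
  define g where "g n \<mu> = (f (of_real (t n) *s (a + \<mu> *s b)) - (\<Sum>m<k. homog f m (a + \<mu> *s b) * of_real (t n) ^ m)) / of_real (t n) ^ k" for n \<mu>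
  have err: "cmod (g n \<mu> - homog f k (a + \<mu> *s b)) \<le> 3 * B * t n" if \<mu>: "\<mu> \<in> ball 0 R" for n \<mu>
  proof -
    define w where "w = a + \<mu> *s b"
    have w: "norm w \<le> \<delta>" using ab[OF \<mu>] by (simp add: w_def)
    let ?c = "complex_of_real (t n)"
    have c0: "?c \<noteq> 0" using t[of n] by simp
    have hb: "cmod (homog f m w) \<le> B * (2/3) ^ m" for m
      by (rule homog_bound_near_zero[OF \<delta>(3)[OF w] \<delta>(4)[OF w]])
    have "(\<lambda>m. (deriv ^^ m) (\<lambda>c. f (c *s w)) 0 / fact m * (?c - 0) ^ m) sums f (?c *s w)"
      by (rule holomorphic_power_series[OF \<delta>(3)[OF w]]) (use t[of n] in auto)
    then have "(\<lambda>m. homog f m w * ?c ^ m) sums f (?c *s w)" by (simp add: homog_def)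
    from sums_split_initial_segment[OF this, of "Suc k"]
    have "(\<lambda>m. homog f (m + Suc k) w * ?c ^ (m + Suc k)) sums (f (?c *s w) - (\<Sum>m<Suc k. homog f m w * ?c ^ m))" .
    then have "(\<lambda>m. homog f (m + Suc k) w * ?c ^ (m + Suc k) / ?c ^ k) sums ((f (?c *s w) - (\<Sum>m<Suc k. homog f m w * ?c ^ m)) / ?c ^ k)"
      by (rule sums_divide)
    moreover have "(f (?c *s w) - (\<Sum>m<Suc k. homog f m w * ?c ^ m)) / ?c ^ k = g n \<mu> - homog f k w"
      using c0 by (simp add: g_def w_def diff_divide_distrib add_divide_distrib)
    moreover have "homog f (m + Suc k) w * ?c ^ (m + Suc k) / ?c ^ k = homog f (m + Suc k) w * ?c ^ Suc m" for m
      using c0 by (simp add: power_add)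
    ultimately have s: "(\<lambda>m. homog f (m + Suc k) w * ?c ^ Suc m) sums (g n \<mu> - homog f k w)" by simp
    have gs: "(\<lambda>m. (B * t n) * (2/3) ^ m) sums ((B * t n) * (1 / (1 - 2/3)))"
      by (intro sums_mult geometric_sums) simp
    have le: "cmod (homog f (m + Suc k) w * ?c ^ Suc m) \<le> (B * t n) * (2/3) ^ m" for m
    proof -
      have "cmod (homog f (m + Suc k) w) \<le> B * (2/3) ^ m"
        using hb[of "m + Suc k"] \<delta>(2) power_decreasing[of m "m + Suc k" "2/3::real"]
        by (elim order_trans) (intro mult_left_mono, auto)
      moreover have "t n ^ Suc m \<le> t n ^ 1" using t[of n] by (intro power_decreasing) auto
      ultimately have "cmod (homog f (m + Suc k) w) * t n ^ Suc m \<le> (B * (2/3) ^ m) * t n"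
        using t[of n] \<delta>(2) by (intro mult_mono) auto
      then show ?thesis using t[of n] by (simp add: norm_mult norm_power mult_ac)
    qed
    have "cmod (g n \<mu> - homog f k w) \<le> (B * t n) * (1 / (1 - 2/3))"
      unfolding sums_unique[OF s] sums_unique[OF gs]
      by (rule norm_suminf_le[OF le sums_summable[OF gs]])
    then show ?thesis by (simp add: w_def mult_ac)
  qed
  have ghol: "g n holomorphic_on ball 0 R" for n
  proof -
    have eq: "of_real (t n) *s (a + \<mu> *s b) = of_real (t n) *s a + \<mu> *s (of_real (t n) *s b)" for \<mu>
      by (simp add: vec_eq_iff algebra_simps)
    have "(\<lambda>\<mu>. f (of_real (t n) *s (a + \<mu> *s b))) holomorphic_on ball 0 R"
      unfolding eq
    proof (rule holomorphic_on_subset[OF holomorphic_vec_line[OF f]], rule subsetI)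
      fix \<mu> :: complex assume \<mu>: "\<mu> \<in> ball 0 R"
      have "norm (of_real (t n) *s (a + \<mu> *s b)) \<le> 1 * \<delta>"
        unfolding norm_vector_scalar_mult using ab[OF \<mu>] t[of n] by (intro mult_mono) auto
      then show "\<mu> \<in> {\<mu>. of_real (t n) *s a + \<mu> *s (of_real (t n) *s b) \<in> cdomain K}"
        using \<delta>(5)[of "of_real (t n) *s (a + \<mu> *s b)"] \<delta>(1) unfolding eq by simp
    qed
    then show ?thesis unfolding g_def using t[of n]
      by (intro holomorphic_intros less) auto
  qed
  have "uniform_limit (ball 0 R) g (\<lambda>\<mu>. homog f k (a + \<mu> *s b)) sequentially"
  proof (rule uniform_limitI)
    fix e :: real assume e: "e > 0"
    have "(\<lambda>n. 3 * B * t n) \<longlonglongrightarrow> 3 * B * 0"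
      unfolding t_def by (intro tendsto_intros LIMSEQ_inverse_real_of_nat)
    then have "eventually (\<lambda>n. 3 * B * t n < e) sequentially" using e by (intro order_tendstoD(2)) auto
    then show "\<forall>\<^sub>F n in sequentially. \<forall>\<mu>\<in>ball 0 R. dist (g n \<mu>) (homog f k (a + \<mu> *s b)) < e"
    proof eventually_elim
      case (elim n)
      then show ?case using err[of _ n] unfolding dist_norm by (auto intro: le_less_trans[OF _ elim])
    qed
  qed
  note ul = this
  show ?case
  proof (rule holomorphic_uniform_sequence[OF open_ball ghol])
    fix x :: complex assume "x \<in> ball 0 R"
    then obtain d where "d > 0" "cball x d \<subseteq> ball 0 R" using open_contains_cball[of "ball (0::complex) R"] open_ball by blast
    then show "\<exists>d>0. cball x d \<subseteq> ball 0 R \<and> uniform_limit (cball x d) g (\<lambda>\<mu>. homog f k (a + \<mu> *s b)) sequentially"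
      using uniform_limit_on_subset[OF ul] by blast
  qed
qed

text \<open>On every complex line the component is entire and, being homogeneous, of growth at most \<open>R ^ k\<close>.
  By Liouville's theorem it is a polynomial of degree at most \<open>k\<close> in each variable.\<close>

lemma homog_polyfun:
  fixes f :: "complex ^ 'n \<Rightarrow> complex"
  assumes f: "holomorphic_vec f (cdomain K)"
  shows "polyfun (homog f k)"
proof (rule slice_near_zero[OF f])
  fix \<delta> B
  assume \<delta>: "0 < \<delta>" "0 \<le> B"
    "\<And>z. norm z \<le> \<delta> \<Longrightarrow> (\<lambda>c. f (c *s z)) holomorphic_on ball 0 2"
    "\<And>z c. norm z \<le> \<delta> \<Longrightarrow> cmod c \<le> 2 \<Longrightarrow> cmod (f (c *s z)) \<le> B"
    "\<And>z :: complex ^ 'n. norm z \<le> 2 * \<delta> \<Longrightarrow> z \<in> cdomain K"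
  have scale: "homog f k w = (of_real t) ^ k * homog f k (of_real (inverse t) *s w)" if "t > 0" for t :: real and w
    unfolding homog_scale[OF f, symmetric] using that by simp
  have hol: "(\<lambda>\<mu>. homog f k (a + \<mu> *s b)) holomorphic_on ball 0 R" if R: "R > 0" for a b R
  proof -
    \<comment> \<open>Homogeneity moves the segment of the line into the ball where slices are controlled.\<close>
    define t where "t = (norm a + R * norm b + 1) / \<delta>"
    have tp: "t > 0" unfolding t_def using \<delta>(1) R by (intro divide_pos_pos add_nonneg_pos) auto
    have eq: "homog f k (a + \<mu> *s b) = (of_real t) ^ k * homog f k (of_real (inverse t) *s a + \<mu> *s (of_real (inverse t) *s b))" for \<mu>
      by (subst scale[OF tp]) (simp add: vec.scale_right_distrib mult.commute)
    have "(\<lambda>\<mu>. homog f k (of_real (inverse t) *s a + \<mu> *s (of_real (inverse t) *s b))) holomorphic_on ball 0 R"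
    proof (rule homog_line_holomorphic_near_zero[OF f \<delta>])
      fix \<mu> :: complex assume \<mu>: "\<mu> \<in> ball 0 R"
      have "norm (of_real (inverse t) *s a + \<mu> *s (of_real (inverse t) *s b)) \<le>
          norm (of_real (inverse t) *s a) + norm (\<mu> *s (of_real (inverse t) *s b))" by (rule norm_triangle_ineq)
      also have "\<dots> = inverse t * (norm a + cmod \<mu> * norm b)"
        using tp by (simp add: norm_vector_scalar_mult norm_mult algebra_simps norm_inverse)
      also have "\<dots> \<le> inverse t * (norm a + R * norm b + 1)"
      proof -
        have "cmod \<mu> * norm b \<le> R * norm b" by (intro mult_right_mono) (use \<mu> in auto)
        then have "norm a + cmod \<mu> * norm b \<le> norm a + R * norm b + 1" by linarith
        then show ?thesis using tp by (intro mult_left_mono) auto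
      qed
      also have "\<dots> = \<delta>" using tp \<delta>(1) unfolding t_def by (simp add: field_simps)
      finally show "norm (of_real (inverse t) *s a + \<mu> *s (of_real (inverse t) *s b)) \<le> \<delta>" .
    qed
    then show ?thesis unfolding eq by (intro holomorphic_intros)
  qed
  have ent: "(\<lambda>\<mu>. homog f k (a + \<mu> *s b)) holomorphic_on UNIV" for a b
  proof -
    have "(\<lambda>\<mu>. homog f k (a + \<mu> *s b)) field_differentiable (at z)" for z
      using hol[of "cmod z + 1" a b] holomorphic_on_imp_differentiable_at[of _ "ball 0 (cmod z + 1)" z]
      by (auto simp: add_nonneg_pos)
    then show ?thesis by (auto simp: holomorphic_on_def)
  qed
  have bound: "cmod (homog f k w) \<le> (B / \<delta> ^ k) * norm w ^ k" for w
  proof (cases "w = 0")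
    case True
    have "cmod (homog f k 0) \<le> B * (2/3) ^ k"
      by (rule homog_bound_near_zero) (use \<delta>(3,4)[of 0] \<delta>(1) in auto)
    moreover have "homog f k 0 = 0" if "k > 0" using homog_scale[OF f, of k 0 0] that by (simp add: power_0_left)
    ultimately show ?thesis using True by (cases "k = 0") (simp_all add: power_0_left)
  next
    case False
    define t where "t = norm w / \<delta>"
    have t: "t > 0" using False \<delta>(1) by (simp add: t_def)
    have n: "norm (of_real (inverse t) *s w) \<le> \<delta>" using False \<delta>(1) by (simp add: norm_vector_scalar_mult t_def norm_divide)
    have "cmod (homog f k (of_real (inverse t) *s w)) \<le> B * (2/3) ^ k"
      by (rule homog_bound_near_zero[OF \<delta>(3)[OF n] \<delta>(4)[OF n]])
    also have "\<dots> \<le> B * 1" using \<delta>(2) by (intro mult_left_mono power_le_one) auto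
    finally have "t ^ k * cmod (homog f k (of_real (inverse t) *s w)) \<le> t ^ k * B"
      using t by (intro mult_left_mono) auto
    then have "cmod (homog f k w) \<le> t ^ k * B"
      using t by (subst scale[OF t]) (simp add: norm_mult norm_power)
    then show ?thesis by (simp add: t_def power_divide mult.commute)
  qed
  show "polyfun (homog f k)"
  proof (rule separately_polynomial_imp_polyfun[where k=k])
    fix z :: "complex ^ 'n" and i
    define a where "a = (\<chi> j. if j = i then 0 else z $ j)"
    have eq: "(\<chi> j. if j = i then x else z $ j) = a + x *s axis i 1" for x
      by (auto simp: vec_eq_iff a_def axis_def)
    have na: "norm (axis i (1::complex) :: complex ^ 'n) \<le> 1"
      using L2_set_le_sum[of UNIV "\<lambda>j. cmod ((axis i 1 :: complex ^ 'n) $ j)"]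
      by (simp add: norm_vec_def axis_def if_distrib[of cmod] cong: if_cong)
    have H: "homog f k (a + x *s axis i 1) = (\<Sum>j\<le>k. (deriv ^^ j) (\<lambda>\<mu>. homog f k (a + \<mu> *s axis i 1)) 0 / fact j * x ^ j)" for x
    proof (rule Liouville_polynomial[OF ent, where A="norm a + 1" and B="(B / \<delta> ^ k) * 2 ^ k"])
      fix \<mu> :: complex assume \<mu>: "norm a + 1 \<le> norm \<mu>"
      have "norm (a + \<mu> *s axis i 1) \<le> norm a + norm (\<mu> *s axis i (1::complex))" by (rule norm_triangle_ineq)
      also have "norm (\<mu> *s axis i (1::complex) :: complex ^ 'n) \<le> norm \<mu> * 1"
        unfolding norm_vector_scalar_mult using na by (intro mult_left_mono) auto
      also have "norm a + norm \<mu> * 1 \<le> 2 * norm \<mu>" using \<mu> by simp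
      finally have "norm (a + \<mu> *s axis i 1) ^ k \<le> (2 * norm \<mu>) ^ k" by (intro power_mono) auto
      then have "(B / \<delta> ^ k) * norm (a + \<mu> *s axis i 1) ^ k \<le> (B / \<delta> ^ k) * (2 * norm \<mu>) ^ k"
        using \<delta> by (intro mult_left_mono) auto
      with bound[of "a + \<mu> *s axis i 1"]
      show "norm (homog f k (a + \<mu> *s axis i 1)) \<le> (B / \<delta> ^ k) * 2 ^ k * norm \<mu> ^ k"
        by (simp add: power_mult_distrib mult.assoc)
    qed
    show "\<exists>c. \<forall>x. homog f k (\<chi> j. if j = i then x else z $ j) = (\<Sum>j\<le>k. c j * x ^ j)"
      unfolding eq by (intro exI allI, rule H)
  qed
qed

text \<open>Cauchy's estimates on slices of slightly larger radius make the homogeneous expansion converge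
  uniformly on the smaller closed domain.\<close>

lemma dilate_polynomial_approx:
  fixes f :: "complex ^ 'n \<Rightarrow> complex"
  assumes f: "holomorphic_vec f (cdomain K)" and r: "0 \<le> r" "r < 1" and e: "0 < e"
  shows "\<exists>p. polyfun p \<and> (\<forall>z\<in>cclosed K. cmod (f (r *\<^sub>R z) - p z) \<le> e)"
proof -
  define s where "s = (1 + r) / 2"
  have s: "r < s" "0 < s" "s < 1" using r by (auto simp: s_def)
  obtain B where B: "0 < B" "\<And>z. z \<in> cclosed K \<Longrightarrow> cmod (f (s *\<^sub>R z)) \<le> B"
    using dilate_bounded[OF f less_imp_le[OF s(2)] s(3)] by metis
  have hb: "cmod (homog f k z) \<le> B / s ^ k" if z: "z \<in> cclosed K" for z k
  proof -
    have "norm ((deriv ^^ k) (\<lambda>c. f (c *s z)) 0) \<le> fact k * B / s ^ k"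
    proof (rule Cauchy_inequality)
      note hol = holomorphic_vec_slice[OF f z]
      show "(\<lambda>c. f (c *s z)) holomorphic_on ball 0 s" by (rule holomorphic_on_subset[OF hol]) (use s in auto)
      show "continuous_on (cball 0 s) (\<lambda>c. f (c *s z))"
        by (rule continuous_on_subset[OF holomorphic_on_imp_continuous_on[OF hol]]) (use s in auto)
      fix c :: complex assume c: "norm (0 - c) = s"
      then have cs: "cmod c = s" by simp
      have "c *s z = s *\<^sub>R ((c / of_real s) *s z)" using s by (simp add: scaleR_eq_smult)
      moreover have "(c / of_real s) *s z \<in> cclosed K"
      proof (cases K)
        case Unit_Ball then show ?thesis using z cs s by (simp add: norm_vector_scalar_mult norm_divide)
      next
        case Unit_Polydisk then show ?thesis using z cs s by (simp add: norm_mult norm_divide)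
      qed
      ultimately show "cmod (f (c *s z)) \<le> B" using B(2) by simp
    qed (use s in auto)
    then have "norm ((deriv ^^ k) (\<lambda>c. f (c *s z)) 0) / fact k \<le> (fact k * B / s ^ k) / fact k"
      by (rule divide_right_mono) simp
    then have "cmod (homog f k z) \<le> (fact k * B / s ^ k) / fact k"
      by (simp only: homog_def norm_divide norm_fact)
    then show ?thesis by simp
  qed
  define q where "q = r / s"
  have q: "0 \<le> q" "q < 1" using r s by (auto simp: q_def)
  have "(\<lambda>N. B * (1 / (1 - q)) * q ^ N) \<longlonglongrightarrow> B * (1 / (1 - q)) * 0"
    using q by (intro tendsto_intros LIMSEQ_realpow_zero) auto
  then have "eventually (\<lambda>N. B * (1 / (1 - q)) * q ^ N < e) sequentially" using e by (intro order_tendstoD(2)) auto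
  then obtain N where N: "B * (1 / (1 - q)) * q ^ N < e" by (auto simp: eventually_sequentially)
  define p where "p z = (\<Sum>k<N. homog f k z * of_real r ^ k)" for z
  have "polyfun p" unfolding p_def
    by (intro polyfun_sum polyfun.mult homog_polyfun[OF f] polyfun.const)
  moreover have "cmod (f (r *\<^sub>R z) - p z) \<le> e" if z: "z \<in> cclosed K" for z
  proof -
    have "(\<lambda>k. homog f k z * of_real r ^ k) sums f (of_real r *s z)"
      by (rule homog_sums[OF f z]) (use r in auto)
    from sums_split_initial_segment[OF this, of N]
    have sm: "(\<lambda>k. homog f (k + N) z * of_real r ^ (k + N)) sums (f (r *\<^sub>R z) - p z)"
      by (simp add: p_def scaleR_eq_smult)
    have gs: "(\<lambda>k. (B * q ^ N) * q ^ k) sums ((B * q ^ N) * (1 / (1 - q)))"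
      using q by (intro sums_mult geometric_sums) auto
    have le: "cmod (homog f (k + N) z * of_real r ^ (k + N)) \<le> (B * q ^ N) * q ^ k" for k
    proof -
      have "cmod (homog f (k + N) z) * r ^ (k + N) \<le> B / s ^ (k + N) * r ^ (k + N)"
        using hb[OF z] r by (intro mult_right_mono) auto
      also have "\<dots> = (B * q ^ N) * q ^ k" by (simp add: q_def power_divide power_add mult_ac)
      finally show ?thesis using r by (simp add: norm_mult norm_power)
    qed
    have "cmod (f (r *\<^sub>R z) - p z) \<le> (B * q ^ N) * (1 / (1 - q))"
      unfolding sums_unique[OF sm] sums_unique[OF gs]
      by (rule norm_suminf_le[OF le sums_summable[OF gs]])
    also have "\<dots> \<le> e" using N by (simp add: mult_ac)
    finally show ?thesis .
  qed
  ultimately show ?thesis by blast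
qed

definition polyres :: "domain_kind \<Rightarrow> (complex ^ 'n \<Rightarrow> complex) \<Rightarrow> complex ^ 'n \<Rightarrow> complex" where
  "polyres K p = restrict p (cdomain K)"

lemma polyfun_bounded:
  assumes "polyfun (p :: complex ^ 'n \<Rightarrow> complex)"
  shows "\<exists>M. \<forall>z\<in>cclosed K. cmod (p z) \<le> M"
proof -
  have "bounded (p ` cclosed K)"
    by (intro compact_imp_bounded compact_continuous_image polyfun_continuous_on assms compact_cclosed)
  then show ?thesis unfolding bounded_iff by simp
qed

lemma polyres_bounded_hol:
  assumes p: "polyfun p"
  shows "polyres K p \<in> bounded_hol K"
proof -
  obtain M where M: "\<forall>z\<in>cclosed K. cmod (p z) \<le> M" using polyfun_bounded[OF p] ..
  show ?thesis
  proof (rule bounded_holI)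
    show "holomorphic_vec (polyres K p) (cdomain K)"
      by (rule holomorphic_vec_cong[OF polyfun_hol[OF p open_cdomain]]) (simp add: polyres_def)
    show "cmod (polyres K p z) \<le> M" if "z \<in> cdomain K" for z
      using bspec[OF M subsetD[OF cdomain_subset_cclosed that]] that by (simp add: polyres_def)
  qed (simp add: polyres_def)
qed

lemma polyres_bdry:
  assumes p: "polyfun p" and z: "z \<in> cboundary K"
  shows "bdry_value (polyres K p) z = p z"
proof (rule bdry_value_eqI, rule radial_tendsto_cong[OF z])
  have "isCont p z" using polyfun_continuous_on[OF p, of UNIV] by (simp add: continuous_on_eq_continuous_at)
  moreover have "((\<lambda>r::real. r *\<^sub>R z) \<longlongrightarrow> 1 *\<^sub>R z) (at_left 1)" by (intro tendsto_intros)
  ultimately show "((\<lambda>r::real. p (r *\<^sub>R z)) \<longlongrightarrow> p z) (at_left 1)"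
    using isCont_tendsto_compose[of z p "\<lambda>r::real. r *\<^sub>R z" "at_left 1"] by simp
qed (simp add: polyres_def)

lemma polynomial_sequence:
  fixes f :: "complex ^ 'n \<Rightarrow> complex"
  assumes f: "holomorphic_vec f (cdomain K)"
  shows "\<exists>p. \<forall>n. polyfun (p n) \<and>
    (\<forall>z\<in>cclosed K. cmod (f (radii n *\<^sub>R z) - p n z) \<le> inverse (real (Suc n)))"
  by (intro choice allI dilate_polynomial_approx[OF f less_imp_le[OF radii(1)] radii(2)]) simp

text \<open>The dilates of \<open>f\<close> converge to \<open>f\<close> in the metric and are uniformly close to polynomials.\<close>

lemma smirnov_polynomials_dense:
  fixes f :: "complex ^ 'n \<Rightarrow> complex"
  assumes f: "f \<in> smirnov K"
  obtains p where "\<And>n. polyfun (p n)" "(\<lambda>n. smirnov_dist K (polyres K (p n)) f) \<longlonglongrightarrow> 0"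
    "\<And>z. z \<in> cdomain K \<Longrightarrow> (\<lambda>n. p n z) \<longlonglongrightarrow> f z"
proof -
  let ?M = "\<sigma> K :: (complex ^ 'n) measure"
  interpret prob_space ?M by (rule prob_space_boundary_measure)
  note hol = smirnov_hol[OF f]
  obtain p where p': "\<forall>n. polyfun (p n) \<and> (\<forall>z\<in>cclosed K. cmod (f (radii n *\<^sub>R z) - p n z) \<le> inverse (real (Suc n)))"
    using polynomial_sequence[OF hol] ..
  have p: "polyfun (p n)" "z \<in> cclosed K \<Longrightarrow> cmod (f (radii n *\<^sub>R z) - p n z) \<le> inverse (real (Suc n))" for n z
    using p' by auto
  have inv0: "(\<lambda>n. inverse (real (Suc n))) \<longlonglongrightarrow> 0" by (rule LIMSEQ_inverse_real_of_nat)
  have "(\<lambda>n. p n z) \<longlonglongrightarrow> f z" if z: "z \<in> cdomain K" for z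
  proof -
    have "isCont f z" using continuous_on_eq_continuous_at[OF open_cdomain] holomorphic_vec_continuous_on[OF hol] z by blast
    moreover have "(\<lambda>n. radii n *\<^sub>R z) \<longlonglongrightarrow> 1 *\<^sub>R z" by (intro tendsto_intros radii_tendsto)
    ultimately have 1: "(\<lambda>n. f (radii n *\<^sub>R z)) \<longlonglongrightarrow> f z"
      using isCont_tendsto_compose[of z f "\<lambda>n. radii n *\<^sub>R z" sequentially] by simp
    have "(\<lambda>n. f (radii n *\<^sub>R z) - p n z) \<longlonglongrightarrow> 0"
      by (rule Lim_null_comparison[OF always_eventually inv0]) (use p(2) z cdomain_subset_cclosed in auto)
    from tendsto_diff[OF 1 this] show ?thesis by simp
  qed
  moreover have "(\<lambda>n. smirnov_dist K (polyres K (p n)) f) \<longlonglongrightarrow> 0"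
  proof (rule Lim_null_comparison[OF always_eventually])
    note c0 = smirnov_diff_convergence(3)[OF f f]
    show "(\<lambda>n. inverse (real (Suc n)) + (\<integral>z. ln (1 + cmod (f (radii n *\<^sub>R z) - bdry_value f z)) \<partial>?M)) \<longlonglongrightarrow> 0"
      using tendsto_add[OF inv0 c0] by simp
    show "\<forall>n. norm (smirnov_dist K (polyres K (p n)) f) \<le> inverse (real (Suc n)) + (\<integral>z. ln (1 + cmod (f (radii n *\<^sub>R z) - bdry_value f z)) \<partial>?M)"
    proof
      fix n
      note ps = bounded_hol_smirnov[OF polyres_bounded_hol[OF p(1)]]
      note [measurable] = dilate_radii_measurable[OF hol] smirnov_bdry_measurable[OF f]
      have i1: "integrable ?M (\<lambda>z. ln (1 + cmod (bdry_value (polyres K (p n)) z - bdry_value f z)))"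
        by (rule smirnov_diff_convergence(1)[OF ps f])
      have i2: "integrable ?M (\<lambda>z. ln (1 + cmod (f (radii n *\<^sub>R z) - bdry_value f z)))"
      proof (rule Bochner_Integration.integrable_bound)
        show "integrable ?M (\<lambda>z. 2 * ln 2 + log_plus (cmod (f (radii n *\<^sub>R z))) + log_plus (cmod (bdry_value f z)))"
          using dilate_radii_log_plus_integrable[OF hol, of n] smirnov_L1(1)[OF f] by simp
        show "AE z in ?M. norm (ln (1 + cmod (f (radii n *\<^sub>R z) - bdry_value f z))) \<le>
           norm (2 * ln 2 + log_plus (cmod (f (radii n *\<^sub>R z))) + log_plus (cmod (bdry_value f z)))"
        proof (intro AE_I2)
          fix z
          show "norm (ln (1 + cmod (f (radii n *\<^sub>R z) - bdry_value f z))) \<le>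
            norm (2 * ln 2 + log_plus (cmod (f (radii n *\<^sub>R z))) + log_plus (cmod (bdry_value f z)))"
            using ln_1_plus_cmod_diff_le[of "f (radii n *\<^sub>R z)" "bdry_value f z"] by simp
        qed
      qed measurable
      have "smirnov_dist K (polyres K (p n)) f \<le> (\<integral>z. inverse (real (Suc n)) + ln (1 + cmod (f (radii n *\<^sub>R z) - bdry_value f z)) \<partial>?M)"
        unfolding smirnov_dist_def
      proof (rule integral_mono_AE[OF i1])
        show "integrable ?M (\<lambda>z. inverse (real (Suc n)) + ln (1 + cmod (f (radii n *\<^sub>R z) - bdry_value f z)))" using i2 by simp
        show "AE z in ?M. ln (1 + cmod (bdry_value (polyres K (p n)) z - bdry_value f z)) \<le> inverse (real (Suc n)) + ln (1 + cmod (f (radii n *\<^sub>R z) - bdry_value f z))"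
          using AE_boundary[of K]
        proof eventually_elim
          case (elim z)
          define d where "d = inverse (real (Suc n))"
          define x where "x = cmod (f (radii n *\<^sub>R z) - bdry_value f z)"
          have d: "0 \<le> d" "0 \<le> x" by (auto simp: d_def x_def)
          have "cmod (p n z - bdry_value f z) \<le> cmod (p n z - f (radii n *\<^sub>R z)) + x"
            using dist_triangle[of "p n z" "bdry_value f z" "f (radii n *\<^sub>R z)"] by (simp add: x_def dist_norm)
          also have "cmod (p n z - f (radii n *\<^sub>R z)) \<le> d"
            using p(2)[OF subsetD[OF cboundary_subset_cclosed elim], of n] by (simp add: norm_minus_commute d_def)
          finally have "1 + cmod (p n z - bdry_value f z) \<le> (1 + d) * (1 + x)"
            using mult_nonneg_nonneg[OF d] by (simp add: algebra_simps)
          then have "ln (1 + cmod (p n z - bdry_value f z)) \<le> ln ((1 + d) * (1 + x))"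
            using d by (subst ln_le_cancel_iff) (auto simp: add_pos_nonneg zero_less_mult_iff)
          also have "\<dots> = ln (1 + d) + ln (1 + x)" using d by (intro ln_mult_pos) auto
          also have "\<dots> \<le> d + ln (1 + x)" using ln_add_one_self_le_self[OF d(1)] by simp
          finally show ?case unfolding polyres_bdry[OF p(1) elim] d_def x_def .
        qed
      qed
      also have "\<dots> = inverse (real (Suc n)) + (\<integral>z. ln (1 + cmod (f (radii n *\<^sub>R z) - bdry_value f z)) \<partial>?M)"
        using i2 prob_space by simp
      finally have "smirnov_dist K (polyres K (p n)) f \<le> inverse (real (Suc n)) + (\<integral>z. ln (1 + cmod (f (radii n *\<^sub>R z) - bdry_value f z)) \<partial>?M)" .
      moreover have "0 \<le> smirnov_dist K (polyres K (p n)) f"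
        unfolding smirnov_dist_def by (rule Bochner_Integration.integral_nonneg) simp
      ultimately show "norm (smirnov_dist K (polyres K (p n)) f) \<le> inverse (real (Suc n)) + (\<integral>z. ln (1 + cmod (f (radii n *\<^sub>R z) - bdry_value f z)) \<partial>?M)"
        by simp
    qed
  qed
  ultimately show thesis using that p(1) by blast
qed

section \<open>Bounded holomorphic functions as a pre-Hilbert algebra\<close>

text \<open>Outside the domain the function is \<^const>\<open>undefined\<close>, as for all members of the Smirnov class.\<close>

definition cst :: "domain_kind \<Rightarrow> complex \<Rightarrow> complex ^ 'n \<Rightarrow> complex" where
  "cst K c = (\<lambda>z\<in>cdomain K. c)"

definition addf :: "domain_kind \<Rightarrow> (complex ^ 'n \<Rightarrow> complex) \<Rightarrow> (complex ^ 'n \<Rightarrow> complex) \<Rightarrow> complex ^ 'n \<Rightarrow> complex" where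
  "addf K f g = (\<lambda>z\<in>cdomain K. f z + g z)"

abbreviation multf :: "domain_kind \<Rightarrow> (complex ^ 'n \<Rightarrow> complex) \<Rightarrow> (complex ^ 'n \<Rightarrow> complex) \<Rightarrow> complex ^ 'n \<Rightarrow> complex" where
  "multf K \<equiv> mult_on (cdomain K)"

text \<open>The Hardy space inner product, used on bounded functions only.\<close>

definition ip :: "domain_kind \<Rightarrow> (complex ^ 'n \<Rightarrow> complex) \<Rightarrow> (complex ^ 'n \<Rightarrow> complex) \<Rightarrow> complex" where
  "ip K f g = (\<integral>z. bdry_value f z * cnj (bdry_value g z) \<partial>\<sigma> K)"

lemma cnj_borel_measurable [measurable]: "cnj \<in> borel_measurable borel"
  by (intro borel_measurable_continuous_onI continuous_intros)

lemma cst_eq_polyres: "cst K c = polyres K (\<lambda>_. c)"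
  by (simp add: cst_def polyres_def)

lemma cst_bounded_hol: "cst K c \<in> bounded_hol K"
  unfolding cst_eq_polyres by (rule polyres_bounded_hol[OF polyfun.const])

lemma cst_smirnov: "cst K c \<in> smirnov K"
  by (rule bounded_hol_smirnov[OF cst_bounded_hol])

lemma cst_apply [simp]: "z \<in> cdomain K \<Longrightarrow> cst K c z = c"
  by (simp add: cst_def)

lemma cst_bdry: "z \<in> cboundary K \<Longrightarrow> bdry_value (cst K c) z = c"
  unfolding cst_eq_polyres by (rule polyres_bdry[OF polyfun.const])

lemma addf_apply [simp]: "z \<in> cdomain K \<Longrightarrow> addf K f g z = f z + g z"
  by (simp add: addf_def)

lemma multf_apply [simp]: "z \<in> cdomain K \<Longrightarrow> multf K f g z = f z * g z"
  by (simp add: mult_on_def)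

lemma bounded_hol_addf:
  assumes f: "f \<in> bounded_hol K" and g: "g \<in> bounded_hol K"
  shows "addf K f g \<in> bounded_hol K"
proof -
  obtain M where M: "\<And>z. z \<in> cdomain K \<Longrightarrow> cmod (f z) \<le> M" using bounded_holE[OF f] by metis
  obtain N where N: "\<And>z. z \<in> cdomain K \<Longrightarrow> cmod (g z) \<le> N" using bounded_holE[OF g] by metis
  show ?thesis
  proof (rule bounded_holI)
    show "holomorphic_vec (addf K f g) (cdomain K)"
      by (rule holomorphic_vec_cong[OF holomorphic_vec_add[OF bounded_hol_hol[OF f] bounded_hol_hol[OF g]]]) simp
    show "cmod (addf K f g z) \<le> M + N" if "z \<in> cdomain K" for z
      using norm_triangle_ineq[of "f z" "g z"] M[OF that] N[OF that] that by simp
  qed (simp add: addf_def)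
qed

lemma bounded_hol_multf:
  assumes f: "f \<in> bounded_hol K" and g: "g \<in> bounded_hol K"
  shows "multf K f g \<in> bounded_hol K"
proof -
  obtain M where M: "0 < M" "\<And>z. z \<in> cdomain K \<Longrightarrow> cmod (f z) \<le> M" using bounded_holE[OF f] by metis
  obtain N where N: "\<And>z. z \<in> cdomain K \<Longrightarrow> cmod (g z) \<le> N" using bounded_holE[OF g] by metis
  show ?thesis
  proof (rule bounded_holI)
    show "holomorphic_vec (multf K f g) (cdomain K)"
      by (rule mult_on_hol[OF bounded_hol_hol[OF f] bounded_hol_hol[OF g]])
    show "cmod (multf K f g z) \<le> M * N" if "z \<in> cdomain K" for z
      using M(1) M(2)[OF that] N[OF that] that by (simp add: norm_mult mult_mono)
  qed simp
qed

lemma addf_bdry: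
  assumes f: "f \<in> bounded_hol K" and g: "g \<in> bounded_hol K"
  shows "AE z in \<sigma> K. bdry_value (addf K f g) z = bdry_value f z + bdry_value g z"
  using AE_boundary[of K] smirnov_radial_limits[OF bounded_hol_smirnov[OF f]] smirnov_radial_limits[OF bounded_hol_smirnov[OF g]]
proof eventually_elim
  case (elim z)
  show ?case
    by (rule bdry_value_combine(2)[OF elim]) (auto intro: tendsto_add)
qed

lemma multf_cst_bdry:
  assumes f: "f \<in> smirnov K"
  shows "AE z in \<sigma> K. bdry_value (multf K (cst K c) f) z = c * bdry_value f z"
  using smirnov_mult_on(2)[OF cst_smirnov f] AE_boundary[of K] by eventually_elim (simp add: cst_bdry)

lemma bounded_hol_bdry_bounded:
  assumes f: "f \<in> bounded_hol K"
  obtains M where "0 < M" "AE z in \<sigma> K. cmod (bdry_value f z) \<le> M"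
proof -
  obtain M where M: "0 < M" "\<And>z. z \<in> cdomain K \<Longrightarrow> cmod (f z) \<le> M" using bounded_holE[OF f] by metis
  show thesis by (rule that[OF M(1) bounded_hol_bdry_le[OF f M(2)]])
qed

lemma ip_integrable:
  assumes f: "f \<in> bounded_hol K" and g: "g \<in> bounded_hol K"
  shows "integrable (\<sigma> K) (\<lambda>z. bdry_value f z * cnj (bdry_value g z))"
proof -
  note [measurable] = smirnov_bdry_measurable[OF bounded_hol_smirnov[OF f]] smirnov_bdry_measurable[OF bounded_hol_smirnov[OF g]]
  obtain M where M: "0 < M" "AE z in \<sigma> K. cmod (bdry_value f z) \<le> M" using bounded_hol_bdry_bounded[OF f] by metis
  obtain N where N: "0 < N" "AE z in \<sigma> K. cmod (bdry_value g z) \<le> N" using bounded_hol_bdry_bounded[OF g] by metis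
  show ?thesis
  proof (rule boundary_integrable_bounded[of _ _ "M * N"])
    show "AE z in \<sigma> K. norm (bdry_value f z * cnj (bdry_value g z)) \<le> M * N"
      using M(2) N(2) by eventually_elim (use M(1) in \<open>simp add: norm_mult mult_mono\<close>)
  qed measurable
qed

lemma ip_addf_left:
  assumes f: "f \<in> bounded_hol K" and g: "g \<in> bounded_hol K" and h: "h \<in> bounded_hol K"
  shows "ip K (addf K f g) h = ip K f h + ip K g h"
proof -
  have "ip K (addf K f g) h = (\<integral>z. bdry_value f z * cnj (bdry_value h z) + bdry_value g z * cnj (bdry_value h z) \<partial>\<sigma> K)"
    unfolding ip_def
  proof (rule integral_cong_AE)
    note [measurable] = smirnov_bdry_measurable[OF bounded_hol_smirnov[OF f]] smirnov_bdry_measurable[OF bounded_hol_smirnov[OF g]]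
      smirnov_bdry_measurable[OF bounded_hol_smirnov[OF h]] smirnov_bdry_measurable[OF bounded_hol_smirnov[OF bounded_hol_addf[OF f g]]]
    show "(\<lambda>z. bdry_value (addf K f g) z * cnj (bdry_value h z)) \<in> borel_measurable (\<sigma> K)" by measurable
    show "(\<lambda>z. bdry_value f z * cnj (bdry_value h z) + bdry_value g z * cnj (bdry_value h z)) \<in> borel_measurable (\<sigma> K)" by measurable
    show "AE z in \<sigma> K. bdry_value (addf K f g) z * cnj (bdry_value h z) = bdry_value f z * cnj (bdry_value h z) + bdry_value g z * cnj (bdry_value h z)"
      using addf_bdry[OF f g] by eventually_elim (simp add: distrib_right)
  qed
  then show ?thesis using ip_integrable[OF f h] ip_integrable[OF g h] by (simp add: ip_def)
qed

lemma ip_scale_left: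
  assumes f: "f \<in> bounded_hol K" and h: "h \<in> bounded_hol K"
  shows "ip K (multf K (cst K c) f) h = c * ip K f h"
proof -
  have "ip K (multf K (cst K c) f) h = (\<integral>z. c * (bdry_value f z * cnj (bdry_value h z)) \<partial>\<sigma> K)"
    unfolding ip_def
  proof (rule integral_cong_AE)
    note [measurable] = smirnov_bdry_measurable[OF bounded_hol_smirnov[OF f]]
      smirnov_bdry_measurable[OF bounded_hol_smirnov[OF h]] smirnov_bdry_measurable[OF bounded_hol_smirnov[OF bounded_hol_multf[OF cst_bounded_hol f]]]
    show "(\<lambda>z. bdry_value (multf K (cst K c) f) z * cnj (bdry_value h z)) \<in> borel_measurable (\<sigma> K)" by measurable
    show "(\<lambda>z. c * (bdry_value f z * cnj (bdry_value h z))) \<in> borel_measurable (\<sigma> K)" by measurable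
    show "AE z in \<sigma> K. bdry_value (multf K (cst K c) f) z * cnj (bdry_value h z) = c * (bdry_value f z * cnj (bdry_value h z))"
      using multf_cst_bdry[OF bounded_hol_smirnov[OF f], of c] by eventually_elim simp
  qed
  then show ?thesis by (simp add: ip_def)
qed

lemma ip_cnj: "ip K g f = cnj (ip K f g)"
  unfolding ip_def by (simp flip: Bochner_Integration.integral_cnj add: mult.commute)

lemma ip_addf_right:
  assumes "f \<in> bounded_hol K" "g \<in> bounded_hol K" "h \<in> bounded_hol K"
  shows "ip K h (addf K f g) = ip K h f + ip K h g"
  using ip_addf_left[OF assms] by (metis ip_cnj complex_cnj_add)

lemma ip_scale_right:
  assumes "f \<in> bounded_hol K" "h \<in> bounded_hol K"
  shows "ip K h (multf K (cst K c) f) = cnj c * ip K h f"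
  using ip_scale_left[OF assms, of c] by (metis ip_cnj complex_cnj_mult)

lemma ip_dilate_limit:
  fixes f :: "complex ^ 'n \<Rightarrow> complex"
  assumes f: "f \<in> bounded_hol K" and g: "g \<in> bounded_hol K"
  shows "(\<lambda>n. \<integral>z. f (radii n *\<^sub>R z) * cnj (bdry_value g z) \<partial>\<sigma> K) \<longlonglongrightarrow> ip K f g"
proof -
  note fs = bounded_hol_smirnov[OF f] and gs = bounded_hol_smirnov[OF g]
  note [measurable] = smirnov_bdry_measurable[OF fs] smirnov_bdry_measurable[OF gs] dilate_radii_measurable[OF smirnov_hol[OF fs]]
  interpret prob_space "\<sigma> K :: (complex ^ 'n) measure" by (rule prob_space_boundary_measure)
  obtain M where M: "0 < M" "\<And>z. z \<in> cdomain K \<Longrightarrow> cmod (f z) \<le> M" using bounded_holE[OF f] by metis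
  obtain N where N: "0 < N" "AE z in \<sigma> K. cmod (bdry_value g z) \<le> N" using bounded_hol_bdry_bounded[OF g] by metis
  show ?thesis unfolding ip_def
  proof (rule integral_dominated_convergence[where w="\<lambda>_. M * N"])
    show "AE z in \<sigma> K. (\<lambda>n. f (radii n *\<^sub>R z) * cnj (bdry_value g z)) \<longlonglongrightarrow> bdry_value f z * cnj (bdry_value g z)"
      using smirnov_L1(3)[OF fs] by eventually_elim (intro tendsto_mult tendsto_const)
    show "AE z in \<sigma> K. norm (f (radii n *\<^sub>R z) * cnj (bdry_value g z)) \<le> M * N" for n
      using N(2) AE_boundary[of K]
    proof eventually_elim
      case (elim z)
      show ?case unfolding norm_mult complex_mod_cnj
        by (rule mult_mono) (use elim M(2)[OF dilate_in_domain[OF elim(2)]] M(1) in auto)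
    qed
  qed measurable
qed

lemma dilate_slice_holomorphic:
  fixes f :: "complex ^ 'n \<Rightarrow> complex"
  assumes f: "holomorphic_vec f (cdomain K)" and z: "z \<in> cboundary K"
  shows "(\<lambda>c. f (c *s (radii n *\<^sub>R z))) holomorphic_on ball 0 (1 / radii n)"
proof -
  have "(\<lambda>c. f (c *s z)) holomorphic_on ball 0 1"
    by (rule holomorphic_vec_slice[OF f subsetD[OF cboundary_subset_cclosed z]])
  from holomorphic_dilate(1)[OF this radii(1)[of n] radii(2)[of n]] show ?thesis
    by (simp add: scaleR_eq_smult mult.commute)
qed

lemma radii_inverse_gt_1: "1 < 1 / radii n"
  using radii[of n] by simp

text \<open>The mean value property over the circular slices.\<close>

lemma ip_one:
  fixes f :: "complex ^ 'n \<Rightarrow> complex"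
  assumes f: "f \<in> bounded_hol K"
  shows "ip K f (cst K 1) = f 0"
proof -
  interpret prob_space "\<sigma> K :: (complex ^ 'n) measure" by (rule prob_space_boundary_measure)
  note hol = bounded_hol_hol[OF f]
  have "(\<integral>z. f (radii n *\<^sub>R z) * cnj (bdry_value (cst K 1) z) \<partial>\<sigma> K) = f 0" for n
  proof -
    obtain B where B: "0 < B" "\<And>z. z \<in> cclosed K \<Longrightarrow> cmod (f (radii n *\<^sub>R z)) \<le> B"
      using dilate_bounded[OF hol less_imp_le[OF radii(1)] radii(2)] by metis
    have "(\<integral>z. f (radii n *\<^sub>R z) * cnj (bdry_value (cst K 1) z) \<partial>\<sigma> K) = (\<integral>z. f (radii n *\<^sub>R z) \<partial>\<sigma> K)"
      by (rule Bochner_Integration.integral_cong) (simp_all add: cst_bdry)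
    also have "\<dots> = (\<integral>z. \<integral>t. f (radii n *\<^sub>R (cis t *s z)) \<partial>unif_angle \<partial>\<sigma> K)"
      by (rule integral_slices[OF dilate_radii_measurable[OF hol], where B=B]) (use B cboundary_subset_cclosed in auto)
    also have "\<dots> = (\<integral>z. f 0 \<partial>(\<sigma> K :: (complex ^ 'n) measure))"
    proof (rule Bochner_Integration.integral_cong[OF refl])
      fix z :: "complex ^ 'n" assume "z \<in> space (\<sigma> K)"
      then have z: "z \<in> cboundary K" by simp
      have "radii n *\<^sub>R (cis t *s z) = cis t *s (radii n *\<^sub>R z)" for t by (simp add: scaleR_eq_smult mult.commute)
      then show "(\<integral>t. f (radii n *\<^sub>R (cis t *s z)) \<partial>unif_angle) = f 0"
        using holomorphic_mean_value[OF dilate_slice_holomorphic[OF hol z] radii_inverse_gt_1, of n] by simp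
    qed
    finally show ?thesis using prob_space by simp
  qed
  then have "(\<lambda>n::nat. f 0) \<longlonglongrightarrow> ip K f (cst K 1)" using ip_dilate_limit[OF f cst_bounded_hol, of 1] by simp
  then show ?thesis by (simp add: LIMSEQ_const_iff)
qed

definition crd :: "domain_kind \<Rightarrow> 'n \<Rightarrow> complex ^ 'n \<Rightarrow> complex" where
  "crd K j = polyres K (\<lambda>z. z $ j)"

lemma crd_bounded_hol: "crd K j \<in> bounded_hol K"
  unfolding crd_def by (rule polyres_bounded_hol[OF polyfun.coord])

lemma crd_apply [simp]: "z \<in> cdomain K \<Longrightarrow> crd K j z = z $ j"
  by (simp add: crd_def polyres_def)

lemma crd_bdry: "z \<in> cboundary K \<Longrightarrow> bdry_value (crd K j) z = z $ j"
  unfolding crd_def by (rule polyres_bdry[OF polyfun.coord])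

lemma mean_first_coefficient:
  assumes G: "G holomorphic_on ball 0 R" "1 < R" and d: "deriv G 0 = 0"
  shows "circle_mean (\<lambda>t. G (cis t) * cnj (cis t)) = 0"
proof -
  have hol0: "(\<lambda>z. G z - G 0) holomorphic_on ball 0 R" by (intro holomorphic_intros G)
  have z0: "G 0 - G 0 = 0" by simp
  obtain h where h: "h holomorphic_on ball 0 R" "\<And>z. norm z < R \<Longrightarrow> G z - G 0 = z * h z" "deriv (\<lambda>z. G z - G 0) 0 = h 0"
    by (rule Schwarz3[OF hol0 z0]) blast
  have Gd: "G field_differentiable at 0" using G by (intro holomorphic_on_imp_differentiable_at[OF G(1)]) auto
  have "h 0 = 0" using h(3) d Gd by (simp add: deriv_diff)
  have cG: "continuous_on UNIV (\<lambda>t. h (cis t))"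
    by (rule continuous_on_compose2[OF holomorphic_on_imp_continuous_on[OF h(1)]]) (use G(2) in \<open>auto intro!: continuous_intros\<close>)
  have eq: "G (cis t) * cnj (cis t) = h (cis t) + G 0 * cnj (cis t)" for t
  proof -
    have c: "cis t * cnj (cis t) = 1" by (simp add: cis_cnj cis_mult)
    have "G (cis t) = G 0 + cis t * h (cis t)" using h(2)[of "cis t"] G(2) by (simp add: algebra_simps)
    then have "G (cis t) * cnj (cis t) = G 0 * cnj (cis t) + h (cis t) * (cis t * cnj (cis t))" by (simp add: algebra_simps)
    then show ?thesis unfolding c by simp
  qed
  have "circle_mean (\<lambda>t. G (cis t) * cnj (cis t)) = circle_mean (\<lambda>t. h (cis t)) + circle_mean (\<lambda>t. G 0 * cnj (cis t))"
    unfolding eq by (intro Bochner_Integration.integral_add unif_angle_integral(1) cG continuous_intros)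
  also have "circle_mean (\<lambda>t. h (cis t)) = 0"
    using holomorphic_mean_value[OF h(1) G(2)] \<open>h 0 = 0\<close> by simp
  also have "circle_mean (\<lambda>t. G 0 * cnj (cis t)) = 0"
  proof -
    have "circle_mean (\<lambda>t. cnj (cis t)) = 0"
      using mean_cis_power[of 0 1] by (simp only: power_0 power_one_right mult_1) simp
    then show ?thesis by (simp only: integral_mult_right_zero mult_zero_right)
  qed
  finally show ?thesis by simp
qed

text \<open>On each slice the coordinate function is a multiple of the variable, so only the linear coefficient
  of \<open>f\<close> is seen.\<close>

lemma ip_crd_zero:
  fixes f :: "complex ^ 'n \<Rightarrow> complex"
  assumes f: "f \<in> bounded_hol K" and d: "\<And>z. z \<in> cdomain K \<Longrightarrow> deriv (\<lambda>c. f (c *s z)) 0 = 0"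
  shows "ip K f (crd K j) = 0"
proof -
  interpret prob_space "\<sigma> K :: (complex ^ 'n) measure" by (rule prob_space_boundary_measure)
  note hol = bounded_hol_hol[OF f]
  have "(\<integral>z. f (radii n *\<^sub>R z) * cnj (bdry_value (crd K j) z) \<partial>\<sigma> K) = 0" for n
  proof -
    obtain B where B: "0 < B" "\<And>z. z \<in> cclosed K \<Longrightarrow> cmod (f (radii n *\<^sub>R z)) \<le> B"
      using dilate_bounded[OF hol less_imp_le[OF radii(1)] radii(2)] by metis
    have nth: "continuous_on S (\<lambda>z :: complex ^ 'n. z $ j)" for S
      by (rule linear_continuous_on[OF bounded_linear_vec_nth])
    have m: "(\<lambda>z. f (radii n *\<^sub>R z) * cnj (z $ j)) \<in> borel_measurable (\<sigma> K)"
      by (intro borel_measurable_boundary continuous_on_mult continuous_on_cnj nth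
          continuous_on_subset[OF dilate_continuous[OF hol less_imp_le[OF radii(1)] radii(2)] cboundary_subset_cclosed])
    have z1: "cmod (z $ j) \<le> 1" if "z \<in> cboundary K" for z :: "complex ^ 'n"
      using that Finite_Cartesian_Product.norm_nth_le[of z j] by (cases K) auto
    have "(\<integral>z. f (radii n *\<^sub>R z) * cnj (bdry_value (crd K j) z) \<partial>\<sigma> K) = (\<integral>z. f (radii n *\<^sub>R z) * cnj (z $ j) \<partial>\<sigma> K)"
      by (rule Bochner_Integration.integral_cong) (simp_all add: crd_bdry)
    also have "\<dots> = (\<integral>z. \<integral>t. f (radii n *\<^sub>R (cis t *s z)) * cnj ((cis t *s z) $ j) \<partial>unif_angle \<partial>\<sigma> K)"
    proof (rule integral_slices[OF m, where B="B * 1"])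
      fix z :: "complex ^ 'n" assume z: "z \<in> cboundary K"
      show "cmod (f (radii n *\<^sub>R z) * cnj (z $ j)) \<le> B * 1"
        unfolding norm_mult using B(1) B(2)[OF subsetD[OF cboundary_subset_cclosed z]] z1[OF z] by (intro mult_mono) auto
    qed
    also have "\<dots> = (\<integral>z. 0 \<partial>(\<sigma> K :: (complex ^ 'n) measure))"
    proof (rule Bochner_Integration.integral_cong[OF refl])
      fix z :: "complex ^ 'n" assume "z \<in> space (\<sigma> K)"
      then have z: "z \<in> cboundary K" by simp
      have e: "radii n *\<^sub>R (cis t *s z) = cis t *s (radii n *\<^sub>R z)" for t by (simp add: scaleR_eq_smult mult.commute)
      have "(\<integral>t. f (cis t *s (radii n *\<^sub>R z)) * cnj (cis t) \<partial>unif_angle) = 0"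
        by (rule mean_first_coefficient[OF dilate_slice_holomorphic[OF hol z] radii_inverse_gt_1 d[OF dilate_in_domain[OF z]]])
      moreover have "f (radii n *\<^sub>R (cis t *s z)) * cnj ((cis t *s z) $ j) = cnj (z $ j) * (f (cis t *s (radii n *\<^sub>R z)) * cnj (cis t))" for t
        unfolding e by (simp only: vector_smult_component complex_cnj_mult mult_ac)
      ultimately show "(\<integral>t. f (radii n *\<^sub>R (cis t *s z)) * cnj ((cis t *s z) $ j) \<partial>unif_angle) = 0"
        by (simp only: integral_mult_right_zero mult_zero_right)
    qed
    finally show ?thesis by simp
  qed
  then show ?thesis using ip_dilate_limit[OF f crd_bounded_hol, of j] by (simp add: LIMSEQ_const_iff)
qed

lemma ip_self_zero:
  fixes f :: "complex ^ 'n \<Rightarrow> complex"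
  assumes f: "f \<in> bounded_hol K" and z: "ip K f f = 0"
  shows "f = cst K 0"
proof (rule smirnov_dist_eq_0[OF bounded_hol_smirnov[OF f] cst_smirnov])
  note fs = bounded_hol_smirnov[OF f]
  note [measurable] = smirnov_bdry_measurable[OF fs]
  have "ip K f f = of_real (\<integral>z. (cmod (bdry_value f z))\<^sup>2 \<partial>\<sigma> K)"
    unfolding ip_def integral_complex_of_real[symmetric] complex_norm_square ..
  then have "(\<integral>z. (cmod (bdry_value f z))\<^sup>2 \<partial>\<sigma> K) = 0" using z by simp
  moreover have "integrable (\<sigma> K) (\<lambda>z. (cmod (bdry_value f z))\<^sup>2)"
    using integrable_norm[OF ip_integrable[OF f f]] by (simp add: norm_mult power2_eq_square)
  ultimately have ae: "AE z in \<sigma> K. (cmod (bdry_value f z))\<^sup>2 = 0"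
    by (subst (asm) integral_nonneg_eq_0_iff_AE) auto
  have "smirnov_dist K f (cst K 0) = (\<integral>z. 0 \<partial>(\<sigma> K :: (complex ^ 'n) measure))"
    unfolding smirnov_dist_def
  proof (rule integral_cong_AE)
    show "(\<lambda>z. ln (1 + cmod (bdry_value f z - bdry_value (cst K 0) z))) \<in> borel_measurable (\<sigma> K)"
      using smirnov_diff_convergence(1)[OF fs cst_smirnov] by auto
    show "AE z in \<sigma> K. ln (1 + cmod (bdry_value f z - bdry_value (cst K 0) z)) = 0"
      using ae AE_boundary[of K] by eventually_elim (simp add: cst_bdry)
  qed simp
  then show "smirnov_dist K f (cst K 0) = 0" by simp
qed

text \<open>The form in which vanishing of the variance \<open>ip f f - \<bar>f 0\<bar>\<^sup>2\<close> is used.\<close>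

lemma ip_self_eq_cst:
  fixes f :: "complex ^ 'n \<Rightarrow> complex"
  assumes f: "f \<in> bounded_hol K" and z: "ip K (addf K f (cst K (- f 0))) (addf K f (cst K (- f 0))) = 0"
  shows "f = cst K (f 0)"
proof (rule extensional_eqI[OF bounded_hol_ext[OF f] bounded_hol_ext[OF cst_bounded_hol]])
  fix w :: "complex ^ 'n" assume w: "w \<in> cdomain K"
  have "addf K f (cst K (- f 0)) = cst K 0"
    by (rule ip_self_zero[OF bounded_hol_addf[OF f cst_bounded_hol] z])
  from fun_cong[OF this, of w] show "f w = cst K (f 0) w" using w by simp
qed

text \<open>The boundary values of \<open>D = f - f 0\<close> are real too, so the mean of \<open>\<bar>D\<bar>\<^sup>2\<close> is that of the holomorphic
  function \<open>D\<^sup>2\<close>, which is its value \<open>0\<close> at the origin.\<close>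

lemma bounded_hol_real_boundary_const:
  fixes f :: "complex ^ 'n \<Rightarrow> complex"
  assumes f: "f \<in> bounded_hol K" and re: "AE z in \<sigma> K. Im (bdry_value f z) = 0"
  shows "f = cst K (f 0)"
proof (rule ip_self_eq_cst[OF f])
  let ?D = "addf K f (cst K (- f 0))"
  note D = bounded_hol_addf[OF f cst_bounded_hol[of K "- f 0"]]
  note DD = bounded_hol_multf[OF D D]
  have b1: "AE z in \<sigma> K. bdry_value ?D z = bdry_value f z - f 0"
    using addf_bdry[OF f cst_bounded_hol[of K "- f 0"]] AE_boundary[of K] by eventually_elim (simp add: cst_bdry)
  have "ip K f (cst K 1) = (\<integral>z. complex_of_real (Re (bdry_value f z)) \<partial>\<sigma> K)"
    unfolding ip_def
  proof (rule integral_cong_AE)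
    note [measurable] = smirnov_bdry_measurable[OF bounded_hol_smirnov[OF f]] smirnov_bdry_measurable[OF cst_smirnov]
    show "(\<lambda>z. bdry_value f z * cnj (bdry_value (cst K 1) z)) \<in> borel_measurable (\<sigma> K)" by measurable
    show "(\<lambda>z. complex_of_real (Re (bdry_value f z))) \<in> borel_measurable (\<sigma> K)" by measurable
    show "AE z in \<sigma> K. bdry_value f z * cnj (bdry_value (cst K 1) z) = complex_of_real (Re (bdry_value f z))"
      using re AE_boundary[of K] by eventually_elim (simp add: cst_bdry complex_eq_iff)
  qed
  also have "\<dots> = of_real (\<integral>z. Re (bdry_value f z) \<partial>\<sigma> K)" by (rule integral_complex_of_real)
  finally have f0: "Im (f 0) = 0" unfolding ip_one[OF f] by simp
  have "ip K ?D ?D = ip K (multf K ?D ?D) (cst K 1)"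
    unfolding ip_def
  proof (rule integral_cong_AE)
    note [measurable] = smirnov_bdry_measurable[OF bounded_hol_smirnov[OF D]] smirnov_bdry_measurable[OF bounded_hol_smirnov[OF DD]] smirnov_bdry_measurable[OF cst_smirnov]
    show "(\<lambda>z. bdry_value ?D z * cnj (bdry_value ?D z)) \<in> borel_measurable (\<sigma> K)" by measurable
    show "(\<lambda>z. bdry_value (multf K ?D ?D) z * cnj (bdry_value (cst K 1) z)) \<in> borel_measurable (\<sigma> K)" by measurable
    show "AE z in \<sigma> K. bdry_value ?D z * cnj (bdry_value ?D z) = bdry_value (multf K ?D ?D) z * cnj (bdry_value (cst K 1) z)"
      using b1 re AE_boundary[of K] smirnov_mult_on(2)[OF bounded_hol_smirnov[OF D] bounded_hol_smirnov[OF D]]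
    proof eventually_elim
      case (elim z)
      have "cnj (bdry_value ?D z) = bdry_value ?D z" unfolding elim(1) using elim(2) f0 by (simp add: complex_eq_iff)
      then show ?case using elim(3,4) by (simp add: cst_bdry)
    qed
  qed
  also have "\<dots> = multf K ?D ?D 0" by (rule ip_one[OF DD])
  also have "\<dots> = 0" by simp
  finally show "ip K ?D ?D = 0" .
qed

text \<open>Both \<open>ip f f\<close> and \<open>\<bar>f 0\<bar>\<^sup>2\<close> equal \<open>1\<close>, so \<open>f\<close> has variance zero.\<close>

lemma bounded_hol_unimodular_const:
  fixes f :: "complex ^ 'n \<Rightarrow> complex"
  assumes f: "f \<in> bounded_hol K" and u: "\<And>z. z \<in> cdomain K \<Longrightarrow> cmod (f z) = 1"
  shows "f = cst K (f 0)"
proof (rule ip_self_eq_cst[OF f])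
  interpret prob_space "\<sigma> K :: (complex ^ 'n) measure" by (rule prob_space_boundary_measure)
  let ?c = "cst K (- f 0) :: complex ^ 'n \<Rightarrow> complex"
  have c: "?c \<in> bounded_hol K" by (rule cst_bounded_hol)
  have ct: "multf K (cst K a) (cst K b) = cst K (a * b)" for a b
    by (rule extensional_eqI[OF mult_on_ext bounded_hol_ext[OF cst_bounded_hol]]) simp
  have cc: "?c = multf K (cst K (- f 0)) (cst K 1)" by (simp add: ct)
  have ff: "ip K f f = 1"
  proof -
    have "ip K f f = (\<integral>z. 1 \<partial>(\<sigma> K :: (complex ^ 'n) measure))"
      unfolding ip_def
    proof (rule integral_cong_AE)
      note [measurable] = smirnov_bdry_measurable[OF bounded_hol_smirnov[OF f]]
      show "(\<lambda>z. bdry_value f z * cnj (bdry_value f z)) \<in> borel_measurable (\<sigma> K)" by measurable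
      show "AE z in \<sigma> K. bdry_value f z * cnj (bdry_value f z) = 1"
        using smirnov_L1(3)[OF bounded_hol_smirnov[OF f]] AE_boundary[of K]
      proof eventually_elim
        case (elim z)
        have "(\<lambda>n. cmod (f (radii n *\<^sub>R z))) \<longlonglongrightarrow> cmod (bdry_value f z)" by (intro tendsto_norm elim)
        then have "(\<lambda>n::nat. 1::real) \<longlonglongrightarrow> cmod (bdry_value f z)" using u dilate_in_domain[OF elim(2)] by simp
        then have "cmod (bdry_value f z) = 1" by (simp add: LIMSEQ_const_iff)
        then show ?case by (simp flip: complex_norm_square)
      qed
    qed simp
    then show ?thesis using prob_space by simp
  qed
  have "ip K (cst K 1) (cst K 1 :: complex ^ 'n \<Rightarrow> complex) = 1"
    using ip_one[OF cst_bounded_hol[of K 1, where ?'a='n]] by simp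
  then have 1: "ip K (cst K 1) f = cnj (f 0)" "ip K f (cst K 1) = f 0" "ip K (cst K 1) (cst K 1 :: complex ^ 'n \<Rightarrow> complex) = 1"
    using ip_one[OF f] ip_cnj[of K "cst K 1" f] ip_one[OF cst_bounded_hol[of K 1, where ?'a='n]] by auto
  have n: "f 0 * cnj (f 0) = 1" using u[of 0] by (simp flip: complex_norm_square)
  have s1: "ip K g ?c = cnj (- f 0) * ip K g (cst K 1)" "ip K ?c g = - f 0 * ip K (cst K 1) g" if "g \<in> bounded_hol K" for g
    using ip_scale_right[OF cst_bounded_hol that, of "- f 0" 1] ip_scale_left[OF cst_bounded_hol that, of "- f 0" 1] by (simp_all add: ct)
  have "ip K (addf K f ?c) (addf K f ?c) = (ip K f f + ip K f ?c) + (ip K ?c f + ip K ?c ?c)"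
    by (simp only: ip_addf_left[OF f c bounded_hol_addf[OF f c]] ip_addf_right[OF f c f] ip_addf_right[OF f c c])
  also have "\<dots> = 1 + cnj (- f 0) * f 0 + ((- f 0) * cnj (f 0) + cnj (- f 0) * (- f 0))"
    using s1[OF f] s1[OF c] s1[OF cst_bounded_hol[of K 1]] ff 1 by simp
  also have "\<dots> = 1 - f 0 * cnj (f 0)" by simp
  finally show "ip K (addf K f ?c) (addf K f ?c) = 0" using n by simp
qed

section \<open>Multiplicative isometries\<close>

lemma smirnov_dist_cst: "smirnov_dist K (cst K a :: complex ^ 'n \<Rightarrow> complex) (cst K b) = ln (1 + cmod (a - b))"
proof -
  interpret prob_space "\<sigma> K :: (complex ^ 'n) measure" by (rule prob_space_boundary_measure)
  have "smirnov_dist K (cst K a :: complex ^ 'n \<Rightarrow> complex) (cst K b) = (\<integral>z. ln (1 + cmod (a - b)) \<partial>(\<sigma> K :: (complex ^ 'n) measure))"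
    unfolding smirnov_dist_def by (rule Bochner_Integration.integral_cong) (simp_all add: cst_bdry)
  then show ?thesis using prob_space by simp
qed

lemma smirnov_dist_zero:
  "smirnov_dist K f (cst K 0 :: complex ^ 'n \<Rightarrow> complex) = (\<integral>z. ln (1 + cmod (bdry_value f z)) \<partial>\<sigma> K)"
  unfolding smirnov_dist_def by (rule Bochner_Integration.integral_cong) (simp_all add: cst_bdry)

lemma multf_cst_cst: "multf K (cst K a) (cst K b) = cst K (a * b)"
  by (rule extensional_eqI[OF mult_on_ext bounded_hol_ext[OF cst_bounded_hol]]) simp

lemma multf_one: "f \<in> smirnov K \<Longrightarrow> multf K (cst K 1) f = f" "f \<in> smirnov K \<Longrightarrow> multf K f (cst K 1) = f"
  by (rule extensional_eqI[OF mult_on_ext smirnov_ext]; simp)+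

lemma multf_zero: "multf K f (cst K 0) = cst K 0"
  by (rule extensional_eqI[OF mult_on_ext bounded_hol_ext[OF cst_bounded_hol]]) simp

lemma multf_commute: "multf K f g = multf K g f"
  by (rule extensional_eqI[OF mult_on_ext mult_on_ext]) simp

primrec fpow :: "domain_kind \<Rightarrow> (complex ^ 'n \<Rightarrow> complex) \<Rightarrow> nat \<Rightarrow> complex ^ 'n \<Rightarrow> complex" where
  "fpow K f 0 = cst K 1"
| "fpow K f (Suc n) = multf K f (fpow K f n)"

lemma fpow_smirnov: "f \<in> smirnov K \<Longrightarrow> fpow K f n \<in> smirnov K"
  by (induction n) (auto intro: cst_smirnov smirnov_mult_on)

lemma fpow_bdry:
  assumes f: "f \<in> smirnov K"
  shows "AE z in \<sigma> K. bdry_value (fpow K f n) z = bdry_value f z ^ n"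
proof (induction n)
  case 0
  show ?case using AE_boundary[of K] by eventually_elim (simp add: cst_bdry)
next
  case (Suc n)
  then show ?case using smirnov_mult_on(2)[OF f fpow_smirnov[OF f, of n]] by eventually_elim simp
qed

lemma ln_1_plus_power_bounds:
  assumes x: "0 \<le> (x::real)"
  shows "real n * log_plus x \<le> ln (1 + x ^ n)" and "ln (1 + x ^ n) \<le> ln 2 + real n * log_plus x"
proof -
  have "real n * log_plus x \<le> ln (1 + x ^ n) \<and> ln (1 + x ^ n) \<le> ln 2 + real n * log_plus x"
  proof (cases "x \<le> 1")
    case True
    then have "log_plus x = 0" using x log_plus_eq_0_iff by blast
    moreover have "x ^ n \<le> 1" "0 \<le> x ^ n" using True x by (auto simp: power_le_one)
    ultimately show ?thesis by simp
  next
    case False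
    then have l: "log_plus x = ln x" by (simp add: log_plus_def)
    have p: "1 \<le> x ^ n" using False by simp
    have "ln (x ^ n) \<le> ln (1 + x ^ n)" using p by simp
    moreover have "ln (1 + x ^ n) \<le> ln (2 * x ^ n)" using p by simp
    moreover have "ln (2 * x ^ n) = ln 2 + ln (x ^ n)" using p by (intro ln_mult_pos) auto
    ultimately show ?thesis unfolding l using False by (simp add: ln_realpow)
  qed
  then show "real n * log_plus x \<le> ln (1 + x ^ n)" "ln (1 + x ^ n) \<le> ln 2 + real n * log_plus x" by auto
qed

text \<open>The distances of the powers from \<open>0\<close> grow linearly with rate the mean of \<open>log_plus \<bar>f\<bar>\<close>. A multiplicative
  isometry commutes with powers, so it preserves this mean.\<close>

lemma log_plus_mean_limit:
  fixes f :: "complex ^ 'n \<Rightarrow> complex"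
  assumes f: "f \<in> smirnov K"
  shows "(\<lambda>n. smirnov_dist K (fpow K f (Suc n)) (cst K 0) / real (Suc n)) \<longlonglongrightarrow> (\<integral>z. log_plus (cmod (bdry_value f z)) \<partial>\<sigma> K)"
proof -
  interpret prob_space "\<sigma> K :: (complex ^ 'n) measure" by (rule prob_space_boundary_measure)
  note [measurable] = smirnov_bdry_measurable[OF f] smirnov_bdry_measurable[OF fpow_smirnov[OF f]]
  let ?L = "\<integral>z. log_plus (cmod (bdry_value f z)) \<partial>\<sigma> K"
  note int = smirnov_L1(1)[OF f]
  have di: "integrable (\<sigma> K) (\<lambda>z. ln (1 + cmod (bdry_value (fpow K f n) z)))" for n
  proof -
    have "integrable (\<sigma> K) (\<lambda>z. ln (1 + cmod (bdry_value (fpow K f n) z - bdry_value (cst K 0) z)))"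
      by (rule smirnov_diff_convergence(1)[OF fpow_smirnov[OF f] cst_smirnov])
    then show ?thesis by (rule Bochner_Integration.integrable_cong[THEN iffD1, rotated 2]) (auto simp: cst_bdry)
  qed
  have lo: "real n * ?L \<le> smirnov_dist K (fpow K f n) (cst K 0)" for n
  proof -
    have "real n * ?L = (\<integral>z. real n * log_plus (cmod (bdry_value f z)) \<partial>\<sigma> K)" by simp
    also have "\<dots> \<le> (\<integral>z. ln (1 + cmod (bdry_value (fpow K f n) z)) \<partial>\<sigma> K)"
    proof (rule integral_mono_AE)
      show "AE z in \<sigma> K. real n * log_plus (cmod (bdry_value f z)) \<le> ln (1 + cmod (bdry_value (fpow K f n) z))"
        using fpow_bdry[OF f, of n] by eventually_elim (simp add: norm_power ln_1_plus_power_bounds(1))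
    qed (auto intro: int di)
    finally show ?thesis by (simp add: smirnov_dist_zero)
  qed
  have hi: "smirnov_dist K (fpow K f n) (cst K 0) \<le> ln 2 + real n * ?L" for n
  proof -
    have "(\<integral>z. ln (1 + cmod (bdry_value (fpow K f n) z)) \<partial>\<sigma> K) \<le> (\<integral>z. ln 2 + real n * log_plus (cmod (bdry_value f z)) \<partial>\<sigma> K)"
    proof (rule integral_mono_AE)
      show "AE z in \<sigma> K. ln (1 + cmod (bdry_value (fpow K f n) z)) \<le> ln 2 + real n * log_plus (cmod (bdry_value f z))"
        using fpow_bdry[OF f, of n] by eventually_elim (simp add: norm_power ln_1_plus_power_bounds(2))
    qed (auto intro!: int di Bochner_Integration.integrable_add)
    also have "\<dots> = ln 2 + real n * ?L" using int prob_space by (subst Bochner_Integration.integral_add) auto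
    finally show ?thesis by (simp add: smirnov_dist_zero)
  qed
  show ?thesis
  proof (rule real_tendsto_sandwich)
    show "eventually (\<lambda>n. ?L \<le> smirnov_dist K (fpow K f (Suc n)) (cst K 0) / real (Suc n)) sequentially"
      by (rule always_eventually, rule allI, subst pos_le_divide_eq) (use lo[of "Suc _"] in \<open>simp_all only: mult.commute of_nat_0_less_iff zero_less_Suc\<close>)
    show "eventually (\<lambda>n. smirnov_dist K (fpow K f (Suc n)) (cst K 0) / real (Suc n) \<le> ln 2 / real (Suc n) + ?L) sequentially"
    proof (rule always_eventually, rule allI)
      fix n
      have "smirnov_dist K (fpow K f (Suc n)) (cst K 0) / real (Suc n) \<le> (ln 2 + real (Suc n) * ?L) / real (Suc n)"
        by (rule divide_right_mono[OF hi]) simp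
      also have "\<dots> = ln 2 / real (Suc n) + ?L" by (simp add: add_divide_distrib del: of_nat_Suc)
      finally show "smirnov_dist K (fpow K f (Suc n)) (cst K 0) / real (Suc n) \<le> ln 2 / real (Suc n) + ?L" .
    qed
    have "(\<lambda>n. ln 2 * inverse (real (Suc n)) + ?L) \<longlonglongrightarrow> ln 2 * 0 + ?L" by (intro tendsto_intros LIMSEQ_inverse_real_of_nat)
    then show "(\<lambda>n. ln 2 / real (Suc n) + ?L) \<longlonglongrightarrow> ?L" by (simp add: divide_inverse)
  qed simp
qed

text \<open>Equality in the triangle inequality.\<close>

lemma norm_eq_1_plus_imp_real:
  assumes "cmod w = 1 + cmod (w - 1)"
  shows "Im w = 0"
proof -
  have "(cmod w - 1)\<^sup>2 = (cmod (w - 1))\<^sup>2" using assms by simp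
  then have "1 + (cmod w)\<^sup>2 - 2 * cmod w = (Re w - 1)\<^sup>2 + (Im w)\<^sup>2" by (simp add: cmod_power2[of "w - 1"] power2_diff)
  then have "cmod w = Re w" unfolding cmod_power2 by (simp add: power2_diff)
  then have "(cmod w)\<^sup>2 = (Re w)\<^sup>2" by simp
  then show ?thesis unfolding cmod_power2 by simp
qed

locale multiplicative_isometry =
  fixes K :: domain_kind and T :: "(complex ^ 'n \<Rightarrow> complex) \<Rightarrow> complex ^ 'n \<Rightarrow> complex"
  assumes surj: "T ` smirnov K = smirnov K"
    and isometry: "\<And>f g. f \<in> smirnov K \<Longrightarrow> g \<in> smirnov K \<Longrightarrow>
        smirnov_dist K (T f) (T g) = smirnov_dist K f g"
    and multiplicative: "\<And>f g. f \<in> smirnov K \<Longrightarrow> g \<in> smirnov K \<Longrightarrow> T (multf K f g) = multf K (T f) (T g)"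
begin

lemma T_smirnov: "f \<in> smirnov K \<Longrightarrow> T f \<in> smirnov K"
  using surj by blast

lemma T_inj: "inj_on T (smirnov K)"
proof (rule inj_onI)
  fix f g assume fg: "f \<in> smirnov K" "g \<in> smirnov K" "T f = T g"
  then have "smirnov_dist K f g = 0" using isometry[OF fg(1,2)] by (simp add: smirnov_dist_def)
  then show "f = g" by (rule smirnov_dist_eq_0[OF fg(1,2)])
qed

lemma T_one: "T (cst K 1) = cst K 1"
proof -
  have "cst K 1 \<in> T ` smirnov K" unfolding surj by (rule cst_smirnov)
  then obtain e where e: "e \<in> smirnov K" "T e = cst K 1" by (auto elim!: imageE)
  have "T (multf K (cst K 1) e) = multf K (T (cst K 1)) (T e)" by (rule multiplicative[OF cst_smirnov e(1)])
  then have "multf K (T (cst K 1)) (cst K 1) = cst K 1" unfolding multf_one(1)[OF e(1)] e(2) by (rule sym)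
  then show ?thesis unfolding multf_one(2)[OF T_smirnov[OF cst_smirnov]] .
qed

lemma T_zero: "T (cst K 0) = cst K 0"
proof -
  have "cst K 0 \<in> T ` smirnov K" unfolding surj by (rule cst_smirnov)
  then obtain e where e: "e \<in> smirnov K" "T e = cst K 0" by (auto elim!: imageE)
  have "T (multf K e (cst K 0)) = multf K (T e) (T (cst K 0))" by (rule multiplicative[OF e(1) cst_smirnov])
  then show ?thesis unfolding e(2) multf_zero multf_commute[of K "cst K 0"] .
qed

lemma T_fpow: "f \<in> smirnov K \<Longrightarrow> T (fpow K f n) = fpow K (T f) n"
  by (induction n) (simp_all add: T_one multiplicative fpow_smirnov)

lemma T_mean_log_plus:
  assumes f: "f \<in> smirnov K"
  shows "(\<integral>z. log_plus (cmod (bdry_value (T f) z)) \<partial>\<sigma> K) = (\<integral>z. log_plus (cmod (bdry_value f z)) \<partial>\<sigma> K)"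
proof (rule LIMSEQ_unique[OF log_plus_mean_limit[OF T_smirnov[OF f]]])
  have eq: "smirnov_dist K (fpow K (T f) n) (cst K 0) = smirnov_dist K (fpow K f n) (cst K 0)" for n
    using isometry[OF fpow_smirnov[OF f, of n] cst_smirnov[of K 0]] unfolding T_fpow[OF f] T_zero .
  show "(\<lambda>n. smirnov_dist K (fpow K (T f) (Suc n)) (cst K 0) / real (Suc n)) \<longlonglongrightarrow> (\<integral>z. log_plus (cmod (bdry_value f z)) \<partial>\<sigma> K)"
    unfolding eq by (rule log_plus_mean_limit[OF f])
qed

text \<open>Being bounded by \<open>1\<close> means, for Smirnov functions, that the mean of \<open>log_plus\<close> of the modulus on the
  boundary vanishes.\<close>

lemma T_contract:
  assumes f: "f \<in> smirnov K" and le: "\<And>z. z \<in> cdomain K \<Longrightarrow> cmod (f z) \<le> 1" and z: "z \<in> cdomain K"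
  shows "cmod (T f z) \<le> 1"
proof (rule smirnov_bdry_le_imp[OF T_smirnov[OF f] _ z])
  have "f \<in> bounded_hol K" using bounded_holI[OF smirnov_ext[OF f] smirnov_hol[OF f] le] by blast
  then have ae: "AE z in \<sigma> K. cmod (bdry_value f z) \<le> 1" by (rule bounded_hol_bdry_le) (rule le)
  have "(\<integral>z. log_plus (cmod (bdry_value f z)) \<partial>\<sigma> K) = 0"
    by (rule integral_eq_zero_AE) (use ae in eventually_elim, simp add: log_plus_eq_0_iff)
  then have "(\<integral>z. log_plus (cmod (bdry_value (T f) z)) \<partial>\<sigma> K) = 0" using T_mean_log_plus[OF f] by simp
  then have "AE z in \<sigma> K. log_plus (cmod (bdry_value (T f) z)) = 0"
    using integral_nonneg_eq_0_iff_AE[OF smirnov_L1(1)[OF T_smirnov[OF f]]] by (simp add: log_plus_def)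
  then show "AE z in \<sigma> K. cmod (bdry_value (T f) z) \<le> 1"
    by eventually_elim (simp add: log_plus_eq_0_iff)
qed

text \<open>Whatever is shown for \<open>T\<close> thereby holds for the inverse as well.\<close>

lemma inverse_isometry: "multiplicative_isometry K (inv_into (smirnov K) T)"
proof
  let ?S = "inv_into (smirnov K) T"
  have S: "?S f \<in> smirnov K" "T (?S f) = f" if "f \<in> smirnov K" for f
    using that inv_into_into[of f T "smirnov K"] f_inv_into_f[of f T "smirnov K"] unfolding surj by blast+
  have ST: "?S (T f) = f" if "f \<in> smirnov K" for f by (rule inv_into_f_f[OF T_inj that])
  show "?S ` smirnov K = smirnov K"
  proof
    show "smirnov K \<subseteq> ?S ` smirnov K"
    proof
      fix f :: "complex ^ 'n \<Rightarrow> complex" assume "f \<in> smirnov K"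
      then show "f \<in> ?S ` smirnov K" by (intro image_eqI[of _ _ "T f"]) (simp_all add: ST T_smirnov)
    qed
  qed (use S in auto)
  show "smirnov_dist K (?S f) (?S g) = smirnov_dist K f g" if "f \<in> smirnov K" "g \<in> smirnov K" for f g
    using isometry[OF S(1)[OF that(1)] S(1)[OF that(2)]] S(2) that by simp
  show "?S (multf K f g) = multf K (?S f) (?S g)" if "f \<in> smirnov K" "g \<in> smirnov K" for f g
  proof -
    have "multf K f g = T (multf K (?S f) (?S g))" using multiplicative[OF S(1)[OF that(1)] S(1)[OF that(2)]] S(2) that by simp
    then show ?thesis using ST[OF smirnov_mult_on(1)[OF S(1)[OF that(1)] S(1)[OF that(2)]]] by simp
  qed
qed

lemma T_cst_mult: "multf K (T (cst K a)) (T (cst K b)) = T (cst K (a * b))"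
  using multiplicative[OF cst_smirnov[of K a] cst_smirnov[of K b]] by (simp add: multf_cst_cst)

lemma T_cst_contract: "cmod a \<le> 1 \<Longrightarrow> z \<in> cdomain K \<Longrightarrow> cmod (T (cst K a) z) \<le> 1"
  by (rule T_contract[OF cst_smirnov]) auto

lemma T_cst_bounded_hol: "cmod a \<le> 1 \<Longrightarrow> T (cst K a) \<in> bounded_hol K"
  using bounded_holI[OF smirnov_ext smirnov_hol T_cst_contract, OF T_smirnov T_smirnov, OF cst_smirnov cst_smirnov] by blast

lemma T_cst_mean_log_plus: "(\<integral>z. log_plus (cmod (bdry_value (T (cst K a)) z)) \<partial>\<sigma> K) = log_plus (cmod a)"
proof -
  interpret prob_space "\<sigma> K :: (complex ^ 'n) measure" by (rule prob_space_boundary_measure)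
  have "(\<integral>z. log_plus (cmod (bdry_value (cst K a :: complex ^ 'n \<Rightarrow> complex) z)) \<partial>\<sigma> K) = (\<integral>z. log_plus (cmod a) \<partial>(\<sigma> K :: (complex ^ 'n) measure))"
    by (rule Bochner_Integration.integral_cong) (simp_all add: cst_bdry)
  then show ?thesis using T_mean_log_plus[OF cst_smirnov[of K a]] prob_space by simp
qed

text \<open>Put \<open>g = T c\<close>. Both the mean of \<open>log_plus \<bar>g\<bar>\<close> and the distance from \<open>g\<close> to \<open>1 = T 1\<close> equal \<open>ln c\<close>,
  while \<open>\<bar>g\<bar> \<le> 1 + \<bar>g - 1\<bar>\<close>; hence there is equality almost everywhere and \<open>g\<close> is real on the boundary.
  Its inverse \<open>g' = T (1 / c)\<close> is bounded and real on the boundary, so it is constant. The two equal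
  quantities then determine the constant.\<close>

lemma T_cst_gt_1:
  assumes c: "1 < c"
  shows "T (cst K (of_real c)) = cst K (of_real c)"
proof -
  interpret prob_space "\<sigma> K :: (complex ^ 'n) measure" by (rule prob_space_boundary_measure)
  let ?g = "T (cst K (of_real c))" and ?g' = "T (cst K (of_real (1 / c)))"
  note g = T_smirnov[OF cst_smirnov[of K "of_real c"]]
  have sc: "cmod (of_real (1 / c)) \<le> 1" using c by (simp add: norm_divide)
  note g' = T_cst_bounded_hol[OF sc]
  have gle: "AE z in \<sigma> K. cmod (bdry_value ?g' z) \<le> 1"
    by (rule bounded_hol_bdry_le[OF g']) (rule T_cst_contract[OF sc])
  have gg: "multf K ?g ?g' = cst K 1" unfolding T_cst_mult using c by (simp add: T_one)
  have nc: "cmod (of_real c - 1) = c - 1" using norm_of_real[of "c - 1", where ?'a=complex] c by simp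
  have d0: "smirnov_dist K ?g (cst K 1) = ln c"
    using isometry[OF cst_smirnov[of K "of_real c"] cst_smirnov[of K 1]] unfolding T_one smirnov_dist_cst nc by simp
  then have d: "(\<integral>z. ln (1 + cmod (bdry_value ?g z - bdry_value (cst K 1) z)) \<partial>\<sigma> K) = ln c"
    unfolding smirnov_dist_def .
  have l: "(\<integral>z. log_plus (cmod (bdry_value ?g z)) \<partial>\<sigma> K) = ln c"
    using T_cst_mean_log_plus[of "of_real c"] c by (simp add: log_plus_def)
  note i1 = smirnov_diff_convergence(1)[OF g cst_smirnov[of K 1]] and i2 = smirnov_L1(1)[OF g]
  have le: "log_plus (cmod w) \<le> ln (1 + cmod (w - 1))" for w
  proof -
    have "cmod w \<le> 1 + cmod (w - 1)" using norm_triangle_ineq[of 1 "w - 1"] by simp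
    moreover have "ln (cmod w) \<le> ln (1 + cmod (w - 1))" if "w \<noteq> 0" using that calculation by (subst ln_le_cancel_iff) (auto simp: add_pos_nonneg)
    ultimately show ?thesis by (cases "w = 0") (auto simp: log_plus_def)
  qed
  have "(\<integral>z. ln (1 + cmod (bdry_value ?g z - bdry_value (cst K 1) z)) - log_plus (cmod (bdry_value ?g z)) \<partial>\<sigma> K) = 0"
    using d l i1 i2 by simp
  moreover have "AE z in \<sigma> K. 0 \<le> ln (1 + cmod (bdry_value ?g z - bdry_value (cst K 1) z)) - log_plus (cmod (bdry_value ?g z))"
    using AE_boundary[of K] by eventually_elim (simp add: cst_bdry le)
  ultimately have "AE z in \<sigma> K. ln (1 + cmod (bdry_value ?g z - bdry_value (cst K 1) z)) - log_plus (cmod (bdry_value ?g z)) = 0"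
    by (subst (asm) integral_nonneg_eq_0_iff_AE) (use i1 i2 in auto)
  then have "AE z in \<sigma> K. Im (bdry_value ?g' z) = 0"
    using AE_boundary[of K] smirnov_mult_on(2)[OF g bounded_hol_smirnov[OF g']] gle
  proof eventually_elim
    case (elim z)
    let ?w = "bdry_value ?g z"
    have p: "?w * bdry_value ?g' z = 1" using elim unfolding gg by (simp add: cst_bdry)
    then have "cmod ?w * cmod (bdry_value ?g' z) = 1" by (metis norm_mult norm_one)
    moreover have "cmod ?w * cmod (bdry_value ?g' z) \<le> cmod ?w * 1" using elim by (intro mult_left_mono) auto
    ultimately have w1: "1 \<le> cmod ?w" by simp
    then have "log_plus (cmod ?w) = ln (cmod ?w)" by (simp add: log_plus_def)
    then have "ln (cmod ?w) = ln (1 + cmod (?w - 1))" using elim by (simp add: cst_bdry)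
    then have "cmod ?w = 1 + cmod (?w - 1)" using w1 by (subst (asm) ln_inj_iff) (auto simp: add_pos_nonneg)
    then have "Im ?w = 0" by (rule norm_eq_1_plus_imp_real)
    moreover have "?w \<noteq> 0" using w1 by auto
    then have "bdry_value ?g' z = 1 / ?w" using p by (simp only: eq_divide_eq if_True mult.commute[of _ ?w] not_False_eq_True simp_thms)
    ultimately show ?case by (simp add: Im_divide)
  qed
  then have g'c: "?g' = cst K (?g' 0)" by (rule bounded_hol_real_boundary_const[OF g'])
  define w where "w = 1 / ?g' 0"
  have gw: "?g = cst K w"
  proof (rule extensional_eqI[OF smirnov_ext[OF g] smirnov_ext[OF cst_smirnov]])
    fix z :: "complex ^ 'n" assume z: "z \<in> cdomain K"
    have "?g' z = ?g' 0" using fun_cong[OF g'c, of z] unfolding cst_apply[OF z] .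
    then have "?g z * ?g' 0 = 1" using fun_cong[OF gg, of z] unfolding cst_apply[OF z] multf_apply[OF z] by metis
    then show "?g z = cst K w z" unfolding cst_apply[OF z] w_def by (metis inverse_unique inverse_eq_divide mult.commute)
  qed
  have "log_plus (cmod w) = ln c"
    using l unfolding gw using prob_space
    by (subst (asm) Bochner_Integration.integral_cong[where g="\<lambda>_. log_plus (cmod w)", OF refl]) (auto simp: cst_bdry)
  then have "max 0 (ln (cmod w)) = ln c" by (simp add: log_plus_def)
  moreover have "ln c > 0" using c by simp
  ultimately have "ln (cmod w) = ln c" by (simp add: max_def split: if_splits)
  moreover have "w \<noteq> 0" using \<open>ln (cmod w) = ln c\<close> \<open>ln c > 0\<close> by auto
  ultimately have w1: "cmod w = c" using c by (subst (asm) ln_inj_iff) auto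
  have "ln (1 + cmod (w - 1)) = ln c" using d0 unfolding gw smirnov_dist_cst .
  then have w2: "cmod (w - 1) = c - 1" using c by (subst (asm) ln_inj_iff) (auto simp: add_pos_nonneg)
  have "(cmod w)\<^sup>2 - (cmod (w - 1))\<^sup>2 = c\<^sup>2 - (c - 1)\<^sup>2" unfolding w1 w2 ..
  then have "Re w = c" unfolding cmod_power2 by (simp add: power2_diff)
  moreover have "(cmod w)\<^sup>2 = c\<^sup>2" unfolding w1 ..
  ultimately have "Im w = 0" unfolding cmod_power2 by simp
  with \<open>Re w = c\<close> have "w = of_real c" by (simp add: complex_eq_iff)
  then show ?thesis using gw by simp
qed

lemma T_cst_pos:
  assumes c: "0 < c"
  shows "T (cst K (of_real c)) = cst K (of_real c)"
proof (cases "c < 1")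
  case True
  have 1: "T (cst K (of_real (1 / c))) = cst K (of_real (1 / c))" using True c by (intro T_cst_gt_1) simp
  have c1: "of_real c * of_real (1 / c) = (1::complex)" using c by simp
  have 2: "multf K (T (cst K (of_real c))) (cst K (of_real (1 / c))) = cst K 1"
    using T_cst_mult[of "of_real c" "of_real (1 / c)"] unfolding 1 c1 T_one .
  show ?thesis
  proof (rule extensional_eqI[OF smirnov_ext[OF T_smirnov[OF cst_smirnov]] smirnov_ext[OF cst_smirnov]])
    fix z :: "complex ^ 'n" assume z: "z \<in> cdomain K"
    show "T (cst K (of_real c)) z = cst K (of_real c) z" using fun_cong[OF 2, of z] z c by (simp add: field_simps)
  qed
next
  case False
  then show ?thesis using T_cst_gt_1[of c] T_one by (cases "c = 1") auto
qed

text \<open>The image and its inverse are both bounded by \<open>1\<close>, so the image has modulus \<open>1\<close> everywhere.\<close>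

lemma T_cst_unimodular:
  assumes u: "cmod u = 1"
  shows "\<exists>t. cmod t = 1 \<and> T (cst K u) = cst K t"
proof -
  let ?g = "T (cst K u)" and ?g' = "T (cst K (cnj u))"
  have u1: "cmod u \<le> 1" "cmod (cnj u) \<le> 1" using u by auto
  have "u * cnj u = 1" using u by (simp flip: complex_norm_square)
  then have gg: "multf K ?g ?g' = cst K 1" unfolding T_cst_mult by (simp add: T_one)
  have m: "cmod (?g z) = 1" if z: "z \<in> cdomain K" for z
  proof -
    have "?g z * ?g' z = 1" using fun_cong[OF gg, of z] z by simp
    then have "cmod (?g z) * cmod (?g' z) = 1" by (metis norm_mult norm_one)
    moreover have "cmod (?g z) * cmod (?g' z) \<le> cmod (?g z) * 1" using T_cst_contract[OF u1(2) z] by (intro mult_left_mono) auto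
    ultimately show ?thesis using T_cst_contract[OF u1(1) z] by simp
  qed
  have "?g = cst K (?g 0)" by (rule bounded_hol_unimodular_const[OF T_cst_bounded_hol[OF u1(1)]]) (rule m)
  then show ?thesis using m[OF zero_in_cdomain] by (intro exI[of _ "?g 0"] conjI)
qed

lemma T_cst_dist:
  assumes "T (cst K a) = cst K s" "T (cst K b) = cst K t"
  shows "cmod (s - t) = cmod (a - b)"
proof -
  have "ln (1 + cmod (s - t)) = ln (1 + cmod (a - b))"
    using isometry[OF cst_smirnov[of K a] cst_smirnov[of K b]] by (simp add: assms smirnov_dist_cst)
  then show ?thesis by (subst (asm) ln_inj_iff) (auto simp: add_pos_nonneg)
qed

text \<open>A unimodular number at distance \<open>\<bar>\<i> - 1\<bar>\<close> from \<open>1\<close> is \<open>\<i>\<close> or \<open>- \<i>\<close>.\<close>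

lemma T_cst_i: "T (cst K \<i>) = cst K \<i> \<or> T (cst K \<i>) = cst K (- \<i>)"
proof -
  obtain t where t: "cmod t = 1" "T (cst K \<i>) = cst K t" using T_cst_unimodular[of \<i>] by auto
  have "cmod (t - 1) = cmod (\<i> - 1)" by (rule T_cst_dist[OF t(2) T_one])
  then have "(cmod (t - 1))\<^sup>2 = (cmod (\<i> - 1))\<^sup>2" by simp
  moreover have tt: "(cmod t)\<^sup>2 = 1" using t by simp
  ultimately have "Re t = 0" unfolding cmod_power2 by (simp add: power2_diff)
  with tt have "(Im t)\<^sup>2 = 1" unfolding cmod_power2 by simp
  then have "Im t = 1 \<or> Im t = -1" by (simp add: power2_eq_1_iff)
  with \<open>Re t = 0\<close> have "t = \<i> \<or> t = - \<i>" by (auto simp: complex_eq_iff)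
  then show ?thesis using t(2) by blast
qed

text \<open>On the circle a point is determined by its distances to \<open>1\<close> and \<open>\<i>\<close>; the modulus is fixed by
  \<open>T_cst_pos\<close>.\<close>

lemma T_cst:
  assumes i: "T (cst K \<i>) = cst K \<i>"
  shows "T (cst K c) = cst K c"
proof (cases "c = 0")
  case True
  then show ?thesis by (simp add: T_zero)
next
  case False
  define u where "u = c / of_real (cmod c)"
  have u: "cmod u = 1" using False by (simp add: u_def norm_divide)
  obtain t where t: "cmod t = 1" "T (cst K u) = cst K t" using T_cst_unimodular[OF u] by blast
  have "(cmod (t - 1))\<^sup>2 = (cmod (u - 1))\<^sup>2" "(cmod (t - \<i>))\<^sup>2 = (cmod (u - \<i>))\<^sup>2" "(cmod t)\<^sup>2 = (cmod u)\<^sup>2"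
    using T_cst_dist[OF t(2) T_one] T_cst_dist[OF t(2) i] t(1) u by simp_all
  then have "Re t = Re u" "Im t = Im u" unfolding cmod_power2 by (simp_all add: power2_diff)
  then have tu: "t = u" by (simp add: complex_eq_iff)
  have a: "T (cst K (of_real (cmod c))) = cst K (of_real (cmod c))" using False by (intro T_cst_pos) simp
  have c: "of_real (cmod c) * u = c" using False by (simp add: u_def)
  show ?thesis using T_cst_mult[of "of_real (cmod c)" u] unfolding a t(2) tu multf_cst_cst c by (rule sym)
qed

end

subsection \<open>Conjugate reflection\<close>

text \<open>The conjugate-linear multiplicative isometry that exchanges the two cases of the theorem.\<close>

definition reflect :: "domain_kind \<Rightarrow> (complex ^ 'n \<Rightarrow> complex) \<Rightarrow> complex ^ 'n \<Rightarrow> complex" where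
  "reflect K f = (\<lambda>z\<in>cdomain K. cnj (f (vec_cnj z)))"

lemma reflect_apply [simp]: "z \<in> cdomain K \<Longrightarrow> reflect K f z = cnj (f (vec_cnj z))"
  by (simp add: reflect_def)

lemma reflect_ext: "reflect K f \<in> extensional (cdomain K)"
  by (simp add: reflect_def)

lemma reflect_reflect: "f \<in> smirnov K \<Longrightarrow> reflect K (reflect K f) = f"
  by (rule extensional_eqI[OF reflect_ext smirnov_ext]) (simp_all add: vec_cnj_cdomain vec_cnj_vec_cnj)

lemma vec_cnj_measurable: "vec_cnj \<in> measurable (\<sigma> K) (\<sigma> K :: (complex ^ 'n) measure)"
  unfolding measurable_def
proof (intro CollectI conjI ballI)
  show "vec_cnj \<in> space (\<sigma> K) \<rightarrow> space (\<sigma> K :: (complex ^ 'n) measure)"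
    by (auto simp: cboundary_vec_cnj)
next
  fix A :: "(complex ^ 'n) set" assume A: "A \<in> sets (\<sigma> K)"
  have m: "vec_cnj \<in> borel_measurable (\<sigma> K :: (complex ^ 'n) measure)"
    by (intro borel_measurable_boundary linear_continuous_on linear_conv_bounded_linear[THEN iffD1] linear_vec_cnj)
  have "A \<in> sets borel"
    using A by (auto simp: sets_boundary_measure sets_restrict_space)
  then show "vec_cnj -` A \<inter> space (\<sigma> K) \<in> sets (\<sigma> K :: (complex ^ 'n) measure)"
    by (rule measurable_sets[OF m])
qed

lemma AE_vec_cnj:
  "AE z in (\<sigma> K :: (complex ^ 'n) measure). P z \<Longrightarrow> AE z in (\<sigma> K :: (complex ^ 'n) measure). P (vec_cnj z)"
  using AE_distrD[OF vec_cnj_measurable[of K]] unfolding boundary_measure_vec_cnj .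

lemma integral_vec_cnj:
  fixes g :: "complex ^ 'n \<Rightarrow> real"
  assumes "g \<in> borel_measurable (\<sigma> K)"
  shows "(\<integral>z. g (vec_cnj z) \<partial>\<sigma> K) = (\<integral>z. g z \<partial>\<sigma> K)"
  using integral_distr[OF vec_cnj_measurable[of K] assms] unfolding boundary_measure_vec_cnj by simp

lemma integrable_vec_cnj:
  fixes g :: "complex ^ 'n \<Rightarrow> real"
  assumes "integrable (\<sigma> K) g"
  shows "integrable (\<sigma> K) (\<lambda>z. g (vec_cnj z))"
  using integrable_distr[OF vec_cnj_measurable[of K], of g] assms unfolding boundary_measure_vec_cnj by simp

lemma vec_cnj_scaleR: "vec_cnj (r *\<^sub>R z) = r *\<^sub>R vec_cnj z"
  by (rule linear_scale[OF linear_vec_cnj])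

lemma reflect_bdry:
  fixes f :: "complex ^ 'n \<Rightarrow> complex"
  assumes f: "f \<in> smirnov K"
  shows "AE z in \<sigma> K. radial_limit_exists (reflect K f) z \<and> bdry_value (reflect K f) z = cnj (bdry_value f (vec_cnj z))"
  using AE_vec_cnj[OF smirnov_radial_limits[OF f]] AE_boundary[of K]
proof eventually_elim
  case (elim z)
  have "((\<lambda>r. reflect K f (r *\<^sub>R z)) \<longlongrightarrow> cnj (bdry_value f (vec_cnj z))) (at_left 1)"
  proof (rule radial_tendsto_cong[OF elim(2)])
    show "reflect K f w = cnj (f (vec_cnj w))" if "w \<in> cdomain K" for w using that by simp
    show "((\<lambda>r. cnj (f (vec_cnj (r *\<^sub>R z)))) \<longlongrightarrow> cnj (bdry_value f (vec_cnj z))) (at_left 1)"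
      unfolding vec_cnj_scaleR by (intro tendsto_cnj bdry_value_tendsto elim)
  qed
  then show ?case using bdry_value_eqI unfolding radial_limit_exists_def by blast
qed

lemma reflect_smirnov:
  fixes f :: "complex ^ 'n \<Rightarrow> complex"
  assumes f: "f \<in> smirnov K"
  shows "reflect K f \<in> smirnov K"
proof (rule smirnovI[where A="\<lambda>n z. log_plus (cmod (f (radii n *\<^sub>R vec_cnj z)))" and A'="\<lambda>z. log_plus (cmod (bdry_value f (vec_cnj z)))"])
  note fl = smirnov_L1[OF f]
  note [measurable] = smirnov_bdry_measurable[OF f] dilate_radii_measurable[OF smirnov_hol[OF f]]
  have [measurable]: "log_plus \<in> borel_measurable borel" unfolding log_plus_def by measurable
  show "holomorphic_vec (reflect K f) (cdomain K)"
    by (rule holomorphic_vec_cong[OF holomorphic_vec_reflect[OF smirnov_hol[OF f]]]) simp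
  show "reflect K f \<in> extensional (cdomain K)" by (rule reflect_ext)
  show "AE z in \<sigma> K. radial_limit_exists (reflect K f) z" using reflect_bdry[OF f] by eventually_elim simp
  have i: "integrable (\<sigma> K) (\<lambda>z. log_plus (cmod (f (radii n *\<^sub>R z))))" for n
  proof -
    obtain B where B: "0 < B" "\<And>z. z \<in> cclosed K \<Longrightarrow> cmod (f (radii n *\<^sub>R z)) \<le> B"
      using dilate_bounded[OF smirnov_hol[OF f] less_imp_le[OF radii(1)] radii(2)] by metis
    show ?thesis
    proof (rule boundary_integrable_bounded[where B="log_plus B"])
      show "AE z in \<sigma> K. norm (log_plus (cmod (f (radii n *\<^sub>R z)))) \<le> log_plus B"
        using AE_boundary[of K]
        by eventually_elim (use B(2) cboundary_subset_cclosed in \<open>auto simp: log_plus_nonneg intro!: log_plus_mono\<close>)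
    qed measurable
  qed
  show "integrable (\<sigma> K) (\<lambda>z. log_plus (cmod (f (radii n *\<^sub>R vec_cnj z))))" for n
    by (rule integrable_vec_cnj[OF i])
  show "integrable (\<sigma> K) (\<lambda>z. log_plus (cmod (bdry_value f (vec_cnj z))))"
    by (rule integrable_vec_cnj[OF fl(1)])
  have "(\<integral>z. \<bar>log_plus (cmod (f (radii n *\<^sub>R vec_cnj z))) - log_plus (cmod (bdry_value f (vec_cnj z)))\<bar> \<partial>\<sigma> K) =
    (\<integral>z. \<bar>log_plus (cmod (f (radii n *\<^sub>R z))) - log_plus (cmod (bdry_value f z))\<bar> \<partial>\<sigma> K)" for n
    by (rule integral_vec_cnj) measurable
  then show "(\<lambda>n. \<integral>z. \<bar>log_plus (cmod (f (radii n *\<^sub>R vec_cnj z))) - log_plus (cmod (bdry_value f (vec_cnj z)))\<bar> \<partial>\<sigma> K) \<longlonglongrightarrow> 0"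
    using fl(2) by simp
  show "AE z in \<sigma> K. (\<lambda>n. log_plus (cmod (f (radii n *\<^sub>R vec_cnj z)))) \<longlonglongrightarrow> log_plus (cmod (bdry_value f (vec_cnj z)))"
    by (rule AE_vec_cnj[OF fl(4)])
  show "log_plus (cmod (reflect K f (radii n *\<^sub>R z))) \<le> log_plus (cmod (f (radii n *\<^sub>R vec_cnj z)))" if "z \<in> cboundary K" for n z
    using dilate_in_domain[OF that] by (simp add: vec_cnj_scaleR)
qed

lemma reflect_dist:
  fixes f g :: "complex ^ 'n \<Rightarrow> complex"
  assumes f: "f \<in> smirnov K" and g: "g \<in> smirnov K"
  shows "smirnov_dist K (reflect K f) (reflect K g) = smirnov_dist K f g"
proof -
  note [measurable] = smirnov_bdry_measurable[OF f] smirnov_bdry_measurable[OF g] vec_cnj_measurable[of K]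
    smirnov_bdry_measurable[OF reflect_smirnov[OF f]] smirnov_bdry_measurable[OF reflect_smirnov[OF g]]
  have "smirnov_dist K (reflect K f) (reflect K g) = (\<integral>z. ln (1 + cmod (bdry_value f (vec_cnj z) - bdry_value g (vec_cnj z))) \<partial>\<sigma> K)"
    unfolding smirnov_dist_def
  proof (rule integral_cong_AE)
    show "AE z in \<sigma> K. ln (1 + cmod (bdry_value (reflect K f) z - bdry_value (reflect K g) z)) =
      ln (1 + cmod (bdry_value f (vec_cnj z) - bdry_value g (vec_cnj z)))"
      using reflect_bdry[OF f] reflect_bdry[OF g]
      by eventually_elim (simp flip: complex_cnj_diff)
  qed measurable
  also have "\<dots> = smirnov_dist K f g" unfolding smirnov_dist_def by (rule integral_vec_cnj) measurable
  finally show ?thesis .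
qed

lemma reflect_multf: "reflect K (multf K f g) = multf K (reflect K f) (reflect K g)"
  by (rule extensional_eqI[OF reflect_ext mult_on_ext]) (simp add: vec_cnj_cdomain)

lemma reflect_cst: "reflect K (cst K c) = cst K (cnj c)"
  by (rule extensional_eqI[OF reflect_ext smirnov_ext[OF cst_smirnov]]) (simp add: vec_cnj_cdomain)

lemma reflect_image: "reflect K ` smirnov K = (smirnov K :: (complex ^ 'n \<Rightarrow> complex) set)"
proof
  show "smirnov K \<subseteq> reflect K ` (smirnov K :: (complex ^ 'n \<Rightarrow> complex) set)"
  proof
    fix f :: "complex ^ 'n \<Rightarrow> complex" assume "f \<in> smirnov K"
    then show "f \<in> reflect K ` smirnov K" by (intro image_eqI[of _ _ "reflect K f"]) (simp_all add: reflect_reflect reflect_smirnov)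
  qed
next
  show "reflect K ` smirnov K \<subseteq> (smirnov K :: (complex ^ 'n \<Rightarrow> complex) set)"
    by (rule image_subsetI) (rule reflect_smirnov)
qed

lemma (in multiplicative_isometry) compose_reflect: "multiplicative_isometry K (\<lambda>f. T (reflect K f))"
proof
  have "(\<lambda>f. T (reflect K f)) ` smirnov K = T ` reflect K ` smirnov K" by (rule image_image[symmetric])
  then show "(\<lambda>f. T (reflect K f)) ` smirnov K = smirnov K" unfolding reflect_image surj .
qed (simp_all add: isometry multiplicative reflect_smirnov reflect_dist reflect_multf)

section \<open>Isometries fixing the constants\<close>

text \<open>The derivative of the modulus at \<open>a\<close> in the direction \<open>- b\<close>.\<close>

lemma cmod_difference_quotient:
  assumes "a \<noteq> (0::complex)"
  shows "(\<lambda>n. real (Suc n) * (cmod (a - b / of_nat (Suc n)) - cmod a)) \<longlonglongrightarrow> - (Re (b * cnj a) / cmod a)"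
proof -
  let ?s = "\<lambda>n. cmod (a - b / of_nat (Suc n)) + cmod a"
  have eq: "real (Suc n) * (cmod (a - b / of_nat (Suc n)) - cmod a) = (- 2 * Re (b * cnj a) + (cmod b)\<^sup>2 * inverse (real (Suc n))) / ?s n" for n
  proof -
    let ?m = "real (Suc n)"
    have m: "?m > 0" by simp
    have s: "?s n \<noteq> 0" using assms by (simp add: add_nonneg_eq_0_iff)
    have bm: "b / of_nat (Suc n) = of_real (1 / ?m) * b" by simp
    have "(cmod (a - of_real (1 / ?m) * b))\<^sup>2 - (cmod a)\<^sup>2 = - 2 * (1 / ?m) * Re (b * cnj a) + (1 / ?m)\<^sup>2 * (cmod b)\<^sup>2"
      unfolding cmod_power2 by (simp del: of_nat_Suc of_real_divide add: power2_eq_square algebra_simps)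
    also have "(cmod (a - of_real (1 / ?m) * b))\<^sup>2 - (cmod a)\<^sup>2 = (cmod (a - b / of_nat (Suc n)) - cmod a) * ?s n"
      unfolding bm by (simp add: power2_eq_square algebra_simps)
    finally have "?m * ((cmod (a - b / of_nat (Suc n)) - cmod a) * ?s n) = ?m * (- 2 * (1 / ?m) * Re (b * cnj a) + (1 / ?m)\<^sup>2 * (cmod b)\<^sup>2)"
      by (rule arg_cong)
    also have "\<dots> = - 2 * Re (b * cnj a) + (cmod b)\<^sup>2 * inverse ?m"
    proof -
      have "m * (- 2 * (1 / m) * r + (1 / m)\<^sup>2 * q) = - 2 * r + q * inverse m" if "m > 0" for m r q :: real
        using that by (simp add: field_simps power2_eq_square)
      then show ?thesis using m by blast
    qed
    finally have "(?m * (cmod (a - b / of_nat (Suc n)) - cmod a)) * ?s n = - 2 * Re (b * cnj a) + (cmod b)\<^sup>2 * inverse ?m"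
      by (simp only: mult.assoc)
    then show ?thesis using s by (simp only: eq_divide_eq if_True not_False_eq_True simp_thms)
  qed
  have z: "(\<lambda>n. inverse (real (Suc n))) \<longlonglongrightarrow> 0" by (rule LIMSEQ_inverse_real_of_nat)
  have "(\<lambda>n. a - b * of_real (inverse (real (Suc n)))) \<longlonglongrightarrow> a - b * of_real 0" by (intro tendsto_intros z)
  then have "(\<lambda>n. a - b / of_nat (Suc n)) \<longlonglongrightarrow> a" by (simp add: divide_inverse)
  then have s: "?s \<longlonglongrightarrow> cmod a + cmod a" by (intro tendsto_intros)
  have lim: "(\<lambda>n. (- 2 * Re (b * cnj a) + (cmod b)\<^sup>2 * inverse (real (Suc n))) / ?s n) \<longlonglongrightarrow> (- 2 * Re (b * cnj a) + (cmod b)\<^sup>2 * 0) / (cmod a + cmod a)"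
    using assms by (intro tendsto_divide tendsto_add tendsto_mult tendsto_const z s) simp
  have g: "(- 2 * r + q * 0) / (c + c) = - (r / c)" for r q c :: real by simp
  show ?thesis unfolding eq using lim unfolding g .
qed

lemma L1_norm_derivative:
  fixes a b :: "'a \<Rightarrow> complex"
  assumes M: "finite_measure M" and [measurable]: "a \<in> borel_measurable M" "b \<in> borel_measurable M"
    and a: "AE z in M. a z \<noteq> 0" "AE z in M. cmod (a z) \<le> A" and b: "AE z in M. cmod (b z) \<le> B"
  shows "(\<lambda>n. real (Suc n) * ((\<integral>z. cmod (a z - b z / of_nat (Suc n)) \<partial>M) - (\<integral>z. cmod (a z) \<partial>M))) \<longlonglongrightarrow> - (\<integral>z. Re (b z * cnj (a z)) / cmod (a z) \<partial>M)"
proof -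
  interpret finite_measure M by (rule M)
  have tri: "\<bar>cmod (x - y) - cmod x\<bar> \<le> cmod y" for x y :: complex
    using norm_triangle_ineq3[of "x - y" x] by simp
  have ia: "integrable M (\<lambda>z. cmod (a z))"
    by (rule integrable_const_bound[where B=A]) (use a(2) in simp_all)
  have iab: "integrable M (\<lambda>z. cmod (a z - b z / of_nat (Suc n)))" for n
  proof (rule integrable_const_bound[where B="A + B"])
    show "AE z in M. norm (cmod (a z - b z / of_nat (Suc n))) \<le> A + B"
      using a(2) b
    proof eventually_elim
      case (elim z)
      have "cmod (b z / of_nat (Suc n)) \<le> cmod (b z) / 1" unfolding norm_divide norm_of_nat by (intro divide_left_mono) auto
      then show ?case using norm_triangle_ineq4[of "a z" "b z / of_nat (Suc n)"] elim unfolding real_norm_def abs_norm_cancel by linarith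
    qed
  qed measurable
  have "(\<lambda>n. \<integral>z. real (Suc n) * (cmod (a z - b z / of_nat (Suc n)) - cmod (a z)) \<partial>M) \<longlonglongrightarrow> (\<integral>z. - (Re (b z * cnj (a z)) / cmod (a z)) \<partial>M)"
  proof (rule integral_dominated_convergence[where w="\<lambda>_. B"])
    show "AE z in M. (\<lambda>n. real (Suc n) * (cmod (a z - b z / of_nat (Suc n)) - cmod (a z))) \<longlonglongrightarrow> - (Re (b z * cnj (a z)) / cmod (a z))"
      using a(1) by eventually_elim (rule cmod_difference_quotient)
    show "AE z in M. norm (real (Suc n) * (cmod (a z - b z / of_nat (Suc n)) - cmod (a z))) \<le> B" for n
      using b
    proof eventually_elim
      case (elim z)
      have "\<bar>cmod (a z - b z / of_nat (Suc n)) - cmod (a z)\<bar> \<le> cmod (b z / of_nat (Suc n))"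
        by (rule tri)
      also have "\<dots> = cmod (b z) / real (Suc n)" unfolding norm_divide norm_of_nat ..
      finally have "real (Suc n) * \<bar>cmod (a z - b z / of_nat (Suc n)) - cmod (a z)\<bar> \<le> real (Suc n) * (cmod (b z) / real (Suc n))"
        by (rule mult_left_mono) simp
      then show ?case using elim by (simp add: abs_mult del: of_nat_Suc)
    qed
  qed simp_all
  moreover have "(\<integral>z. real (Suc n) * (cmod (a z - b z / of_nat (Suc n)) - cmod (a z)) \<partial>M) =
      real (Suc n) * ((\<integral>z. cmod (a z - b z / of_nat (Suc n)) \<partial>M) - (\<integral>z. cmod (a z) \<partial>M))" for n
    unfolding integral_mult_right_zero by (subst Bochner_Integration.integral_diff[OF iab ia]) (rule refl)
  ultimately show ?thesis by simp
qed

definition L1_dist :: "domain_kind \<Rightarrow> (complex ^ 'n \<Rightarrow> complex) \<Rightarrow> (complex ^ 'n \<Rightarrow> complex) \<Rightarrow> real" where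
  "L1_dist K f g = (\<integral>z. cmod (bdry_value f z - bdry_value g z) \<partial>\<sigma> K)"

lemma ln_1_plus_bounds:
  assumes "0 \<le> (y::real)"
  shows "y - y\<^sup>2 \<le> ln (1 + y)" "ln (1 + y) \<le> y"
proof -
  show "y - y\<^sup>2 \<le> ln (1 + y)"
  proof (cases "y \<le> 1")
    case True
    then show ?thesis using assms by (intro ln_one_plus_pos_lower_bound)
  next
    case False
    then have "y \<le> y\<^sup>2" by (simp add: power2_eq_square)
    moreover have "0 \<le> ln (1 + y)" using assms by simp
    ultimately show ?thesis by linarith
  qed
  show "ln (1 + y) \<le> y" using assms by (rule ln_add_one_self_le_self)
qed

text \<open>Since \<open>ln (1 + y)\<close> is \<open>y\<close> up to an error \<open>y\<^sup>2\<close>, scaling down the two functions linearizes the metric.\<close>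

lemma L1_dist_limit:
  fixes F G :: "complex ^ 'n \<Rightarrow> complex"
  assumes F: "F \<in> bounded_hol K" and G: "G \<in> bounded_hol K"
  shows "(\<lambda>n. real (Suc n) * smirnov_dist K (multf K (cst K (1 / of_nat (Suc n))) F) (multf K (cst K (1 / of_nat (Suc n))) G)) \<longlonglongrightarrow> L1_dist K F G"
proof -
  interpret prob_space "\<sigma> K :: (complex ^ 'n) measure" by (rule prob_space_boundary_measure)
  note Fs = bounded_hol_smirnov[OF F] and Gs = bounded_hol_smirnov[OF G]
  note [measurable] = smirnov_bdry_measurable[OF Fs] smirnov_bdry_measurable[OF Gs]
    smirnov_bdry_measurable[OF smirnov_mult_on(1)[OF cst_smirnov Fs]] smirnov_bdry_measurable[OF smirnov_mult_on(1)[OF cst_smirnov Gs]]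
  obtain M where M: "0 < M" "AE z in \<sigma> K. cmod (bdry_value F z) \<le> M" using bounded_hol_bdry_bounded[OF F] by metis
  obtain N where N: "0 < N" "AE z in \<sigma> K. cmod (bdry_value G z) \<le> N" using bounded_hol_bdry_bounded[OF G] by metis
  let ?x = "\<lambda>z. cmod (bdry_value F z - bdry_value G z)"
  define C where "C = M + N"
  have C: "AE z in \<sigma> K. ?x z \<le> C"
    using M(2) N(2)
  proof eventually_elim
    case (elim z)
    then show ?case using norm_triangle_ineq4[of "bdry_value F z" "bdry_value G z"] unfolding C_def by linarith
  qed
  have ix: "integrable (\<sigma> K) ?x" by (rule integrable_const_bound[where B=C]) (use C in simp_all)
  let ?d = "\<lambda>n. real (Suc n) * smirnov_dist K (multf K (cst K (1 / of_nat (Suc n))) F) (multf K (cst K (1 / of_nat (Suc n))) G)"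
  have d: "?d n = (\<integral>z. real (Suc n) * ln (1 + ?x z / real (Suc n)) \<partial>\<sigma> K)" for n
    unfolding smirnov_dist_def integral_mult_right_zero
  proof (rule arg_cong[where f="\<lambda>t. real (Suc n) * t"], rule integral_cong_AE)
    show "AE z in \<sigma> K. ln (1 + cmod (bdry_value (multf K (cst K (1 / of_nat (Suc n))) F) z - bdry_value (multf K (cst K (1 / of_nat (Suc n))) G) z)) = ln (1 + ?x z / real (Suc n))"
      using multf_cst_bdry[OF Fs, of "1 / of_nat (Suc n)"] multf_cst_bdry[OF Gs, of "1 / of_nat (Suc n)"]
    proof eventually_elim
      case (elim z)
      have "cmod (1 / of_nat (Suc n) * bdry_value F z - 1 / of_nat (Suc n) * bdry_value G z) = ?x z / real (Suc n)"
        unfolding right_diff_distrib[symmetric] norm_mult norm_divide norm_of_nat norm_one by simp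
      then show ?case unfolding elim by (rule arg_cong)
    qed
  qed measurable
  have b: "y - y\<^sup>2 / m \<le> m * ln (1 + y / m)" "m * ln (1 + y / m) \<le> y" if "m > 0" "y \<ge> 0" for y m :: real
  proof -
    have 0: "0 \<le> y / m" using that by simp
    have "m * (y / m - (y / m)\<^sup>2) \<le> m * ln (1 + y / m)" "m * ln (1 + y / m) \<le> m * (y / m)"
      by (rule mult_left_mono[OF ln_1_plus_bounds(1)[OF 0]], use that in simp, rule mult_left_mono[OF ln_1_plus_bounds(2)[OF 0]], use that in simp)
    moreover have "m * (y / m - (y / m)\<^sup>2) = y - y\<^sup>2 / m" "m * (y / m) = y" using that by (simp_all add: field_simps power2_eq_square)
    ultimately show "y - y\<^sup>2 / m \<le> m * ln (1 + y / m)" "m * ln (1 + y / m) \<le> y" by simp_all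
  qed
  have il: "integrable (\<sigma> K) (\<lambda>z. real (Suc n) * ln (1 + ?x z / real (Suc n)))" for n
  proof (rule Bochner_Integration.integrable_bound[OF ix])
    show "AE z in \<sigma> K. norm (real (Suc n) * ln (1 + ?x z / real (Suc n))) \<le> norm (?x z)"
    proof (rule AE_I2)
      fix z :: "complex ^ 'n"
      have "0 \<le> real (Suc n) * ln (1 + ?x z / real (Suc n))" by (intro mult_nonneg_nonneg ln_ge_zero) auto
      then show "norm (real (Suc n) * ln (1 + ?x z / real (Suc n))) \<le> norm (?x z)"
        using b(2)[of "real (Suc n)" "?x z"] by (simp del: of_nat_Suc)
    qed
  qed measurable
  show ?thesis
  proof (rule real_tendsto_sandwich)
    show "eventually (\<lambda>n. L1_dist K F G - C\<^sup>2 * inverse (real (Suc n)) \<le> ?d n) sequentially"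
    proof (rule always_eventually, rule allI)
      fix n
      have "L1_dist K F G - C\<^sup>2 * inverse (real (Suc n)) = (\<integral>z. ?x z - C\<^sup>2 * inverse (real (Suc n)) \<partial>\<sigma> K)"
        unfolding L1_dist_def using ix prob_space by (subst Bochner_Integration.integral_diff) auto
      also have "\<dots> \<le> (\<integral>z. real (Suc n) * ln (1 + ?x z / real (Suc n)) \<partial>\<sigma> K)"
      proof (rule integral_mono_AE[OF _ il])
        show "AE z in \<sigma> K. ?x z - C\<^sup>2 * inverse (real (Suc n)) \<le> real (Suc n) * ln (1 + ?x z / real (Suc n))"
          using C
        proof eventually_elim
          case (elim z)
          have "(?x z)\<^sup>2 / real (Suc n) \<le> C\<^sup>2 / real (Suc n)" by (intro divide_right_mono power_mono elim) auto
          moreover have "C\<^sup>2 * inverse (real (Suc n)) = C\<^sup>2 / real (Suc n)" by (simp only: divide_inverse)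
          moreover have "?x z - (?x z)\<^sup>2 / real (Suc n) \<le> real (Suc n) * ln (1 + ?x z / real (Suc n))" by (rule b(1)) auto
          ultimately show ?case by linarith
        qed
      qed (use ix in auto)
      finally show "L1_dist K F G - C\<^sup>2 * inverse (real (Suc n)) \<le> ?d n" unfolding d .
    qed
    show "eventually (\<lambda>n. ?d n \<le> L1_dist K F G) sequentially"
      unfolding d L1_dist_def
      by (intro always_eventually allI integral_mono il ix b(2)) auto
    have "(\<lambda>n. L1_dist K F G - C\<^sup>2 * inverse (real (Suc n))) \<longlonglongrightarrow> L1_dist K F G - C\<^sup>2 * 0"
      by (intro tendsto_intros LIMSEQ_inverse_real_of_nat)
    then show "(\<lambda>n. L1_dist K F G - C\<^sup>2 * inverse (real (Suc n))) \<longlonglongrightarrow> L1_dist K F G" by simp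
  qed simp
qed

definition bounded_unit :: "domain_kind \<Rightarrow> (complex ^ 'n \<Rightarrow> complex) \<Rightarrow> bool" where
  "bounded_unit K k \<longleftrightarrow> k \<in> bounded_hol K \<and> (\<exists>k'\<in>bounded_hol K. multf K k k' = cst K 1)"

lemma bounded_unit_bdry_nonzero:
  assumes "bounded_unit K k"
  shows "AE z in \<sigma> K. bdry_value k z \<noteq> 0"
proof -
  from assms obtain k' where k: "k \<in> bounded_hol K" "k' \<in> bounded_hol K" "multf K k k' = cst K 1"
    unfolding bounded_unit_def by blast
  show ?thesis
    using smirnov_mult_on(2)[OF bounded_hol_smirnov[OF k(1)] bounded_hol_smirnov[OF k(2)]] AE_boundary[of K]
    unfolding k(3) by eventually_elim (auto simp: cst_bdry)
qed

text \<open>The derivative of the mean modulus at \<open>h\<close> in the direction \<open>- F\<close> is minus the mean of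
  \<open>Re (F * cnj h) / \<bar>h\<bar>\<close>. The choice \<open>h = k\<^sup>2\<close> and direction \<open>k F\<close> cancels the modulus:
  \<open>k F * cnj (k\<^sup>2) / \<bar>k\<^sup>2\<bar> = F * cnj k\<close>. So the mean modulus together with the product recovers the inner
  product. Invertibility of \<open>k\<close> keeps its boundary values away from zero almost everywhere.\<close>

lemma L1_dist_derivative:
  fixes F k :: "complex ^ 'n \<Rightarrow> complex"
  assumes F: "F \<in> bounded_hol K" and k: "bounded_unit K k"
  shows "(\<lambda>n. real (Suc n) * (L1_dist K (multf K k k) (multf K (cst K (1 / of_nat (Suc n))) (multf K k F)) - L1_dist K (multf K k k) (cst K 0)))
     \<longlonglongrightarrow> - Re (ip K F k)"
proof -
  interpret prob_space "\<sigma> K :: (complex ^ 'n) measure" by (rule prob_space_boundary_measure)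
  have kb: "k \<in> bounded_hol K" using k by (simp add: bounded_unit_def)
  note ks = bounded_hol_smirnov[OF kb] and Fs = bounded_hol_smirnov[OF F]
  note kk = smirnov_mult_on[OF ks ks] and kF = smirnov_mult_on[OF ks Fs]
  note [measurable] = smirnov_bdry_measurable[OF ks] smirnov_bdry_measurable[OF Fs] smirnov_bdry_measurable[OF kk(1)]
    smirnov_bdry_measurable[OF smirnov_mult_on(1)[OF cst_smirnov kF(1)]] smirnov_bdry_measurable[OF cst_smirnov]
  obtain M where M: "0 < M" "AE z in \<sigma> K. cmod (bdry_value k z) \<le> M" using bounded_hol_bdry_bounded[OF kb] by metis
  obtain N where N: "0 < N" "AE z in \<sigma> K. cmod (bdry_value F z) \<le> N" using bounded_hol_bdry_bounded[OF F] by metis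
  let ?a = "\<lambda>z. bdry_value k z * bdry_value k z" and ?b = "\<lambda>z. bdry_value k z * bdry_value F z"
  have "(\<lambda>n. real (Suc n) * ((\<integral>z. cmod (?a z - ?b z / of_nat (Suc n)) \<partial>\<sigma> K) - (\<integral>z. cmod (?a z) \<partial>\<sigma> K)))
    \<longlonglongrightarrow> - (\<integral>z. Re (?b z * cnj (?a z)) / cmod (?a z) \<partial>\<sigma> K)"
  proof (rule L1_norm_derivative[where A="M * M" and B="M * N"])
    show "AE z in \<sigma> K. ?a z \<noteq> 0" using bounded_unit_bdry_nonzero[OF k] by eventually_elim simp
    show "AE z in \<sigma> K. cmod (?a z) \<le> M * M"
      using M(2) by eventually_elim (use M(1) in \<open>auto simp: norm_mult intro!: mult_mono\<close>)
    show "AE z in \<sigma> K. cmod (?b z) \<le> M * N"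
      using M(2) N(2) by eventually_elim (use M(1) N(1) in \<open>auto simp: norm_mult intro!: mult_mono\<close>)
  qed (rule finite_measure_axioms, measurable)
  moreover have "(\<integral>z. Re (?b z * cnj (?a z)) / cmod (?a z) \<partial>\<sigma> K) = Re (ip K F k)"
  proof -
    have "Re (ip K F k) = (\<integral>z. Re (bdry_value F z * cnj (bdry_value k z)) \<partial>\<sigma> K)"
      unfolding ip_def by (rule integral_Re[symmetric, OF ip_integrable[OF F kb]])
    also have "\<dots> = (\<integral>z. Re (?b z * cnj (?a z)) / cmod (?a z) \<partial>\<sigma> K)"
    proof (rule integral_cong_AE)
      show "AE z in \<sigma> K. Re (bdry_value F z * cnj (bdry_value k z)) = Re (?b z * cnj (?a z)) / cmod (?a z)"
        using bounded_unit_bdry_nonzero[OF k]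
      proof eventually_elim
        case (elim z)
        let ?k = "bdry_value k z" and ?F = "bdry_value F z"
        have "?b z * cnj (?a z) = (?k * cnj ?k) * (?F * cnj ?k)" by (simp add: mult_ac)
        also have "\<dots> = of_real ((cmod ?k)\<^sup>2) * (?F * cnj ?k)" by (simp only: complex_norm_square)
        finally have "Re (?b z * cnj (?a z)) = (cmod ?k)\<^sup>2 * Re (?F * cnj ?k)" by (simp only: times_complex.sel Re_complex_of_real Im_complex_of_real mult_zero_left diff_0_right)
        moreover have "cmod (?a z) = (cmod ?k)\<^sup>2" by (simp add: norm_mult power2_eq_square)
        moreover have "(cmod ?k)\<^sup>2 \<noteq> 0" using elim by simp
        ultimately show ?case by (simp only: nonzero_mult_div_cancel_left not_False_eq_True)
      qed
    qed measurable
    finally show ?thesis by simp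
  qed
  moreover have "L1_dist K (multf K k k) (multf K (cst K (1 / of_nat (Suc n))) (multf K k F)) = (\<integral>z. cmod (?a z - ?b z / of_nat (Suc n)) \<partial>\<sigma> K)" for n
    unfolding L1_dist_def
  proof (rule integral_cong_AE)
    show "AE z in \<sigma> K. cmod (bdry_value (multf K k k) z - bdry_value (multf K (cst K (1 / of_nat (Suc n))) (multf K k F)) z) = cmod (?a z - ?b z / of_nat (Suc n))"
      using kk(2) kF(2) multf_cst_bdry[OF kF(1), of "1 / of_nat (Suc n)"] by eventually_elim simp
  qed measurable
  moreover have "L1_dist K (multf K k k) (cst K 0) = (\<integral>z. cmod (?a z) \<partial>\<sigma> K)"
    unfolding L1_dist_def
  proof (rule integral_cong_AE)
    show "AE z in \<sigma> K. cmod (bdry_value (multf K k k) z - bdry_value (cst K 0) z) = cmod (?a z)"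
      using kk(2) AE_boundary[of K] by eventually_elim (simp add: cst_bdry)
  qed measurable
  ultimately show ?thesis by simp
qed

lemma bounded_unit_cst:
  assumes "c \<noteq> 0"
  shows "bounded_unit K (cst K c)"
  unfolding bounded_unit_def
  by (intro conjI bexI[of _ "cst K (1 / c)"] cst_bounded_hol) (use assms in \<open>simp add: multf_cst_cst\<close>)

text \<open>Adding a large constant makes a bounded function invertible; since a nonzero constant is invertible,
  units span all bounded functions.\<close>

lemma bounded_unit_shift:
  fixes f :: "complex ^ 'n \<Rightarrow> complex"
  assumes f: "f \<in> bounded_hol K"
  shows "\<exists>c. c \<noteq> 0 \<and> bounded_unit K (addf K f (cst K c))"
proof -
  obtain M where M: "0 < M" "\<And>z. z \<in> cdomain K \<Longrightarrow> cmod (f z) \<le> M" using bounded_holE[OF f] by metis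
  let ?c = "of_real (M + 1) :: complex"
  let ?g = "addf K f (cst K ?c)"
  have g: "?g \<in> bounded_hol K" by (rule bounded_hol_addf[OF f cst_bounded_hol])
  have l: "1 \<le> cmod (?g z)" if "z \<in> cdomain K" for z
  proof -
    have "cmod ?c = M + 1" unfolding norm_of_real using M(1) by simp
    moreover have "cmod ?c \<le> cmod (f z + ?c) + cmod (f z)" using norm_triangle_ineq4[of "f z + ?c" "f z"] by simp
    ultimately show ?thesis using M(2)[OF that] that by simp
  qed
  let ?h = "\<lambda>z\<in>cdomain K. inverse (?g z)"
  have nz: "?g z \<noteq> 0" if "z \<in> cdomain K" for z using l[OF that] by fastforce
  have "?h \<in> bounded_hol K"
  proof (rule bounded_holI[where M=1])
    show "holomorphic_vec ?h (cdomain K)"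
      by (rule holomorphic_vec_cong[OF holomorphic_vec_inverse[OF bounded_hol_hol[OF g] nz]]) auto
    show "cmod (?h z) \<le> 1" if "z \<in> cdomain K" for z
      using l[OF that] that by (simp add: norm_inverse inverse_le_1_iff del: addf_apply)
  qed simp
  moreover have "multf K ?g ?h = cst K 1"
    by (rule extensional_eqI[OF mult_on_ext smirnov_ext[OF cst_smirnov]]) (use nz in \<open>simp del: addf_apply\<close>)
  moreover have "?c \<noteq> 0" using M(1) by (simp only: of_real_eq_0_iff)
  ultimately show ?thesis using g unfolding bounded_unit_def by blast
qed

locale unital_isometry = multiplicative_isometry K T
  for K :: domain_kind and T :: "(complex ^ 'n \<Rightarrow> complex) \<Rightarrow> complex ^ 'n \<Rightarrow> complex" +
  assumes T_i: "T (cst K \<i>) = cst K \<i>"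
begin

lemmas T_const = T_cst[OF T_i]

lemma inverse_unital: "unital_isometry K (inv_into (smirnov K) T)"
proof -
  interpret I: multiplicative_isometry K "inv_into (smirnov K) T" by (rule inverse_isometry)
  show ?thesis
    by unfold_locales (use inv_into_f_f[OF T_inj cst_smirnov[of K \<i>]] in \<open>simp add: T_i\<close>)
qed

lemma T_scale: "f \<in> smirnov K \<Longrightarrow> T (multf K (cst K c) f) = multf K (cst K c) (T f)"
  using multiplicative[OF cst_smirnov[of K c], of f] by (simp add: T_const)

lemma T_bound:
  assumes f: "f \<in> smirnov K" and M: "0 < M" and le: "\<And>z. z \<in> cdomain K \<Longrightarrow> cmod (f z) \<le> M" and z: "z \<in> cdomain K"
  shows "cmod (T f z) \<le> M"
proof -
  let ?c = "of_real (1 / M) :: complex"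
  have c: "cmod ?c = 1 / M" unfolding norm_of_real using M by simp
  have "cmod (T (multf K (cst K ?c) f) z) \<le> 1"
  proof (rule T_contract[OF smirnov_mult_on(1)[OF cst_smirnov f] _ z])
    fix w :: "complex ^ 'n" assume w: "w \<in> cdomain K"
    have "cmod (multf K (cst K ?c) f w) = cmod (f w) / M" unfolding multf_apply[OF w] cst_apply[OF w] norm_mult c by simp
    also have "\<dots> \<le> 1" using le[OF w] M by simp
    finally show "cmod (multf K (cst K ?c) f w) \<le> 1" .
  qed
  then have "1 / M * cmod (T f z) \<le> 1" unfolding T_scale[OF f] multf_apply[OF z] cst_apply[OF z] norm_mult c .
  then show ?thesis using M by simp
qed

lemma T_bounded_hol:
  assumes f: "f \<in> bounded_hol K"
  shows "T f \<in> bounded_hol K"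
proof -
  obtain M where M: "0 < M" "\<And>z. z \<in> cdomain K \<Longrightarrow> cmod (f z) \<le> M" using bounded_holE[OF f] by metis
  note fs = bounded_hol_smirnov[OF f]
  show ?thesis
    by (rule bounded_holI[OF smirnov_ext[OF T_smirnov[OF fs]] smirnov_hol[OF T_smirnov[OF fs]]])
      (rule T_bound[OF fs M(1)], rule M(2))
qed

text \<open>\<open>T\<close> commutes with scalar multiplication, so the limit in \<open>L1_dist_limit\<close> is preserved.\<close>

lemma T_L1_dist:
  assumes F: "F \<in> bounded_hol K" and G: "G \<in> bounded_hol K"
  shows "L1_dist K (T F) (T G) = L1_dist K F G"
proof (rule LIMSEQ_unique[OF L1_dist_limit[OF T_bounded_hol[OF F] T_bounded_hol[OF G]]])
  note Fs = bounded_hol_smirnov[OF F] and Gs = bounded_hol_smirnov[OF G]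
  have eq: "smirnov_dist K (multf K (cst K c) (T F)) (multf K (cst K c) (T G)) = smirnov_dist K (multf K (cst K c) F) (multf K (cst K c) G)" for c
    unfolding T_scale[OF Fs, symmetric] T_scale[OF Gs, symmetric]
    by (intro isometry smirnov_mult_on(1) cst_smirnov Fs Gs)
  show "(\<lambda>n. real (Suc n) * smirnov_dist K (multf K (cst K (1 / of_nat (Suc n))) (T F)) (multf K (cst K (1 / of_nat (Suc n))) (T G))) \<longlonglongrightarrow> L1_dist K F G"
    unfolding eq by (rule L1_dist_limit[OF F G])
qed

lemma T_bounded_unit:
  assumes "bounded_unit K k"
  shows "bounded_unit K (T k)"
proof -
  from assms obtain k' where k: "k \<in> bounded_hol K" "k' \<in> bounded_hol K" "multf K k k' = cst K 1"
    unfolding bounded_unit_def by blast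
  have "multf K (T k) (T k') = cst K 1"
    using multiplicative[OF bounded_hol_smirnov[OF k(1)] bounded_hol_smirnov[OF k(2)]] unfolding k(3) T_one by (rule sym)
  then show ?thesis unfolding bounded_unit_def using T_bounded_hol[OF k(1)] T_bounded_hol[OF k(2)] by blast
qed

lemma T_Re_ip_unit:
  assumes F: "F \<in> bounded_hol K" and k: "bounded_unit K k"
  shows "Re (ip K (T F) (T k)) = Re (ip K F k)"
proof -
  have kb: "k \<in> bounded_hol K" using k by (simp add: bounded_unit_def)
  note ks = bounded_hol_smirnov[OF kb] and Fs = bounded_hol_smirnov[OF F]
  have e1: "multf K (T k) (T k) = T (multf K k k)" by (rule multiplicative[OF ks ks, symmetric])
  have e2: "multf K (cst K c) (multf K (T k) (T F)) = T (multf K (cst K c) (multf K k F))" for c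
    unfolding T_scale[OF smirnov_mult_on(1)[OF ks Fs]] multiplicative[OF ks Fs] ..
  have e3: "L1_dist K (T (multf K k k)) (T (multf K (cst K c) (multf K k F))) = L1_dist K (multf K k k) (multf K (cst K c) (multf K k F))" for c
    by (intro T_L1_dist bounded_hol_multf cst_bounded_hol kb F)
  have e4: "L1_dist K (T (multf K k k)) (cst K 0) = L1_dist K (multf K k k) (cst K 0)"
    using T_L1_dist[OF bounded_hol_multf[OF kb kb] cst_bounded_hol[of K 0]] unfolding T_zero .
  have "- Re (ip K (T F) (T k)) = - Re (ip K F k)"
    by (rule LIMSEQ_unique[OF L1_dist_derivative[OF T_bounded_hol[OF F] T_bounded_unit[OF k], unfolded e1 e2 e3 e4] L1_dist_derivative[OF F k]])
  then show ?thesis by simp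
qed

lemma T_ip_unit:
  assumes F: "F \<in> bounded_hol K" and k: "bounded_unit K k"
  shows "ip K (T F) (T k) = ip K F k"
proof -
  have kb: "k \<in> bounded_hol K" using k by (simp add: bounded_unit_def)
  have "Re (ip K (T (multf K (cst K \<i>) F)) (T k)) = Re (ip K (multf K (cst K \<i>) F) k)"
    by (rule T_Re_ip_unit[OF bounded_hol_multf[OF cst_bounded_hol F] k])
  then have "Re (\<i> * ip K (T F) (T k)) = Re (\<i> * ip K F k)"
    unfolding T_scale[OF bounded_hol_smirnov[OF F]] ip_scale_left[OF T_bounded_hol[OF F] T_bounded_hol[OF kb]] ip_scale_left[OF F kb] .
  then show ?thesis using T_Re_ip_unit[OF F k] by (simp add: complex_eq_iff)
qed

lemma orthogonal_to_units:
  assumes D: "D \<in> bounded_hol K" and o: "\<And>q. bounded_unit K q \<Longrightarrow> ip K D q = 0"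
  shows "D = cst K 0"
proof (rule ip_self_zero[OF D])
  obtain c where c: "c \<noteq> 0" "bounded_unit K (addf K D (cst K c))" using bounded_unit_shift[OF D] by blast
  have "ip K D (addf K D (cst K c)) = ip K D D + ip K D (cst K c)" by (rule ip_addf_right[OF D cst_bounded_hol D])
  then show "ip K D D = 0" unfolding o[OF c(2)] o[OF bounded_unit_cst[OF c(1)]] by simp
qed

lemma bounded_unit_preimage:
  assumes q: "bounded_unit K q"
  shows "\<exists>k. bounded_unit K k \<and> T k = q"
proof -
  interpret I: unital_isometry K "inv_into (smirnov K) T" by (rule inverse_unital)
  have "q \<in> smirnov K" using q by (simp add: bounded_unit_def bounded_hol_smirnov)
  then have "T (inv_into (smirnov K) T q) = q" using f_inv_into_f[of q T "smirnov K"] unfolding surj by blast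
  then show ?thesis using I.T_bounded_unit[OF q] by blast
qed

text \<open>The defect of additivity is orthogonal to the image of every unit, that is, to every unit.\<close>

lemma T_add:
  assumes F: "F \<in> bounded_hol K" and G: "G \<in> bounded_hol K"
  shows "T (addf K F G) = addf K (T F) (T G)"
proof -
  let ?D = "addf K (T (addf K F G)) (multf K (cst K (-1)) (addf K (T F) (T G)))"
  note TF = T_bounded_hol[OF F] and TG = T_bounded_hol[OF G] and FG = bounded_hol_addf[OF F G]
  note TFG = T_bounded_hol[OF FG] and A = bounded_hol_addf[OF TF TG]
  have D: "?D \<in> bounded_hol K" by (intro bounded_hol_addf bounded_hol_multf cst_bounded_hol TFG TF TG)
  have "?D = cst K 0"
  proof (rule orthogonal_to_units[OF D])
    fix q :: "complex ^ 'n \<Rightarrow> complex" assume "bounded_unit K q"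
    then obtain k where k: "bounded_unit K k" "T k = q" using bounded_unit_preimage by blast
    have kb: "k \<in> bounded_hol K" using k by (simp add: bounded_unit_def)
    note Tk = T_bounded_hol[OF kb]
    have "ip K ?D (T k) = ip K F k + ip K G k + -1 * (ip K F k + ip K G k)"
      unfolding ip_addf_left[OF TFG bounded_hol_multf[OF cst_bounded_hol A] Tk] ip_scale_left[OF A Tk]
        ip_addf_left[OF TF TG Tk] T_ip_unit[OF F k(1)] T_ip_unit[OF G k(1)] T_ip_unit[OF FG k(1)] ip_addf_left[OF F G kb] ..
    then show "ip K ?D q = 0" using k(2) by simp
  qed
  then have e: "?D z = cst K 0 z" for z by simp
  show ?thesis
  proof (rule extensional_eqI[OF bounded_hol_ext[OF TFG] bounded_hol_ext[OF A]])
    fix z :: "complex ^ 'n" assume z: "z \<in> cdomain K"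
    have alg: "x = y + w" if "x + - 1 * (y + w) = 0" for x y w :: complex using that by (simp add: add_eq_0_iff2)
    show "T (addf K F G) z = addf K (T F) (T G) z"
      using e[of z] unfolding addf_apply[OF z] multf_apply[OF z] cst_apply[OF z] by (rule alg)
  qed
qed

lemma T_ip:
  assumes F: "F \<in> bounded_hol K" and G: "G \<in> bounded_hol K"
  shows "ip K (T F) (T G) = ip K F G"
proof -
  obtain c where c: "c \<noteq> 0" "bounded_unit K (addf K G (cst K c))" using bounded_unit_shift[OF G] by blast
  note TF = T_bounded_hol[OF F] and TG = T_bounded_hol[OF G]
  have "ip K (T F) (T (addf K G (cst K c))) = ip K F (addf K G (cst K c))" by (rule T_ip_unit[OF F c(2)])
  then have "ip K (T F) (T G) + ip K (T F) (T (cst K c)) = ip K F G + ip K F (cst K c)"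
    unfolding T_add[OF G cst_bounded_hol] ip_addf_right[OF TG T_bounded_hol[OF cst_bounded_hol] TF] ip_addf_right[OF G cst_bounded_hol F] .
  then show ?thesis unfolding T_ip_unit[OF F bounded_unit_cst[OF c(1)]] by simp
qed

lemma T_at_zero: "F \<in> bounded_hol K \<Longrightarrow> T F 0 = F 0"
  using T_ip[of F "cst K 1"] ip_one[of "T F" K] ip_one[of F K] by (simp add: T_one T_bounded_hol cst_bounded_hol)

end

section \<open>The images of the coordinate functions\<close>

text \<open>The derivative of a slice function at the origin is the complex linear derivative of \<open>f\<close>, evaluated
  in the direction of the slice.\<close>

lemma slice_linear_part:
  fixes f :: "complex ^ 'n \<Rightarrow> complex"
  assumes f: "holomorphic_vec f (cdomain K)"
  shows "\<exists>a. \<forall>z. ((\<lambda>c. f (c *s z)) has_field_derivative (\<Sum>k\<in>UNIV. a k * z $ k)) (at 0)"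
proof -
  obtain L where L: "(f has_derivative L) (at 0)" "\<And>c v. L (c *s v) = c * L v"
    using holomorphic_vecE[OF f zero_in_cdomain] by metis
  have lin: "linear L" using has_derivative_linear[OF L(1)] .
  have Lz: "L z = (\<Sum>k\<in>UNIV. L (axis k 1) * z $ k)" for z
  proof -
    have "L z = L (\<Sum>k\<in>UNIV. z $ k *s axis k 1)" by (simp add: basis_expansion)
    also have "\<dots> = (\<Sum>k\<in>UNIV. L (axis k 1) * z $ k)" by (simp add: linear_sum[OF lin] L(2) mult.commute)
    finally show ?thesis .
  qed
  have "((\<lambda>c. f (c *s z)) has_field_derivative L z) (at 0)" for z
  proof -
    have "linear (\<lambda>c. c *s z)"
      by (rule linearI) (simp_all add: vector_sadd_rdistrib scaleR_eq_smult scaleR_conv_of_real)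
    then have "((\<lambda>c. c *s z) has_derivative (\<lambda>c. c *s z)) (at 0)"
      by (intro bounded_linear_imp_has_derivative) (simp add: linear_conv_bounded_linear)
    moreover have "(f has_derivative L) (at ((0::complex) *s z))" using L(1) by simp
    ultimately have "((\<lambda>c. f (c *s z)) has_derivative (\<lambda>c. L (c *s z))) (at 0)"
      by (rule has_derivative_compose)
    then show ?thesis by (simp add: has_field_derivative_def L(2) mult_commute_abs)
  qed
  then show ?thesis by (intro exI[of _ "\<lambda>k. L (axis k 1)"] allI DERIV_cong[OF _ Lz])
qed

lemma polyfun_linear: "polyfun (\<lambda>z. \<Sum>k\<in>UNIV. b k * z $ k)"
  by (rule polyfun_sum[OF polyfun.mult[OF polyfun.const polyfun.coord]])

abbreviation linear_form :: "domain_kind \<Rightarrow> ('n \<Rightarrow> complex) \<Rightarrow> complex ^ 'n \<Rightarrow> complex" where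
  "linear_form K b \<equiv> polyres K (\<lambda>z. \<Sum>k\<in>UNIV. b k * z $ k)"

lemma polyres_apply [simp]: "z \<in> cdomain K \<Longrightarrow> polyres K p z = p z"
  by (simp add: polyres_def)

lemma ip_linear_form:
  fixes f :: "complex ^ 'n \<Rightarrow> complex"
  assumes f: "f \<in> bounded_hol K"
  shows "ip K f (linear_form K b) = (\<Sum>k\<in>UNIV. cnj (b k) * ip K f (crd K k))"
proof -
  have "ip K f (linear_form K b) = (\<integral>z. (\<Sum>k\<in>UNIV. cnj (b k) * (bdry_value f z * cnj (bdry_value (crd K k) z))) \<partial>\<sigma> K)"
    unfolding ip_def
    by (rule Bochner_Integration.integral_cong) (simp_all add: polyres_bdry[OF polyfun_linear] crd_bdry sum_distrib_left mult_ac)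
  also have "\<dots> = (\<Sum>k\<in>UNIV. cnj (b k) * ip K f (crd K k))"
    unfolding ip_def by (subst Bochner_Integration.integral_sum) (simp_all add: ip_integrable[OF f crd_bounded_hol])
  finally show ?thesis .
qed

lemma slice_field_derivative:
  fixes u :: "complex ^ 'n \<Rightarrow> complex"
  assumes u: "u \<in> bounded_hol K"
  shows "\<exists>d. ((\<lambda>c. u (c *s z)) has_field_derivative d) (at 0)"
  using slice_linear_part[OF bounded_hol_hol[OF u]] by blast

lemma slice_smult_mem: "z \<in> cdomain K \<Longrightarrow> c \<in> ball 0 1 \<Longrightarrow> c *s z \<in> cdomain K"
  by (rule cdomain_smult) auto

lemma multf_slice_deriv:
  fixes u v :: "complex ^ 'n \<Rightarrow> complex"
  assumes u: "u \<in> bounded_hol K" "u 0 = 0" and v: "v \<in> bounded_hol K" "v 0 = 0" and z: "z \<in> cdomain K"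
  shows "deriv (\<lambda>c. multf K u v (c *s z)) 0 = 0"
proof (rule DERIV_imp_deriv)
  obtain d where d: "((\<lambda>c. u (c *s z)) has_field_derivative d) (at 0)" using slice_field_derivative[OF u(1)] by blast
  obtain e where e: "((\<lambda>c. v (c *s z)) has_field_derivative e) (at 0)" using slice_field_derivative[OF v(1)] by blast
  have "((\<lambda>c. u (c *s z) * v (c *s z)) has_field_derivative 0) (at 0)"
    using DERIV_mult[OF d e] u(2) v(2) by simp
  then show "((\<lambda>c. multf K u v (c *s z)) has_field_derivative 0) (at 0)"
    by (rule has_field_derivative_transform_within_open[OF _ open_ball[of 0 1]]) (use slice_smult_mem[OF z] in auto)
qed

text \<open>Modulo constants and multiples of the factors, a product of polynomials is a product of two factors
  vanishing at the origin.\<close>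

lemma orthogonal_to_polynomials:
  fixes g :: "complex ^ 'n \<Rightarrow> complex"
  assumes g: "g \<in> bounded_hol K" and 1: "ip K g (cst K 1) = 0" and c: "\<And>k. ip K g (crd K k) = 0"
    and m: "\<And>u v. u \<in> bounded_hol K \<Longrightarrow> v \<in> bounded_hol K \<Longrightarrow> u 0 = 0 \<Longrightarrow> v 0 = 0 \<Longrightarrow> ip K g (multf K u v) = 0"
    and p: "polyfun p"
  shows "ip K g (polyres K p) = 0"
proof -
  have cst0: "ip K g (cst K a) = 0" for a
    using ip_scale_right[OF cst_bounded_hol g, of a 1] 1 by (simp add: multf_cst_cst)
  show ?thesis using p
  proof (induction rule: polyfun.induct)
    case (const a)
    show ?case using cst0[of a] by (simp add: cst_eq_polyres)
  next
    case (coord i)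
    show ?case using c[of i] by (simp add: crd_def)
  next
    case (add p q)
    note P = polyres_bounded_hol[OF add.hyps(1), of K] and Q = polyres_bounded_hol[OF add.hyps(2), of K]
    have "polyres K (\<lambda>z. p z + q z) = addf K (polyres K p) (polyres K q)"
      by (simp add: polyres_def addf_def fun_eq_iff restrict_def)
    then show ?case using ip_addf_right[OF P Q g] add.IH by simp
  next
    case (mult p q)
    note P = polyres_bounded_hol[OF mult.hyps(1), of K] and Q = polyres_bounded_hol[OF mult.hyps(2), of K]
    let ?P = "addf K (polyres K p) (cst K (- p 0))" and ?Q = "addf K (polyres K q) (cst K (- q 0))"
    have PQ: "?P \<in> bounded_hol K" "?Q \<in> bounded_hol K" by (intro bounded_hol_addf cst_bounded_hol P Q)+
    let ?R1 = "addf K (multf K (cst K (q 0)) (polyres K p)) (cst K (- (p 0 * q 0)))"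
    let ?R2 = "addf K (multf K (cst K (p 0)) (polyres K q)) ?R1"
    have R1: "?R1 \<in> bounded_hol K" and R2: "?R2 \<in> bounded_hol K"
      by (intro bounded_hol_addf bounded_hol_multf cst_bounded_hol P Q)+
    have "polyres K (\<lambda>z. p z * q z) = addf K (multf K ?P ?Q) ?R2"
      by (rule extensional_eqI[OF bounded_hol_ext[OF polyres_bounded_hol[OF polyfun.mult[OF mult.hyps]]] bounded_hol_ext[OF bounded_hol_addf[OF bounded_hol_multf[OF PQ] R2]]])
        (simp add: algebra_simps)
    moreover have "ip K g (multf K ?P ?Q) = 0" by (rule m[OF PQ]) simp_all
    ultimately show ?case
      using ip_addf_right[OF bounded_hol_multf[OF PQ] R2 g] ip_addf_right[OF bounded_hol_multf[OF cst_bounded_hol Q, of "p 0"] R1 g]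
        ip_addf_right[OF bounded_hol_multf[OF cst_bounded_hol P, of "q 0"] cst_bounded_hol g, of "- (p 0 * q 0)"]
        ip_scale_right[OF P g, of "q 0"] ip_scale_right[OF Q g, of "p 0"] mult.IH cst0 by simp
  qed
qed

lemma orthogonal_to_all_polynomials:
  fixes g :: "complex ^ 'n \<Rightarrow> complex"
  assumes g: "g \<in> bounded_hol K" and p: "\<And>p. polyfun p \<Longrightarrow> ip K g (polyres K p) = 0"
  shows "g = cst K 0"
proof (rule ip_self_zero[OF g])
  interpret prob_space "\<sigma> K :: (complex ^ 'n) measure" by (rule prob_space_boundary_measure)
  note hol = bounded_hol_hol[OF g] and gs = bounded_hol_smirnov[OF g]
  note [measurable] = smirnov_bdry_measurable[OF gs] dilate_radii_measurable[OF hol]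
  obtain M where M: "0 < M" "AE z in \<sigma> K. cmod (bdry_value g z) \<le> M" using bounded_hol_bdry_bounded[OF g] by metis
  obtain q where q: "\<And>n. polyfun (q n)" "\<And>n z. z \<in> cclosed K \<Longrightarrow> cmod (g (radii n *\<^sub>R z) - q n z) \<le> inverse (real (Suc n))"
    using polynomial_sequence[OF hol] by blast
  have b: "cmod (\<integral>z. g (radii n *\<^sub>R z) * cnj (bdry_value g z) \<partial>\<sigma> K) \<le> inverse (real (Suc n)) * M" for n
  proof -
    obtain B where B: "0 < B" "\<And>z. z \<in> cclosed K \<Longrightarrow> cmod (g (radii n *\<^sub>R z)) \<le> B"
      using dilate_bounded[OF hol less_imp_le[OF radii(1)] radii(2)] by metis
    have i1: "integrable (\<sigma> K) (\<lambda>z. g (radii n *\<^sub>R z) * cnj (bdry_value g z))"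
    proof (rule integrable_const_bound[where B="B * M"])
      show "AE z in \<sigma> K. norm (g (radii n *\<^sub>R z) * cnj (bdry_value g z)) \<le> B * M"
        using AE_boundary[of K] M(2)
        by eventually_elim (use B cboundary_subset_cclosed M(1) in \<open>auto simp: norm_mult intro!: mult_mono\<close>)
    qed measurable
    note Q = polyres_bounded_hol[OF q(1)[of n], of K]
    have i2: "integrable (\<sigma> K) (\<lambda>z. bdry_value (polyres K (q n)) z * cnj (bdry_value g z))"
      by (rule ip_integrable[OF Q g])
    have z: "ip K (polyres K (q n)) g = 0" using p[OF q(1)[of n]] ip_cnj[of K "polyres K (q n)" g] by simp
    have "(\<integral>z. g (radii n *\<^sub>R z) * cnj (bdry_value g z) \<partial>\<sigma> K) =
      (\<integral>z. g (radii n *\<^sub>R z) * cnj (bdry_value g z) - bdry_value (polyres K (q n)) z * cnj (bdry_value g z) \<partial>\<sigma> K)"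
      unfolding Bochner_Integration.integral_diff[OF i1 i2] using z unfolding ip_def by simp
    also have "cmod \<dots> \<le> (\<integral>z. inverse (real (Suc n)) * M \<partial>(\<sigma> K :: (complex ^ 'n) measure))"
    proof (rule Bochner_Integration.integral_norm_bound_integral[THEN order_trans, rotated 2])
      show "(\<integral>z. cmod (g (radii n *\<^sub>R z) * cnj (bdry_value g z) - bdry_value (polyres K (q n)) z * cnj (bdry_value g z)) \<partial>\<sigma> K)
         \<le> (\<integral>z. inverse (real (Suc n)) * M \<partial>(\<sigma> K :: (complex ^ 'n) measure))"
      proof (rule integral_mono_AE)
        show "AE z in \<sigma> K. cmod (g (radii n *\<^sub>R z) * cnj (bdry_value g z) - bdry_value (polyres K (q n)) z * cnj (bdry_value g z)) \<le> inverse (real (Suc n)) * M"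
          using AE_boundary[of K] M(2)
        proof eventually_elim
          case (elim z)
          have "cmod (g (radii n *\<^sub>R z) * cnj (bdry_value g z) - bdry_value (polyres K (q n)) z * cnj (bdry_value g z)) =
            cmod (g (radii n *\<^sub>R z) - q n z) * cmod (bdry_value g z)"
            unfolding left_diff_distrib[symmetric] norm_mult polyres_bdry[OF q(1) elim(1)] by simp
          also have "\<dots> \<le> inverse (real (Suc n)) * M"
            using q(2)[of z n] elim cboundary_subset_cclosed by (intro mult_mono) auto
          finally show ?case .
        qed
      qed (use i1 i2 in auto)
    qed (use i1 i2 in auto)
    also have "\<dots> = inverse (real (Suc n)) * M" using prob_space by simp
    finally show ?thesis .
  qed
  have "(\<lambda>n. inverse (real (Suc n)) * M) \<longlonglongrightarrow> 0 * M" by (intro tendsto_intros LIMSEQ_inverse_real_of_nat)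
  then have "(\<lambda>n. inverse (real (Suc n)) * M) \<longlonglongrightarrow> 0" by simp
  then have "(\<lambda>n. \<integral>z. g (radii n *\<^sub>R z) * cnj (bdry_value g z) \<partial>\<sigma> K) \<longlonglongrightarrow> 0"
    by (rule Lim_null_comparison[OF always_eventually, rotated]) (use b in blast)
  then show "ip K g g = 0" using LIMSEQ_unique[OF ip_dilate_limit[OF g g]] by blast
qed

lemma matrix_component: "(A *v z) $ j = (\<Sum>k\<in>UNIV. A $ j $ k * z $ k)"
  by (simp add: matrix_vector_mult_def)

lemma cclosed_dilate_domain:
  "z \<in> cclosed K \<Longrightarrow> 0 < r \<Longrightarrow> r < 1 \<Longrightarrow> r *\<^sub>R z \<in> cdomain K"
proof (cases K)
  case Unit_Ball
  assume "z \<in> cclosed K" and r: "0 < r" "r < 1"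
  then have "r * norm z \<le> r * 1" using Unit_Ball by (intro mult_left_mono) auto
  then have "r * norm z < 1" using r by linarith
  then show ?thesis using Unit_Ball r by simp
next
  case Unit_Polydisk
  assume z: "z \<in> cclosed K" and r: "0 < r" "r < 1"
  have "cmod ((r *\<^sub>R z) $ j) < 1" for j
  proof -
    have "r * cmod (z $ j) \<le> r * 1" using z Unit_Polydisk r by (intro mult_left_mono) auto
    then have "r * cmod (z $ j) < 1" using r by linarith
    then show ?thesis using r by simp
  qed
  then show ?thesis using Unit_Polydisk by simp
qed

context unital_isometry
begin

lemma bounded_hol_preimage:
  assumes u: "u \<in> bounded_hol K"
  shows "\<exists>v\<in>bounded_hol K. T v = u"
proof -
  interpret I: unital_isometry K "inv_into (smirnov K) T" by (rule inverse_unital)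
  have "T (inv_into (smirnov K) T u) = u"
    using f_inv_into_f[of u T "smirnov K"] bounded_hol_smirnov[OF u] unfolding surj by blast
  then show ?thesis using I.T_bounded_hol[OF u] by blast
qed

text \<open>Let \<open>g\<close> be the image of a coordinate minus its linear part. It is orthogonal to constants and
  coordinates because its value and its derivative at the origin vanish. It is orthogonal to a product
  \<open>u v\<close> of functions vanishing at the origin: the linear part is, by degree, and for the image of the
  coordinate the preimages \<open>u'\<close>, \<open>v'\<close> also vanish at the origin, so that the inner product is that of
  the coordinate with \<open>u' v'\<close>, again zero by degree. Hence \<open>g\<close> is orthogonal to all polynomials.\<close>

lemma T_crd_linear: "\<exists>a. \<forall>z\<in>cdomain K. T (crd K j) z = (\<Sum>k\<in>UNIV. a k * z $ k)"
proof -
  let ?f = "T (crd K j)"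
  have f: "?f \<in> bounded_hol K" by (rule T_bounded_hol[OF crd_bounded_hol])
  obtain a where a: "\<And>z. ((\<lambda>c. ?f (c *s z)) has_field_derivative (\<Sum>k\<in>UNIV. a k * z $ k)) (at 0)"
    using slice_linear_part[OF bounded_hol_hol[OF f]] by blast
  \<comment> \<open>The linear part is entered with a minus sign, so that the sum below is the remainder.\<close>
  let ?l = "linear_form K (\<lambda>k. - a k)"
  have l: "?l \<in> bounded_hol K" by (rule polyres_bounded_hol[OF polyfun_linear])
  let ?g = "addf K ?f ?l"
  have g: "?g \<in> bounded_hol K" by (rule bounded_hol_addf[OF f l])
  have f0: "?f 0 = 0" by (simp add: T_at_zero[OF crd_bounded_hol])
  have o1: "ip K ?g (cst K 1) = 0" unfolding ip_one[OF g] by (simp add: f0)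
  have o2: "ip K ?g (crd K k) = 0" for k
    proof (rule ip_crd_zero[OF g])
      fix z :: "complex ^ 'n" assume z: "z \<in> cdomain K"
      have "((\<lambda>c. c * (\<Sum>k\<in>UNIV. - a k * z $ k)) has_field_derivative 1 * (\<Sum>k\<in>UNIV. - a k * z $ k)) (at 0)"
        by (rule DERIV_cmult_right[OF DERIV_ident])
      from DERIV_add[OF a[of z] this]
      have "((\<lambda>c. ?f (c *s z) + c * (\<Sum>k\<in>UNIV. - a k * z $ k)) has_field_derivative 0) (at 0)"
        by (simp add: sum_negf)
      then have "((\<lambda>c. ?g (c *s z)) has_field_derivative 0) (at 0)"
        by (rule has_field_derivative_transform_within_open[OF _ open_ball[of 0 1]])
          (use slice_smult_mem[OF z] in \<open>auto simp: sum_distrib_left mult_ac sum_negf\<close>)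
      then show "deriv (\<lambda>c. ?g (c *s z)) 0 = 0" by (rule DERIV_imp_deriv)
    qed
  have o3: "ip K ?g (multf K u v) = 0" if u: "u \<in> bounded_hol K" and v: "v \<in> bounded_hol K" and u0: "u 0 = 0" and v0: "v 0 = 0" for u v
  proof -
    obtain u' where u': "u' \<in> bounded_hol K" "T u' = u" using bounded_hol_preimage[OF u] by blast
    obtain v' where v': "v' \<in> bounded_hol K" "T v' = v" using bounded_hol_preimage[OF v] by blast
    have z: "u' 0 = 0" "v' 0 = 0" using T_at_zero[OF u'(1)] T_at_zero[OF v'(1)] u'(2) v'(2) u0 v0 by simp_all
    have o5: "ip K (multf K u' v') (crd K k) = 0" for k
      by (rule ip_crd_zero[OF bounded_hol_multf[OF u'(1) v'(1)] multf_slice_deriv[OF u'(1) z(1) v'(1) z(2)]])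
    have o4: "ip K (multf K u v) (crd K k) = 0" for k
      by (rule ip_crd_zero[OF bounded_hol_multf[OF u v] multf_slice_deriv[OF u u0 v v0]])
    have uv: "multf K u v = T (multf K u' v')"
      using multiplicative[OF bounded_hol_smirnov[OF u'(1)] bounded_hol_smirnov[OF v'(1)]] unfolding u'(2) v'(2) by (rule sym)
    have "ip K ?f (multf K u v) = ip K (crd K j) (multf K u' v')"
      unfolding uv by (rule T_ip[OF crd_bounded_hol bounded_hol_multf[OF u'(1) v'(1)]])
    also have "\<dots> = 0" unfolding ip_cnj[of K "crd K j"] o5 by simp
    finally have "ip K ?f (multf K u v) = 0" .
    moreover have "ip K ?l (multf K u v) = 0"
      unfolding ip_cnj[of K ?l] ip_linear_form[OF bounded_hol_multf[OF u v]] o4 by simp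
    ultimately show "ip K ?g (multf K u v) = 0"
      unfolding ip_addf_left[OF f l bounded_hol_multf[OF u v]] by simp
  qed
  have "?g = cst K 0"
    by (rule orthogonal_to_all_polynomials[OF g], rule orthogonal_to_polynomials[OF g o1 o2]) (rule o3)
  then have e: "?g z = cst K 0 z" for z by simp
  show ?thesis
  proof (intro exI[of _ a] ballI)
    fix z :: "complex ^ 'n" assume z: "z \<in> cdomain K"
    show "T (crd K j) z = (\<Sum>k\<in>UNIV. a k * z $ k)" using e[of z] z by (simp add: sum_negf)
  qed
qed

lemma T_polynomials:
  assumes A: "\<And>j z. z \<in> cdomain K \<Longrightarrow> T (crd K j) z = (A *v z) $ j"
    and p: "polyfun p" and z: "z \<in> cdomain K"
  shows "T (polyres K p) z = p (A *v z)"
  using p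
proof (induction rule: polyfun.induct)
  case (const c)
  show ?case using T_const[of c] z by (simp add: cst_eq_polyres)
next
  case (coord i)
  show ?case using A[OF z, of i] by (simp add: crd_def)
next
  case (add p q)
  note P = polyres_bounded_hol[OF add.hyps(1), of K] and Q = polyres_bounded_hol[OF add.hyps(2), of K]
  have "polyres K (\<lambda>z. p z + q z) = addf K (polyres K p) (polyres K q)"
    by (simp add: polyres_def addf_def fun_eq_iff restrict_def)
  then show ?case using T_add[OF P Q] add.IH z by simp
next
  case (mult p q)
  note P = polyres_bounded_hol[OF mult.hyps(1), of K] and Q = polyres_bounded_hol[OF mult.hyps(2), of K]
  have "polyres K (\<lambda>z. p z * q z) = multf K (polyres K p) (polyres K q)"
    by (simp add: polyres_def mult_on_def fun_eq_iff restrict_def)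
  then show ?case using multiplicative[OF bounded_hol_smirnov[OF P] bounded_hol_smirnov[OF Q]] mult.IH z by simp
qed

text \<open>The matrix is contractive because \<open>T\<close> does not increase the supremum norm: for the ball this is
  tested on the linear form given by the inner product with \<open>A z\<close>, for the polydisk on the coordinates.
  Since \<open>T\<close> is a substitution on polynomials, density extends this to the whole class.\<close>

lemma T_linear_substitution:
  "\<exists>A. (\<forall>z\<in>cdomain K. A *v z \<in> cdomain K) \<and> (\<forall>f\<in>smirnov K. \<forall>z\<in>cdomain K. T f z = f (A *v z))"
proof -
  have "\<forall>j. \<exists>a. \<forall>z\<in>cdomain K. T (crd K j) z = (\<Sum>k\<in>UNIV. a k * z $ k)" using T_crd_linear by blast
  then obtain a where a: "\<forall>j. \<forall>z\<in>cdomain K. T (crd K j) z = (\<Sum>k\<in>UNIV. a j k * z $ k)" by metis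
  define A where "A = (\<chi> j k. a j k)"
  have A: "T (crd K j) z = (A *v z) $ j" if "z \<in> cdomain K" for j z
    using a that by (simp add: matrix_component A_def)
  have closed: "A *v z \<in> cclosed K" if z: "z \<in> cdomain K" for z
  proof (cases K)
    case Unit_Ball
    define w where "w = A *v z"
    have "norm w \<le> 1"
    proof (cases "w = 0")
      case False
      let ?F = "linear_form K (\<lambda>k. cnj (w $ k))"
      have F: "?F \<in> smirnov K" by (rule bounded_hol_smirnov[OF polyres_bounded_hol[OF polyfun_linear]])
      have n: "0 < norm w" using False by simp
      have "cmod (T ?F z) \<le> norm w"
      proof (rule T_bound[OF F n _ z])
        fix v :: "complex ^ 'n" assume v: "v \<in> cdomain K"
        have "cmod (?F v) \<le> (\<Sum>k\<in>UNIV. cmod (w $ k) * cmod (v $ k))"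
          using v by (simp add: norm_mult sum_norm_le)
        also have "\<dots> \<le> L2_set (\<lambda>k. cmod (w $ k)) UNIV * L2_set (\<lambda>k. cmod (v $ k)) UNIV"
          using L2_set_mult_ineq[of "\<lambda>k. cmod (w $ k)" "\<lambda>k. cmod (v $ k)" UNIV] by simp
        also have "\<dots> = norm w * norm v" by (simp add: norm_vec_def)
        also have "\<dots> \<le> norm w * 1" using v Unit_Ball by (intro mult_left_mono) auto
        finally show "cmod (?F v) \<le> norm w" by simp
      qed
      moreover have "T ?F z = of_real ((norm w)\<^sup>2)"
      proof -
        have "T ?F z = (\<Sum>k\<in>UNIV. cnj (w $ k) * w $ k)"
          using T_polynomials[OF A polyfun_linear z, of "\<lambda>k. cnj (w $ k)"] by (simp add: w_def)
        also have "\<dots> = (\<Sum>k\<in>UNIV. of_real ((cmod (w $ k))\<^sup>2))"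
          by (intro sum.cong refl) (simp only: complex_norm_square mult.commute)
        also have "\<dots> = of_real ((norm w)\<^sup>2)" by (simp add: norm_vec_def L2_set_def sum_nonneg)
        finally show ?thesis .
      qed
      ultimately have "norm w * norm w \<le> norm w * 1" by (simp add: power2_eq_square norm_mult)
      then show ?thesis using n by simp
    qed simp
    then show ?thesis using Unit_Ball by (simp add: w_def)
  next
    case Unit_Polydisk
    have "cmod ((A *v z) $ j) \<le> 1" for j
      unfolding A[OF z, symmetric]
      by (rule T_bound[OF bounded_hol_smirnov[OF crd_bounded_hol] _ _ z]) (use Unit_Polydisk in \<open>auto intro: less_imp_le\<close>)
    then show ?thesis using Unit_Polydisk by simp
  qed
  have Alin: "linear ((*v) A)" by simp
  have X: "A *v z \<in> cdomain K" if z: "z \<in> cdomain K" for z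
  proof -
    obtain r w where w: "0 < r" "r < 1" "w \<in> cdomain K" "z = r *\<^sub>R w" using cdomain_expand[OF z] by metis
    have "A *v z = r *\<^sub>R (A *v w)" unfolding w(4) by (rule linear_scale[OF Alin])
    then show ?thesis using cclosed_dilate_domain[OF closed[OF w(3)] w(1,2)] by simp
  qed
  have "T f z = f (A *v z)" if f: "f \<in> smirnov K" and z: "z \<in> cdomain K" for f z
  proof -
    obtain p where p: "\<And>n. polyfun (p n)" "(\<lambda>n. smirnov_dist K (polyres K (p n)) f) \<longlonglongrightarrow> 0"
        "\<And>z. z \<in> cdomain K \<Longrightarrow> (\<lambda>n. p n z) \<longlonglongrightarrow> f z"
      using smirnov_polynomials_dense[OF f] by blast
    have ps: "polyres K (p n) \<in> smirnov K" for n by (rule bounded_hol_smirnov[OF polyres_bounded_hol[OF p(1)]])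
    show ?thesis
    proof (rule smirnov_limit_unique[where f="\<lambda>n. T (polyres K (p n))" and K=K and u="\<lambda>z. f (A *v z)"])
      show "T (polyres K (p n)) \<in> smirnov K" for n by (rule T_smirnov[OF ps])
      show "T f \<in> smirnov K" by (rule T_smirnov[OF f])
      show "holomorphic_vec (\<lambda>z. f (A *v z)) (cdomain K)"
        by (rule holomorphic_vec_compose_linear[OF smirnov_hol[OF f] Alin _ open_cdomain])
          (auto simp: X vector_scalar_commute)
      show "(\<lambda>n. smirnov_dist K (T (polyres K (p n))) (T f)) \<longlonglongrightarrow> 0"
        unfolding isometry[OF ps f] by (rule p(2))
      show "(\<lambda>n. T (polyres K (p n)) z) \<longlonglongrightarrow> f (A *v z)" if "z \<in> cdomain K" for z
      proof -
        have "T (polyres K (p n)) z = p n (A *v z)" for n by (rule T_polynomials[OF _ p(1) that]) (rule A)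
        then show ?thesis using p(3)[OF X[OF that]] by simp
      qed
    qed (rule z)
  qed
  then show ?thesis using X by blast
qed

lemma T_automorphism:
  "\<exists>A B. (\<forall>z\<in>cdomain K. A *v z \<in> cdomain K) \<and> (\<forall>z\<in>cdomain K. B *v z \<in> cdomain K) \<and>
     (\<forall>z. A *v (B *v z) = z) \<and> (\<forall>z. B *v (A *v z) = z) \<and>
     (\<forall>f\<in>smirnov K. \<forall>z\<in>cdomain K. T f z = f (A *v z))"
proof -
  let ?S = "inv_into (smirnov K) T"
  interpret I: unital_isometry K ?S by (rule inverse_unital)
  obtain A where A: "\<forall>z\<in>cdomain K. A *v z \<in> cdomain K" "\<forall>f\<in>smirnov K. \<forall>z\<in>cdomain K. T f z = f (A *v z)"
    using T_linear_substitution by blast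
  obtain B where B: "\<forall>z\<in>cdomain K. B *v z \<in> cdomain K" "\<forall>f\<in>smirnov K. \<forall>z\<in>cdomain K. ?S f z = f (B *v z)"
    using I.T_linear_substitution by blast
  have crd: "crd K j \<in> smirnov K" for j by (rule bounded_hol_smirnov[OF crd_bounded_hol])
  have TS: "T (?S (crd K j)) = crd K j" for j
    using f_inv_into_f[of "crd K j" T "smirnov K"] crd unfolding surj by blast
  have ST: "?S (T (crd K j)) = crd K j" for j by (rule inv_into_f_f[OF T_inj crd])
  have BA: "B *v (A *v z) = z" if z: "z \<in> cdomain K" for z
  proof -
    have "(B *v (A *v z)) $ j = z $ j" for j
    proof -
      have "crd K j z = ?S (crd K j) (A *v z)" using A(2) I.T_smirnov[OF crd] z TS by metis
      also have "\<dots> = crd K j (B *v (A *v z))" using B(2) crd A(1) z by blast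
      finally show ?thesis using A(1) B(1) z by simp
    qed
    then show ?thesis by (simp add: vec_eq_iff)
  qed
  have AB: "A *v (B *v z) = z" if z: "z \<in> cdomain K" for z
  proof -
    have "(A *v (B *v z)) $ j = z $ j" for j
    proof -
      have "crd K j z = T (crd K j) (B *v z)" using B(2) T_smirnov[OF crd] z ST by metis
      also have "\<dots> = crd K j (A *v (B *v z))" using A(2) crd B(1) z by blast
      finally show ?thesis using A(1) B(1) z by simp
    qed
    then show ?thesis by (simp add: vec_eq_iff)
  qed
  have ext: "C *v (D *v z) = z" if CD: "\<And>z. z \<in> cdomain K \<Longrightarrow> C *v (D *v z) = z" for C D :: "complex ^ 'n ^ 'n" and z
  proof -
    let ?s = "inverse (norm z + 1)"
    have s: "?s > 0" using norm_ge_zero[of z] by (simp add: add_nonneg_pos)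
    have n: "norm (?s *\<^sub>R z) < 1"
      using norm_ge_zero[of z] by (simp add: divide_simps add_nonneg_pos)
    have "?s *\<^sub>R z \<in> cdomain K"
    proof (cases K)
      case Unit_Polydisk
      have "cmod ((?s *\<^sub>R z) $ j) < 1" for j using order_le_less_trans[OF Finite_Cartesian_Product.norm_nth_le n] .
      then show ?thesis using Unit_Polydisk by simp
    qed (use n in simp)
    then have "C *v (D *v (?s *\<^sub>R z)) = ?s *\<^sub>R z" by (rule CD)
    moreover have "C *v (D *v (?s *\<^sub>R z)) = ?s *\<^sub>R (C *v (D *v z))"
      by (simp add: scaleR_eq_smult vector_scalar_commute)
    moreover have "norm z + 1 \<noteq> 0" using norm_ge_zero[of z] by linarith
    ultimately show ?thesis by simp
  qed
  show ?thesis using A B ext[OF AB] ext[OF BA] by blast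
qed

end

section \<open>Linear automorphisms of the two domains\<close>

lemma hermitian_inner_self: "hermitian_inner z z = of_real ((norm z)\<^sup>2)"
proof -
  have "hermitian_inner z z = (\<Sum>k\<in>UNIV. of_real ((cmod (z $ k))\<^sup>2))"
    unfolding hermitian_inner_def by (intro sum.cong refl) (simp only: complex_norm_square)
  also have "\<dots> = of_real ((norm z)\<^sup>2)" by (simp add: norm_vec_def L2_set_def sum_nonneg)
  finally show ?thesis .
qed

lemma hermitian_inner_bilinear:
  "hermitian_inner (x + y) z = hermitian_inner x z + hermitian_inner y z"
  "hermitian_inner z (x + y) = hermitian_inner z x + hermitian_inner z y"
  "hermitian_inner (c *s x) z = c * hermitian_inner x z"
  "hermitian_inner z (c *s x) = cnj c * hermitian_inner z x"
  by (simp_all add: hermitian_inner_def algebra_simps sum.distrib sum_distrib_left)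

text \<open>Both \<open>A\<close> and its inverse are contractions, so \<open>A\<close> preserves the norm, and polarization gives the
  inner product.\<close>

lemma ball_automorphism_unitary:
  fixes A B :: "complex ^ 'n ^ 'n"
  assumes A: "\<And>z. z \<in> ball 0 1 \<Longrightarrow> A *v z \<in> ball 0 1" and B: "\<And>z. z \<in> ball 0 1 \<Longrightarrow> B *v z \<in> ball 0 1"
    and AB: "\<And>z. A *v (B *v z) = z" and BA: "\<And>z. B *v (A *v z) = z"
  shows "unitary_transformation ((*v) A)"
proof -
  have contract: "norm (C *v z) \<le> norm z" if C: "\<And>z. z \<in> ball 0 1 \<Longrightarrow> C *v z \<in> ball 0 1" for C :: "complex ^ 'n ^ 'n" and z
  proof (rule dense_ge)
    fix s assume s: "norm z < s"
    then have s0: "0 < s" using norm_ge_zero[of z] by linarith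
    have "norm (inverse s *\<^sub>R z) < 1" using s s0 by (simp add: divide_simps)
    then have "norm (C *v (inverse s *\<^sub>R z)) < 1" using C[of "inverse s *\<^sub>R z"] by simp
    moreover have "C *v (inverse s *\<^sub>R z) = inverse s *\<^sub>R (C *v z)" by (simp add: scaleR_eq_smult vector_scalar_commute)
    ultimately show "norm (C *v z) \<le> s" using s0 by (simp add: divide_simps)
  qed
  have n: "norm (A *v z) = norm z" for z
    using contract[OF A, of z] contract[OF B, of "A *v z"] BA[of z] by simp
  let ?H = hermitian_inner
  have H: "?H (A *v z) (A *v z) = ?H z z" for z unfolding hermitian_inner_self n ..
  have add: "A *v (z + w) = A *v z + A *v w" for z w by (rule matrix_vector_right_distrib)
  have sc: "A *v (c *s z) = c *s (A *v z)" for c z by (simp add: vector_scalar_commute)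
  have "?H (A *v z) (A *v w) = ?H z w" for z w
  proof -
    have "?H (A *v (z + w)) (A *v (z + w)) = ?H (z + w) (z + w)" by (rule H)
    then have 1: "?H (A *v z) (A *v w) + ?H (A *v w) (A *v z) = ?H z w + ?H w z"
      unfolding add hermitian_inner_bilinear H by (simp add: add.commute)
    have "?H (A *v (z + \<i> *s w)) (A *v (z + \<i> *s w)) = ?H (z + \<i> *s w) (z + \<i> *s w)" by (rule H)
    then have "- \<i> * ?H (A *v z) (A *v w) + \<i> * ?H (A *v w) (A *v z) = - \<i> * ?H z w + \<i> * ?H w z"
      unfolding add sc hermitian_inner_bilinear H by (simp add: algebra_simps)
    then have "\<i> * (?H (A *v w) (A *v z) - ?H (A *v z) (A *v w)) = \<i> * (?H w z - ?H z w)" by (simp add: algebra_simps)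
    then have 2: "?H (A *v w) (A *v z) - ?H (A *v z) (A *v w) = ?H w z - ?H z w" by (simp only: mult_cancel_left complex_i_not_zero simp_thms)
    have "2 * ?H (A *v z) (A *v w) = 2 * ?H z w" using 1 2 by algebra
    then show ?thesis by simp
  qed
  moreover have "surj ((*v) A)" using AB by (metis surjI)
  ultimately show ?thesis unfolding unitary_transformation_def
    using matrix_vector_mul_linear_gen[of A] by blast
qed

text \<open>The row sum is attained, up to a factor, at a vector whose entries cancel the phases of the row.\<close>

lemma polydisk_row_sum:
  fixes A :: "complex ^ 'n ^ 'n"
  assumes A: "\<And>z. (\<And>j. cmod (z $ j) < 1) \<Longrightarrow> cmod ((A *v z) $ j) < 1"
  shows "(\<Sum>k\<in>UNIV. cmod (A $ j $ k)) \<le> 1"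
proof (rule ccontr)
  let ?s = "\<Sum>k\<in>UNIV. cmod (A $ j $ k)"
  assume "\<not> ?s \<le> 1"
  then have s: "1 < ?s" by simp
  \<comment> \<open>The factor brings the vector into the polydisk; its image then has a coordinate equal to \<open>1\<close>.\<close>
  let ?z = "(\<chi> k. of_real (inverse ?s) * cnj (sgn (A $ j $ k))) :: complex ^ 'n"
  have iv: "inverse ?s < 1" "0 < inverse ?s" using s by (simp_all add: inverse_less_1_iff)
  have "cmod (?z $ k) < 1" for k
  proof -
    have "cmod (?z $ k) = inverse ?s * cmod (sgn (A $ j $ k))"
      using iv(2) unfolding vec_lambda_beta norm_mult norm_of_real complex_mod_cnj by linarith
    also have "\<dots> \<le> inverse ?s * 1" using iv by (intro mult_left_mono) (auto simp: norm_sgn)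
    finally show ?thesis using iv by linarith
  qed
  then have "cmod ((A *v ?z) $ j) < 1" by (rule A)
  moreover have "(A *v ?z) $ j = of_real (inverse ?s * ?s)"
  proof -
    have e: "x * (c * cnj (sgn x)) = c * of_real (cmod x)" for x c :: complex
    proof (cases "x = 0")
      case False
      have "x * cnj (sgn x) = of_real (cmod x)"
        using False complex_norm_square[of x] by (simp add: sgn_div_norm scaleR_conv_of_real field_simps power2_eq_square)
      then show ?thesis by (simp add: mult_ac)
    qed simp
    show ?thesis unfolding matrix_component vec_lambda_beta e by (simp only: sum_distrib_left[symmetric] of_real_sum[symmetric] of_real_mult)
  qed
  ultimately show False using s by simp
qed

text \<open>In \<open>1 = \<Sum>l. A j l * B l j\<close> the moduli of a row of \<open>A\<close> sum to at most \<open>1\<close> and those of the entries of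
  \<open>B\<close> are at most \<open>1\<close>. So wherever \<open>A j k\<close> is nonzero, \<open>B k j\<close> is unimodular and is the only nonzero
  entry of its row. Then \<open>B A = 1\<close> shows that every row of \<open>A\<close> has a single nonzero entry.\<close>

lemma polydisk_automorphism_monomial:
  fixes A B :: "complex ^ 'n ^ 'n"
  assumes A: "\<And>z j. (\<And>j. cmod (z $ j) < 1) \<Longrightarrow> cmod ((A *v z) $ j) < 1"
    and B: "\<And>z j. (\<And>j. cmod (z $ j) < 1) \<Longrightarrow> cmod ((B *v z) $ j) < 1"
    and AB: "\<And>z. A *v (B *v z) = z" and BA: "\<And>z. B *v (A *v z) = z"
  shows "\<exists>c p. (\<forall>j. cmod (c j) = 1) \<and> p permutes (UNIV :: 'n set) \<and> (\<forall>z. A *v z = (\<chi> j. c j * z $ p j))"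
proof -
  have rA: "(\<Sum>k\<in>UNIV. cmod (A $ j $ k)) \<le> 1" for j by (rule polydisk_row_sum[OF A])
  have rB: "(\<Sum>k\<in>UNIV. cmod (B $ j $ k)) \<le> 1" for j by (rule polydisk_row_sum[OF B])
  have entry: "(\<Sum>l\<in>UNIV. C $ j $ l * D $ l $ k) = (if j = k then 1 else 0)"
    if "\<And>z. C *v (D *v z) = z" for C D :: "complex ^ 'n ^ 'n" and j k
  proof -
    have "C ** D = mat 1" unfolding matrix_eq matrix_vector_mul_assoc[symmetric] using that by simp
    then have "(C ** D) $ j $ k = mat 1 $ j $ k" by simp
    then show ?thesis by (simp add: matrix_matrix_mult_def mat_def)
  qed
  note eAB = entry[OF AB] and eBA = entry[OF BA]
  have b1: "cmod (B $ k $ j) \<le> 1" for k j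
    using member_le_sum[of j UNIV "\<lambda>j. cmod (B $ k $ j)"] rB[of k] by simp
  have one: "cmod (B $ k $ j) = 1" if nz: "A $ j $ k \<noteq> 0" for j k
  proof (rule ccontr)
    assume "cmod (B $ k $ j) \<noteq> 1"
    then have lt: "cmod (B $ k $ j) < 1" using b1[of k j] by simp
    have "1 = cmod (\<Sum>l\<in>UNIV. A $ j $ l * B $ l $ j)" by (simp add: eAB)
    also have "\<dots> \<le> (\<Sum>l\<in>UNIV. cmod (A $ j $ l) * cmod (B $ l $ j))" by (simp add: sum_norm_le norm_mult)
    also have "\<dots> < (\<Sum>l\<in>UNIV. cmod (A $ j $ l))"
    proof (rule sum_strict_mono_ex1)
      show "\<forall>l\<in>UNIV. cmod (A $ j $ l) * cmod (B $ l $ j) \<le> cmod (A $ j $ l)"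
        using b1 by (intro ballI mult_right_le_one_le) auto
      show "\<exists>l\<in>UNIV. cmod (A $ j $ l) * cmod (B $ l $ j) < cmod (A $ j $ l)"
        using nz lt by (intro bexI[of _ k]) auto
    qed simp
    finally show False using rA[of j] by simp
  qed
  have supp: "B $ k $ l = 0" if "cmod (B $ k $ j) = 1" "l \<noteq> j" for j k l
  proof -
    have "(\<Sum>m\<in>{j, l}. cmod (B $ k $ m)) \<le> (\<Sum>m\<in>UNIV. cmod (B $ k $ m))" by (rule sum_mono2) auto
    moreover have "(\<Sum>m\<in>{j, l}. cmod (B $ k $ m)) = cmod (B $ k $ j) + cmod (B $ k $ l)" using that(2) by simp
    ultimately have "cmod (B $ k $ l) \<le> 0" using that(1) rB[of k] by linarith
    then show ?thesis by simp
  qed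
  have row: "B $ k $ j * A $ j $ l = (if k = l then 1 else 0)" if "A $ j $ k \<noteq> 0" for j k l
  proof -
    have "(\<Sum>m\<in>UNIV. B $ k $ m * A $ m $ l) = (\<Sum>m\<in>{j}. B $ k $ m * A $ m $ l)"
      by (rule sum.mono_neutral_right) (use supp[OF one[OF that]] in auto)
    then show ?thesis using eBA[of k l] by simp
  qed
  have ex: "\<exists>k. A $ j $ k \<noteq> 0" for j
  proof (rule ccontr)
    assume "\<not> ?thesis"
    then show False using eAB[of j j] by simp
  qed
  then obtain p where p: "\<And>j. A $ j $ p j \<noteq> 0" by metis
  have off: "A $ j $ l = 0" if "l \<noteq> p j" for j l
    using row[OF p[of j], of l] one[OF p[of j]] that by auto
  have c: "cmod (A $ j $ p j) = 1" for j
  proof -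
    have "cmod (B $ p j $ j) * cmod (A $ j $ p j) = 1" using row[OF p[of j], of "p j"] by (simp flip: norm_mult)
    then show ?thesis using one[OF p[of j]] by simp
  qed
  have "inj p"
  proof (rule injI, rule ccontr)
    fix i j assume ij: "p i = p j" "i \<noteq> j"
    have "B $ p i $ j = 0" by (rule supp[OF one[OF p[of i]]]) (use ij in auto)
    then show False using one[OF p[of j]] ij(1) by simp
  qed
  then have "bij p" by (simp add: bij_def finite_UNIV_inj_surj)
  then have "p permutes UNIV" by (intro bij_imp_permutes) auto
  moreover have "A *v z = (\<chi> j. A $ j $ p j * z $ p j)" for z
  proof (rule vec_eq_iff[THEN iffD2], rule allI)
    fix j
    have "(\<Sum>k\<in>UNIV. A $ j $ k * z $ k) = (\<Sum>k\<in>{p j}. A $ j $ k * z $ k)"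
      by (rule sum.mono_neutral_right) (use off in auto)
    then show "(A *v z) $ j = (\<chi> j. A $ j $ p j * z $ p j) $ j" by (simp add: matrix_component)
  qed
  ultimately show ?thesis using c by (intro exI[of _ "\<lambda>j. A $ j $ p j"] exI[of _ p]) blast
qed

lemma matrix_holomorphic_automorphism:
  fixes A B :: "complex ^ 'n ^ 'n"
  assumes A: "\<And>z. z \<in> cdomain K \<Longrightarrow> A *v z \<in> cdomain K" and B: "\<And>z. z \<in> cdomain K \<Longrightarrow> B *v z \<in> cdomain K"
    and AB: "\<And>z. A *v (B *v z) = z" and BA: "\<And>z. B *v (A *v z) = z"
  shows "holomorphic_automorphism ((*v) A) (cdomain K)"
  unfolding holomorphic_automorphism_def
proof (intro conjI allI)
  show bij: "bij_betw ((*v) A) (cdomain K) (cdomain K)"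
    by (rule bij_betw_byWitness[where f'="(*v) B"]) (use assms in auto)
  have hol: "holomorphic_vec (\<lambda>z. (C *v z) $ i) (cdomain K)" for C :: "complex ^ 'n ^ 'n" and i
    unfolding matrix_component by (rule polyfun_hol[OF polyfun_linear open_cdomain])
  show "holomorphic_vec (\<lambda>z. (A *v z) $ i) (cdomain K)" for i by (rule hol)
  show "holomorphic_vec (\<lambda>z. inv_into (cdomain K) ((*v) A) z $ i) (cdomain K)" for i
  proof (rule holomorphic_vec_cong[OF hol[of B]])
    fix z :: "complex ^ 'n" assume z: "z \<in> cdomain K"
    have "inv_into (cdomain K) ((*v) A) z = B *v z"
      by (rule inv_into_f_eq[OF bij_betw_imp_inj_on[OF bij] B[OF z] AB])
    then show "(B *v z) $ i = inv_into (cdomain K) ((*v) A) z $ i" by simp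
  qed
qed

lemma (in unital_isometry) T_composition:
  "\<exists>\<Phi> :: complex ^ 'n \<Rightarrow> complex ^ 'n.
      holomorphic_automorphism \<Phi> (cdomain K) \<and>
      (case K of
         Unit_Ball \<Rightarrow> \<exists>U. unitary_transformation U \<and> (\<forall>z\<in>cdomain K. \<Phi> z = U z)
       | Unit_Polydisk \<Rightarrow> \<exists>(c :: 'n \<Rightarrow> complex) p. (\<forall>j. cmod (c j) = 1) \<and> p permutes UNIV \<and>
           (\<forall>z\<in>cdomain K. \<Phi> z = (\<chi> j. c j * z $ p j))) \<and>
      (\<forall>f\<in>smirnov K. \<forall>z\<in>cdomain K. T f z = f (\<Phi> z))"
proof -
  obtain A B where A: "\<And>z. z \<in> cdomain K \<Longrightarrow> A *v z \<in> cdomain K" and B: "\<And>z. z \<in> cdomain K \<Longrightarrow> B *v z \<in> cdomain K"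
    and AB: "\<And>z. A *v (B *v z) = z" and BA: "\<And>z. B *v (A *v z) = z"
    and T: "\<forall>f\<in>smirnov K. \<forall>z\<in>cdomain K. T f z = f (A *v z)"
    using T_automorphism by blast
  have aut: "holomorphic_automorphism ((*v) A) (cdomain K)" by (rule matrix_holomorphic_automorphism[OF A B AB BA])
  have "case K of
         Unit_Ball \<Rightarrow> \<exists>U. unitary_transformation U \<and> (\<forall>z\<in>cdomain K. A *v z = U z)
       | Unit_Polydisk \<Rightarrow> \<exists>(c :: 'n \<Rightarrow> complex) p. (\<forall>j. cmod (c j) = 1) \<and> p permutes UNIV \<and>
           (\<forall>z\<in>cdomain K. A *v z = (\<chi> j. c j * z $ p j))"
  proof (cases K)
    case Unit_Ball
    have "unitary_transformation ((*v) A)"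
      by (rule ball_automorphism_unitary[OF _ _ AB BA]) (use A B Unit_Ball in auto)
    then show ?thesis using Unit_Ball by auto
  next
    case Unit_Polydisk
    have "\<exists>c p. (\<forall>j. cmod (c j) = 1) \<and> p permutes (UNIV :: 'n set) \<and> (\<forall>z. A *v z = (\<chi> j. c j * z $ p j))"
      by (rule polydisk_automorphism_monomial[OF _ _ AB BA]) (use A B Unit_Polydisk in auto)
    then show ?thesis unfolding Unit_Polydisk domain_kind.case by blast
  qed
  then show ?thesis using aut T by blast
qed

theorem theorem2p2:
  fixes K :: domain_kind
    and T :: "(complex ^ 'n \<Rightarrow> complex) \<Rightarrow> (complex ^ 'n \<Rightarrow> complex)"
  assumes surj: "T ` smirnov K = smirnov K"
    and isometry: "\<And>f g. f \<in> smirnov K \<Longrightarrow> g \<in> smirnov K \<Longrightarrow>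
        smirnov_dist K (T f) (T g) = smirnov_dist K f g"
    and multiplicative: "\<And>f g. f \<in> smirnov K \<Longrightarrow> g \<in> smirnov K \<Longrightarrow>
        T (mult_on (cdomain K) f g) = mult_on (cdomain K) (T f) (T g)"
  shows "\<exists>\<Phi> :: complex ^ 'n \<Rightarrow> complex ^ 'n.
      holomorphic_automorphism \<Phi> (cdomain K) \<and>
      (case K of
         Unit_Ball \<Rightarrow> \<exists>U. unitary_transformation U \<and> (\<forall>z\<in>cdomain K. \<Phi> z = U z)
       | Unit_Polydisk \<Rightarrow> \<exists>(c :: 'n \<Rightarrow> complex) p. (\<forall>j. cmod (c j) = 1) \<and> p permutes UNIV \<and>
           (\<forall>z\<in>cdomain K. \<Phi> z = (\<chi> j. c j * z $ p j))) \<and>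
      ((\<forall>f\<in>smirnov K. \<forall>z\<in>cdomain K. T f z = f (\<Phi> z)) \<or>
       (\<forall>f\<in>smirnov K. \<forall>z\<in>cdomain K. T f z = cnj (f (vec_cnj (\<Phi> z)))))"
proof -
  interpret M: multiplicative_isometry K T by (rule multiplicative_isometry.intro[OF surj isometry multiplicative])
  consider "T (cst K \<i>) = cst K \<i>" | "T (cst K \<i>) = cst K (- \<i>)" using M.T_cst_i by blast
  then show ?thesis
  proof cases
    case 1
    interpret unital_isometry K T by unfold_locales (rule 1)
    show ?thesis using T_composition by blast
  next
    case 2
    let ?T = "\<lambda>f. T (reflect K f)"
    have "multf K (T (cst K \<i>)) (T (cst K (- \<i>))) = cst K 1"
      using M.T_cst_mult[of \<i> "- \<i>"] M.T_one by simp
    then have m: "multf K (cst K (- \<i>)) (T (cst K (- \<i>))) = cst K 1" unfolding 2 .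
    have Ti: "T (cst K (- \<i>)) = cst K \<i>"
    proof (rule extensional_eqI[OF smirnov_ext[OF M.T_smirnov[OF cst_smirnov]] smirnov_ext[OF cst_smirnov]])
      fix z :: "complex ^ 'n" assume z: "z \<in> cdomain K"
      have "- \<i> * T (cst K (- \<i>)) z = 1" using fun_cong[OF m, of z] unfolding cst_apply[OF z] multf_apply[OF z] .
      then have "\<i> * (- \<i> * T (cst K (- \<i>)) z) = \<i>" by simp
      then show "T (cst K (- \<i>)) z = cst K \<i> z" using z by simp
    qed
    interpret R: multiplicative_isometry K ?T by (rule M.compose_reflect)
    interpret R: unital_isometry K ?T by unfold_locales (simp add: reflect_cst Ti)
    obtain \<Phi> :: "complex ^ 'n \<Rightarrow> complex ^ 'n" where \<Phi>: "holomorphic_automorphism \<Phi> (cdomain K)"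
      "case K of
         Unit_Ball \<Rightarrow> \<exists>U. unitary_transformation U \<and> (\<forall>z\<in>cdomain K. \<Phi> z = U z)
       | Unit_Polydisk \<Rightarrow> \<exists>(c :: 'n \<Rightarrow> complex) p. (\<forall>j. cmod (c j) = 1) \<and> p permutes UNIV \<and>
           (\<forall>z\<in>cdomain K. \<Phi> z = (\<chi> j. c j * z $ p j))"
      "\<forall>f\<in>smirnov K. \<forall>z\<in>cdomain K. ?T f z = f (\<Phi> z)"
      using R.T_composition by blast
    have "T f z = cnj (f (vec_cnj (\<Phi> z)))" if f: "f \<in> smirnov K" and z: "z \<in> cdomain K" for f z
    proof -
      have \<Phi>z: "\<Phi> z \<in> cdomain K" using \<Phi>(1) z unfolding holomorphic_automorphism_def by (blast dest: bij_betwE)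
      have "T f z = ?T (reflect K f) z" by (simp add: reflect_reflect[OF f])
      also have "\<dots> = reflect K f (\<Phi> z)" using \<Phi>(3) reflect_smirnov[OF f] z by blast
      also have "\<dots> = cnj (f (vec_cnj (\<Phi> z)))" by (rule reflect_apply[OF \<Phi>z])
      finally show ?thesis .
    qed
    then show ?thesis using \<Phi>(1,2) by blast
  qed
qed

end
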